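(* For any integers $n \geq 2$ and $k \geq 1$ there exists a constant $C = C(n,k)$ such that the following holds. If $(X_i)_{i \ge 1}$ is any sequence of integral stationary geodesic networks in $\mathbb{R}^n$ whose associated measures $\mu_{X_i}$ converge weakly (as Radon measures on $\mathbb{R}^n$) to a multiplicity $k$ line $\ell$ (i.e. to $k\,\mathcal{H}^1$ restricted to an affine line $\ell\subset\mathbb{R}^n$), and $K \subset \mathbb{R}^n$ is compact, then for all sufficiently large $i$ (depending on $K$ and the sequence $(X_i)$), the number of singular points of $X_i$ in $K$ is at most $C(n,k)$.
   Context: A geodesic network in $\mathbb{R}^n$ is a closed subset $X \subset \mathbb{R}^n$ which is locally a finite embedded graph, each of whose edges is a geodesic of $\mathbb{R}^n$ (a straight segment, ray, or complete line). $X_{\mathrm{reg}} \subset X$ is the set of points around which $X$ is locally a straight segment, and $X_{\mathrm{sing}} = X \setminus X_{\mathrm{reg}}$ is the set of singular points. A geodesic network with multiplicity also carries a locally constant function $\Theta : X_{\mathrm{reg}} \to (0,\infty)$; it is integral if $\Theta$ takes only positive integer values on $X_{\mathrm{reg}}$. $\Theta$ is extended to all of $\mathbb{R}^n$ by $\Theta(x) = \frac12\sum_j \Theta_j$ at $x \in X_{\mathrm{sing}}$, where $\Theta_1,\dots,\Theta_m$ are the multiplicities of the geodesics touching $x$, and by $\Theta = 0$ off $X$. The associated measure is $\mu_X = \Theta\, d\mathcal{H}^1$ (a Radon measure with support $X$). $X$ is stationary if at each $x \in X_{\mathrm{sing}}$, with $s_1,\dots,s_m$ the unit vectors at $x$ pointing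 along the geodesics leaving $x$ and $\Theta_1,\dots,\Theta_m$ their multiplicities, $\sum_{i} \Theta_i s_i = 0$. An integral stationary geodesic network is one that is both integral and stationary. *)

theory Defs
  imports "HOL-Analysis.Analysis"
begin

section \<open>One-dimensional Hausdorff measure\<close>

text \<open>
  In dimension one the normalising constant of Hausdorff measure is 1, so that
  \<open>\<H>\<^sup>1\<close> of a segment is its length. The boundedness requirement is needed because
  \<^const>\<open>diameter\<close> is unspecified on unbounded sets.
\<close>

definition hausdorff1_pre :: "real \<Rightarrow> 'a::metric_space set \<Rightarrow> ennreal" where
  "hausdorff1_pre \<delta> A =
     (INF C\<in>{C :: nat \<Rightarrow> 'a set. A \<subseteq> (\<Union>i. C i) \<and> (\<forall>i. bounded (C i) \<and> diameter (C i) \<le> \<delta>)}.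
        \<Sum>i. ennreal (diameter (C i)))"

definition hausdorff1_outer :: "'a::metric_space set \<Rightarrow> ennreal" where
  "hausdorff1_outer A = (SUP \<delta>\<in>{0<..}. hausdorff1_pre \<delta> A)"

definition hausdorff1 :: "'a::metric_space measure" where
  "hausdorff1 = measure_of UNIV (sets borel) hausdorff1_outer"

lemma hausdorff1_pre_le:
  assumes "A \<subseteq> (\<Union>i. C i)" "\<And>i. bounded (C i)" "\<And>i. diameter (C i) \<le> \<delta>"
  shows "hausdorff1_pre \<delta> A \<le> (\<Sum>i. ennreal (diameter (C i)))"
  unfolding hausdorff1_pre_def using assms by (intro INF_lower) auto

lemma hausdorff1_pre_mono: "A \<subseteq> B \<Longrightarrow> hausdorff1_pre \<delta> A \<le> hausdorff1_pre \<delta> B"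
  unfolding hausdorff1_pre_def by (intro INF_superset_mono) auto

lemma hausdorff1_pre_antimono: "\<delta> \<le> \<epsilon> \<Longrightarrow> hausdorff1_pre \<epsilon> A \<le> hausdorff1_pre \<delta> A"
  unfolding hausdorff1_pre_def by (intro INF_superset_mono) (auto intro: order_trans)

lemma hausdorff1_pre_le_outer: "\<delta> > 0 \<Longrightarrow> hausdorff1_pre \<delta> A \<le> hausdorff1_outer A"
  unfolding hausdorff1_outer_def by (intro SUP_upper) auto

lemma hausdorff1_outer_mono: "A \<subseteq> B \<Longrightarrow> hausdorff1_outer A \<le> hausdorff1_outer B"
  unfolding hausdorff1_outer_def by (intro SUP_mono) (auto intro: hausdorff1_pre_mono)

lemma hausdorff1_outer_empty: "hausdorff1_outer {} = 0"
proof -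
  have "hausdorff1_pre \<delta> ({} :: 'a set) \<le> 0" if "\<delta> > 0" for \<delta> :: real
    using hausdorff1_pre_le[of "{}" "\<lambda>_. {} :: 'a set" \<delta>] that by simp
  then have "hausdorff1_outer ({} :: 'a set) \<le> 0"
    unfolding hausdorff1_outer_def by (intro SUP_least) auto
  then show ?thesis by simp
qed

lemma hausdorff1_pre_countably_subadditive:
  fixes A :: "nat \<Rightarrow> 'a::metric_space set"
  shows "hausdorff1_pre \<delta> (\<Union>n. A n) \<le> (\<Sum>n. hausdorff1_pre \<delta> (A n))"
proof (rule ennreal_le_epsilon)
  fix e :: real assume "0 < e" "(\<Sum>n. hausdorff1_pre \<delta> (A n)) < top"
  then have *: "hausdorff1_pre \<delta> (A n) < hausdorff1_pre \<delta> (A n) + e * (1/2)^Suc n" for n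
    by (auto simp add: less_top dest!: ennreal_suminf_lessD)
  have "\<exists>C :: nat \<Rightarrow> 'a set. A n \<subseteq> (\<Union>i. C i) \<and> (\<forall>i. bounded (C i) \<and> diameter (C i) \<le> \<delta>) \<and>
          (\<Sum>i. ennreal (diameter (C i))) \<le> hausdorff1_pre \<delta> (A n) + e * (1/2)^Suc n" for n
    using *[of n] unfolding hausdorff1_pre_def[of \<delta> "A n"] INF_less_iff
    by (auto intro: less_imp_le)
  then obtain B :: "nat \<Rightarrow> nat \<Rightarrow> 'a set"
    where sbB: "\<And>n. A n \<subseteq> (\<Union>i. B n i)"
      and B: "\<And>n i. bounded (B n i)" "\<And>n i. diameter (B n i) \<le> \<delta>"
      and Ble: "\<And>n. (\<Sum>i. ennreal (diameter (B n i))) \<le> hausdorff1_pre \<delta> (A n) + e * (1/2)^Suc n"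
    by metis
  define C where "C = case_prod B \<circ> prod_decode"
  have A_C: "(\<Union>i. A i) \<subseteq> (\<Union>i. C i)"
    using sbB by (auto simp add: C_def subset_eq) (metis prod.case prod_encode_inverse)
  have "hausdorff1_pre \<delta> (\<Union>i. A i) \<le> (\<Sum>i. ennreal (diameter (C i)))"
    using A_C B by (intro hausdorff1_pre_le) (auto simp: C_def split: prod.split)
  also have "\<dots> = (\<Sum>n. \<Sum>i. ennreal (diameter (B n i)))"
    using suminf_ennreal_2dimen[of "\<lambda>n. \<Sum>i. ennreal (diameter (B n i))"
        "\<lambda>(n, i). ennreal (diameter (B n i))"]
    by (simp add: C_def split_def)
  also have "\<dots> \<le> (\<Sum>n. hausdorff1_pre \<delta> (A n) + e * (1/2) ^ Suc n)"
    by (intro suminf_le allI Ble) auto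
  also have "\<dots> = (\<Sum>n. hausdorff1_pre \<delta> (A n)) + (\<Sum>n. ennreal e * ennreal ((1/2) ^ Suc n))"
    using \<open>0 < e\<close> by (subst suminf_add[symmetric])
                     (auto simp del: ennreal_suminf_cmult simp add: ennreal_mult[symmetric])
  also have "\<dots> = (\<Sum>n. hausdorff1_pre \<delta> (A n)) + e"
    unfolding ennreal_suminf_cmult
    by (subst suminf_ennreal_eq[OF zero_le_power power_half_series]) auto
  finally show "hausdorff1_pre \<delta> (\<Union>i. A i) \<le> (\<Sum>n. hausdorff1_pre \<delta> (A n)) + e" .
qed

lemma hausdorff1_outer_countably_subadditive:
  "hausdorff1_outer (\<Union>n. A n) \<le> (\<Sum>n. hausdorff1_outer (A n :: 'a::metric_space set))"
proof -
  have "hausdorff1_pre \<delta> (\<Union>n. A n) \<le> (\<Sum>n. hausdorff1_outer (A n))" if "\<delta> > 0" for \<delta>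
  proof -
    have "hausdorff1_pre \<delta> (\<Union>n. A n) \<le> (\<Sum>n. hausdorff1_pre \<delta> (A n))"
      by (rule hausdorff1_pre_countably_subadditive)
    also have "\<dots> \<le> (\<Sum>n. hausdorff1_outer (A n))"
      by (intro suminf_le hausdorff1_pre_le_outer that) auto
    finally show ?thesis .
  qed
  then show ?thesis
    unfolding hausdorff1_outer_def[of "\<Union>n. A n"] by (intro SUP_least) auto
qed

lemma outer_measure_space_hausdorff1: "outer_measure_space (Pow UNIV) hausdorff1_outer"
  unfolding outer_measure_space_def positive_def increasing_def countably_subadditive_def
  by (simp add: hausdorff1_outer_empty hausdorff1_outer_mono hausdorff1_outer_countably_subadditive)

lemma hausdorff1_outer_Un: "hausdorff1_outer (A \<union> B) \<le> hausdorff1_outer A + hausdorff1_outer B"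
proof -
  interpret sigma_algebra UNIV "Pow UNIV" by (rule sigma_algebra_Pow)
  have "subadditive (Pow UNIV) (hausdorff1_outer :: 'a set \<Rightarrow> ennreal)"
    using outer_measure_space_hausdorff1 countably_subadditive_subadditive
    unfolding outer_measure_space_def by blast
  then have "hausdorff1_outer (A \<union> (B - A)) \<le> hausdorff1_outer A + hausdorff1_outer (B - A)"
    by (rule subadditiveD) auto
  also have "\<dots> \<le> hausdorff1_outer A + hausdorff1_outer B"
    by (intro add_left_mono hausdorff1_outer_mono) auto
  finally show ?thesis by simp
qed

lemma hausdorff1_pre_separated:
  fixes P Q :: "'a::metric_space set"
  assumes "\<delta> < \<epsilon>" and sep: "\<And>x y. x \<in> P \<Longrightarrow> y \<in> Q \<Longrightarrow> \<epsilon> \<le> dist x y"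
  shows "hausdorff1_pre \<delta> P + hausdorff1_pre \<delta> Q \<le> hausdorff1_pre \<delta> (P \<union> Q)"
  unfolding hausdorff1_pre_def[of \<delta> "P \<union> Q"]
proof (rule INF_greatest, safe)
  fix C :: "nat \<Rightarrow> 'a set"
  assume C: "P \<union> Q \<subseteq> (\<Union>i. C i)" "\<forall>i. bounded (C i) \<and> diameter (C i) \<le> \<delta>"
  have sub: "diameter (C i \<inter> S) \<le> diameter (C i)" for i S
    using C by (intro diameter_subset) auto
  have le: "ennreal (diameter (C i \<inter> P)) + ennreal (diameter (C i \<inter> Q)) \<le> ennreal (diameter (C i))" for i
  proof -
    have "C i \<inter> P = {} \<or> C i \<inter> Q = {}"
    proof (rule ccontr)
      assume "\<not> (C i \<inter> P = {} \<or> C i \<inter> Q = {})"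
      then obtain x y where "x \<in> C i" "x \<in> P" "y \<in> C i" "y \<in> Q" by auto
      then have "dist x y \<le> \<delta>" "\<epsilon> \<le> dist x y"
        using C diameter_bounded_bound[of "C i" x y] sep by (auto intro: order_trans)
      then show False using assms by simp
    qed
    then show ?thesis using sub[of i P] sub[of i Q] by (auto intro: ennreal_leI)
  qed
  have "hausdorff1_pre \<delta> P \<le> (\<Sum>i. ennreal (diameter (C i \<inter> P)))"
    using C sub by (intro hausdorff1_pre_le) (auto intro: order_trans)
  moreover have "hausdorff1_pre \<delta> Q \<le> (\<Sum>i. ennreal (diameter (C i \<inter> Q)))"
    using C sub by (intro hausdorff1_pre_le) (auto intro: order_trans)
  ultimately have "hausdorff1_pre \<delta> P + hausdorff1_pre \<delta> Q
      \<le> (\<Sum>i. ennreal (diameter (C i \<inter> P))) + (\<Sum>i. ennreal (diameter (C i \<inter> Q)))"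
    by (rule add_mono)
  also have "\<dots> = (\<Sum>i. ennreal (diameter (C i \<inter> P)) + ennreal (diameter (C i \<inter> Q)))"
    by (rule suminf_add) auto
  also have "\<dots> \<le> (\<Sum>i. ennreal (diameter (C i)))"
    by (intro suminf_le le) auto
  finally show "hausdorff1_pre \<delta> P + hausdorff1_pre \<delta> Q \<le> (\<Sum>i. ennreal (diameter (C i)))" .
qed

lemma hausdorff1_outer_separated:
  fixes P Q :: "'a::metric_space set"
  assumes "0 < \<epsilon>" and sep: "\<And>x y. x \<in> P \<Longrightarrow> y \<in> Q \<Longrightarrow> \<epsilon> \<le> dist x y"
  shows "hausdorff1_outer P + hausdorff1_outer Q \<le> hausdorff1_outer (P \<union> Q)"
proof -
  have "hausdorff1_outer P + hausdorff1_outer Q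
      = (SUP \<delta>\<in>{0<..}. hausdorff1_pre \<delta> P + hausdorff1_pre \<delta> Q)"
    unfolding hausdorff1_outer_def
  proof (rule SUP_add_directed_ennreal[symmetric])
    fix i j :: real assume "i \<in> {0<..}" "j \<in> {0<..}"
    then show "\<exists>k\<in>{0<..}. hausdorff1_pre i P + hausdorff1_pre j Q
        \<le> hausdorff1_pre k P + hausdorff1_pre k Q"
      by (intro bexI[of _ "min i j"] add_mono hausdorff1_pre_antimono) auto
  qed
  also have "\<dots> \<le> hausdorff1_outer (P \<union> Q)"
  proof (rule SUP_least)
    fix \<delta> :: real assume "\<delta> \<in> {0<..}"
    have "hausdorff1_pre \<delta> P + hausdorff1_pre \<delta> Q
        \<le> hausdorff1_pre (min \<delta> (\<epsilon> / 2)) P + hausdorff1_pre (min \<delta> (\<epsilon> / 2)) Q"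
      by (intro add_mono hausdorff1_pre_antimono) auto
    also have "\<dots> \<le> hausdorff1_pre (min \<delta> (\<epsilon> / 2)) (P \<union> Q)"
      using assms by (intro hausdorff1_pre_separated[of _ \<epsilon>]) auto
    also have "\<dots> \<le> hausdorff1_outer (P \<union> Q)"
      using assms \<open>\<delta> \<in> {0<..}\<close> by (intro hausdorff1_pre_le_outer) auto
    finally show "hausdorff1_pre \<delta> P + hausdorff1_pre \<delta> Q \<le> hausdorff1_outer (P \<union> Q)" .
  qed
  finally show ?thesis .
qed

text \<open>Caratheodory's criterion, for half-spaces.\<close>

lemma halfspace_hausdorff1_lambda_system:
  fixes b :: "'a::euclidean_space"
  assumes "b \<in> Basis"
  shows "{x. x \<bullet> b \<le> a} \<in> lambda_system UNIV (Pow UNIV) hausdorff1_outer"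
proof -
  let ?H = "hausdorff1_outer :: 'a set \<Rightarrow> ennreal"
  have dist_ge: "\<bar>x \<bullet> b - y \<bullet> b\<bar> \<le> dist x y" for x y
    using Basis_le_norm[OF assms, of "x - y"] by (simp add: dist_norm inner_diff_left)
  have main: "?H (A \<inter> {x. x \<bullet> b \<le> a}) + ?H (A \<inter> {x. x \<bullet> b > a}) \<le> ?H A" for A
  proof (cases "?H A = top")
    case False
    define r where "r n = a + 1 / real (Suc n)" for n
    have r_pos: "r n > a" for n by (simp add: r_def)
    have r_dec: "r n < r m" if "m < n" for m n
      using that by (simp add: r_def frac_less2)
    define S where "S n = A \<inter> {x. x \<bullet> b > r n}" for n
    define R where "R n = A \<inter> {x. r (Suc n) < x \<bullet> b \<and> x \<bullet> b \<le> r n}" for n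
    have R_sum: "(\<Sum>i<n. ?H (R (2 * i + j))) \<le> ?H (A \<inter> {x. x \<bullet> b > r (2 * n + j - 1)})"
      if "j \<in> {0, 1}" for n j :: nat
    proof (induction n)
      case (Suc n)
      let ?k = "2 * n + j"
      have "(\<Sum>i<Suc n. ?H (R (2 * i + j))) = (\<Sum>i<n. ?H (R (2 * i + j))) + ?H (R ?k)"
        by simp
      also have "\<dots> \<le> ?H (if n = 0 then {} else A \<inter> {x. x \<bullet> b > r (?k - 1)}) + ?H (R ?k)"
        using Suc.IH by (intro add_right_mono) (auto simp: hausdorff1_outer_empty)
      also have "\<dots> \<le> ?H ((if n = 0 then {} else A \<inter> {x. x \<bullet> b > r (?k - 1)}) \<union> R ?k)"
      proof (cases "n = 0")
        case False
        then have "r ?k < r (?k - 1)" by (intro r_dec) auto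
        then show ?thesis
        proof (intro hausdorff1_outer_separated[of "r (?k - 1) - r ?k"])
          fix x y assume "x \<in> (if n = 0 then {} else A \<inter> {x. x \<bullet> b > r (?k - 1)})" "y \<in> R ?k"
          then show "r (?k - 1) - r ?k \<le> dist x y"
            using dist_ge[of x y] False by (auto simp: R_def)
        qed auto
      qed (auto simp: hausdorff1_outer_empty)
      also have "\<dots> \<le> ?H (A \<inter> {x. x \<bullet> b > r (2 * Suc n + j - 1)})"
      proof (intro hausdorff1_outer_mono)
        have "r (Suc ?k) < r (?k - 1)" by (intro r_dec) auto
        then show "(if n = 0 then {} else A \<inter> {x. x \<bullet> b > r (?k - 1)}) \<union> R ?k
            \<subseteq> A \<inter> {x. x \<bullet> b > r (2 * Suc n + j - 1)}"
          by (auto simp: R_def split: if_splits)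
      qed
      finally show ?case .
    qed auto
    have R_fin: "(\<Sum>i. ?H (R (2 * i + j))) \<le> ?H A" if "j \<in> {0, 1}" for j :: nat
    proof (rule suminf_le_const)
      show "(\<Sum>i<n. ?H (R (2 * i + j))) \<le> ?H A" for n
        using R_sum[OF that, of n] hausdorff1_outer_mono[of "A \<inter> {x. x \<bullet> b > r (2 * n + j - 1)}" A]
        by (auto intro: order_trans)
    qed auto
    have fin2: "?H A + ?H A < top" using False by (simp add: less_top)
    have "(\<Sum>i<n. ?H (R i)) \<le> ?H A + ?H A" for n
    proof -
      have eq: "(\<Sum>i<2 * n. ?H (R i)) = (\<Sum>i<n. ?H (R (2 * i + 0))) + (\<Sum>i<n. ?H (R (2 * i + 1)))"
        by (induction n) (auto simp: algebra_simps)
      have "(\<Sum>i<n. ?H (R i)) \<le> (\<Sum>i<2 * n. ?H (R i))"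
        by (intro sum_mono2) auto
      also have "\<dots> \<le> (\<Sum>i. ?H (R (2 * i + 0))) + (\<Sum>i. ?H (R (2 * i + 1)))"
        unfolding eq by (intro add_mono sum_le_suminf) auto
      also have "\<dots> \<le> ?H A + ?H A"
        by (intro add_mono R_fin) auto
      finally show ?thesis .
    qed
    then have "(\<Sum>i. ?H (R i)) \<le> ?H A + ?H A"
      by (intro suminf_le_const) auto
    then have "(\<Sum>i. ?H (R i)) < top" using fin2 by (rule le_less_trans)
    then have "(\<lambda>n. \<Sum>i. ?H (R (i + n))) \<longlonglongrightarrow> 0"
    proof -
      assume fin: "(\<Sum>i. ?H (R i)) < top"
      then have Rfin: "?H (R i) < top" for i by (auto dest: ennreal_suminf_lessD)
      define q where "q i = enn2real (?H (R i))" for i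
      have q: "?H (R i) = ennreal (q i)" "0 \<le> q i" for i
        using Rfin[of i] by (auto simp: q_def)
      have "summable q"
        using fin q by (intro summable_suminf_not_top) auto
      then have "(\<lambda>n. \<Sum>i. q (i + n)) \<longlonglongrightarrow> 0"
        by (rule suminf_exist_split2)
      then have "(\<lambda>n. ennreal (\<Sum>i. q (i + n))) \<longlonglongrightarrow> ennreal 0"
        by (rule tendsto_ennrealI)
      moreover have "ennreal (\<Sum>i. q (i + n)) = (\<Sum>i. ?H (R (i + n)))" for n
        unfolding q using q \<open>summable q\<close>
        by (intro suminf_ennreal2[symmetric]) (auto simp: summable_iff_shift)
      ultimately show ?thesis by simp
    qed
    then have "(\<lambda>n. ?H A + (\<Sum>i. ?H (R (i + n)))) \<longlonglongrightarrow> ?H A + 0"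
      by (intro tendsto_intros)
    moreover have "?H (A \<inter> {x. x \<bullet> b \<le> a}) + ?H (A \<inter> {x. x \<bullet> b > a})
        \<le> ?H A + (\<Sum>i. ?H (R (i + n)))" for n
    proof -
      have cover: "A \<inter> {x. x \<bullet> b > a} \<subseteq> S n \<union> (\<Union>i. R (i + n))"
      proof
        fix x assume x: "x \<in> A \<inter> {x. x \<bullet> b > a}"
        show "x \<in> S n \<union> (\<Union>i. R (i + n))"
        proof (cases "x \<bullet> b > r n")
          case False
          have "r \<longlonglongrightarrow> a + 0"
            unfolding r_def by (intro tendsto_intros LIMSEQ_inverse_real_of_nat[unfolded inverse_eq_divide])
          then have "\<forall>\<^sub>F m in sequentially. r m < x \<bullet> b"
            using x by (auto dest!: order_tendstoD(2)[where a = "x \<bullet> b"])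
          then obtain m where m: "r m < x \<bullet> b" by (auto simp: eventually_sequentially)
          define l where "l = (LEAST m. r m < x \<bullet> b)"
          have l: "r l < x \<bullet> b" unfolding l_def using m by (rule LeastI)
          have "n < l"
          proof (rule ccontr)
            assume "\<not> n < l"
            then have "r n \<le> r l" using r_dec[of l n] by (cases "l = n") auto
            then show False using l False by simp
          qed
          then obtain k where k: "l = Suc (k + n)"
            by (metis add.commute less_imp_Suc_add)
          have "\<not> r (k + n) < x \<bullet> b"
            using not_less_Least[of "k + n" "\<lambda>m. r m < x \<bullet> b"] k by (simp add: l_def[symmetric])
          then have "x \<in> R (k + n)" using x l k by (auto simp: R_def)
          then show ?thesis by auto
        qed (use x in \<open>auto simp: S_def\<close>)
      qed
      have "?H (A \<inter> {x. x \<bullet> b > a}) \<le> ?H (S n \<union> (\<Union>i. R (i + n)))"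
        by (intro hausdorff1_outer_mono cover)
      also have "\<dots> \<le> ?H (S n) + ?H (\<Union>i. R (i + n))"
        by (rule hausdorff1_outer_Un)
      also have "\<dots> \<le> ?H (S n) + (\<Sum>i. ?H (R (i + n)))"
        by (intro add_left_mono hausdorff1_outer_countably_subadditive)
      finally have "?H (A \<inter> {x. x \<bullet> b \<le> a}) + ?H (A \<inter> {x. x \<bullet> b > a})
          \<le> ?H (A \<inter> {x. x \<bullet> b \<le> a}) + (?H (S n) + (\<Sum>i. ?H (R (i + n))))"
        by (rule add_left_mono)
      also have "\<dots> = (?H (A \<inter> {x. x \<bullet> b \<le> a}) + ?H (S n)) + (\<Sum>i. ?H (R (i + n)))"
        by (simp add: add.assoc)
      also have "\<dots> \<le> ?H ((A \<inter> {x. x \<bullet> b \<le> a}) \<union> S n) + (\<Sum>i. ?H (R (i + n)))"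
      proof (intro add_right_mono hausdorff1_outer_separated[of "r n - a"])
        fix x y assume "x \<in> A \<inter> {x. x \<bullet> b \<le> a}" "y \<in> S n"
        then show "r n - a \<le> dist x y" using dist_ge[of x y] by (auto simp: S_def)
      qed (use r_pos in auto)
      also have "\<dots> \<le> ?H A + (\<Sum>i. ?H (R (i + n)))"
        by (intro add_right_mono hausdorff1_outer_mono) (auto simp: S_def)
      finally show ?thesis .
    qed
    ultimately show ?thesis by (intro LIMSEQ_le_const) auto
  qed auto
  show ?thesis
    unfolding lambda_system_def
  proof (intro CollectI conjI ballI antisym)
    fix A :: "'a set"
    have eq: "(UNIV - {x. x \<bullet> b \<le> a}) \<inter> A = A \<inter> {x. x \<bullet> b > a}" "{x. x \<bullet> b \<le> a} \<inter> A = A \<inter> {x. x \<bullet> b \<le> a}"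
      by auto
    show "?H ({x. x \<bullet> b \<le> a} \<inter> A) + ?H ((UNIV - {x. x \<bullet> b \<le> a}) \<inter> A) \<le> ?H A"
      unfolding eq by (rule main)
    have "A = ({x. x \<bullet> b \<le> a} \<inter> A) \<union> ((UNIV - {x. x \<bullet> b \<le> a}) \<inter> A)" by auto
    then show "?H A \<le> ?H ({x. x \<bullet> b \<le> a} \<inter> A) + ?H ((UNIV - {x. x \<bullet> b \<le> a}) \<inter> A)"
      using hausdorff1_outer_Un by metis
  qed auto
qed

lemma space_hausdorff1 [simp]: "space hausdorff1 = UNIV"
  by (simp add: hausdorff1_def)

lemma sets_hausdorff1 [simp, measurable_cong]:
  "sets (hausdorff1 :: 'a::euclidean_space measure) = sets borel"
  unfolding hausdorff1_def by (metis sets.sets_measure_of_eq space_borel)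

theorem emeasure_hausdorff1:
  fixes A :: "'a::euclidean_space set"
  assumes "A \<in> sets borel"
  shows "emeasure hausdorff1 A = hausdorff1_outer A"
proof -
  interpret sigma_algebra UNIV "Pow UNIV :: 'a set set" by (rule sigma_algebra_Pow)
  let ?L = "lambda_system UNIV (Pow UNIV) (hausdorff1_outer :: 'a set \<Rightarrow> ennreal)"
  have L: "measure_space UNIV ?L hausdorff1_outer"
    by (rule caratheodory_lemma[OF outer_measure_space_hausdorff1])
  then have "sigma_algebra UNIV ?L" by (simp add: measure_space_def)
  moreover have "(\<lambda>(a, b). {x::'a. x \<bullet> b \<le> a}) ` (UNIV \<times> Basis) \<subseteq> ?L"
    using halfspace_hausdorff1_lambda_system by auto
  ultimately have "sets (borel :: 'a measure) \<subseteq> ?L"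
    unfolding borel_eq_halfspace_le by (simp add: sigma_algebra.sigma_sets_subset)
  moreover have "sigma_algebra UNIV (sets (borel :: 'a measure))"
    using sets.sigma_algebra_axioms[of "borel :: 'a measure"] by simp
  ultimately have "measure_space UNIV (sets (borel :: 'a measure)) hausdorff1_outer"
    using L measure_down by blast
  then show ?thesis
    unfolding hausdorff1_def measure_space_def
    using assms by (intro emeasure_measure_of_sigma) auto
qed

section \<open>Geodesic networks in a Euclidean space\<close>

text \<open>
  A finite embedded graph with straight edges, given by the endpoints of its edges:
  two different edges meet at most in common endpoints. Only nondegenerate edges occur,
  so the graph has no isolated vertices.
\<close>

definition straight_graph :: "('a::euclidean_space \<times> 'a) set \<Rightarrow> bool" where
  "straight_graph E \<longleftrightarrow>
     finite E \<and> (\<forall>(a, b)\<in>E. a \<noteq> b) \<and>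
     (\<forall>(a, b)\<in>E. \<forall>(c, d)\<in>E. (a, b) \<noteq> (c, d) \<longrightarrow>
        closed_segment a b \<inter> closed_segment c d \<subseteq> {a, b} \<inter> {c, d})"

definition geodesic_network :: "'a::euclidean_space set \<Rightarrow> bool" where
  "geodesic_network X \<longleftrightarrow>
     closed X \<and>
     (\<forall>x\<in>X. \<exists>U E. open U \<and> x \<in> U \<and> straight_graph E \<and>
        X \<inter> U = (\<Union>(a, b)\<in>E. closed_segment a b) \<inter> U)"

text \<open>Regular points lie in the relative interior of a segment; endpoints are singular.\<close>

definition reg_points :: "'a::euclidean_space set \<Rightarrow> 'a set" where
  "reg_points X =
     {x \<in> X. \<exists>U a b. open U \<and> x \<in> U \<and> x \<in> open_segment a b \<and> X \<inter> U = open_segment a b \<inter> U}"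

definition sing_points :: "'a::euclidean_space set \<Rightarrow> 'a set" where
  "sing_points X = X - reg_points X"

text \<open>Only the values of \<open>\<Theta>\<close> on the regular points are relevant.\<close>

definition network_with_mult :: "'a::euclidean_space set \<Rightarrow> ('a \<Rightarrow> real) \<Rightarrow> bool" where
  "network_with_mult X \<Theta> \<longleftrightarrow>
     geodesic_network X \<and>
     (\<forall>x\<in>reg_points X. \<Theta> x > 0) \<and>
     (\<forall>x\<in>reg_points X. \<exists>U. open U \<and> x \<in> U \<and> \<Theta> constant_on (U \<inter> reg_points X))"

definition directions :: "'a::euclidean_space set \<Rightarrow> 'a \<Rightarrow> 'a set" where
  "directions X x = {s. norm s = 1 \<and> (\<forall>\<^sub>F t in at_right 0. x + t *\<^sub>R s \<in> X)}"

text \<open>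
  The multiplicity of the geodesic leaving \<open>x\<close> in direction \<open>s\<close>: in a geodesic network the
  points \<open>x + t *\<^sub>R s\<close> are regular for small \<open>t > 0\<close>, and \<open>\<Theta>\<close> is constant along them.
\<close>

definition edge_mult :: "('a::euclidean_space \<Rightarrow> real) \<Rightarrow> 'a \<Rightarrow> 'a \<Rightarrow> real" where
  "edge_mult \<Theta> x s = (THE m. \<forall>\<^sub>F t in at_right 0. \<Theta> (x + t *\<^sub>R s) = m)"

definition extended_mult :: "'a::euclidean_space set \<Rightarrow> ('a \<Rightarrow> real) \<Rightarrow> 'a \<Rightarrow> real" where
  "extended_mult X \<Theta> x =
     (if x \<in> reg_points X then \<Theta> x
      else if x \<in> sing_points X then (\<Sum>s\<in>directions X x. edge_mult \<Theta> x s) / 2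
      else 0)"

definition network_measure :: "'a::euclidean_space set \<Rightarrow> ('a \<Rightarrow> real) \<Rightarrow> 'a measure" where
  "network_measure X \<Theta> = density hausdorff1 (\<lambda>x. ennreal (extended_mult X \<Theta> x))"

definition integral_network :: "'a::euclidean_space set \<Rightarrow> ('a \<Rightarrow> real) \<Rightarrow> bool" where
  "integral_network X \<Theta> \<longleftrightarrow>
     network_with_mult X \<Theta> \<and> (\<forall>x\<in>reg_points X. \<exists>m::nat. m > 0 \<and> \<Theta> x = real m)"

definition stationary_network :: "'a::euclidean_space set \<Rightarrow> ('a \<Rightarrow> real) \<Rightarrow> bool" where
  "stationary_network X \<Theta> \<longleftrightarrow>
     network_with_mult X \<Theta> \<and>
     (\<forall>x\<in>sing_points X. (\<Sum>s\<in>directions X x. edge_mult \<Theta> x s *\<^sub>R s) = 0)"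

definition multiplicity_line_measure :: "nat \<Rightarrow> 'a::euclidean_space set \<Rightarrow> 'a measure" where
  "multiplicity_line_measure k L = density hausdorff1 (\<lambda>x. of_nat k * indicator L x)"

text \<open>Weak convergence of Radon measures, tested on continuous functions of compact support.\<close>

definition radon_weak_conv ::
    "(nat \<Rightarrow> 'a::euclidean_space measure) \<Rightarrow> 'a measure \<Rightarrow> bool" where
  "radon_weak_conv M N \<longleftrightarrow>
     (\<forall>f :: 'a \<Rightarrow> real. continuous_on UNIV f \<and> compact (closure {x. f x \<noteq> 0}) \<longrightarrow>
        (\<lambda>i. \<integral>x. f x \<partial>M i) \<longlonglongrightarrow> (\<integral>x. f x \<partial>N))"

end

theory Submission
  imports Defs
begin

text \<open>
  Slice the network by hyperplanes orthogonal to a direction \<open>u\<close> close to that of the line and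
  regard \<open>u \<bullet> x\<close> as time. Stationarity says that the vector-valued flux
  \<open>F = \<Sum> m\<^sub>e s\<^sub>e\<close> of the edges crossing a slice is constant, and closeness to the multiplicity \<open>k\<close>
  line gives slices crossed with total multiplicity exactly \<open>k\<close> at both ends and a tiny defect
  \<open>k - F \<bullet> u\<close>. So the edges behave like a gas of particles with small lateral velocities that conserves
  mass and momentum at collisions and almost conserves energy.

  The second moment \<open>J\<close> of the lateral positions has a monotone derivative \<open>2 G\<close>. On a time interval
  that is short compared with \<open>sqrt J\<close> over the typical velocity, the particles do not mix: by
  integrality a hyperplane parallel to \<open>F\<close> cuts the network into two disjoint ones of
  multiplicities \<open>k\<^sub>1 + k\<^sub>2 = k\<close>, each with at most the defect of the whole. While \<open>G \<ge> 0\<close>, boundedly many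
  such intervals suffice until the expansion is so far advanced that the velocities are almost
  proportional to the positions; from then on clusters of particles stay in disjoint cones and the network is
  split for good. The part where \<open>G \<le> 0\<close> is the same with time reversed. Induction on \<open>k\<close>
  bounds the number of singular points.
\<close>

section \<open>Balanced nets of oriented segments\<close>

text \<open>Only the flux is balanced at a vertex. The multiplicity crossing a slice may a priori
  increase in between, since edges almost orthogonal to \<open>u\<close> carry little flux along
  \<open>u\<close>. This obstacle shapes the order of the argument: until conservation of mass is
  known, the moments \<open>G\<close>, \<open>J\<close> and the centre are built from expressions
  linear in the direction of an edge, so that the vector balance alone makes them continuous across
  vertices, and lengths of edges are bounded through the growth of \<open>G\<close>. The separation
  by a hyperplane is proved at this level, and conservation of multiplicity is then deduced from it
  by induction on \<open>k\<close>. The defect, multiplicity minus flux component, is nonnegative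
  and additive over vertex-disjoint parts, hence inherited by both parts of a splitting. A defect
  below 1 and integrality together pin down multiplicities that are only known up to an error. The
  admissible defect shrinks rapidly with \<open>k\<close>, because after a long expansion the
  proportionality of velocities and positions must be accurate at the finest scale on which a gap
  between clusters may have to be sought.\<close>

type_synonym 'a edge = "'a \<times> 'a"

definition dir :: "'a::euclidean_space edge \<Rightarrow> 'a" where
  "dir e = sgn (snd e - fst e)"

text \<open>Defined for every \<open>t\<close>, also outside the time range of the edge: the point
  at height \<open>t\<close> on the whole line through the edge.\<close>

definition pos :: "'a::euclidean_space \<Rightarrow> 'a edge \<Rightarrow> real \<Rightarrow> 'a" where
  "pos u e t = fst e + ((t - u \<bullet> fst e) / (u \<bullet> dir e)) *\<^sub>R dir e"

text \<open>Half-open on purpose: at the height of a vertex its outgoing edges count and its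
  incoming ones do not. Slices are therefore right continuous in \<open>t\<close>, and nothing is
  counted twice at a vertex.\<close>

definition cross :: "'a::euclidean_space \<Rightarrow> 'a edge set \<Rightarrow> real \<Rightarrow> 'a edge set" where
  "cross u E t = {e\<in>E. u \<bullet> fst e \<le> t \<and> t < u \<bullet> snd e}"

text \<open>For upward edges and x \<le> y these are the edges that cross some slice at a time in
  [x, y].\<close>

definition meeting :: "'a::euclidean_space \<Rightarrow> 'a edge set \<Rightarrow> real \<Rightarrow> real \<Rightarrow> 'a edge set" where
  "meeting u E x y = {e\<in>E. u \<bullet> fst e \<le> y \<and> x < u \<bullet> snd e}"

definition span_time :: "'a::euclidean_space \<Rightarrow> real \<Rightarrow> real \<Rightarrow> 'a edge \<Rightarrow> real" where
  "span_time u x y e = min (u \<bullet> snd e) y - max (u \<bullet> fst e) x"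

definition crossing_mult :: "'a::euclidean_space \<Rightarrow> 'a edge set \<Rightarrow> ('a edge \<Rightarrow> nat) \<Rightarrow> real \<Rightarrow> nat" where
  "crossing_mult u E m t = (\<Sum>e\<in>cross u E t. m e)"

definition flux :: "'a::euclidean_space \<Rightarrow> 'a edge set \<Rightarrow> ('a edge \<Rightarrow> nat) \<Rightarrow> real \<Rightarrow> 'a" where
  "flux u E m t = (\<Sum>e\<in>cross u E t. real (m e) *\<^sub>R dir e)"

text \<open>A vertex with one incoming and one outgoing edge of the same direction is a mere
  subdivision point of a segment and is not counted. The time range is half-open like that of the
  balance condition of a net, so that ranges can be concatenated.\<close>

definition sing_vertices :: "'a::euclidean_space \<Rightarrow> 'a edge set \<Rightarrow> real \<Rightarrow> real \<Rightarrow> 'a set" where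
  "sing_vertices u E a b =
     {v. a < u \<bullet> v \<and> u \<bullet> v \<le> b \<and> (\<exists>e\<in>E. fst e = v \<or> snd e = v) \<and>
         \<not> (\<exists>e e'. {d\<in>E. snd d = v} = {e} \<and> {d\<in>E. fst d = v} = {e'} \<and> dir e = dir e')}"

text \<open>\<open>balanced\<close> is stationarity at heights in (a, b]. The two last conditions
  say that an edge is determined by one end and its direction; this is what remains of embeddedness,
  and edges of a net may cross away from the vertices.\<close>

locale net =
  fixes u :: "'a::euclidean_space" and E :: "'a edge set" and m :: "'a edge \<Rightarrow> nat" and a b :: real
  assumes norm_u: "norm u = 1"
    and fin: "finite E"
    and up: "e \<in> E \<Longrightarrow> u \<bullet> fst e < u \<bullet> snd e"
    and mult_pos: "e \<in> E \<Longrightarrow> 1 \<le> m e"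
    and ab: "a \<le> b"
    and balanced: "a < u \<bullet> v \<Longrightarrow> u \<bullet> v \<le> b \<Longrightarrow>
        (\<Sum>e\<in>{e\<in>E. snd e = v}. real (m e) *\<^sub>R dir e) = (\<Sum>e\<in>{e\<in>E. fst e = v}. real (m e) *\<^sub>R dir e)"
    and emb_fst: "e \<in> E \<Longrightarrow> e' \<in> E \<Longrightarrow> fst e = fst e' \<Longrightarrow> dir e = dir e' \<Longrightarrow> e = e'"
    and emb_snd: "e \<in> E \<Longrightarrow> e' \<in> E \<Longrightarrow> snd e = snd e' \<Longrightarrow> dir e = dir e' \<Longrightarrow> e = e'"
begin

lemma norm_dir: "e \<in> E \<Longrightarrow> norm (dir e) = 1"
  using up[of e] by (auto simp: dir_def norm_sgn)

lemma slope_pos: "e \<in> E \<Longrightarrow> 0 < u \<bullet> dir e"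
  using up[of e] by (auto simp: dir_def sgn_div_norm inner_diff_right intro!: mult_pos_pos)

lemma slope_le_1: "e \<in> E \<Longrightarrow> u \<bullet> dir e \<le> 1"
  using Cauchy_Schwarz_ineq2[of u "dir e"] norm_u norm_dir[of e] by auto

lemma dir_inner_dir: "e \<in> E \<Longrightarrow> dir e \<bullet> dir e = 1"
  using norm_dir[of e] by (simp add: norm_eq_1)

lemma finite_cross [simp]: "finite (cross u E t)"
  using fin by (auto simp: cross_def)

lemma finite_meeting [simp]: "finite (meeting u E x y)"
  using fin by (auto simp: meeting_def)

lemma cross_subset: "cross u E t \<subseteq> E"
  by (auto simp: cross_def)

lemma crossD: "e \<in> cross u E t \<Longrightarrow> e \<in> E"
  by (auto simp: cross_def)

lemma meetingD: "e \<in> meeting u E x y \<Longrightarrow> e \<in> E"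
  by (auto simp: meeting_def)

lemma span_nonneg: "e \<in> meeting u E x y \<Longrightarrow> x \<le> y \<Longrightarrow> 0 \<le> span_time u x y e"
  using up[of e] by (auto simp: meeting_def span_time_def)

lemma u_pos: "e \<in> E \<Longrightarrow> u \<bullet> pos u e t = t"
  using slope_pos[of e] by (auto simp: pos_def inner_add_right)

lemma pos_fst [simp]: "pos u e (u \<bullet> fst e) = fst e"
  by (simp add: pos_def)

lemma pos_snd:
  assumes "e \<in> E" shows "pos u e (u \<bullet> snd e) = snd e"
proof -
  define d where "d = snd e - fst e"
  have "u \<bullet> d > 0" using up[OF assms] by (simp add: d_def inner_diff_right)
  then have "d \<noteq> 0" by auto
  have "pos u e (u \<bullet> snd e) = fst e + ((u \<bullet> d) / (u \<bullet> sgn d)) *\<^sub>R sgn d"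
    by (simp add: pos_def dir_def d_def inner_diff_right)
  also have "((u \<bullet> d) / (u \<bullet> sgn d)) *\<^sub>R sgn d = d"
    using \<open>u \<bullet> d > 0\<close> \<open>d \<noteq> 0\<close> by (simp add: sgn_div_norm)
  finally show ?thesis by (simp add: d_def)
qed

lemma pos_diff:
  assumes "e \<in> E"
  shows "pos u e y - pos u e x = ((y - x) / (u \<bullet> dir e)) *\<^sub>R dir e"
  by (simp add: pos_def diff_divide_distrib algebra_simps)

lemma real_crossing_mult: "real (crossing_mult u E m t) = (\<Sum>e\<in>cross u E t. real (m e))"
  by (simp add: crossing_mult_def)

lemma sum_by_vertex:
  fixes \<psi> :: "'a edge \<Rightarrow> 'b::real_normed_vector"
  assumes S: "\<And>e. e \<in> S \<Longrightarrow> e \<in> E \<and> g e \<in> V" and "finite V"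
    and full: "\<And>e. e \<in> E \<Longrightarrow> g e \<in> V \<Longrightarrow> e \<in> S"
  shows "(\<Sum>e\<in>S. \<psi> e) = (\<Sum>v\<in>V. \<Sum>e\<in>{e\<in>E. g e = v}. \<psi> e)"
proof -
  have "finite S" using fin S by (meson finite_subset subsetI)
  have "(\<Sum>e\<in>S. \<psi> e) = (\<Sum>v\<in>V. \<Sum>e\<in>{e\<in>S. g e = v}. \<psi> e)"
    using \<open>finite S\<close> \<open>finite V\<close> S by (subst sum.group) auto
  also have "\<dots> = (\<Sum>v\<in>V. \<Sum>e\<in>{e\<in>E. g e = v}. \<psi> e)"
    using S full by (intro sum.cong refl) auto
  finally show ?thesis .
qed

text \<open>The discrete first variation formula: a quantity that is balanced at the vertices changes only along edges.\<close>

lemma evolve: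
  fixes \<phi> :: "'a edge \<Rightarrow> real \<Rightarrow> 'b::real_normed_vector"
  assumes bal: "\<And>v. x < u \<bullet> v \<Longrightarrow> u \<bullet> v \<le> y \<Longrightarrow>
      (\<Sum>e\<in>{e\<in>E. snd e = v}. \<phi> e (u \<bullet> v)) = (\<Sum>e\<in>{e\<in>E. fst e = v}. \<phi> e (u \<bullet> v))"
    and xy: "x \<le> y"
  shows "(\<Sum>e\<in>cross u E y. \<phi> e y) - (\<Sum>e\<in>cross u E x. \<phi> e x) =
     (\<Sum>e\<in>meeting u E x y. \<phi> e (min (u \<bullet> snd e) y) - \<phi> e (max (u \<bullet> fst e) x))"
proof -
  let ?B = "meeting u E x y"
  define V where "V = {v \<in> fst ` E \<union> snd ` E. x < u \<bullet> v \<and> u \<bullet> v \<le> y}"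
  have "finite V" using fin by (auto simp: V_def)
  \<comment> \<open>An edge meeting the interval either still crosses at \<open>y\<close> or ends in
    (x, y]. Dually, for the lower ends, it either crosses at \<open>x\<close> or starts in (x, y].
    The ends inside cancel by the balance.\<close>
  have up1: "(\<Sum>e\<in>?B. \<phi> e (min (u \<bullet> snd e) y)) =
     (\<Sum>e\<in>cross u E y. \<phi> e y) + (\<Sum>e\<in>{e\<in>E. x < u \<bullet> snd e \<and> u \<bullet> snd e \<le> y}. \<phi> e (u \<bullet> snd e))"
  proof -
    have eq: "?B = cross u E y \<union> {e\<in>E. x < u \<bullet> snd e \<and> u \<bullet> snd e \<le> y}"
      using xy up by (fastforce simp: meeting_def cross_def)
    have disj: "cross u E y \<inter> {e\<in>E. x < u \<bullet> snd e \<and> u \<bullet> snd e \<le> y} = {}"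
      by (auto simp: cross_def)
    have "(\<Sum>e\<in>?B. \<phi> e (min (u \<bullet> snd e) y)) = (\<Sum>e\<in>cross u E y. \<phi> e (min (u \<bullet> snd e) y))
       + (\<Sum>e\<in>{e\<in>E. x < u \<bullet> snd e \<and> u \<bullet> snd e \<le> y}. \<phi> e (min (u \<bullet> snd e) y))"
      unfolding eq using disj fin by (intro sum.union_disjoint) auto
    also have "(\<Sum>e\<in>cross u E y. \<phi> e (min (u \<bullet> snd e) y)) = (\<Sum>e\<in>cross u E y. \<phi> e y)"
      by (intro sum.cong) (auto simp: cross_def min_def)
    also have "(\<Sum>e\<in>{e\<in>E. x < u \<bullet> snd e \<and> u \<bullet> snd e \<le> y}. \<phi> e (min (u \<bullet> snd e) y))
        = (\<Sum>e\<in>{e\<in>E. x < u \<bullet> snd e \<and> u \<bullet> snd e \<le> y}. \<phi> e (u \<bullet> snd e))"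
      by (intro sum.cong) (auto simp: min_def)
    finally show ?thesis .
  qed
  have lo1: "(\<Sum>e\<in>?B. \<phi> e (max (u \<bullet> fst e) x)) =
     (\<Sum>e\<in>cross u E x. \<phi> e x) + (\<Sum>e\<in>{e\<in>E. x < u \<bullet> fst e \<and> u \<bullet> fst e \<le> y}. \<phi> e (u \<bullet> fst e))"
  proof -
    have eq: "?B = cross u E x \<union> {e\<in>E. x < u \<bullet> fst e \<and> u \<bullet> fst e \<le> y}"
      using xy up by (fastforce simp: meeting_def cross_def)
    have disj: "cross u E x \<inter> {e\<in>E. x < u \<bullet> fst e \<and> u \<bullet> fst e \<le> y} = {}"
      by (auto simp: cross_def)
    have "(\<Sum>e\<in>?B. \<phi> e (max (u \<bullet> fst e) x)) = (\<Sum>e\<in>cross u E x. \<phi> e (max (u \<bullet> fst e) x))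
       + (\<Sum>e\<in>{e\<in>E. x < u \<bullet> fst e \<and> u \<bullet> fst e \<le> y}. \<phi> e (max (u \<bullet> fst e) x))"
      unfolding eq using disj fin by (intro sum.union_disjoint) auto
    also have "(\<Sum>e\<in>cross u E x. \<phi> e (max (u \<bullet> fst e) x)) = (\<Sum>e\<in>cross u E x. \<phi> e x)"
      by (intro sum.cong) (auto simp: cross_def max_def)
    also have "(\<Sum>e\<in>{e\<in>E. x < u \<bullet> fst e \<and> u \<bullet> fst e \<le> y}. \<phi> e (max (u \<bullet> fst e) x))
        = (\<Sum>e\<in>{e\<in>E. x < u \<bullet> fst e \<and> u \<bullet> fst e \<le> y}. \<phi> e (u \<bullet> fst e))"
      by (intro sum.cong) (auto simp: max_def)
    finally show ?thesis .
  qed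
  have "(\<Sum>e\<in>{e\<in>E. x < u \<bullet> snd e \<and> u \<bullet> snd e \<le> y}. \<phi> e (u \<bullet> snd e))
      = (\<Sum>v\<in>V. \<Sum>e\<in>{e\<in>E. snd e = v}. \<phi> e (u \<bullet> snd e))"
    using \<open>finite V\<close> by (intro sum_by_vertex[where g=snd]) (auto simp: V_def)
  also have "\<dots> = (\<Sum>v\<in>V. \<Sum>e\<in>{e\<in>E. snd e = v}. \<phi> e (u \<bullet> v))"
    by (intro sum.cong refl) auto
  also have "\<dots> = (\<Sum>v\<in>V. \<Sum>e\<in>{e\<in>E. fst e = v}. \<phi> e (u \<bullet> v))"
    by (rule sum.cong[OF refl], rule bal) (auto simp: V_def)
  also have "\<dots> = (\<Sum>v\<in>V. \<Sum>e\<in>{e\<in>E. fst e = v}. \<phi> e (u \<bullet> fst e))"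
    by (intro sum.cong refl) auto
  also have "\<dots> = (\<Sum>e\<in>{e\<in>E. x < u \<bullet> fst e \<and> u \<bullet> fst e \<le> y}. \<phi> e (u \<bullet> fst e))"
    using \<open>finite V\<close> by (intro sum_by_vertex[where g=fst, symmetric]) (auto simp: V_def)
  finally show ?thesis
    using up1 lo1 by (simp add: sum_subtractf)
qed

lemma flux_const:
  assumes "a \<le> x" "x \<le> b"
  shows "flux u E m x = flux u E m a"
  using evolve[of a x "\<lambda>e t. real (m e) *\<^sub>R dir e"] balanced assms
  by (simp add: flux_def)

text \<open>Linearity in the direction turns the vector balance at \<open>v\<close> into the scalar
  balance required by \<open>evolve\<close>. The dependence on the position is arbitrary, because
  all edges at a vertex share that position.\<close>

lemma evolve_inner:
  fixes W :: "'a \<Rightarrow> 'a \<Rightarrow> real"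
  assumes "a \<le> x" "x \<le> y" "y \<le> b" and lin: "\<And>v. linear (\<lambda>s. W v s)"
  shows "(\<Sum>e\<in>cross u E y. real (m e) * W (pos u e y) (dir e)) - (\<Sum>e\<in>cross u E x. real (m e) * W (pos u e x) (dir e)) =
     (\<Sum>e\<in>meeting u E x y. real (m e) * (W (pos u e (min (u \<bullet> snd e) y)) (dir e) - W (pos u e (max (u \<bullet> fst e) x)) (dir e)))"
proof -
  have sum_eq: "(\<Sum>e\<in>S. real (m e) * W v (dir e)) = W v (\<Sum>e\<in>S. real (m e) *\<^sub>R dir e)" for S v
    using lin[of v] by (simp add: linear_sum linear_scale)
  have "(\<Sum>e\<in>cross u E y. real (m e) * W (pos u e y) (dir e)) - (\<Sum>e\<in>cross u E x. real (m e) * W (pos u e x) (dir e)) =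
     (\<Sum>e\<in>meeting u E x y. real (m e) * W (pos u e (min (u \<bullet> snd e) y)) (dir e) - real (m e) * W (pos u e (max (u \<bullet> fst e) x)) (dir e))"
  proof (rule evolve)
    fix v assume v: "x < u \<bullet> v" "u \<bullet> v \<le> y"
    have "(\<Sum>e\<in>{e\<in>E. snd e = v}. real (m e) * W (pos u e (u \<bullet> v)) (dir e)) = (\<Sum>e\<in>{e\<in>E. snd e = v}. real (m e) * W v (dir e))"
      by (intro sum.cong refl) (metis (mono_tags, lifting) mem_Collect_eq pos_snd)
    also have "\<dots> = W v (\<Sum>e\<in>{e\<in>E. fst e = v}. real (m e) *\<^sub>R dir e)"
      unfolding sum_eq using balanced[of v] v assms by simp
    also have "\<dots> = (\<Sum>e\<in>{e\<in>E. fst e = v}. real (m e) * W v (dir e))"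
      by (simp add: sum_eq)
    also have "\<dots> = (\<Sum>e\<in>{e\<in>E. fst e = v}. real (m e) * W (pos u e (u \<bullet> v)) (dir e))"
      by (intro sum.cong refl) (metis (mono_tags, lifting) mem_Collect_eq pos_fst)
    finally show "(\<Sum>e\<in>{e\<in>E. snd e = v}. real (m e) * W (pos u e (u \<bullet> v)) (dir e)) = (\<Sum>e\<in>{e\<in>E. fst e = v}. real (m e) * W (pos u e (u \<bullet> v)) (dir e))" .
  qed fact
  then show ?thesis by (simp add: right_diff_distrib)
qed

text \<open>\<open>evolve\<close> applied to t times the flux density: both boundary terms are
  multiples of the constant flux.\<close>

lemma flux_time_integral:
  assumes "a \<le> x" "x \<le> y" "y \<le> b"
  shows "(\<Sum>e\<in>meeting u E x y. (real (m e) * span_time u x y e) *\<^sub>R dir e) = (y - x) *\<^sub>R flux u E m a"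
proof -
  have "(\<Sum>e\<in>cross u E y. y *\<^sub>R real (m e) *\<^sub>R dir e) - (\<Sum>e\<in>cross u E x. x *\<^sub>R real (m e) *\<^sub>R dir e) =
     (\<Sum>e\<in>meeting u E x y. min (u \<bullet> snd e) y *\<^sub>R real (m e) *\<^sub>R dir e - max (u \<bullet> fst e) x *\<^sub>R real (m e) *\<^sub>R dir e)"
  proof (rule evolve)
    fix v assume v: "x < u \<bullet> v" "u \<bullet> v \<le> y"
    show "(\<Sum>e\<in>{e\<in>E. snd e = v}. (u \<bullet> v) *\<^sub>R real (m e) *\<^sub>R dir e) = (\<Sum>e\<in>{e\<in>E. fst e = v}. (u \<bullet> v) *\<^sub>R real (m e) *\<^sub>R dir e)"
      using balanced[of v] v assms by (simp only: scaleR_sum_right[symmetric])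
  qed fact
  moreover have "(\<Sum>e\<in>cross u E y. y *\<^sub>R real (m e) *\<^sub>R dir e) = y *\<^sub>R flux u E m a"
    using flux_const[of y] assms
    by (simp add: scaleR_sum_right[symmetric] flux_def[symmetric] del: scaleR_scaleR)
  moreover have "(\<Sum>e\<in>cross u E x. x *\<^sub>R real (m e) *\<^sub>R dir e) = x *\<^sub>R flux u E m a"
    using flux_const[of x] assms
    by (simp add: scaleR_sum_right[symmetric] flux_def[symmetric] del: scaleR_scaleR)
  ultimately have "y *\<^sub>R flux u E m a - x *\<^sub>R flux u E m a = (\<Sum>e\<in>meeting u E x y. min (u \<bullet> snd e) y *\<^sub>R real (m e) *\<^sub>R dir e - max (u \<bullet> fst e) x *\<^sub>R real (m e) *\<^sub>R dir e)"
    by simp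
  also have "\<dots> = (\<Sum>e\<in>meeting u E x y. (real (m e) * span_time u x y e) *\<^sub>R dir e)"
    by (intro sum.cong) (auto simp: span_time_def algebra_simps)
  finally show ?thesis by (simp add: algebra_simps)
qed

text \<open>The gap between the two sides is the defect.\<close>

lemma flux_inner_le: "flux u E m t \<bullet> u \<le> real (crossing_mult u E m t)"
proof -
  have "flux u E m t \<bullet> u = (\<Sum>e\<in>cross u E t. real (m e) * (u \<bullet> dir e))"
    unfolding inner_commute[of _ u] by (simp add: flux_def inner_sum_right)
  also have "\<dots> \<le> (\<Sum>e\<in>cross u E t. real (m e) * 1)"
    using slope_le_1 by (intro sum_mono mult_left_mono) (auto simp: cross_def)
  finally show ?thesis by (simp add: real_crossing_mult)
qed

lemma span_eq_integral:
  assumes "x \<le> y" "e \<in> E"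
  shows "((\<lambda>t. if e \<in> cross u E t then real (m e) else 0) has_integral
     (if e \<in> meeting u E x y then real (m e) * span_time u x y e else 0)) {x..y}"
proof (cases "e \<in> meeting u E x y")
  case False
  have "\<forall>t\<in>{x..y}. e \<notin> cross u E t" using False by (auto simp: meeting_def cross_def)
  then have "((\<lambda>t. if e \<in> cross u E t then real (m e) else 0) has_integral 0) {x..y}"
    by (intro has_integral_is_0) auto
  then show ?thesis using False by simp
next
  case True
  let ?l = "max (u \<bullet> fst e) x" and ?h = "min (u \<bullet> snd e) y"
  have lh: "?l \<le> ?h" using True assms up[OF assms(2)] by (auto simp: meeting_def)
  have "((\<lambda>t. real (m e)) has_integral real (m e) * (?h - ?l)) {?l..?h}"
    using has_integral_const_real[of "real (m e)" ?l ?h] lh by (simp add: mult.commute)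
  then have "((\<lambda>t. if t \<in> {?l..?h} then real (m e) else 0) has_integral real (m e) * (?h - ?l)) {x..y}"
    by (subst has_integral_restrict) auto
  \<comment> \<open>The crossing times form a half-open interval, which differs from the closed one
    in its upper end only.\<close>
  then have "((\<lambda>t. if e \<in> cross u E t then real (m e) else 0) has_integral real (m e) * (?h - ?l)) {x..y}"
    by (rule has_integral_spike[where S="{?h}", rotated 2]) (use assms in \<open>auto simp: cross_def\<close>)
  then show ?thesis using True by (simp add: span_time_def)
qed

lemma mult_time_integral:
  assumes "x \<le> y"
  shows "((\<lambda>t. real (crossing_mult u E m t)) has_integral
     (\<Sum>e\<in>meeting u E x y. real (m e) * span_time u x y e)) {x..y}"
proof -
  have "((\<lambda>t. \<Sum>e\<in>E. if e \<in> cross u E t then real (m e) else 0) has_integral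
     (\<Sum>e\<in>E. if e \<in> meeting u E x y then real (m e) * span_time u x y e else 0)) {x..y}"
    using assms span_eq_integral by (intro has_integral_sum fin) auto
  moreover have "(\<lambda>t. \<Sum>e\<in>E. if e \<in> cross u E t then real (m e) else 0) = (\<lambda>t. real (crossing_mult u E m t))"
    using fin cross_subset by (auto simp: real_crossing_mult sum.If_cases Int_absorb1 fun_eq_iff Int_def[symmetric] intro!: sum.cong)
  moreover have "(\<Sum>e\<in>E. if e \<in> meeting u E x y then real (m e) * span_time u x y e else 0)
     = (\<Sum>e\<in>meeting u E x y. real (m e) * span_time u x y e)"
    using fin by (subst sum.If_cases) (auto simp: meeting_def intro!: sum.cong)
  ultimately show ?thesis by simp
qed

end

section \<open>Orthogonal projection along a unit vector, and points avoiding short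
  intervals\<close>

definition perp :: "'a::euclidean_space \<Rightarrow> 'a \<Rightarrow> 'a" where
  "perp f z = z - (z \<bullet> f) *\<^sub>R f"

lemma linear_perp: "linear (perp f)"
  by (auto simp: perp_def linear_iff algebra_simps)

lemmas perp_diff = linear_diff[OF linear_perp]
lemmas perp_scale = linear_scale[OF linear_perp]
lemmas perp_add = linear_add[OF linear_perp]

lemma perp_orth: "norm f = 1 \<Longrightarrow> perp f z \<bullet> f = 0"
  by (simp add: perp_def inner_diff_left norm_eq_1)

lemma perp_self_adj: "perp f x \<bullet> y = x \<bullet> perp f y"
  by (simp add: perp_def inner_diff_left inner_diff_right inner_commute)

lemma perp_perp: "norm f = 1 \<Longrightarrow> perp f (perp f z) = perp f z"
  using perp_orth[of f z] by (simp add: perp_def[of f "perp f z"])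

lemma perp_inner_perp: "norm f = 1 \<Longrightarrow> perp f x \<bullet> perp f y = x \<bullet> perp f y"
  by (simp add: perp_self_adj perp_perp)

lemma norm_perp_sq: "norm f = 1 \<Longrightarrow> (norm (perp f z))\<^sup>2 = (norm z)\<^sup>2 - (z \<bullet> f)\<^sup>2"
  unfolding power2_norm_eq_inner perp_def
  by (simp add: inner_diff_left inner_diff_right norm_eq_1 inner_commute power2_eq_square)

lemma norm_perp_le: "norm f = 1 \<Longrightarrow> norm (perp f z) \<le> norm z"
  by (rule power2_le_imp_le) (auto simp: norm_perp_sq)

text \<open>Closed intervals of total length below \<open>l\<close> cannot cover (0, l), by Lebesgue
  measure. With shadows of edges as intervals this provides a separating hyperplane.\<close>

lemma avoid_intervals:
  fixes lo hi :: "'b \<Rightarrow> real"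
  assumes "finite B" and "\<And>i. i \<in> B \<Longrightarrow> lo i \<le> hi i" and less: "(\<Sum>i\<in>B. hi i - lo i) < l"
  shows "\<exists>\<beta>. 0 < \<beta> \<and> \<beta> < l \<and> (\<forall>i\<in>B. \<beta> < lo i \<or> hi i < \<beta>)"
proof (rule ccontr)
  assume "\<not> ?thesis"
  then have sub: "{0<..<l} \<subseteq> (\<Union>i\<in>B. {lo i..hi i})" by (auto simp: not_less) force
  have l: "0 < l" using less assms(2) by (meson diff_ge_0_iff_ge le_less_trans sum_nonneg)
  have "ennreal l = emeasure lborel {0<..<l}" using l by simp
  also have "\<dots> \<le> emeasure lborel (\<Union>i\<in>B. {lo i..hi i})"
    by (rule emeasure_mono[OF sub]) (use assms in auto)
  also have "\<dots> \<le> (\<Sum>i\<in>B. emeasure lborel {lo i..hi i})"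
    by (rule emeasure_subadditive_finite) (use assms in auto)
  also have "\<dots> = (\<Sum>i\<in>B. ennreal (hi i - lo i))" using assms by simp
  also have "\<dots> = ennreal (\<Sum>i\<in>B. hi i - lo i)" using assms by (intro sum_ennreal) auto
  finally show False using less l assms(2) by (simp add: ennreal_le_iff sum_nonneg)
qed

section \<open>Splitting a net into two vertex-disjoint nets\<close>

context net begin

lemma mult_le_cross: "e \<in> cross u E t \<Longrightarrow> m e \<le> crossing_mult u E m t"
  unfolding crossing_mult_def by (rule member_le_sum) auto

lemma net_sub: "a \<le> x \<Longrightarrow> x \<le> y \<Longrightarrow> y \<le> b \<Longrightarrow> net u E m x y"
  by unfold_locales (use norm_u fin up mult_pos balanced emb_fst emb_snd in auto)

text \<open>Vertices are kept apart exactly at the heights in (x, y], where a net on [x, y] has to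
  be balanced. Each part thus inherits the balance vertex by vertex, while both may share ends
  outside this range.\<close>

definition splits :: "real \<Rightarrow> real \<Rightarrow> 'a edge set \<Rightarrow> 'a edge set \<Rightarrow> bool" where
  "splits x y E1 E2 \<longleftrightarrow> a \<le> x \<and> x \<le> y \<and> y \<le> b \<and> E1 \<union> E2 = meeting u E x y \<and> E1 \<inter> E2 = {} \<and>
     (\<forall>e\<in>E1. \<forall>e'\<in>E2. \<forall>v. x < u \<bullet> v \<and> u \<bullet> v \<le> y \<longrightarrow> \<not> ((fst e = v \<or> snd e = v) \<and> (fst e' = v \<or> snd e' = v)))"

lemma splits_sym: "splits x y E1 E2 \<Longrightarrow> splits x y E2 E1"
  unfolding splits_def by blast

lemma splits_subset: "splits x y E1 E2 \<Longrightarrow> E1 \<subseteq> E"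
  by (auto simp: splits_def meeting_def)

lemma splits_finite: "splits x y E1 E2 \<Longrightarrow> finite E1"
  by (rule finite_subset[OF splits_subset fin])

text \<open>Every edge at \<open>v\<close> meets the interval, so it belongs to one of the parts,
  and not to the second one, which has no vertex in common with the first.\<close>

lemma splits_in_out:
  assumes s: "splits x y E1 E2" and v: "x < u \<bullet> v" "u \<bullet> v \<le> y"
    and e: "e \<in> E1" "fst e = v \<or> snd e = v"
  shows "{d\<in>E1. snd d = v} = {d\<in>E. snd d = v}" "{d\<in>E1. fst d = v} = {d\<in>E. fst d = v}"
proof -
  have "d \<in> E1" if "d \<in> E" "fst d = v \<or> snd d = v" for d
  proof -
    have "d \<in> meeting u E x y" using that v up[of d] by (auto simp: meeting_def)
    then show ?thesis using s e that v unfolding splits_def by blast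
  qed
  then show "{d\<in>E1. snd d = v} = {d\<in>E. snd d = v}" "{d\<in>E1. fst d = v} = {d\<in>E. fst d = v}"
    using splits_subset[OF s] by auto
qed

lemma splits_net:
  assumes s: "splits x y E1 E2" shows "net u E1 m x y"
proof unfold_locales
  have sub: "E1 \<subseteq> E" by (rule splits_subset[OF s])
  show "norm u = 1" by (rule norm_u)
  show "finite E1" by (rule splits_finite[OF s])
  show "x \<le> y" using s by (simp add: splits_def)
  show "u \<bullet> fst e < u \<bullet> snd e" if "e \<in> E1" for e using up that sub by blast
  show "1 \<le> m e" if "e \<in> E1" for e using mult_pos that sub by blast
  show "e = e'" if "e \<in> E1" "e' \<in> E1" "fst e = fst e'" "dir e = dir e'" for e e'
    using emb_fst that sub by blast
  show "e = e'" if "e \<in> E1" "e' \<in> E1" "snd e = snd e'" "dir e = dir e'" for e e'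
    using emb_snd that sub by blast
  fix v assume v: "x < u \<bullet> v" "u \<bullet> v \<le> y"
  show "(\<Sum>e\<in>{e\<in>E1. snd e = v}. real (m e) *\<^sub>R dir e) = (\<Sum>e\<in>{e\<in>E1. fst e = v}. real (m e) *\<^sub>R dir e)"
  proof (cases "\<exists>e\<in>E1. fst e = v \<or> snd e = v")
    case True
    then obtain e where "e \<in> E1" "fst e = v \<or> snd e = v" by auto
    then show ?thesis
      using splits_in_out[OF s v] balanced[of v] v s by (simp add: splits_def)
  next
    case False
    then have "{e\<in>E1. snd e = v} = {}" "{e\<in>E1. fst e = v} = {}" by auto
    then show ?thesis by (simp only: sum.empty)
  qed
qed

lemma splits_cross:
  assumes s: "splits x y E1 E2" and t: "x \<le> t" "t \<le> y"
  shows "cross u E t = cross u E1 t \<union> cross u E2 t" "cross u E1 t \<inter> cross u E2 t = {}"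
proof -
  have "e \<in> E1 \<union> E2 \<longleftrightarrow> e \<in> meeting u E x y" for e using s by (simp add: splits_def)
  then show "cross u E t = cross u E1 t \<union> cross u E2 t"
    using t splits_subset[OF s] splits_subset[OF splits_sym[OF s]] by (fastforce simp: cross_def meeting_def)
  show "cross u E1 t \<inter> cross u E2 t = {}" using s by (auto simp: splits_def cross_def)
qed

lemma splits_sum:
  fixes g :: "'a edge \<Rightarrow> 'b::comm_monoid_add"
  assumes s: "splits x y E1 E2" and t: "x \<le> t" "t \<le> y"
  shows "(\<Sum>e\<in>cross u E t. g e) = (\<Sum>e\<in>cross u E1 t. g e) + (\<Sum>e\<in>cross u E2 t. g e)"
proof -
  have "finite (cross u E1 t)" "finite (cross u E2 t)"
    using splits_finite[OF s] splits_finite[OF splits_sym[OF s]] by (auto simp: cross_def)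
  then show ?thesis
    using splits_cross[OF assms] by (simp add: sum.union_disjoint)
qed

lemma splits_sing:
  assumes s: "splits x y E1 E2"
  shows "sing_vertices u E x y \<subseteq> sing_vertices u E1 x y \<union> sing_vertices u E2 x y"
proof
  fix v assume v: "v \<in> sing_vertices u E x y"
  then obtain e where e: "e \<in> E" "fst e = v \<or> snd e = v" and vt: "x < u \<bullet> v" "u \<bullet> v \<le> y"
    by (auto simp: sing_vertices_def)
  have "e \<in> meeting u E x y" using e vt up[of e] by (auto simp: meeting_def)
  then have "e \<in> E1 \<or> e \<in> E2" using s by (auto simp: splits_def)
  then show "v \<in> sing_vertices u E1 x y \<union> sing_vertices u E2 x y"
  proof
    assume e1: "e \<in> E1"
    show ?thesis using v e1 e vt splits_in_out[OF s vt e1 e(2)]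
      by (simp add: sing_vertices_def) blast
  next
    assume e1: "e \<in> E2"
    show ?thesis using v e1 e vt splits_in_out[OF splits_sym[OF s] vt e1 e(2)]
      by (simp add: sing_vertices_def) blast
  qed
qed

lemma finite_sing: "finite (sing_vertices u E x y)"
proof -
  have "sing_vertices u E x y \<subseteq> fst ` E \<union> snd ` E" by (auto simp: sing_vertices_def)
  then show ?thesis using fin by (meson finite_UnI finite_imageI finite_subset)
qed

lemma splits_card_sing:
  assumes s: "splits x y E1 E2"
  shows "card (sing_vertices u E x y) \<le> card (sing_vertices u E1 x y) + card (sing_vertices u E2 x y)"
proof -
  interpret n1: net u E1 m x y by (rule splits_net[OF s])
  interpret n2: net u E2 m x y by (rule splits_net[OF splits_sym[OF s]])
  have "card (sing_vertices u E x y) \<le> card (sing_vertices u E1 x y \<union> sing_vertices u E2 x y)"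
    by (intro card_mono splits_sing[OF s]) (auto simp: n1.finite_sing n2.finite_sing)
  also have "\<dots> \<le> card (sing_vertices u E1 x y) + card (sing_vertices u E2 x y)"
    by (rule card_Un_le)
  finally show ?thesis .
qed

lemma splits_mult:
  assumes s: "splits x y E1 E2" and t: "x \<le> t" "t \<le> y"
  shows "crossing_mult u E m t = crossing_mult u E1 m t + crossing_mult u E2 m t"
    "flux u E m t = flux u E1 m t + flux u E2 m t"
  using splits_sum[OF assms, of m] splits_sum[OF assms, of "\<lambda>e. real (m e) *\<^sub>R dir e"]
  by (auto simp: crossing_mult_def flux_def)

text \<open>Each part has constant flux and a defect between 0 and that of the whole, which is below
  1. Hence its multiplicity at \<open>x\<close> is less than its multiplicity at \<open>y\<close>
  plus 1, that is, no part loses multiplicity; as both sums equal \<open>k\<close>, none gains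
  any.\<close>

lemma splits_mult_const:
  assumes s: "splits x y E1 E2"
    and N: "crossing_mult u E m x = k" "crossing_mult u E m y = k"
    and dev: "real k - flux u E m a \<bullet> u < 1"
  shows "crossing_mult u E1 m y = crossing_mult u E1 m x"
    "real (crossing_mult u E1 m x) - flux u E1 m x \<bullet> u \<le> real k - flux u E m a \<bullet> u"
proof -
  interpret n1: net u E1 m x y by (rule splits_net[OF s])
  interpret n2: net u E2 m x y by (rule splits_net[OF splits_sym[OF s]])
  have xy: "a \<le> x" "x \<le> y" "y \<le> b" using s by (auto simp: splits_def)
  have F: "flux u E m a = flux u E1 m x + flux u E2 m x"
    using splits_mult(2)[OF s, of x] flux_const[of x] xy by simp
  have Nx: "k = crossing_mult u E1 m x + crossing_mult u E2 m x"
    using splits_mult(1)[OF s, of x] N xy by simp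
  have Ny: "k = crossing_mult u E1 m y + crossing_mult u E2 m y"
    using splits_mult(1)[OF s, of y] N xy by simp
  note i = n1.flux_inner_le[of x] n2.flux_inner_le[of x] n1.flux_inner_le[of y] n2.flux_inner_le[of y]
    n1.flux_const[of y] n2.flux_const[of y]
  show le: "real (crossing_mult u E1 m x) - flux u E1 m x \<bullet> u \<le> real k - flux u E m a \<bullet> u"
    using i F Nx by (simp add: inner_add_left)
  have "real (crossing_mult u E1 m x) < real (crossing_mult u E1 m y) + 1"
    using le dev i xy by simp
  moreover have "real (crossing_mult u E2 m x) - flux u E2 m x \<bullet> u \<le> real k - flux u E m a \<bullet> u"
    using i F Nx by (simp add: inner_add_left)
  then have "real (crossing_mult u E2 m x) < real (crossing_mult u E2 m y) + 1"
    using dev i xy by simp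
  ultimately show "crossing_mult u E1 m y = crossing_mult u E1 m x"
    using Nx Ny by linarith
qed

end

section \<open>Nets of small flux defect\<close>

text \<open>The multiplicity is prescribed at the two ends only; that it equals \<open>k\<close> in
  between is the content of \<open>thin_net_mult\<close>. The factor 512 = 16 * 32 combines the 32
  in the time bound of \<open>split_exists\<close> with a factor 16 lost in that proof.\<close>

locale thin_net = net +
  fixes k :: nat
  assumes Na: "crossing_mult u E m a = k" and Nb: "crossing_mult u E m b = k" and k1: "1 \<le> k"
    and dev: "real k - flux u E m a \<bullet> u \<le> 1 / (512 * (real k)\<^sup>2)"
begin

text \<open>\<open>en\<close> plays the role of the kinetic energy. The spread \<open>J\<close> about the moving centre of mass has derivative
  \<open>2 * G\<close>, and \<open>G\<close> has derivative \<open>\<Sum> m e * rate e \<ge> 0\<close>.\<close>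

definition f where "f = sgn (flux u E m a)"
definition en where "en = real k - norm (flux u E m a)"
abbreviation P where "P \<equiv> perp f"
text \<open>A point on the edge moves with velocity \<open>dir e\<close> divided by
  \<open>u \<bullet> dir e\<close>, so this is the time derivative of
  \<open>dir e \<bullet> P (pos u e t)\<close>.\<close>

definition rate where "rate e = (norm (P (dir e)))\<^sup>2 / (u \<bullet> dir e)"
definition G where "G t = (\<Sum>e\<in>cross u E t. real (m e) * (dir e \<bullet> P (pos u e t)))"
text \<open>An edge has the weight \<open>m e * (u \<bullet> dir e)\<close>, its contribution to the
  flux along \<open>u\<close>. These weights have a constant sum and make the first moment linear in
  the direction, hence continuous across vertices. Projection along \<open>f\<close> removes the
  drift, so that the centre does not depend on time.\<close>

definition ctr where
  "ctr = (1 / (flux u E m a \<bullet> u)) *\<^sub>R (\<Sum>e\<in>cross u E a. (real (m e) * (u \<bullet> dir e)) *\<^sub>R P (pos u e a))"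
definition J where
  "J t = (\<Sum>e\<in>cross u E t. real (m e) * ((u \<bullet> dir e) * (norm (P (pos u e t - ctr)))\<^sup>2))"

lemma k_sq: "1 \<le> (real k)\<^sup>2" using k1 by (simp add: one_le_power)

lemma dev512: "real k - flux u E m a \<bullet> u \<le> 1/512"
proof -
  have "1 / (512 * (real k)\<^sup>2) \<le> 1/512" using k_sq k1 by (intro divide_left_mono) auto
  then show ?thesis using dev by linarith
qed

lemma flux_u_pos: "0 < flux u E m a \<bullet> u"
  using dev512 k1 by (simp add: less_le_trans)

lemma flux_nz: "flux u E m a \<noteq> 0"
  using flux_u_pos by auto

lemma norm_f: "norm f = 1"
  using flux_nz by (simp add: f_def norm_sgn)

lemma flux_f: "flux u E m a = norm (flux u E m a) *\<^sub>R f"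
  using flux_nz by (simp add: f_def sgn_div_norm)

lemma flux_inner_f: "flux u E m a \<bullet> f = norm (flux u E m a)"
  using flux_f norm_f by (metis inner_scaleR_left mult.right_neutral norm_eq_1)

lemma perp_flux: "P (flux u E m a) = 0"
  using flux_inner_f flux_f by (simp add: perp_def)

lemma flux_u_le_norm: "flux u E m a \<bullet> u \<le> norm (flux u E m a)"
  using norm_cauchy_schwarz[of "flux u E m a" u] norm_u by simp

lemma norm_flux_le: "norm (flux u E m a) \<le> k"
proof -
  have "norm (flux u E m a) \<le> (\<Sum>e\<in>cross u E a. norm (real (m e) *\<^sub>R dir e))"
    unfolding flux_def by (rule norm_sum)
  also have "\<dots> = real (crossing_mult u E m a)"
    using norm_dir by (auto simp: real_crossing_mult cross_def)
  finally show ?thesis using Na by simp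
qed

lemma en_nonneg: "0 \<le> en" using norm_flux_le by (simp add: en_def)

lemma en_le_dev: "en \<le> real k - flux u E m a \<bullet> u"
  using flux_u_le_norm by (simp add: en_def)

lemma f_inner_u: "1 - (real k - flux u E m a \<bullet> u) \<le> f \<bullet> u"
proof -
  have "norm (flux u E m a) * (f \<bullet> u) = flux u E m a \<bullet> u"
    using flux_f by (metis inner_scaleR_left)
  moreover have "f \<bullet> u \<le> 1" using norm_cauchy_schwarz[of f u] norm_f norm_u by simp
  moreover have "real k - norm (flux u E m a) \<ge> 0" using norm_flux_le by simp
  moreover have "1 \<le> real k" using k1 by simp
  moreover have "0 < f \<bullet> u" using flux_u_pos flux_nz by (simp add: f_def sgn_div_norm)
  ultimately have "flux u E m a \<bullet> u \<le> real k * (f \<bullet> u)"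
    by (metis diff_ge_0_iff_ge less_imp_le mult_right_mono)
  then have "real k * (1 - f \<bullet> u) \<le> real k - flux u E m a \<bullet> u" by (simp add: algebra_simps)
  moreover have "1 * (1 - f \<bullet> u) \<le> real k * (1 - f \<bullet> u)"
    using \<open>f \<bullet> u \<le> 1\<close> \<open>1 \<le> real k\<close> by (intro mult_right_mono) auto
  ultimately show ?thesis by simp
qed

lemma norm_f_u_sq: "(norm (f - u))\<^sup>2 \<le> 2 * (real k - flux u E m a \<bullet> u)"
  using f_inner_u norm_f norm_u
  by (simp add: power2_norm_eq_inner inner_diff_left inner_diff_right norm_eq_1 inner_commute)

text \<open>The squared distance is at most twice the defect, and 2 / 512 is the square of
  1/16.\<close>

lemma norm_f_u: "norm (f - u) \<le> 1/16"
proof (rule power2_le_imp_le)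
  have "(norm (f - u))\<^sup>2 \<le> 2 * (1/512)" by (rule order_trans[OF norm_f_u_sq]) (intro mult_left_mono dev512, simp)
  then show "(norm (f - u))\<^sup>2 \<le> (1/16)\<^sup>2" by (simp add: power2_eq_square)
qed simp

text \<open>The flux component bounds every multiplicity from below and falls short of
  \<open>k\<close> by less than 1, so integrality leaves no smaller value than
  \<open>k\<close>.\<close>

lemma crossing_mult_ge: "a \<le> t \<Longrightarrow> t \<le> b \<Longrightarrow> k \<le> crossing_mult u E m t"
proof -
  assume t: "a \<le> t" "t \<le> b"
  have "flux u E m a \<bullet> u \<le> real (crossing_mult u E m t)"
    using flux_inner_le[of t] flux_const[OF t] by simp
  then have "real k < real (crossing_mult u E m t) + 1" using dev512 by linarith
  then show ?thesis by linarith
qed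

lemma dir_f_u:
  assumes "e \<in> E" shows "\<bar>dir e \<bullet> f - u \<bullet> dir e\<bar> \<le> 1/16" "dir e \<bullet> f \<le> 1"
proof -
  have "\<bar>dir e \<bullet> (f - u)\<bar> \<le> norm (dir e) * norm (f - u)" by (rule Cauchy_Schwarz_ineq2)
  then show "\<bar>dir e \<bullet> f - u \<bullet> dir e\<bar> \<le> 1/16"
    using norm_f_u norm_dir[OF assms] by (simp add: inner_diff_right inner_commute)
  show "dir e \<bullet> f \<le> 1" using norm_cauchy_schwarz[of "dir e" f] norm_f norm_dir[OF assms] by simp
qed

lemma perp_dir_sq: "e \<in> E \<Longrightarrow> (norm (P (dir e)))\<^sup>2 = 1 - (dir e \<bullet> f)\<^sup>2"
  by (simp add: norm_perp_sq norm_f norm_dir)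

text \<open>With x = \<open>dir e \<bullet> f\<close> the left factor of (1 - x)(1 + x) is kept. The
  other one exceeds 1/2, since edges go up along \<open>u\<close> and \<open>f\<close> is close to
  \<open>u\<close>.\<close>

lemma perp_dir_sq_ge:
  assumes "e \<in> E" shows "(1 - dir e \<bullet> f) / 2 \<le> (norm (P (dir e)))\<^sup>2"
proof -
  let ?x = "dir e \<bullet> f"
  have "?x \<ge> - (1/16)" using dir_f_u[OF assms] slope_pos[OF assms] by linarith
  then have "(1 - ?x) * (1/2) \<le> (1 - ?x) * (1 + ?x)"
    using dir_f_u(2)[OF assms] by (intro mult_left_mono) auto
  then show ?thesis unfolding perp_dir_sq[OF assms] by (simp add: power2_eq_square diff_divide_distrib algebra_simps)
qed

lemma perp_dir_sq_le:
  assumes "e \<in> E" shows "(norm (P (dir e)))\<^sup>2 \<le> 2 * (1 - dir e \<bullet> f)"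
proof -
  let ?x = "dir e \<bullet> f"
  have "(1 - ?x) * (1 + ?x) \<le> (1 - ?x) * 2"
    using dir_f_u(2)[OF assms] by (intro mult_left_mono) auto
  then show ?thesis unfolding perp_dir_sq[OF assms] by (simp add: power2_eq_square diff_divide_distrib algebra_simps)
qed

text \<open>The length of an edge per unit of time is unbounded for edges almost orthogonal to
  \<open>u\<close>, but for those the rate is just as large. For the remaining edges the component
  along \<open>f\<close> takes over. Summed over all edges, the rates are controlled by
  \<open>G\<close> and the components by the flux, even at times when the multiplicity is not
  known.\<close>

lemma length_bound:
  assumes "e \<in> E" shows "1 / (u \<bullet> dir e) \<le> 4 * rate e + 2 * (dir e \<bullet> f)"
proof -
  let ?x = "dir e \<bullet> f" and ?c = "u \<bullet> dir e"
  have c: "0 < ?c" "?c \<le> 1" and d: "\<bar>?x - ?c\<bar> \<le> 1/16" and x1: "?x \<le> 1"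
    using slope_pos[OF assms] slope_le_1[OF assms] dir_f_u[OF assms] by auto
  \<comment> \<open>For x \<le> 4/5 the first term is at least 36/25 and absorbs the second one,
    which is at least -1/8. For x > 4/5 the second term alone is at least 28/25.\<close>
  have "1 \<le> 4 * (1 - ?x\<^sup>2) + 2 * ?x * ?c"
  proof (cases "?x \<le> 4/5")
    case True
    have "\<bar>?x\<bar> \<le> 4/5" using True d c by linarith
    then have "?x\<^sup>2 \<le> (4/5)\<^sup>2" by (metis abs_le_square_iff abs_of_nonneg divide_nonneg_nonneg zero_le_numeral)
    moreover have "- (1/16) \<le> ?x * ?c"
    proof (cases "?x \<ge> 0")
      case True
      then have "0 \<le> ?x * ?c" using c by simp
      then show ?thesis by linarith
    next
      case False
      then have "- ?x * ?c \<le> (1/16) * 1" using d c by (intro mult_mono) linarith+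
      then show ?thesis by simp
    qed
    ultimately show ?thesis by (simp add: power2_eq_square)
  next
    case False
    then have "(4/5) * (7/10) \<le> ?x * ?c" using d by (intro mult_mono) linarith+
    moreover have "?x\<^sup>2 \<le> 1" using False x1 by (simp add: power_le_one)
    ultimately show ?thesis by simp
  qed
  then have "1 / ?c \<le> (4 * (1 - ?x\<^sup>2) + 2 * ?x * ?c) / ?c" using c by (intro divide_right_mono) auto
  also have "\<dots> = 4 * rate e + 2 * ?x" using c by (simp add: rate_def perp_dir_sq[OF assms] field_simps)
  finally show ?thesis .
qed

lemma rate_nonneg: "e \<in> E \<Longrightarrow> 0 \<le> rate e"
  using slope_pos[of e] by (simp add: rate_def)

lemma rate_ge:
  assumes "e \<in> E" shows "(1 - dir e \<bullet> f) / 2 \<le> rate e"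
proof -
  have "(norm (P (dir e)))\<^sup>2 * 1 \<le> (norm (P (dir e)))\<^sup>2 * (1 / (u \<bullet> dir e))"
    using slope_pos[OF assms] slope_le_1[OF assms] by (intro mult_left_mono) auto
  then show ?thesis unfolding rate_def using perp_dir_sq_ge[OF assms] by (simp only: times_divide_eq_right mult_1_right)
qed

lemma G_diff:
  assumes "a \<le> x" "x \<le> y" "y \<le> b"
  shows "G y - G x = (\<Sum>e\<in>meeting u E x y. real (m e) * (rate e * span_time u x y e))"
proof -
  have "G y - G x = (\<Sum>e\<in>meeting u E x y. real (m e) * (dir e \<bullet> P (pos u e (min (u \<bullet> snd e) y)) - dir e \<bullet> P (pos u e (max (u \<bullet> fst e) x))))"
    unfolding G_def using assms by (intro evolve_inner[where W="\<lambda>v s. s \<bullet> P v"]) (auto simp: linear_iff inner_add_left)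
  also have "\<dots> = (\<Sum>e\<in>meeting u E x y. real (m e) * (rate e * span_time u x y e))"
  proof (rule sum.cong[OF refl])
    fix e assume "e \<in> meeting u E x y"
    then have e: "e \<in> E" by (rule meetingD)
    have "dir e \<bullet> P (pos u e (min (u \<bullet> snd e) y)) - dir e \<bullet> P (pos u e (max (u \<bullet> fst e) x))
       = dir e \<bullet> P ((span_time u x y e / (u \<bullet> dir e)) *\<^sub>R dir e)"
      by (simp add: inner_diff_right[symmetric] perp_diff[symmetric] pos_diff[OF e] span_time_def)
    also have "\<dots> = rate e * span_time u x y e"
      by (simp add: perp_scale rate_def power2_norm_eq_inner perp_inner_perp[OF norm_f])
    finally show "real (m e) * (dir e \<bullet> P (pos u e (min (u \<bullet> snd e) y)) - dir e \<bullet> P (pos u e (max (u \<bullet> fst e) x))) = real (m e) * (rate e * span_time u x y e)"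
      by simp
  qed
  finally show ?thesis .
qed

text \<open>The flux is parallel to \<open>f\<close>, so the total lateral momentum vanishes. Hence
  \<open>G\<close> does not depend on the origin, which may be moved to the centre.\<close>

lemma sum_mult_perp_dir:
  assumes "a \<le> t" "t \<le> b"
  shows "(\<Sum>e\<in>cross u E t. real (m e) * (dir e \<bullet> P z)) = 0"
proof -
  have "(\<Sum>e\<in>cross u E t. real (m e) * (dir e \<bullet> P z)) = flux u E m t \<bullet> P z"
    by (simp add: flux_def inner_sum_left)
  also have "\<dots> = P (flux u E m a) \<bullet> z" using flux_const[OF assms] by (simp add: perp_self_adj)
  finally show ?thesis by (simp add: perp_flux)
qed

lemma G_centred:
  assumes "a \<le> t" "t \<le> b"
  shows "G t = (\<Sum>e\<in>cross u E t. real (m e) * (dir e \<bullet> P (pos u e t - z)))"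
  using sum_mult_perp_dir[OF assms, of z]
  by (simp add: G_def perp_diff inner_diff_right right_diff_distrib sum_subtractf)

lemma G_mono: "a \<le> x \<Longrightarrow> x \<le> y \<Longrightarrow> y \<le> b \<Longrightarrow> G x \<le> G y"
proof -
  assume *: "a \<le> x" "x \<le> y" "y \<le> b"
  have "0 \<le> (\<Sum>e\<in>meeting u E x y. real (m e) * (rate e * span_time u x y e))"
    using * rate_nonneg span_nonneg meetingD by (intro sum_nonneg mult_nonneg_nonneg of_nat_0_le_iff) blast+
  then show ?thesis using G_diff[OF *] by simp
qed

lemma linear_flux_weight: "linear (\<lambda>s. (u \<bullet> s) * p + q * (s \<bullet> r))"
  by (intro linearI) (simp_all add: inner_add_left inner_add_right distrib_left distrib_right)

text \<open>The weighted first moment changes in time only by the projection of the time integral of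
  the flux. That integral is parallel to \<open>f\<close> and projects to 0.\<close>

lemma centre_const:
  assumes t: "a \<le> t" "t \<le> b"
  shows "(\<Sum>e\<in>cross u E t. real (m e) * ((u \<bullet> dir e) * (w \<bullet> P (pos u e t - ctr)))) = 0"
proof -
  have "(\<Sum>e\<in>cross u E t. real (m e) * ((u \<bullet> dir e) * (w \<bullet> P (pos u e t)))) - (\<Sum>e\<in>cross u E a. real (m e) * ((u \<bullet> dir e) * (w \<bullet> P (pos u e a))))
    = (\<Sum>e\<in>meeting u E a t. real (m e) * ((u \<bullet> dir e) * (w \<bullet> P (pos u e (min (u \<bullet> snd e) t))) - (u \<bullet> dir e) * (w \<bullet> P (pos u e (max (u \<bullet> fst e) a)))))"
    using t by (intro evolve_inner[where W="\<lambda>v s. (u \<bullet> s) * (w \<bullet> P v)"]) (auto simp: linear_iff inner_add_right algebra_simps)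
  also have "\<dots> = (\<Sum>e\<in>meeting u E a t. (w \<bullet> P ((real (m e) * span_time u a t e) *\<^sub>R dir e)))"
  proof (rule sum.cong[OF refl])
    fix e assume "e \<in> meeting u E a t"
    then have e: "e \<in> E" by (rule meetingD)
    have "(w \<bullet> P (pos u e (min (u \<bullet> snd e) t))) - (w \<bullet> P (pos u e (max (u \<bullet> fst e) a)))
       = w \<bullet> P ((span_time u a t e / (u \<bullet> dir e)) *\<^sub>R dir e)"
      by (simp add: inner_diff_right[symmetric] perp_diff[symmetric] pos_diff[OF e] span_time_def)
    then show "real (m e) * ((u \<bullet> dir e) * (w \<bullet> P (pos u e (min (u \<bullet> snd e) t))) - (u \<bullet> dir e) * (w \<bullet> P (pos u e (max (u \<bullet> fst e) a)))) = w \<bullet> P ((real (m e) * span_time u a t e) *\<^sub>R dir e)"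
      using slope_pos[OF e] by (simp add: perp_scale right_diff_distrib[symmetric])
  qed
  also have "\<dots> = w \<bullet> P (\<Sum>e\<in>meeting u E a t. (real (m e) * span_time u a t e) *\<^sub>R dir e)"
    by (simp add: linear_sum[OF linear_perp] inner_sum_right)
  also have "\<dots> = 0"
    using flux_time_integral[of a t] t by (simp add: perp_scale perp_flux)
  finally have eq: "(\<Sum>e\<in>cross u E t. real (m e) * ((u \<bullet> dir e) * (w \<bullet> P (pos u e t)))) = (\<Sum>e\<in>cross u E a. real (m e) * ((u \<bullet> dir e) * (w \<bullet> P (pos u e a))))"
    by simp
  have c: "(\<Sum>e\<in>cross u E t. real (m e) * (u \<bullet> dir e)) = flux u E m a \<bullet> u"
    unfolding flux_const[OF t, symmetric] inner_commute[of _ u] by (simp add: flux_def inner_sum_right)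
  have Pctr: "P ctr = ctr"
    by (simp add: ctr_def perp_scale linear_sum[OF linear_perp] perp_perp[OF norm_f])
  have "(\<Sum>e\<in>cross u E a. real (m e) * ((u \<bullet> dir e) * (w \<bullet> P (pos u e a)))) = (flux u E m a \<bullet> u) * (w \<bullet> ctr)"
    using flux_u_pos by (simp add: ctr_def inner_sum_right mult.assoc)
  moreover have "(\<Sum>e\<in>cross u E t. real (m e) * ((u \<bullet> dir e) * (w \<bullet> P (pos u e t - ctr))))
     = (\<Sum>e\<in>cross u E t. real (m e) * ((u \<bullet> dir e) * (w \<bullet> P (pos u e t)))) - (\<Sum>e\<in>cross u E t. real (m e) * (u \<bullet> dir e)) * (w \<bullet> ctr)"
    by (simp add: perp_diff Pctr inner_diff_right right_diff_distrib sum_subtractf sum_distrib_right mult.assoc)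
  ultimately show ?thesis using eq c by simp
qed

text \<open>An exact Taylor formula at \<open>x\<close>. The second derivative of \<open>J\<close>
  is twice the total rate, and the last sum is the integral remainder: 2 (y - t) times the rate,
  integrated over the time that each edge spends in [x, y].\<close>

lemma J_formula:
  assumes "a \<le> x" "x \<le> y" "y \<le> b"
  shows "J y = J x + 2 * (y - x) * G x + (\<Sum>e\<in>meeting u E x y. real (m e) *
       (rate e * ((y - max (u \<bullet> fst e) x)\<^sup>2 - (y - min (u \<bullet> snd e) y)\<^sup>2)))"
proof -
  \<comment> \<open>The second term of \<open>W\<close> is the first-order Taylor term: summed over
    a slice, \<open>W\<close> gives \<open>J y\<close> at time y and
    \<open>J x + 2 * (y - x) * G x\<close> at time x. Along an edge the derivative of
    \<open>W\<close> is 2 (y - t) times the rate.\<close>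
  define W where "W v s = (u \<bullet> s) * (norm (P (v - ctr)))\<^sup>2 + 2 * (y - u \<bullet> v) * (s \<bullet> P (v - ctr))" for v s
  have "linear (W v)" for v unfolding W_def by (rule linear_flux_weight)
  then have "(\<Sum>e\<in>cross u E y. real (m e) * W (pos u e y) (dir e)) - (\<Sum>e\<in>cross u E x. real (m e) * W (pos u e x) (dir e)) =
     (\<Sum>e\<in>meeting u E x y. real (m e) * (W (pos u e (min (u \<bullet> snd e) y)) (dir e) - W (pos u e (max (u \<bullet> fst e) x)) (dir e)))"
    using assms by (intro evolve_inner) auto
  also have "\<dots> = (\<Sum>e\<in>meeting u E x y. real (m e) *
       (rate e * ((y - max (u \<bullet> fst e) x)\<^sup>2 - (y - min (u \<bullet> snd e) y)\<^sup>2)))"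
  proof (rule sum.cong[OF refl])
    fix e assume "e \<in> meeting u E x y"
    then have e: "e \<in> E" by (rule meetingD)
    define h l c where "h = min (u \<bullet> snd e) y" and "l = max (u \<bullet> fst e) x" and "c = u \<bullet> dir e"
    have c: "c > 0" using slope_pos[OF e] by (simp add: c_def)
    define p d where "p = P (pos u e l - ctr)" and "d = P (dir e)"
    have ph: "P (pos u e h - ctr) = p + ((h - l) / c) *\<^sub>R d"
    proof -
      have "pos u e h - ctr = (pos u e l - ctr) + ((h - l) / c) *\<^sub>R dir e"
        using pos_diff[OF e, of h l] by (simp add: c_def algebra_simps)
      then show ?thesis by (simp only: perp_add perp_scale p_def d_def)
    qed
    have Pd: "dir e \<bullet> P z = d \<bullet> P z" for z by (simp add: d_def perp_inner_perp[OF norm_f])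
    have pd: "dir e \<bullet> p = d \<bullet> p" by (simp add: p_def Pd)
    have dd: "dir e \<bullet> d = d \<bullet> d" by (simp add: d_def perp_inner_perp[OF norm_f])
    have h1: "W (pos u e h) (dir e) = c * ((p + ((h - l) / c) *\<^sub>R d) \<bullet> (p + ((h - l) / c) *\<^sub>R d)) + 2 * (y - h) * (d \<bullet> p + ((h - l) / c) * (d \<bullet> d))"
      by (simp add: W_def u_pos[OF e] ph c_def[symmetric] power2_norm_eq_inner inner_add_right pd dd)
    have l1: "W (pos u e l) (dir e) = c * (p \<bullet> p) + 2 * (y - l) * (d \<bullet> p)"
      by (simp add: W_def u_pos[OF e] p_def[symmetric] c_def[symmetric] power2_norm_eq_inner pd)
    have r: "rate e = (d \<bullet> d) / c" by (simp add: rate_def d_def c_def power2_norm_eq_inner)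
    define q where "q = (h - l) / c"
    have q: "c * q = h - l" using c by (simp add: q_def)
    have "c * ((p + q *\<^sub>R d) \<bullet> (p + q *\<^sub>R d)) = c * (p \<bullet> p) + 2 * (c * q) * (d \<bullet> p) + (c * q) * q * (d \<bullet> d)"
      by (simp add: inner_add_left inner_add_right inner_commute[of p d] algebra_simps)
    then have "W (pos u e h) (dir e) - W (pos u e l) (dir e) = (h - l) * q * (d \<bullet> d) + 2 * (y - h) * (q * (d \<bullet> d))"
      unfolding h1 l1 q_def[symmetric] q by (simp add: algebra_simps)
    also have "\<dots> = ((d \<bullet> d) / c) * ((h - l)\<^sup>2 + 2 * (y - h) * (h - l))"
      using c by (simp add: q_def power2_eq_square field_simps)
    also have "\<dots> = rate e * ((y - l)\<^sup>2 - (y - h)\<^sup>2)"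
      unfolding r by (simp add: power2_eq_square algebra_simps)
    finally show "real (m e) * (W (pos u e (min (u \<bullet> snd e) y)) (dir e) - W (pos u e (max (u \<bullet> fst e) x)) (dir e)) =
       real (m e) * (rate e * ((y - max (u \<bullet> fst e) x)\<^sup>2 - (y - min (u \<bullet> snd e) y)\<^sup>2))"
      by (simp add: h_def l_def)
  qed
  moreover have "(\<Sum>e\<in>cross u E y. real (m e) * W (pos u e y) (dir e)) = J y"
    unfolding J_def W_def by (intro sum.cong refl) (simp add: u_pos[OF crossD])
  moreover have "(\<Sum>e\<in>cross u E x. real (m e) * W (pos u e x) (dir e)) = J x + 2 * (y - x) * G x"
  proof -
    have "(\<Sum>e\<in>cross u E x. real (m e) * W (pos u e x) (dir e)) =
       (\<Sum>e\<in>cross u E x. real (m e) * ((u \<bullet> dir e) * (norm (P (pos u e x - ctr)))\<^sup>2) + 2 * (y - x) * (real (m e) * (dir e \<bullet> P (pos u e x - ctr))))"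
      unfolding W_def by (intro sum.cong refl) (simp add: u_pos[OF crossD] algebra_simps)
    then show ?thesis
      using G_centred[of x ctr] assms by (simp add: J_def sum.distrib sum_distrib_left)
  qed
  ultimately show ?thesis by simp
qed

lemma J_nonneg: "0 \<le> J t"
  unfolding J_def using slope_pos crossD by (intro sum_nonneg mult_nonneg_nonneg) (auto simp: less_imp_le)

text \<open>At a time of multiplicity exactly \<open>k\<close> the deviations from \<open>f\<close>
  add up to the energy and those from \<open>u\<close> to the defect. All terms are nonnegative and
  multiplicities are at least 1, so every single edge obeys the bound for the sum.\<close>

lemma sum_rate_bound:
  assumes t: "a \<le> t" "t \<le> b" and N: "crossing_mult u E m t = k"
  shows "(\<Sum>e\<in>cross u E t. real (m e) * (1 - dir e \<bullet> f)) = en"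
    and "(\<Sum>e\<in>cross u E t. real (m e) * (1 - u \<bullet> dir e)) = real k - flux u E m a \<bullet> u"
    and "e \<in> cross u E t \<Longrightarrow> 1 - (real k - flux u E m a \<bullet> u) \<le> u \<bullet> dir e"
    and "e \<in> cross u E t \<Longrightarrow> 1 - en \<le> dir e \<bullet> f"
proof -
  have F: "flux u E m a = (\<Sum>e\<in>cross u E t. real (m e) *\<^sub>R dir e)"
    using flux_const[OF t] by (simp add: flux_def)
  have k: "real k = (\<Sum>e\<in>cross u E t. real (m e))" using N real_crossing_mult[of t] by simp
  have "flux u E m a \<bullet> f = (\<Sum>e\<in>cross u E t. real (m e) * (dir e \<bullet> f))"
    unfolding F by (simp add: inner_sum_left)
  then show 1: "(\<Sum>e\<in>cross u E t. real (m e) * (1 - dir e \<bullet> f)) = en"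
    by (simp add: en_def flux_inner_f k right_diff_distrib sum_subtractf)
  have "flux u E m a \<bullet> u = (\<Sum>e\<in>cross u E t. real (m e) * (u \<bullet> dir e))"
    unfolding F inner_commute[of _ u] by (simp add: inner_sum_right)
  then show 2: "(\<Sum>e\<in>cross u E t. real (m e) * (1 - u \<bullet> dir e)) = real k - flux u E m a \<bullet> u"
    by (simp add: k right_diff_distrib sum_subtractf)
  assume e: "e \<in> cross u E t"
  then have eE: "e \<in> E" by (rule crossD)
  have m: "1 \<le> real (m e)" using mult_pos[OF eE] by simp
  have "1 * (1 - u \<bullet> dir e) \<le> real (m e) * (1 - u \<bullet> dir e)"
    using m slope_le_1[OF eE] by (intro mult_right_mono) auto
  also have "\<dots> \<le> (\<Sum>e\<in>cross u E t. real (m e) * (1 - u \<bullet> dir e))"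
    using slope_le_1 crossD e by (intro member_le_sum mult_nonneg_nonneg) auto
  finally show "1 - (real k - flux u E m a \<bullet> u) \<le> u \<bullet> dir e" using 2 by simp
  have "1 * (1 - dir e \<bullet> f) \<le> real (m e) * (1 - dir e \<bullet> f)"
    using m dir_f_u(2)[OF eE] by (intro mult_right_mono) auto
  also have "\<dots> \<le> (\<Sum>e\<in>cross u E t. real (m e) * (1 - dir e \<bullet> f))"
    using dir_f_u(2) crossD e by (intro member_le_sum mult_nonneg_nonneg) auto
  finally show "1 - en \<le> dir e \<bullet> f" using 1 by simp
qed

text \<open>Cauchy-Schwarz, with the square root of the slope \<open>u \<bullet> dir e\<close> in
  the factor of the positions and its inverse in the factor of the directions.\<close>

lemma G_sq_le: "a \<le> t \<Longrightarrow> t \<le> b \<Longrightarrow> (G t)\<^sup>2 \<le> (\<Sum>e\<in>cross u E t. real (m e) * rate e) * J t"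
proof -
  assume t: "a \<le> t" "t \<le> b"
  let ?A = "cross u E t"
  define \<alpha> where "\<alpha> e = sqrt (real (m e) * rate e)" for e
  define \<beta> where "\<beta> e = sqrt (real (m e) * (u \<bullet> dir e)) * norm (P (pos u e t - ctr))" for e
  have "\<bar>G t\<bar> \<le> (\<Sum>e\<in>?A. \<bar>real (m e) * (dir e \<bullet> P (pos u e t - ctr))\<bar>)"
    unfolding G_centred[OF t, of ctr] by (rule sum_abs)
  also have "\<dots> \<le> (\<Sum>e\<in>?A. \<alpha> e * \<beta> e)"
  proof (rule sum_mono)
    fix e assume "e \<in> ?A"
    then have e: "e \<in> E" by (rule crossD)
    have "\<alpha> e * \<beta> e = sqrt ((real (m e))\<^sup>2 * (norm (P (dir e)))\<^sup>2) * norm (P (pos u e t - ctr))"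
      using slope_pos[OF e] by (simp add: \<alpha>_def \<beta>_def rate_def real_sqrt_mult[symmetric] power2_eq_square mult_ac)
    also have "\<dots> = real (m e) * (norm (P (dir e)) * norm (P (pos u e t - ctr)))"
      by (simp add: real_sqrt_mult)
    finally have eq: "\<alpha> e * \<beta> e = real (m e) * (norm (P (dir e)) * norm (P (pos u e t - ctr)))" .
    have "\<bar>dir e \<bullet> P (pos u e t - ctr)\<bar> \<le> norm (P (dir e)) * norm (P (pos u e t - ctr))"
      using Cauchy_Schwarz_ineq2[of "P (dir e)" "P (pos u e t - ctr)"] by (simp add: perp_inner_perp[OF norm_f])
    then show "\<bar>real (m e) * (dir e \<bullet> P (pos u e t - ctr))\<bar> \<le> \<alpha> e * \<beta> e"
      unfolding eq abs_mult by (simp add: mult_left_mono)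
  qed
  finally have "(G t)\<^sup>2 \<le> (\<Sum>e\<in>?A. \<alpha> e * \<beta> e)\<^sup>2"
    using power_mono[of "\<bar>G t\<bar>" _ 2] by simp
  also have "\<dots> \<le> (\<Sum>e\<in>?A. (\<alpha> e)\<^sup>2) * (\<Sum>e\<in>?A. (\<beta> e)\<^sup>2)"
    by (rule Cauchy_Schwarz_ineq_sum)
  also have "(\<Sum>e\<in>?A. (\<alpha> e)\<^sup>2) = (\<Sum>e\<in>?A. real (m e) * rate e)"
    using rate_nonneg crossD by (intro sum.cong refl) (auto simp: \<alpha>_def)
  also have "(\<Sum>e\<in>?A. (\<beta> e)\<^sup>2) = J t"
    unfolding J_def using slope_pos crossD by (intro sum.cong refl) (auto simp: \<beta>_def power_mult_distrib less_imp_le)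
  finally show ?thesis .
qed

end

section \<open>Separation on short time intervals and conservation of multiplicity\<close>

context thin_net begin

lemma rate_le_good:
  assumes t: "a \<le> t" "t \<le> b" and N: "crossing_mult u E m t = k" and e: "e \<in> cross u E t"
  shows "rate e \<le> 4 * (1 - dir e \<bullet> f)"
proof -
  have eE: "e \<in> E" by (rule crossD[OF e])
  have c: "1/2 \<le> u \<bullet> dir e" using sum_rate_bound(3)[OF t N e] dev512 by linarith
  have "rate e \<le> (norm (P (dir e)))\<^sup>2 / (1/2)"
    unfolding rate_def using c by (intro divide_left_mono) auto
  then show ?thesis using perp_dir_sq_le[OF eE] by simp
qed

lemma G_le_good:
  assumes t: "a \<le> t" "t \<le> b" and N: "crossing_mult u E m t = k"
  shows "\<bar>G t\<bar> \<le> 2 * sqrt en * sqrt (J t)"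
proof -
  have "(\<Sum>e\<in>cross u E t. real (m e) * rate e) \<le> (\<Sum>e\<in>cross u E t. real (m e) * (4 * (1 - dir e \<bullet> f)))"
    using rate_le_good[OF t N] by (intro sum_mono mult_left_mono) auto
  also have "\<dots> = 4 * en"
    unfolding sum_rate_bound(1)[OF t N, symmetric] sum_distrib_left by (intro sum.cong) auto
  finally have "(G t)\<^sup>2 \<le> 4 * en * J t"
    using G_sq_le[OF t] J_nonneg[of t] by (meson mult_right_mono order_trans)
  then have "sqrt ((G t)\<^sup>2) \<le> sqrt (4 * en * J t)" by (rule real_sqrt_le_mono)
  then show ?thesis by (simp add: real_sqrt_mult)
qed

text \<open>Good times are assumed at the two ends only. The values of \<open>G\<close> there bound
  its growth, and this growth controls the rates at all intermediate times, whatever the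
  multiplicity.\<close>

lemma G_diff_le:
  assumes xy: "a \<le> x" "x \<le> y" "y \<le> b" and N: "crossing_mult u E m x = k" "crossing_mult u E m y = k"
  shows "G y - G x \<le> 4 * sqrt en * max (sqrt (J x)) (sqrt (J y))"
proof -
  have "\<bar>G x\<bar> \<le> 2 * sqrt en * max (sqrt (J x)) (sqrt (J y))"
    using G_le_good[of x] N xy en_nonneg by (intro order_trans[OF G_le_good] mult_left_mono) auto
  moreover have "\<bar>G y\<bar> \<le> 2 * sqrt en * max (sqrt (J x)) (sqrt (J y))"
    using N xy en_nonneg by (intro order_trans[OF G_le_good] mult_left_mono) auto
  ultimately show ?thesis by linarith
qed

text \<open>The sum of \<open>length_bound\<close> over all edges: the rates add up to the growth of
  \<open>G\<close>, the components along \<open>f\<close> to at most \<open>k\<close> per unit of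
  time.\<close>

lemma length_integral_le:
  assumes xy: "a \<le> x" "x \<le> y" "y \<le> b"
  shows "(\<Sum>e\<in>meeting u E x y. real (m e) * (span_time u x y e / (u \<bullet> dir e))) \<le> 4 * (G y - G x) + 2 * real k * (y - x)"
proof -
  let ?B = "meeting u E x y"
  have "(\<Sum>e\<in>?B. real (m e) * (span_time u x y e / (u \<bullet> dir e))) \<le>
      (\<Sum>e\<in>?B. 4 * (real (m e) * (rate e * span_time u x y e)) + 2 * (((real (m e) * span_time u x y e) *\<^sub>R dir e) \<bullet> f))"
  proof (rule sum_mono)
    fix e assume e: "e \<in> ?B"
    have "(real (m e) * span_time u x y e) * (1 / (u \<bullet> dir e)) \<le> (real (m e) * span_time u x y e) * (4 * rate e + 2 * (dir e \<bullet> f))"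
      using span_nonneg[OF e] xy length_bound[OF meetingD[OF e]] by (intro mult_left_mono) auto
    then show "real (m e) * (span_time u x y e / (u \<bullet> dir e)) \<le> 4 * (real (m e) * (rate e * span_time u x y e)) + 2 * (((real (m e) * span_time u x y e) *\<^sub>R dir e) \<bullet> f)"
      by (simp add: algebra_simps)
  qed
  also have "\<dots> = 4 * (G y - G x) + 2 * ((\<Sum>e\<in>?B. (real (m e) * span_time u x y e) *\<^sub>R dir e) \<bullet> f)"
    using G_diff[OF xy] by (simp only: sum.distrib sum_distrib_left[symmetric] inner_sum_left)
  also have "\<dots> = 4 * (G y - G x) + 2 * ((y - x) * norm (flux u E m a))"
    using flux_time_integral[OF xy] flux_inner_f by simp
  also have "\<dots> \<le> 4 * (G y - G x) + 2 * ((y - x) * real k)"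
    using norm_flux_le xy by (intro add_left_mono mult_left_mono) auto
  finally show ?thesis by (simp add: algebra_simps)
qed

text \<open>The weights add up to at most \<open>k\<close>, so some edge is at distance at least R /
  sqrt k from the centre. In the direction \<theta> towards that edge the weighted mean of the
  coordinates is 0, so some edge has a coordinate that is not positive.\<close>

lemma far_edges:
  assumes t: "a \<le> t" "t \<le> b" and J: "J t = R\<^sup>2" "0 < R"
  obtains \<theta> e1 e2 where "norm \<theta> = 1" "P \<theta> = \<theta>" "e1 \<in> cross u E t" "e2 \<in> cross u E t"
    "R / sqrt (real k) \<le> \<theta> \<bullet> P (pos u e1 t - ctr)" "\<theta> \<bullet> P (pos u e2 t - ctr) \<le> 0"
proof -
  let ?A = "cross u E t"
  have ne: "?A \<noteq> {}" using J unfolding J_def by auto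
  have wpos: "0 < real (m e) * (u \<bullet> dir e)" if "e \<in> ?A" for e
    using slope_pos[OF crossD[OF that]] mult_pos[OF crossD[OF that]] by simp
  have sumw: "(\<Sum>e\<in>?A. real (m e) * (u \<bullet> dir e)) = flux u E m a \<bullet> u"
    unfolding flux_const[OF t, symmetric] inner_commute[of _ u] by (simp add: flux_def inner_sum_right)
  have "\<exists>e\<in>?A. R\<^sup>2 / real k \<le> (norm (P (pos u e t - ctr)))\<^sup>2"
  proof (rule ccontr)
    assume "\<not> ?thesis"
    then have less: "(norm (P (pos u e t - ctr)))\<^sup>2 < R\<^sup>2 / real k" if "e \<in> ?A" for e
      using that by (meson not_le)
    have "R\<^sup>2 = (\<Sum>e\<in>?A. (real (m e) * (u \<bullet> dir e)) * (norm (P (pos u e t - ctr)))\<^sup>2)"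
      using J by (simp add: J_def mult.assoc)
    also have "\<dots> < (\<Sum>e\<in>?A. (real (m e) * (u \<bullet> dir e)) * (R\<^sup>2 / real k))"
      using ne less wpos by (intro sum_strict_mono mult_strict_left_mono) auto
    also have "\<dots> = (flux u E m a \<bullet> u) * (R\<^sup>2 / real k)"
      by (simp only: sum_distrib_right[symmetric] sumw)
    also have "\<dots> \<le> real k * (R\<^sup>2 / real k)"
      using flux_u_le_norm norm_flux_le by (intro mult_right_mono) auto
    also have "\<dots> = R\<^sup>2" using k1 by simp
    finally show False by simp
  qed
  then obtain e1 where e1: "e1 \<in> ?A" and far: "R\<^sup>2 / real k \<le> (norm (P (pos u e1 t - ctr)))\<^sup>2" by auto
  define Y where "Y = P (pos u e1 t - ctr)"
  have "sqrt (R\<^sup>2 / real k) \<le> norm Y"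
    using far by (metis Y_def norm_ge_zero real_sqrt_le_mono real_sqrt_abs abs_of_nonneg)
  then have Yge: "R / sqrt (real k) \<le> norm Y" using J by (simp add: real_sqrt_divide)
  moreover have "0 < R / sqrt (real k)" using J k1 by simp
  ultimately have Ypos: "0 < norm Y" by linarith
  define \<theta> where "\<theta> = sgn Y"
  have th: "norm \<theta> = 1" "P \<theta> = \<theta>"
    using Ypos by (auto simp: \<theta>_def norm_sgn sgn_div_norm perp_scale Y_def perp_perp[OF norm_f])
  have "\<theta> \<bullet> Y = norm Y" using Ypos by (simp add: \<theta>_def sgn_div_norm power2_norm_eq_inner[symmetric] power2_eq_square)
  then have 1: "R / sqrt (real k) \<le> \<theta> \<bullet> P (pos u e1 t - ctr)" using Yge by (simp add: Y_def)
  have "\<exists>e\<in>?A. \<theta> \<bullet> P (pos u e t - ctr) \<le> 0"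
  proof (rule ccontr)
    assume "\<not> ?thesis"
    then have "0 < real (m e) * ((u \<bullet> dir e) * (\<theta> \<bullet> P (pos u e t - ctr)))" if "e \<in> ?A" for e
      using that wpos[OF that] by (metis mult.assoc mult_pos_pos not_le)
    then have "0 < (\<Sum>e\<in>?A. real (m e) * ((u \<bullet> dir e) * (\<theta> \<bullet> P (pos u e t - ctr))))"
      using ne by (intro sum_pos) auto
    then show False using centre_const[OF t, of \<theta>] by simp
  qed
  then show ?thesis using that th e1 1 by blast
qed

text \<open>If the time interval is short compared with the spread divided by the typical velocity, then some
  hyperplane parallel to the mean direction separates the network into two parts.\<close>

lemma split_exists:
  assumes xy: "a \<le> x" "x \<le> y" "y \<le> b" and N: "crossing_mult u E m x = k" "crossing_mult u E m y = k"
    and R: "0 < R" "R = max (sqrt (J x)) (sqrt (J y))"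
    and short: "(y - x) * sqrt en \<le> R / (32 * (real k)\<^sup>2)"
  shows "\<exists>E1 E2. splits x y E1 E2 \<and> (cross u E1 x \<noteq> {} \<or> cross u E1 y \<noteq> {}) \<and> (cross u E2 x \<noteq> {} \<or> cross u E2 y \<noteq> {})"
proof -
  let ?B = "meeting u E x y"
  define lo where "lo e = max (u \<bullet> fst e) x" for e :: "'a edge"
  define hi where "hi e = min (u \<bullet> snd e) y" for e :: "'a edge"
  \<comment> \<open>The end of the interval at which the spread is larger. There two edges have
    \<theta>-coordinates at least R / sqrt k apart.\<close>
  define T where "T = (if sqrt (J x) = R then x else y)"
  have T: "T = x \<or> T = y" "sqrt (J T) = R" using R by (auto simp: T_def max_def split: if_splits)
  then have Tab: "a \<le> T" "T \<le> b" using xy by auto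
  have "J T = R\<^sup>2" using T J_nonneg[of T] by auto
  then obtain \<theta> e1 e2 where th: "norm \<theta> = 1" "P \<theta> = \<theta>" and e12: "e1 \<in> cross u E T" "e2 \<in> cross u E T"
    and v1: "R / sqrt (real k) \<le> \<theta> \<bullet> P (pos u e1 T - ctr)" and v2: "\<theta> \<bullet> P (pos u e2 T - ctr) \<le> 0"
    using far_edges[OF Tab _ R(1)] by blast
  define val where "val e t = \<theta> \<bullet> (pos u e t - ctr)" for e t
  have val_P: "\<theta> \<bullet> P (pos u e t - ctr) = val e t" for e t
    using th(2) by (metis perp_self_adj val_def)
  \<comment> \<open>[l e, h e] is the shadow on the \<theta>-axis of the part of the edge in the
    time interval. The aim is a total length of the shadows below R / sqrt k.\<close>
  define l where "l e = min (val e (lo e)) (val e (hi e))" for e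
  define h where "h e = max (val e (lo e)) (val e (hi e))" for e
  have lh: "l e \<le> h e" for e by (auto simp: l_def h_def)
  define D where "D = G y - G x"
  define \<Delta> where "\<Delta> = y - x"
  have \<Delta>: "0 \<le> \<Delta>" using xy by (simp add: \<Delta>_def)
  have D0: "0 \<le> D" using G_mono[OF xy] by (simp add: D_def)
  have D4: "D \<le> 4 * sqrt en * R" using G_diff_le[OF xy N] R by (simp add: D_def)
  have D_eq: "D = (\<Sum>e\<in>?B. real (m e) * (rate e * span_time u x y e))" using G_diff[OF xy] by (simp add: D_def)
  define M where "M = (\<Sum>e\<in>?B. real (m e) * (span_time u x y e / (u \<bullet> dir e)))"
  have M: "M \<le> 4 * D + 2 * real k * \<Delta>" using length_integral_le[OF xy] by (simp add: M_def D_def \<Delta>_def)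
  \<comment> \<open>A shadow is at most the geometric mean of the contributions of the edge to the
    growth \<open>D\<close> of \<open>G\<close> and to the total length \<open>M\<close>, which
    prepares for Cauchy-Schwarz.\<close>
  have "(\<Sum>e\<in>?B. h e - l e) \<le> (\<Sum>e\<in>?B. sqrt (real (m e) * (rate e * span_time u x y e)) * sqrt (real (m e) * (span_time u x y e / (u \<bullet> dir e))))"
  proof (rule sum_mono)
    fix e assume e: "e \<in> ?B"
    have eE: "e \<in> E" by (rule meetingD[OF e])
    have c: "0 < u \<bullet> dir e" by (rule slope_pos[OF eE])
    have sp: "0 \<le> span_time u x y e" by (rule span_nonneg[OF e xy(2)])
    have m1: "1 \<le> real (m e)" using mult_pos[OF eE] by simp
    have "h e - l e = \<bar>val e (hi e) - val e (lo e)\<bar>" by (auto simp: h_def l_def)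
    also have "val e (hi e) - val e (lo e) = (span_time u x y e / (u \<bullet> dir e)) * (\<theta> \<bullet> dir e)"
      by (simp add: val_def inner_diff_right[symmetric] pos_diff[OF eE] span_time_def hi_def lo_def)
    also have "\<bar>\<dots>\<bar> = (span_time u x y e / (u \<bullet> dir e)) * \<bar>\<theta> \<bullet> dir e\<bar>"
      using c sp by (simp add: abs_mult)
    also have "\<bar>\<theta> \<bullet> dir e\<bar> \<le> norm (P (dir e))"
      using Cauchy_Schwarz_ineq2[of \<theta> "P (dir e)"] th by (metis mult_1 perp_self_adj)
    then have "(span_time u x y e / (u \<bullet> dir e)) * \<bar>\<theta> \<bullet> dir e\<bar> \<le> (span_time u x y e / (u \<bullet> dir e)) * norm (P (dir e))"
      using c sp by (intro mult_left_mono) auto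
    also have "\<dots> \<le> real (m e) * ((span_time u x y e / (u \<bullet> dir e)) * norm (P (dir e)))"
      using m1 c sp mult_right_mono[OF m1, of "(span_time u x y e / (u \<bullet> dir e)) * norm (P (dir e))"] by simp
    also have "\<dots> = sqrt ((real (m e) * (rate e * span_time u x y e)) * (real (m e) * (span_time u x y e / (u \<bullet> dir e))))"
    proof -
      have "(real (m e) * (rate e * span_time u x y e)) * (real (m e) * (span_time u x y e / (u \<bullet> dir e)))
         = (real (m e) * ((span_time u x y e / (u \<bullet> dir e)) * norm (P (dir e))))\<^sup>2"
        using c by (simp add: rate_def power2_eq_square field_simps)
      then show ?thesis using c sp by simp
    qed
    finally show "h e - l e \<le> sqrt (real (m e) * (rate e * span_time u x y e)) * sqrt (real (m e) * (span_time u x y e / (u \<bullet> dir e)))"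
      by (simp only: real_sqrt_mult)
  qed
  then have "(\<Sum>e\<in>?B. h e - l e)\<^sup>2 \<le> (\<Sum>e\<in>?B. sqrt (real (m e) * (rate e * span_time u x y e)) * sqrt (real (m e) * (span_time u x y e / (u \<bullet> dir e))))\<^sup>2"
    using lh by (intro power_mono sum_nonneg) auto
  also have "\<dots> \<le> (\<Sum>e\<in>?B. (sqrt (real (m e) * (rate e * span_time u x y e)))\<^sup>2) * (\<Sum>e\<in>?B. (sqrt (real (m e) * (span_time u x y e / (u \<bullet> dir e))))\<^sup>2)"
    by (rule Cauchy_Schwarz_ineq_sum)
  also have "\<dots> = D * M"
  proof -
    have "(sqrt (real (m e) * (rate e * span_time u x y e)))\<^sup>2 = real (m e) * (rate e * span_time u x y e)"
      "(sqrt (real (m e) * (span_time u x y e / (u \<bullet> dir e))))\<^sup>2 = real (m e) * (span_time u x y e / (u \<bullet> dir e))" if "e \<in> ?B" for e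
      using span_nonneg[OF that xy(2)] rate_nonneg[OF meetingD[OF that]] slope_pos[OF meetingD[OF that]] by simp_all
    then show ?thesis unfolding D_eq M_def by simp
  qed
  also have "\<dots> \<le> D * (4 * D + 2 * real k * \<Delta>)" using M D0 by (rule mult_left_mono)
  also have "\<dots> = 4 * (D * D) + 2 * real k * (\<Delta> * D)" by (simp add: algebra_simps)
  also have "\<dots> \<le> 4 * ((4 * sqrt en * R) * (4 * sqrt en * R)) + 2 * real k * (\<Delta> * (4 * sqrt en * R))"
    using D4 D0 \<Delta> R(1) en_nonneg by (intro add_mono mult_left_mono mult_mono) auto
  also have "\<dots> = 64 * (sqrt en * sqrt en) * R\<^sup>2 + 8 * real k * R * (\<Delta> * sqrt en)"
    by (simp add: power2_eq_square algebra_simps)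
  \<comment> \<open>The energy is at most the defect, so the first term is at most R^2 / (8 k^2).
    The bound on the duration turns the second one into R^2 / (4 k).\<close>
  also have "\<dots> \<le> 64 * (1 / (512 * (real k)\<^sup>2)) * R\<^sup>2 + 8 * real k * R * (R / (32 * (real k)\<^sup>2))"
    using en_le_dev dev short R(1) en_nonneg by (intro add_mono mult_left_mono mult_right_mono) (auto simp: \<Delta>_def)
  also have "\<dots> = R\<^sup>2 / real k * (1 / (8 * real k) + 1/4)"
    using k1 by (simp add: field_simps power2_eq_square)
  also have "\<dots> < R\<^sup>2 / real k * 1"
  proof (rule mult_strict_left_mono)
    have "1 / (8 * real k) \<le> 1/8" using k1 by (simp add: field_simps)
    then show "1 / (8 * real k) + 1/4 < 1" by linarith
    show "0 < R\<^sup>2 / real k" using R k1 by simp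
  qed
  also have "\<dots> = (R / sqrt (real k))\<^sup>2" by (simp add: power_divide)
  finally have sq: "(\<Sum>e\<in>?B. h e - l e)\<^sup>2 < (R / sqrt (real k))\<^sup>2" .
  have "0 \<le> R / sqrt (real k)" using R(1) by simp
  with sq have "(\<Sum>e\<in>?B. h e - l e) < R / sqrt (real k)"
    by (rule power_less_imp_less_base)
  \<comment> \<open>As \<theta> is orthogonal to \<open>f\<close>, the value \<beta> determines a
    hyperplane parallel to the flux which no edge touches during the interval.\<close>
  then obtain \<beta> where \<beta>: "0 < \<beta>" "\<beta> < R / sqrt (real k)" and avoid: "\<And>e. e \<in> ?B \<Longrightarrow> \<beta> < l e \<or> h e < \<beta>"
    using avoid_intervals[of ?B l h, OF finite_meeting lh] by blast
  define E1 where "E1 = {e\<in>?B. h e < \<beta>}"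
  define E2 where "E2 = {e\<in>?B. \<beta> < l e}"
  have vert: "l e \<le> \<theta> \<bullet> (v - ctr) \<and> \<theta> \<bullet> (v - ctr) \<le> h e"
    if e: "e \<in> ?B" and v: "x < u \<bullet> v" "u \<bullet> v \<le> y" "fst e = v \<or> snd e = v" for e v
  proof -
    have "\<theta> \<bullet> (v - ctr) = val e (lo e) \<or> \<theta> \<bullet> (v - ctr) = val e (hi e)"
      using v pos_fst[of e] pos_snd[OF meetingD[OF e]] by (auto simp: val_def lo_def hi_def max_def min_def)
    then show ?thesis by (auto simp: l_def h_def)
  qed
  have "splits x y E1 E2"
    unfolding splits_def
  proof (intro conjI ballI allI impI)
    show "E1 \<union> E2 = ?B" using avoid by (auto simp: E1_def E2_def)
    have "\<not> (h e < \<beta> \<and> \<beta> < l e)" for e using lh[of e] by linarith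
    then show "E1 \<inter> E2 = {}" by (auto simp: E1_def E2_def)
    fix e e' v assume ee: "e \<in> E1" "e' \<in> E2" and v: "x < u \<bullet> v \<and> u \<bullet> v \<le> y"
    show "\<not> ((fst e = v \<or> snd e = v) \<and> (fst e' = v \<or> snd e' = v))"
    proof
      assume *: "(fst e = v \<or> snd e = v) \<and> (fst e' = v \<or> snd e' = v)"
      have "\<theta> \<bullet> (v - ctr) \<le> h e" "h e < \<beta>" using vert[of e v] ee v * by (auto simp: E1_def)
      moreover have "l e' \<le> \<theta> \<bullet> (v - ctr)" "\<beta> < l e'" using vert[of e' v] ee v * by (auto simp: E2_def)
      ultimately show False by linarith
    qed
  qed (use xy in auto)
  moreover have in_B: "e \<in> ?B \<and> l e \<le> val e T \<and> val e T \<le> h e" if "e \<in> cross u E T" for e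
  proof -
    have "T = lo e \<or> T = hi e" using T that by (auto simp: cross_def lo_def hi_def)
    moreover have "e \<in> ?B" using T that xy by (auto simp: cross_def meeting_def)
    ultimately show ?thesis by (auto simp: l_def h_def)
  qed
  have i1: "e1 \<in> ?B" "val e1 T \<le> h e1" and i2: "e2 \<in> ?B" "l e2 \<le> val e2 T"
    using in_B[OF e12(1)] in_B[OF e12(2)] by auto
  have "\<not> h e1 < \<beta>" using i1 v1 \<beta> val_P[of e1 T] by linarith
  then have "e1 \<in> E2" using i1 avoid[of e1] by (auto simp: E2_def)
  have "\<not> \<beta> < l e2" using i2 v2 \<beta> val_P[of e2 T] by linarith
  then have "e2 \<in> E1" using i2 avoid[of e2] by (auto simp: E1_def)
  with \<open>e1 \<in> E2\<close> have "e1 \<in> cross u E2 T" "e2 \<in> cross u E1 T" using e12 by (simp_all add: cross_def)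
  then have "cross u E2 T \<noteq> {}" "cross u E1 T \<noteq> {}" by auto
  then show ?thesis using \<open>splits x y E1 E2\<close> T(1) by blast
qed

text \<open>A part that crosses one end has multiplicity at least 1 there, hence at both ends, and
  this leaves less than \<open>k\<close> for the other part. The defect of a part is at most that of
  the whole, and the admissible bound only grows when the multiplicity decreases.\<close>

lemma splits_thin:
  assumes s: "splits x y E1 E2" and N: "crossing_mult u E m x = k" "crossing_mult u E m y = k"
    and ne: "cross u E1 x \<noteq> {} \<or> cross u E1 y \<noteq> {}" "cross u E2 x \<noteq> {} \<or> cross u E2 y \<noteq> {}"
  obtains k1 k2 where "thin_net u E1 m x y k1" "thin_net u E2 m x y k2" "k1 + k2 = k" "k1 < k" "k2 < k"
    "real k1 - flux u E1 m x \<bullet> u \<le> real k - flux u E m a \<bullet> u"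
    "real k2 - flux u E2 m x \<bullet> u \<le> real k - flux u E m a \<bullet> u"
proof -
  have xy: "a \<le> x" "x \<le> y" "y \<le> b" using s by (auto simp: splits_def)
  have dev1: "real k - flux u E m a \<bullet> u < 1" using dev512 by linarith
  define k1 k2 where "k1 = crossing_mult u E1 m x" and "k2 = crossing_mult u E2 m x"
  have sum: "k1 + k2 = k" using splits_mult(1)[OF s, of x] N xy by (simp add: k1_def k2_def)
  have *: "1 \<le> crossing_mult u E1 m x \<and> thin_net u E1 m x y (crossing_mult u E1 m x) \<and>
      real (crossing_mult u E1 m x) - flux u E1 m x \<bullet> u \<le> real k - flux u E m a \<bullet> u"
    if s: "splits x y E1 E2" and ne: "cross u E1 x \<noteq> {} \<or> cross u E1 y \<noteq> {}" for E1 E2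
  proof -
    interpret n1: net u E1 m x y by (rule splits_net[OF s])
    note c = splits_mult_const[OF s N dev1]
    have "1 \<le> crossing_mult u E1 m t" if "cross u E1 t \<noteq> {}" for t
      using that n1.mult_le_cross[of _ t] n1.mult_pos n1.crossD by (meson all_not_in_conv order_trans)
    then have pos: "1 \<le> crossing_mult u E1 m x" using ne c(1) by metis
    have le: "crossing_mult u E1 m x \<le> k" using splits_mult(1)[OF s, of x] N xy by simp
    have "real (crossing_mult u E1 m x) - flux u E1 m x \<bullet> u \<le> 1 / (512 * (real k)\<^sup>2)"
      using c(2) dev by linarith
    also have "\<dots> \<le> 1 / (512 * (real (crossing_mult u E1 m x))\<^sup>2)"
      using pos le by (intro divide_left_mono mult_left_mono power_mono) auto
    finally have "thin_net u E1 m x y (crossing_mult u E1 m x)"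
      using c(1) pos by unfold_locales auto
    then show ?thesis using pos c(2) by simp
  qed
  show ?thesis
    using that[of k1 k2] *[OF s ne(1)] *[OF splits_sym[OF s] ne(2)] sum by (auto simp: k1_def k2_def)
qed

lemma cross_right_const: "\<exists>\<delta>>0. \<forall>r. s \<le> r \<and> r < s + \<delta> \<longrightarrow> cross u E r = cross u E s"
proof -
  define C where "C = {r \<in> (\<lambda>v. u \<bullet> v) ` (fst ` E \<union> snd ` E). s < r}"
  have "finite C" using fin by (auto simp: C_def)
  define \<delta> where "\<delta> = (if C = {} then 1 else Min C - s)"
  have "0 < \<delta>" using \<open>finite C\<close> by (auto simp: \<delta>_def) (auto simp: C_def)
  have \<delta>: "s + \<delta> \<le> r" if "r \<in> C" for r
    using that \<open>finite C\<close> by (auto simp: \<delta>_def)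
  have far: "u \<bullet> v \<le> s \<or> s + \<delta> \<le> u \<bullet> v" if "v \<in> fst ` E \<union> snd ` E" for v
    using \<delta>[of "u \<bullet> v"] that by (force simp: C_def not_le)
  have eq: "cross u E r = cross u E s" if r: "s \<le> r" "r < s + \<delta>" for r
  proof -
    have "(u \<bullet> fst e \<le> r \<longleftrightarrow> u \<bullet> fst e \<le> s) \<and> (r < u \<bullet> snd e \<longleftrightarrow> s < u \<bullet> snd e)" if "e \<in> E" for e
      using far[of "fst e"] far[of "snd e"] that r by auto
    then show ?thesis unfolding cross_def by (intro Collect_cong) blast
  qed
  show ?thesis by (rule exI[of _ \<delta>]) (use eq \<open>0 < \<delta>\<close> in blast)
qed

text \<open>During such an interval a multiplicity of at least k + 1 shares a flux of norm at most
  \<open>k\<close>. Hence the deviations 1 - \<open>dir e \<bullet> f\<close>, weighted by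
  multiplicity, integrate to at least the duration, and each of them is at most twice the
  rate.\<close>

lemma bad_energy:
  assumes xy: "a \<le> x" "x \<le> y" "y \<le> b" and bad: "\<And>t. x < t \<Longrightarrow> t < y \<Longrightarrow> crossing_mult u E m t \<noteq> k"
  shows "(y - x) / 2 \<le> G y - G x"
proof -
  let ?B = "meeting u E x y"
  have ge: "k + 1 \<le> crossing_mult u E m t" if "x < t" "t < y" for t
    using crossing_mult_ge[of t] bad[OF that] that xy by simp
  have ge': "1 + real k \<le> real (crossing_mult u E m t)" if "x < t" "t < y" for t
    using ge[OF that] by linarith
  \<comment> \<open>The integrand is altered at the two end points, because the multiplicity is
    known to be bad in the open interval only.\<close>
  have "((\<lambda>t. if t \<in> {x, y} then real (k + 1) else real (crossing_mult u E m t)) has_integral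
     (\<Sum>e\<in>?B. real (m e) * span_time u x y e)) {x..y}"
    by (rule has_integral_spike[OF _ _ mult_time_integral[OF xy(2)], of "{x, y}"]) auto
  moreover have "((\<lambda>t. real (k + 1)) has_integral real (k + 1) * (y - x)) {x..y}"
    using has_integral_const_real[of "real (k + 1)" x y] xy by (simp add: mult.commute)
  ultimately have "real (k + 1) * (y - x) \<le> (\<Sum>e\<in>?B. real (m e) * span_time u x y e)"
    by (elim has_integral_le[rotated]) (use ge' in auto)
  moreover have "(\<Sum>e\<in>?B. (real (m e) * span_time u x y e) * (dir e \<bullet> f)) = (y - x) * norm (flux u E m a)"
  proof -
    have "(\<Sum>e\<in>?B. (real (m e) * span_time u x y e) * (dir e \<bullet> f)) = (\<Sum>e\<in>?B. (real (m e) * span_time u x y e) *\<^sub>R dir e) \<bullet> f"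
      by (simp add: inner_sum_left)
    then show ?thesis using flux_time_integral[OF xy] flux_inner_f by simp
  qed
  moreover have "(y - x) * norm (flux u E m a) \<le> (y - x) * real k"
    using norm_flux_le xy by (intro mult_left_mono) auto
  ultimately have "y - x \<le> (\<Sum>e\<in>?B. (real (m e) * span_time u x y e) * (1 - dir e \<bullet> f))"
    by (simp add: right_diff_distrib sum_subtractf algebra_simps)
  also have "\<dots> \<le> (\<Sum>e\<in>?B. (real (m e) * span_time u x y e) * (2 * rate e))"
  proof (intro sum_mono mult_left_mono)
    fix e assume e: "e \<in> ?B"
    show "1 - dir e \<bullet> f \<le> 2 * rate e" using rate_ge[OF meetingD[OF e]] by (simp add: field_simps)
    show "0 \<le> real (m e) * span_time u x y e" using span_nonneg[OF e xy(2)] by simp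
  qed
  also have "\<dots> = 2 * (G y - G x)"
    unfolding G_diff[OF xy] by (simp add: sum_distrib_left mult_ac)
  finally show ?thesis by simp
qed

end

text \<open>Otherwise the network would split at a minimal interval on which the multiplicity is too large.\<close>

lemma thin_net_mult:
  assumes "thin_net u E m a b k" "a \<le> t" "t \<le> b"
  shows "crossing_mult u E m t = k"
  using assms
proof (induction k arbitrary: E a b t rule: less_induct)
  case (less k)
  interpret thin_net u E m a b k by (rule less.prems(1))
  show ?case
  proof (rule ccontr)
    assume bad: "crossing_mult u E m t \<noteq> k"
    define S1 where "S1 = {s. a \<le> s \<and> s \<le> t \<and> crossing_mult u E m s = k}"
    define S2 where "S2 = {s. t \<le> s \<and> s \<le> b \<and> crossing_mult u E m s = k}"
    have S1: "a \<in> S1" "bdd_above S1" using Na less.prems by (auto simp: S1_def bdd_above_def)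
    have S2: "b \<in> S2" "bdd_below S2" using Nb less.prems by (auto simp: S2_def bdd_below_def)
    \<comment> \<open>The gap from \<alpha> to \<beta> is the largest interval around
      \<open>t\<close> without good times in its interior.\<close>
    define \<alpha> where "\<alpha> = Sup S1"
    define \<beta> where "\<beta> = Inf S2"
    have al: "a \<le> \<alpha>" "\<alpha> \<le> t" using S1 by (auto simp: \<alpha>_def intro: cSup_upper cSup_least simp: S1_def)
    have be: "t \<le> \<beta>" "\<beta> \<le> b" using S2 by (auto simp: \<beta>_def intro: cInf_lower cInf_greatest simp: S2_def)
    have N\<beta>: "crossing_mult u E m \<beta> = k"
    proof -
      obtain \<delta> where \<delta>: "0 < \<delta>" "\<And>r. \<beta> \<le> r \<Longrightarrow> r < \<beta> + \<delta> \<Longrightarrow> cross u E r = cross u E \<beta>"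
        using cross_right_const[of \<beta>] by blast
      have "Inf S2 < \<beta> + \<delta>" using \<delta> by (simp add: \<beta>_def)
      then obtain r where r: "r \<in> S2" "r < \<beta> + \<delta>" using S2 cInf_lessD by blast
      then have "\<beta> \<le> r" using S2 by (simp add: \<beta>_def cInf_lower)
      then have "crossing_mult u E m r = crossing_mult u E m \<beta>"
        using \<delta>(2)[of r] r by (simp add: crossing_mult_def)
      then show ?thesis using r by (simp add: S2_def)
    qed
    have lt: "\<alpha> < \<beta>" using al be N\<beta> bad by (metis le_less order_less_le_trans not_less_iff_gr_or_eq)
    \<comment> \<open>So a good time t1 \<le> \<alpha> is taken close enough to make \<beta> - t1
      less than twice the gap.\<close>
    have "\<alpha> - (\<beta> - \<alpha>) < Sup S1" using lt by (simp add: \<alpha>_def)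
    then obtain t1 where t1: "t1 \<in> S1" "\<alpha> - (\<beta> - \<alpha>) < t1" using S1 less_cSupD by blast
    then have t1\<alpha>: "t1 \<le> \<alpha>" using S1 by (simp add: \<alpha>_def cSup_upper)
    have Nt1: "crossing_mult u E m t1 = k" "a \<le> t1" using t1 by (auto simp: S1_def)
    have badt: "crossing_mult u E m s \<noteq> k" if "\<alpha> < s" "s < \<beta>" for s
    proof
      assume N: "crossing_mult u E m s = k"
      show False
      proof (cases "s \<le> t")
        case True
        then have "s \<in> S1" using N that al by (auto simp: S1_def)
        then show False using that S1 cSup_upper[of s S1] by (simp add: \<alpha>_def)
      next
        case False
        then have "s \<in> S2" using N that be by (auto simp: S2_def)
        then show False using that S2 cInf_lower[of s S2] by (simp add: \<beta>_def)
      qed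
    qed
    have "(\<beta> - \<alpha>) / 2 \<le> G \<beta> - G \<alpha>" using al lt be badt by (intro bad_energy) auto
    also have "\<dots> \<le> G \<beta> - G t1" using G_mono[of t1 \<alpha>] Nt1 t1\<alpha> al be by simp
    finally have D: "(\<beta> - \<alpha>) / 2 \<le> G \<beta> - G t1" .
    define R where "R = max (sqrt (J t1)) (sqrt (J \<beta>))"
    have xy: "a \<le> t1" "t1 \<le> \<beta>" "\<beta> \<le> b" using Nt1 t1\<alpha> lt be by auto
    have DR: "G \<beta> - G t1 \<le> 4 * sqrt en * R"
      unfolding R_def by (rule G_diff_le[OF xy Nt1(1) N\<beta>])
    have "0 < (\<beta> - \<alpha>) / 2" using lt by simp
    also note D also note DR
    finally have "0 < 4 * sqrt en * R" .
    moreover have "0 \<le> sqrt en" using en_nonneg by simp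
    ultimately have R: "0 < R" by (simp add: zero_less_mult_iff)
    \<comment> \<open>The gap forces \<open>G\<close> to grow and the spread limits that growth, so
      the interval is at most 16 sqrt en * R long. Multiplied by sqrt en this is at most R / (32
      k^2), exactly what the separation requires; here the constant 512 is determined.\<close>
    have "(\<beta> - t1) / 4 \<le> (\<beta> - \<alpha>) / 2" using t1 by simp
    also note D also note DR
    finally have "\<beta> - t1 \<le> 16 * sqrt en * R" by simp
    then have "(\<beta> - t1) * sqrt en \<le> (16 * sqrt en * R) * sqrt en" using en_nonneg by (intro mult_right_mono) auto
    also have "\<dots> = 16 * en * R" using en_nonneg by simp
    also have "\<dots> \<le> 16 * (1 / (512 * (real k)\<^sup>2)) * R"
      using en_le_dev dev R by (intro mult_right_mono mult_left_mono) auto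
    also have "\<dots> = R / (32 * (real k)\<^sup>2)" by simp
    finally have "(\<beta> - t1) * sqrt en \<le> R / (32 * (real k)\<^sup>2)" .
    then obtain E1 E2 where s: "splits t1 \<beta> E1 E2"
      and ne: "cross u E1 t1 \<noteq> {} \<or> cross u E1 \<beta> \<noteq> {}" "cross u E2 t1 \<noteq> {} \<or> cross u E2 \<beta> \<noteq> {}"
      using split_exists[OF xy Nt1(1) N\<beta> R R_def] by blast
    obtain k1 k2 where k: "thin_net u E1 m t1 \<beta> k1" "thin_net u E2 m t1 \<beta> k2" "k1 + k2 = k" "k1 < k" "k2 < k"
      by (rule splits_thin[OF s Nt1(1) N\<beta> ne])
    have t: "t1 \<le> t" "t \<le> \<beta>" using t1\<alpha> al be by auto
    have "crossing_mult u E m t = k"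
      using splits_mult(1)[OF s t] less.IH[OF k(4) k(1) t] less.IH[OF k(5) k(2) t] k(3) by simp
    then show False using bad by simp
  qed
qed

section \<open>Conservation of energy and growth of the spread\<close>

context thin_net begin

definition dvn where "dvn = real k - flux u E m a \<bullet> u"

lemma dvn: "0 \<le> dvn" "dvn \<le> 1/512" "en \<le> dvn"
  using dev512 en_le_dev en_nonneg by (auto simp: dvn_def)

lemma mult_const: "a \<le> t \<Longrightarrow> t \<le> b \<Longrightarrow> crossing_mult u E m t = k"
  using thin_net_mult[of u E m a b k t] thin_net_axioms by blast

lemma thin_sub:
  assumes "a \<le> x" "x \<le> y" "y \<le> b" shows "thin_net u E m x y k"
proof -
  interpret s: net u E m x y by (rule net_sub[OF assms])
  show ?thesis
    using mult_const[of x] mult_const[of y] assms k1 dev flux_const[of x] by unfold_locales auto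
qed

lemma meeting_cross:
  assumes "e \<in> meeting u E x y" "a \<le> x" "y \<le> b" "x \<le> y"
  shows "e \<in> cross u E (max (u \<bullet> fst e) x)" "a \<le> max (u \<bullet> fst e) x" "max (u \<bullet> fst e) x \<le> y" "max (u \<bullet> fst e) x \<le> b"
  using assms up[of e] by (auto simp: meeting_def cross_def)

lemma slope_ge: "e \<in> cross u E t \<Longrightarrow> a \<le> t \<Longrightarrow> t \<le> b \<Longrightarrow> 1 - dvn \<le> u \<bullet> dir e"
  using sum_rate_bound(3)[of t e] mult_const by (simp add: dvn_def)

lemma dir_f_ge: "e \<in> cross u E t \<Longrightarrow> a \<le> t \<Longrightarrow> t \<le> b \<Longrightarrow> 1 - en \<le> dir e \<bullet> f"
  using sum_rate_bound(4)[of t e] mult_const by simp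

text \<open>To first order the rate is 1 - x^2, that is 2 (1 - x), for x =
  \<open>dir e \<bullet> f\<close> near 1. The corrections are of the order of the defect.\<close>

lemma rate_bounds:
  assumes e: "e \<in> cross u E t" and t: "a \<le> t" "t \<le> b"
  shows "(2 - dvn) * (1 - dir e \<bullet> f) \<le> rate e" "rate e \<le> (2 + 4 * dvn) * (1 - dir e \<bullet> f)"
proof -
  have eE: "e \<in> E" by (rule crossD[OF e])
  let ?x = "dir e \<bullet> f" and ?c = "u \<bullet> dir e"
  have c: "1 - dvn \<le> ?c" "?c \<le> 1" "0 < ?c" using slope_ge[OF e t] slope_le_1[OF eE] slope_pos[OF eE] by auto
  have x: "1 - dvn \<le> ?x" "?x \<le> 1" using dir_f_ge[OF e t] dvn dir_f_u(2)[OF eE] by auto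
  have "(2 - dvn) * (1 - ?x) \<le> (1 + ?x) * (1 - ?x)" using x by (intro mult_right_mono) auto
  also have "\<dots> = (norm (P (dir e)))\<^sup>2" unfolding perp_dir_sq[OF eE] by (simp add: power2_eq_square algebra_simps)
  also have "\<dots> \<le> rate e" unfolding rate_def using c by (simp add: pos_le_divide_eq mult_left_le)
  finally show "(2 - dvn) * (1 - ?x) \<le> rate e" .
  have "(1 + 2 * dvn) * (1 - dvn) \<le> (1 + 2 * dvn) * ?c" using c dvn by (intro mult_left_mono) auto
  moreover have "1 \<le> (1 + 2 * dvn) * (1 - dvn)"
  proof -
    have "0 \<le> dvn * (1 - 2 * dvn)" using dvn by (intro mult_nonneg_nonneg) auto
    then show ?thesis by (simp add: algebra_simps)
  qed
  ultimately have inv: "1 \<le> (1 + 2 * dvn) * ?c" by linarith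
  have "rate e \<le> (norm (P (dir e)))\<^sup>2 * ((1 + 2 * dvn) * ?c) / ?c"
    unfolding rate_def using c inv mult_left_mono[OF inv, of "(norm (P (dir e)))\<^sup>2"] by (intro divide_right_mono) auto
  also have "\<dots> = (1 + 2 * dvn) * (norm (P (dir e)))\<^sup>2" using c by simp
  also have "\<dots> \<le> (1 + 2 * dvn) * (2 * (1 - ?x))" using perp_dir_sq_le[OF eE] dvn by (intro mult_left_mono) auto
  finally show "rate e \<le> (2 + 4 * dvn) * (1 - ?x)" by (simp add: algebra_simps)
qed

text \<open>The common time is the latest start of an incoming edge, or \<open>a\<close>. It makes
  the bounds for a slice available for all incoming edges at once.\<close>

lemma in_slopes:
  assumes v: "a < u \<bullet> v" "u \<bullet> v \<le> b"
  shows "\<exists>t. a \<le> t \<and> t \<le> b \<and> {e\<in>E. snd e = v} \<subseteq> cross u E t"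
proof -
  define S where "S = insert a ((\<lambda>e. u \<bullet> fst e) ` {e\<in>E. snd e = v})"
  have S: "finite S" "S \<noteq> {}" using fin by (auto simp: S_def)
  have "Max S \<in> S" using S by (rule Max_in)
  then have "Max S < u \<bullet> v" using v up by (auto simp: S_def)
  moreover have "a \<le> Max S" using S by (intro Max_ge) (auto simp: S_def)
  moreover have "u \<bullet> fst e \<le> Max S" if "e \<in> {e\<in>E. snd e = v}" for e
    using S(1) that by (intro Max_ge) (auto simp: S_def)
  ultimately show ?thesis using v by (intro exI[of _ "Max S"]) (auto simp: cross_def)
qed

text \<open>The flux balance equates the slope-weighted sums. On each side the multiplicity exceeds
  this sum by something between 0 and \<open>dvn\<close>, so the two integers differ by less than
  1.\<close>

lemma vertex_mult:
  assumes v: "a < u \<bullet> v" "u \<bullet> v \<le> b"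
  shows "(\<Sum>e\<in>{e\<in>E. snd e = v}. m e) = (\<Sum>e\<in>{e\<in>E. fst e = v}. m e)"
proof -
  let ?I = "{e\<in>E. snd e = v}" and ?O = "{e\<in>E. fst e = v}"
  have fl: "(\<Sum>e\<in>?I. real (m e) * (u \<bullet> dir e)) = (\<Sum>e\<in>?O. real (m e) * (u \<bullet> dir e))"
    using arg_cong[OF balanced[OF v], of "\<lambda>z. u \<bullet> z"] by (simp add: inner_sum_right)
  have def: "0 \<le> (\<Sum>e\<in>S. real (m e) * (1 - u \<bullet> dir e)) \<and> (\<Sum>e\<in>S. real (m e) * (1 - u \<bullet> dir e)) \<le> dvn"
    if "S \<subseteq> cross u E t" "a \<le> t" "t \<le> b" for S t
  proof -
    have nn: "0 \<le> real (m e) * (1 - u \<bullet> dir e)" if "e \<in> E" for e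
      using slope_le_1[OF that] by simp
    have "(\<Sum>e\<in>S. real (m e) * (1 - u \<bullet> dir e)) \<le> (\<Sum>e\<in>cross u E t. real (m e) * (1 - u \<bullet> dir e))"
      using that nn crossD by (intro sum_mono2) auto
    then show ?thesis using sum_rate_bound(2)[of t] mult_const that nn cross_subset[of t]
      by (auto simp: dvn_def intro!: sum_nonneg)
  qed
  obtain t where t: "a \<le> t" "t \<le> b" "?I \<subseteq> cross u E t" using in_slopes[OF v] by blast
  have "?O \<subseteq> cross u E (u \<bullet> v)" using up by (auto simp: cross_def)
  then have O: "0 \<le> (\<Sum>e\<in>?O. real (m e) * (1 - u \<bullet> dir e)) \<and> (\<Sum>e\<in>?O. real (m e) * (1 - u \<bullet> dir e)) \<le> dvn"
    using v by (intro def) auto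
  have I: "0 \<le> (\<Sum>e\<in>?I. real (m e) * (1 - u \<bullet> dir e)) \<and> (\<Sum>e\<in>?I. real (m e) * (1 - u \<bullet> dir e)) \<le> dvn"
    by (rule def[OF t(3,1,2)])
  have "real (\<Sum>e\<in>?I. m e) - real (\<Sum>e\<in>?O. m e) =
     (\<Sum>e\<in>?I. real (m e) * (1 - u \<bullet> dir e)) - (\<Sum>e\<in>?O. real (m e) * (1 - u \<bullet> dir e))"
    using fl by (simp add: right_diff_distrib sum_subtractf)
  then have "\<bar>real (\<Sum>e\<in>?I. m e) - real (\<Sum>e\<in>?O. m e)\<bar> < 1" using O I dvn by linarith
  then show ?thesis by linarith
qed

text \<open>Now that multiplicity and flux are both conserved at vertices, so is the energy 1 -
  \<open>dir e \<bullet> f\<close>. Any function \<open>g\<close> of time may be carried along as a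
  factor, and the total energy of each slice is the constant \<open>en\<close>.\<close>

lemma energy_integral:
  assumes xy: "a \<le> x" "x \<le> y" "y \<le> b"
  shows "(\<Sum>e\<in>meeting u E x y. real (m e) * (1 - dir e \<bullet> f) * (g (max (u \<bullet> fst e) x) - g (min (u \<bullet> snd e) y))) = en * (g x - g y)"
proof -
  have "(\<Sum>e\<in>cross u E y. real (m e) * (1 - dir e \<bullet> f) * g y) - (\<Sum>e\<in>cross u E x. real (m e) * (1 - dir e \<bullet> f) * g x)
     = (\<Sum>e\<in>meeting u E x y. real (m e) * (1 - dir e \<bullet> f) * g (min (u \<bullet> snd e) y) - real (m e) * (1 - dir e \<bullet> f) * g (max (u \<bullet> fst e) x))"
  proof (rule evolve)
    fix v assume v: "x < u \<bullet> v" "u \<bullet> v \<le> y"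
    have av: "a < u \<bullet> v" "u \<bullet> v \<le> b" using v xy by auto
    have s: "(\<Sum>e\<in>S. real (m e) * (1 - dir e \<bullet> f) * c) = (real (\<Sum>e\<in>S. m e) - (\<Sum>e\<in>S. real (m e) *\<^sub>R dir e) \<bullet> f) * c" for S c
      by (simp add: inner_sum_left sum_subtractf right_diff_distrib sum_distrib_right[symmetric])
    show "(\<Sum>e\<in>{e\<in>E. snd e = v}. real (m e) * (1 - dir e \<bullet> f) * g (u \<bullet> v)) = (\<Sum>e\<in>{e\<in>E. fst e = v}. real (m e) * (1 - dir e \<bullet> f) * g (u \<bullet> v))"
      unfolding s balanced[OF av] vertex_mult[OF av] ..
  qed fact
  moreover have "(\<Sum>e\<in>cross u E t. real (m e) * (1 - dir e \<bullet> f) * c) = en * c" if "a \<le> t" "t \<le> b" for t c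
    using sum_rate_bound(1)[OF that mult_const[OF that]] by (simp add: sum_distrib_right[symmetric])
  ultimately have "en * g y - en * g x = (\<Sum>e\<in>meeting u E x y. real (m e) * (1 - dir e \<bullet> f) * g (min (u \<bullet> snd e) y) - real (m e) * (1 - dir e \<bullet> f) * g (max (u \<bullet> fst e) x))"
    using xy by simp
  then show ?thesis by (simp add: sum_subtractf right_diff_distrib)
qed

text \<open>Rates are comparable with energies, so the exact energy identity yields both bounds;
  monotonicity of \<open>g\<close> up to time \<open>y\<close> keeps the weights nonnegative. The
  case g(t) = -t gives the growth of \<open>G\<close>, and g(t) = (y - t)^2 that of
  \<open>J\<close>.\<close>

lemma rate_integral:
  assumes xy: "a \<le> x" "x \<le> y" "y \<le> b" and g: "\<And>s t. s \<le> t \<Longrightarrow> t \<le> y \<Longrightarrow> g t \<le> (g s :: real)"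
  shows "(2 - dvn) * (en * (g x - g y)) \<le> (\<Sum>e\<in>meeting u E x y. real (m e) * (rate e * (g (max (u \<bullet> fst e) x) - g (min (u \<bullet> snd e) y))))"
    and "(\<Sum>e\<in>meeting u E x y. real (m e) * (rate e * (g (max (u \<bullet> fst e) x) - g (min (u \<bullet> snd e) y)))) \<le> (2 + 4 * dvn) * (en * (g x - g y))"
proof -
  let ?d = "\<lambda>e. g (max (u \<bullet> fst e) x) - g (min (u \<bullet> snd e) y)"
  have d: "0 \<le> real (m e) * ?d e" if "e \<in> meeting u E x y" for e
  proof -
    have "max (u \<bullet> fst e) x \<le> min (u \<bullet> snd e) y" using that up[OF meetingD[OF that]] xy by (auto simp: meeting_def)
    then have "0 \<le> ?d e" using g[of "max (u \<bullet> fst e) x" "min (u \<bullet> snd e) y"] by simp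
    then show ?thesis by simp
  qed
  have r: "(2 - dvn) * (1 - dir e \<bullet> f) \<le> rate e \<and> rate e \<le> (2 + 4 * dvn) * (1 - dir e \<bullet> f)" if "e \<in> meeting u E x y" for e
    using rate_bounds[OF meeting_cross(1,2,4)[OF that xy(1,3,2)]] by blast
  have "(2 - dvn) * (en * (g x - g y)) = (\<Sum>e\<in>meeting u E x y. (real (m e) * ?d e) * ((2 - dvn) * (1 - dir e \<bullet> f)))"
    unfolding energy_integral[OF xy, of g, symmetric] sum_distrib_left by (intro sum.cong) auto
  also have "\<dots> \<le> (\<Sum>e\<in>meeting u E x y. (real (m e) * ?d e) * rate e)"
    using d r by (intro sum_mono mult_left_mono) auto
  finally show "(2 - dvn) * (en * (g x - g y)) \<le> (\<Sum>e\<in>meeting u E x y. real (m e) * (rate e * ?d e))"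
    by (simp add: mult_ac)
  have "(\<Sum>e\<in>meeting u E x y. (real (m e) * ?d e) * rate e) \<le> (\<Sum>e\<in>meeting u E x y. (real (m e) * ?d e) * ((2 + 4 * dvn) * (1 - dir e \<bullet> f)))"
    using d r by (intro sum_mono mult_left_mono) auto
  also have "\<dots> = (2 + 4 * dvn) * (en * (g x - g y))"
    unfolding energy_integral[OF xy, of g, symmetric] sum_distrib_left by (intro sum.cong) auto
  finally show "(\<Sum>e\<in>meeting u E x y. real (m e) * (rate e * ?d e)) \<le> (2 + 4 * dvn) * (en * (g x - g y))"
    by (simp add: mult_ac)
qed

lemma G_growth:
  assumes xy: "a \<le> x" "x \<le> y" "y \<le> b"
  shows "G x + (2 - dvn) * (en * (y - x)) \<le> G y" "G y \<le> G x + (2 + 4 * dvn) * (en * (y - x))"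
proof -
  have "(\<Sum>e\<in>meeting u E x y. real (m e) * (rate e * (- max (u \<bullet> fst e) x - - min (u \<bullet> snd e) y))) = G y - G x"
    unfolding G_diff[OF xy] by (intro sum.cong refl) (simp add: span_time_def)
  then show "G x + (2 - dvn) * (en * (y - x)) \<le> G y" "G y \<le> G x + (2 + 4 * dvn) * (en * (y - x))"
    using rate_integral[OF xy, of uminus] by simp_all
qed

lemma J_growth:
  assumes xy: "a \<le> x" "x \<le> y" "y \<le> b"
  shows "J x + 2 * (y - x) * G x + (2 - dvn) * (en * (y - x)\<^sup>2) \<le> J y"
    "J y \<le> J x + 2 * (y - x) * G x + (2 + 4 * dvn) * (en * (y - x)\<^sup>2)"
  using rate_integral[OF xy, of "\<lambda>t. (y - t)\<^sup>2"] J_formula[OF xy] by (simp_all add: power_mono)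

lemma J_mono: "a \<le> x \<Longrightarrow> x \<le> y \<Longrightarrow> y \<le> b \<Longrightarrow> 0 \<le> G x \<Longrightarrow> J x \<le> J y"
proof -
  assume xy: "a \<le> x" "x \<le> y" "y \<le> b" and G: "0 \<le> G x"
  have "0 \<le> 2 * (y - x) * G x" "0 \<le> (2 - dvn) * (en * (y - x)\<^sup>2)"
    using xy G dvn en_nonneg by (auto intro!: mult_nonneg_nonneg)
  then show ?thesis using J_growth(1)[OF xy] by linarith
qed

text \<open>After a long enough expansion the velocities are almost proportional to the positions.\<close>

lemma radial:
  assumes xy: "a \<le> x" "x < y" "y \<le> b" and G: "0 \<le> G x" and en: "0 < en" and q: "J x \<le> q * (en * (y - x)\<^sup>2)"
  defines "\<mu> \<equiv> G y / J y"
  shows "0 < G y" "0 < J y"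
    "(\<Sum>e\<in>cross u E y. real (m e) * ((u \<bullet> dir e) * (norm ((1 / (u \<bullet> dir e)) *\<^sub>R P (dir e) - \<mu> *\<^sub>R P (pos u e y - ctr)))\<^sup>2)) \<le> en * (11 * dvn + 2 * q)"
    "en * (2 - 7 * dvn - 2 * q) \<le> \<mu>\<^sup>2 * J y"
proof -
  define s where "s = y - x"
  have s: "0 < s" using xy by (simp add: s_def)
  have y: "a \<le> y" "y \<le> b" and xy': "x \<le> y" using xy by auto
  note gr = G_growth[OF xy(1) xy' xy(3), folded s_def] J_growth[OF xy(1) xy' xy(3), folded s_def]
  have es: "0 < en * s" "0 < en * s\<^sup>2" using en s by auto
  have "0 < (2 - dvn) * (en * s)" using es dvn en s by (intro mult_pos_pos) auto
  then show Gy: "0 < G y" using gr(1) G by linarith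
  have sG: "0 \<le> 2 * s * G x" using s G by simp
  have "en * s\<^sup>2 \<le> (2 - dvn) * (en * s\<^sup>2)"
    using mult_right_mono[of 1 "2 - dvn" "en * s\<^sup>2"] es dvn by simp
  then have Jes: "en * s\<^sup>2 \<le> J y" using gr(3) sG J_nonneg[of x] by linarith
  then show Jy: "0 < J y" using es by linarith
  have q0: "0 \<le> q"
  proof (rule ccontr)
    assume "\<not> 0 \<le> q"
    then have "q * (en * s\<^sup>2) < 0" using es by (simp add: mult_neg_pos)
    then show False using q J_nonneg[of x] by (simp add: s_def)
  qed
  have "q * (en * s\<^sup>2) \<le> q * J y" using Jes q0 by (rule mult_left_mono)
  then have Jx: "J x \<le> q * J y" using q by (simp add: s_def)
  \<comment> \<open>If the total rate were exactly 2 en, then (G y)^2 - (G x)^2 would equal 2 en (J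
    y - J x). The following estimates preserve this in one direction, up to factors 1 -
    O(dvn).\<close>
  define X where "X = (2 - dvn) * (en * s)"
  have X: "0 \<le> X" using es dvn by (simp add: X_def)
  have "(G x + X)\<^sup>2 \<le> (G y)\<^sup>2" using gr(1) G X by (intro power_mono) (auto simp: X_def)
  moreover have "(G x)\<^sup>2 \<ge> 0" by simp
  moreover have "(G x + X)\<^sup>2 = (G x)\<^sup>2 + X * (X + 2 * G x)" by (simp add: power2_eq_square algebra_simps)
  ultimately have G2: "X * (X + 2 * G x) \<le> (G y)\<^sup>2" by linarith
  have "(1 - 3 * dvn) * (J y - J x) \<le> (1 - 3 * dvn) * (2 * s * G x + (2 + 4 * dvn) * (en * s\<^sup>2))"
    using gr(4) dvn by (intro mult_left_mono) auto
  also have "\<dots> \<le> 2 * s * G x + (2 - dvn) * (en * s\<^sup>2)"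
  proof -
    have "(1 - 3 * dvn) * (2 * s * G x) \<le> 1 * (2 * s * G x)" using sG dvn by (intro mult_right_mono) auto
    moreover have "(1 - 3 * dvn) * (2 + 4 * dvn) * (en * s\<^sup>2) \<le> (2 - dvn) * (en * s\<^sup>2)"
    proof (rule mult_right_mono)
      have "0 \<le> dvn * (1 + 12 * dvn)" using dvn by (intro mult_nonneg_nonneg) auto
      then show "(1 - 3 * dvn) * (2 + 4 * dvn) \<le> 2 - dvn" by (simp add: algebra_simps)
    qed (use es in auto)
    ultimately show ?thesis by (simp add: algebra_simps)
  qed
  also have "\<dots> = s * (X + 2 * G x)" by (simp add: X_def power2_eq_square algebra_simps)
  finally have "(2 - dvn) * en * ((1 - 3 * dvn) * (J y - J x)) \<le> (2 - dvn) * en * (s * (X + 2 * G x))"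
    using en dvn by (intro mult_left_mono) auto
  also have "\<dots> = X * (X + 2 * G x)" by (simp add: X_def)
  also note G2
  finally have G3: "(2 - dvn) * en * ((1 - 3 * dvn) * (J y - J x)) \<le> (G y)\<^sup>2" .
  have Jd: "0 \<le> J y - J x" using J_mono[of x y] xy G by simp
  have "(2 - 7 * dvn) * (en * (J y - J x)) \<le> (2 - dvn) * (1 - 3 * dvn) * (en * (J y - J x))"
    using dvn en Jd by (intro mult_right_mono) (auto simp: algebra_simps)
  also have "\<dots> \<le> (G y)\<^sup>2" using G3 by (simp add: algebra_simps)
  finally have G4: "(2 - 7 * dvn) * (en * (J y - J x)) \<le> (G y)\<^sup>2" .
  have "(2 - 7 * dvn - 2 * q) * (en * J y) \<le> (2 - 7 * dvn) * (en * (J y - q * J y))"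
  proof -
    have "0 \<le> 7 * dvn * q * (en * J y)" using dvn q0 en Jy by simp
    then show ?thesis by (simp add: algebra_simps)
  qed
  also have "\<dots> \<le> (2 - 7 * dvn) * (en * (J y - J x))"
    using Jx dvn en by (intro mult_left_mono) auto
  also note G4
  finally have G5: "en * (2 - 7 * dvn - 2 * q) * J y \<le> (G y)\<^sup>2" by (simp add: algebra_simps)
  have lJ: "\<mu>\<^sup>2 * J y = (G y)\<^sup>2 / J y" using Jy by (simp add: \<mu>_def power2_eq_square)
  show 4: "en * (2 - 7 * dvn - 2 * q) \<le> \<mu>\<^sup>2 * J y"
    unfolding lJ using G5 Jy by (simp add: pos_le_divide_eq)
  let ?A = "cross u E y"
  \<comment> \<open>\<mu> is the least squares factor between velocities and positions, so the sum
    of squares is the total rate minus \<open>\<mu>\<^sup>2 * J y\<close>. The total rate is about 2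
    en, and so is the subtracted term once the initial spread is negligible.\<close>
  have "(\<Sum>e\<in>?A. real (m e) * ((u \<bullet> dir e) * (norm ((1 / (u \<bullet> dir e)) *\<^sub>R P (dir e) - \<mu> *\<^sub>R P (pos u e y - ctr)))\<^sup>2))
     = (\<Sum>e\<in>?A. real (m e) * rate e - 2 * \<mu> * (real (m e) * (dir e \<bullet> P (pos u e y - ctr))) + \<mu>\<^sup>2 * (real (m e) * ((u \<bullet> dir e) * (norm (P (pos u e y - ctr)))\<^sup>2)))"
  proof (rule sum.cong[OF refl])
    fix e assume "e \<in> ?A"
    then have c: "0 < u \<bullet> dir e" using slope_pos crossD by blast
    define c where "c = u \<bullet> dir e"
    define p d where "p = P (pos u e y - ctr)" and "d = P (dir e)"
    have dp: "dir e \<bullet> p = d \<bullet> p" by (simp add: p_def d_def perp_inner_perp[OF norm_f])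
    have "c * (norm ((1 / c) *\<^sub>R d - \<mu> *\<^sub>R p))\<^sup>2 = (d \<bullet> d) / c - 2 * \<mu> * (d \<bullet> p) + \<mu>\<^sup>2 * (c * (p \<bullet> p))"
      using c unfolding power2_norm_eq_inner c_def[symmetric]
      by (simp add: inner_diff_left inner_diff_right inner_commute[of p d] power2_eq_square field_simps)
    then have "c * (norm ((1 / c) *\<^sub>R d - \<mu> *\<^sub>R p))\<^sup>2 = rate e - 2 * \<mu> * (d \<bullet> p) + \<mu>\<^sup>2 * (c * (norm p)\<^sup>2)"
      by (simp add: rate_def d_def c_def power2_norm_eq_inner)
    then have "real (m e) * (c * (norm ((1 / c) *\<^sub>R d - \<mu> *\<^sub>R p))\<^sup>2) = real (m e) * (rate e - 2 * \<mu> * (d \<bullet> p) + \<mu>\<^sup>2 * (c * (norm p)\<^sup>2))"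
      by (simp only:)
    then show "real (m e) * ((u \<bullet> dir e) * (norm ((1 / (u \<bullet> dir e)) *\<^sub>R P (dir e) - \<mu> *\<^sub>R P (pos u e y - ctr)))\<^sup>2)
      = real (m e) * rate e - 2 * \<mu> * (real (m e) * (dir e \<bullet> P (pos u e y - ctr))) + \<mu>\<^sup>2 * (real (m e) * ((u \<bullet> dir e) * (norm (P (pos u e y - ctr)))\<^sup>2))"
      unfolding c_def[symmetric] p_def[symmetric] d_def[symmetric] dp by (simp add: right_diff_distrib distrib_left mult_ac)
  qed
  also have "\<dots> = (\<Sum>e\<in>?A. real (m e) * rate e) - 2 * \<mu> * G y + \<mu>\<^sup>2 * J y"
    unfolding sum.distrib sum_subtractf sum_distrib_left[symmetric] G_centred[OF y, of ctr, symmetric] J_def[symmetric] ..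
  also have "\<dots> = (\<Sum>e\<in>?A. real (m e) * rate e) - \<mu>\<^sup>2 * J y"
    using Jy by (simp add: \<mu>_def power2_eq_square)
  also have "\<dots> \<le> (2 + 4 * dvn) * en - en * (2 - 7 * dvn - 2 * q)"
  proof -
    have "(\<Sum>e\<in>?A. real (m e) * rate e) \<le> (\<Sum>e\<in>?A. real (m e) * ((2 + 4 * dvn) * (1 - dir e \<bullet> f)))"
      using rate_bounds(2) y by (intro sum_mono mult_left_mono) auto
    also have "\<dots> = (2 + 4 * dvn) * en"
      unfolding sum_rate_bound(1)[OF y mult_const[OF y], symmetric] sum_distrib_left by (intro sum.cong) auto
    finally show ?thesis using 4 by linarith
  qed
  also have "\<dots> = en * (11 * dvn + 2 * q)" by (simp add: algebra_simps)
  finally show "(\<Sum>e\<in>?A. real (m e) * ((u \<bullet> dir e) * (norm ((1 / (u \<bullet> dir e)) *\<^sub>R P (dir e) - \<mu> *\<^sub>R P (pos u e y - ctr)))\<^sup>2)) \<le> en * (11 * dvn + 2 * q)" .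
qed

end

text \<open>Compares velocities through directions. The factor 6 is 2 for the division by a slope of
  at least 1/2, plus 4 for the difference of the reciprocals of two such slopes.\<close>

lemma slope_vector_diff:
  fixes s s' u :: "'a::real_inner"
  assumes "norm u = 1" "norm s = 1" "norm s' = 1" "1/2 \<le> u \<bullet> s" "1/2 \<le> u \<bullet> s'"
  shows "norm ((1 / (u \<bullet> s)) *\<^sub>R s - (1 / (u \<bullet> s')) *\<^sub>R s') \<le> 6 * norm (s - s')"
proof -
  define c c' where "c = u \<bullet> s" and "c' = u \<bullet> s'"
  have c: "1/2 \<le> c" "1/2 \<le> c'" using assms by (auto simp: c_def c'_def)
  have "(1 / c) *\<^sub>R s - (1 / c') *\<^sub>R s' = (1 / c) *\<^sub>R (s - s') + (1 / c - 1 / c') *\<^sub>R s'"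
    by (simp add: algebra_simps)
  then have "norm ((1 / c) *\<^sub>R s - (1 / c') *\<^sub>R s') \<le> norm ((1 / c) *\<^sub>R (s - s')) + norm ((1 / c - 1 / c') *\<^sub>R s')"
    by (metis norm_triangle_ineq)
  also have "\<dots> = (1 / c) * norm (s - s') + \<bar>1 / c - 1 / c'\<bar>"
    using c assms by simp
  also have "\<bar>1 / c - 1 / c'\<bar> = \<bar>c' - c\<bar> / (c * c')"
    using c by (simp add: field_simps abs_divide abs_mult)
  also have "\<bar>c' - c\<bar> \<le> norm (s - s')"
    using Cauchy_Schwarz_ineq2[of u "s' - s"] assms(1)
    by (simp add: c_def c'_def inner_diff_right norm_minus_commute)
  then have "\<bar>c' - c\<bar> / (c * c') \<le> norm (s - s') / (1/2 * (1/2))"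
    using c by (intro frac_le mult_mono) auto
  also have "(1 / c) * norm (s - s') \<le> 2 * norm (s - s')"
    using c by (intro mult_right_mono) (auto simp: field_simps)
  finally show ?thesis by (simp add: c_def c'_def)
qed

text \<open>Velocities are unit vectors stretched by factors p, q \<ge> 1, which cannot bring them
  closer: with w = s \<bullet> s' the difference of the squared distances is (p - q)^2 + 2 (p q -
  1)(1 - w).\<close>

lemma norm_diff_le_slope_vector_diff:
  fixes s s' u :: "'a::real_inner"
  assumes "norm s = 1" "norm s' = 1" "0 < u \<bullet> s" "0 < u \<bullet> s'" "u \<bullet> s \<le> 1" "u \<bullet> s' \<le> 1"
  shows "norm (s - s') \<le> norm ((1 / (u \<bullet> s)) *\<^sub>R s - (1 / (u \<bullet> s')) *\<^sub>R s')"
proof -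
  define p q where "p = 1 / (u \<bullet> s)" and "q = 1 / (u \<bullet> s')"
  have pq: "1 \<le> p" "1 \<le> q" using assms by (auto simp: p_def q_def)
  define w where "w = s \<bullet> s'"
  have w: "w \<le> 1" using norm_cauchy_schwarz[of s s'] assms by (simp add: w_def)
  have ss: "s \<bullet> s = 1" "s' \<bullet> s' = 1" using assms by (auto simp: norm_eq_1)
  have "(norm (s - s'))\<^sup>2 = 2 - 2 * w"
    by (simp add: power2_norm_eq_inner inner_diff_left inner_diff_right inner_commute[of s' s] ss w_def)
  moreover have "(norm (p *\<^sub>R s - q *\<^sub>R s'))\<^sup>2 = p * p + q * q - 2 * (p * q) * w"
    by (simp add: power2_norm_eq_inner inner_diff_left inner_diff_right inner_commute[of s' s] ss w_def algebra_simps)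
  moreover have "2 - 2 * w \<le> p * p + q * q - 2 * (p * q) * w"
  proof -
    have "1 * (1 - w) \<le> (p * q) * (1 - w)" using pq w mult_mono[of 1 p 1 q] by (intro mult_right_mono) auto
    moreover have "0 \<le> (p - q) * (p - q)" by simp
    ultimately show ?thesis by (simp add: algebra_simps)
  qed
  ultimately have "(norm (s - s'))\<^sup>2 \<le> (norm (p *\<^sub>R s - q *\<^sub>R s'))\<^sup>2" by simp
  then have "norm (s - s') \<le> norm (p *\<^sub>R s - q *\<^sub>R s')" by (rule power2_le_imp_le) simp
  then show ?thesis by (simp add: p_def q_def)
qed

section \<open>Clusters of edges in disjoint cones\<close>

context thin_net begin

text \<open>Simultaneous positions and velocities differ by vectors orthogonal to \<open>u\<close>.
  As \<open>f\<close> is close to \<open>u\<close>, the projection along \<open>f\<close> preserves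
  most of such a vector.\<close>

lemma norm_le_perp:
  assumes "z \<bullet> u = 0" shows "norm z \<le> 2 * norm (P z)"
proof -
  have "\<bar>z \<bullet> f\<bar> = \<bar>z \<bullet> (f - u)\<bar>" using assms by (simp add: inner_diff_right)
  also have "\<dots> \<le> norm z * norm (f - u)" by (rule Cauchy_Schwarz_ineq2)
  also have "\<dots> \<le> norm z * (1/16)" using norm_f_u by (intro mult_left_mono) auto
  finally have "\<bar>z \<bullet> f\<bar>\<^sup>2 \<le> (norm z * (1/16))\<^sup>2" by (intro power_mono) auto
  then have "256 * (z \<bullet> f)\<^sup>2 \<le> (norm z)\<^sup>2" by (simp add: power_mult_distrib power2_eq_square)
  then have "(norm z)\<^sup>2 \<le> 4 * (norm (P z))\<^sup>2" unfolding norm_perp_sq[OF norm_f] right_diff_distrib using zero_le_power2[of "norm z"] by linarith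
  then have "(norm z)\<^sup>2 \<le> (2 * norm (P z))\<^sup>2" by (simp add: power_mult_distrib)
  then show ?thesis by (rule power2_le_imp_le) simp
qed

text \<open>If the cross section at the initial time consists of at least two clusters that are far apart compared
  with their size, and the velocities are almost proportional to the positions, then the clusters stay in
  disjoint space-time cones: within a cone the flux and the multiplicity are conserved, which
  bounds all velocities there.\<close>

lemma cones_split:
  fixes \<mu> r :: real and z :: 'a
  defines "q \<equiv> \<lambda>e. \<mu> *\<^sub>R P (pos u e a - z)"
  assumes r: "0 < r" and \<mu>: "0 < \<mu>"
    and near: "\<And>e. e \<in> cross u E a \<Longrightarrow> norm ((1 / (u \<bullet> dir e)) *\<^sub>R P (dir e) - q e) \<le> r"
    and gap: "\<And>e e'. e \<in> cross u E a \<Longrightarrow> e' \<in> cross u E a \<Longrightarrow> norm (q e - q e') \<le> r \<or> (72 * real k + 6) * r < norm (q e - q e')"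
    and two: "e1 \<in> cross u E a" "e2 \<in> cross u E a" "(72 * real k + 6) * r < norm (q e1 - q e2)"
  shows "\<exists>E1 E2. splits a b E1 E2 \<and> cross u E1 a \<noteq> {} \<and> cross u E2 a \<noteq> {}"
proof -
  let ?A = "cross u E a"
  define M where "M = 72 * real k + 6"
  have kr: "1 \<le> real k" using k1 by simp
  have M78: "78 \<le> M" using kr by (simp add: M_def)
  define x' where "x' e = (1 / (u \<bullet> dir e)) *\<^sub>R dir e" for e
  have Px': "P (x' e) = (1 / (u \<bullet> dir e)) *\<^sub>R P (dir e)" for e by (simp add: x'_def perp_scale)
  have pos_lin: "pos u e t = pos u e s + (t - s) *\<^sub>R x' e" if "e \<in> E" for e s t
    using pos_diff[OF that, of t s] by (simp add: x'_def algebra_simps)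
  \<comment> \<open>The cluster has projected size r / \<mu>, hence size at most 2 r / \<mu> by
    \<open>norm_le_perp\<close>. The radius grows with the speed 36 k r, by which velocities inside
    the cone can differ from that of \<open>g\<close> according to \<open>Q_slope\<close>.\<close>
  define K where "K g t = {x. norm (x - pos u g t) \<le> 2 * r / \<mu> + 36 * real k * r * (t - a)}" for g t
  have mult: "crossing_mult u E m t = k" if "a \<le> t" "t \<le> b" for t
    using thin_net_mult[of u E m a b k t] thin_net_axioms that by blast
  have slope: "1/2 \<le> u \<bullet> dir e" if "e \<in> cross u E t" "a \<le> t" "t \<le> b" for e t
    using sum_rate_bound(3)[OF that(2,3) mult[OF that(2,3)] that(1)] dev512 by linarith
  have aa: "a \<le> a" "a \<le> b" using ab by auto
  \<comment> \<open>The choice depends only on the set of edges close to \<open>e\<close>, so all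
    edges of a cluster get the same representative.\<close>
  define rep where "rep e = (SOME g. g \<in> ?A \<and> norm (q e - q g) \<le> r)" for e
  have rep_ex: "rep e \<in> ?A \<and> norm (q e - q (rep e)) \<le> r" if "e \<in> ?A" for e
    unfolding rep_def by (rule someI[of _ e]) (use that r in auto)
  \<comment> \<open>Closeness is transitive because of the gap: two steps give a distance of at most
    2 r, which is not above the gap and so at most r.\<close>
  have close_trans: "norm (q e - q g) \<le> r" if "e \<in> ?A" "g \<in> ?A" "h \<in> ?A" "norm (q e - q h) \<le> r" "norm (q h - q g) \<le> r" for e g h
  proof -
    have "norm (q e - q g) \<le> norm (q e - q h) + norm (q h - q g)"
      by (metis norm_triangle_ineq diff_add_cancel add_diff_eq)
    also have "\<dots> \<le> 2 * r" using that by simp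
    also have "\<dots> < M * r" using M78 r by (intro mult_strict_right_mono) auto
    finally have "\<not> M * r < norm (q e - q g)" by simp
    then show ?thesis using gap[OF that(1,2)] by (auto simp: M_def)
  qed
  define Rp where "Rp = rep ` ?A"
  have RpA: "g \<in> ?A" if "g \<in> Rp" for g using that rep_ex by (auto simp: Rp_def)
  have finR: "finite Rp" by (simp add: Rp_def)
  have rep_eq: "rep e = rep e'" if "e \<in> ?A" "e' \<in> ?A" "norm (q e - q e') \<le> r" for e e'
  proof -
    have "norm (q e - q g) \<le> r \<longleftrightarrow> norm (q e' - q g) \<le> r" if "g \<in> ?A" for g
      using close_trans[of e g e'] close_trans[of e' g e] that \<open>e \<in> ?A\<close> \<open>e' \<in> ?A\<close> \<open>norm (q e - q e') \<le> r\<close>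
      by (auto simp: norm_minus_commute)
    then have "(g \<in> ?A \<and> norm (q e - q g) \<le> r) = (g \<in> ?A \<and> norm (q e' - q g) \<le> r)" for g by blast
    then show ?thesis unfolding rep_def by simp
  qed
  have rep_rep: "rep g = g" if "g \<in> Rp" for g
  proof -
    obtain e where e: "e \<in> ?A" "g = rep e" using \<open>g \<in> Rp\<close> by (auto simp: Rp_def)
    then show ?thesis using rep_eq[of e "rep e"] rep_ex[OF e(1)] by auto
  qed
  have far: "M * r < norm (q g - q h)" if "g \<in> Rp" "h \<in> Rp" "g \<noteq> h" for g h
  proof (rule ccontr)
    assume "\<not> ?thesis"
    then have "norm (q g - q h) \<le> r" using gap[OF RpA[OF that(1)] RpA[OF that(2)]] by (auto simp: M_def)
    then show False using rep_eq[OF RpA[OF that(1)] RpA[OF that(2)]] rep_rep that by auto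
  qed
  have K_disj: "\<not> (x \<in> K g t \<and> x \<in> K h t)" if gh: "g \<in> Rp" "h \<in> Rp" "g \<noteq> h" and t: "a \<le> t" for g h x t
  proof
    assume x: "x \<in> K g t \<and> x \<in> K h t"
    define \<sigma> where "\<sigma> = t - a"
    have \<sigma>: "0 \<le> \<sigma>" using t by (simp add: \<sigma>_def)
    have g: "g \<in> E" and h: "h \<in> E" using gh RpA crossD by blast+
    define d where "d = pos u g t - pos u h t"
    have "d = (x - pos u h t) - (x - pos u g t)" by (simp add: d_def)
    then have "norm d \<le> norm (x - pos u h t) + norm (x - pos u g t)" using norm_triangle_ineq4 by metis
    also have "\<dots> \<le> 4 * r / \<mu> + 72 * real k * r * \<sigma>" using x by (simp add: K_def \<sigma>_def)
    finally have d1: "norm d \<le> 4 * r / \<mu> + 72 * real k * r * \<sigma>" .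
    \<comment> \<open>Relative to \<open>z\<close> a representative has projected position q / \<mu>
      and velocity q up to an error r. So two of them drift apart like 1 / \<mu> + \<sigma> times
      the difference of their values of q, up to 2 r \<sigma>.\<close>
    have "P d = (1 / \<mu> + \<sigma>) *\<^sub>R (q g - q h) + \<sigma> *\<^sub>R ((P (x' g) - q g) - (P (x' h) - q h))"
    proof -
      have "(1 / \<mu>) *\<^sub>R q e = P (pos u e a - z)" for e using \<mu> by (simp add: q_def)
      then have "(1 / \<mu>) *\<^sub>R (q g - q h) = P (pos u g a) - P (pos u h a)" by (simp add: scaleR_diff_right perp_diff)
      moreover have "P d = P (pos u g a) - P (pos u h a) + \<sigma> *\<^sub>R (P (x' g) - P (x' h))"
        unfolding d_def pos_lin[OF g, of t a] pos_lin[OF h, of t a]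
        by (simp add: perp_add perp_diff perp_scale \<sigma>_def algebra_simps)
      ultimately have "P d = (1 / \<mu>) *\<^sub>R (q g - q h) + \<sigma> *\<^sub>R (P (x' g) - P (x' h))" by simp
      then show ?thesis by (simp add: algebra_simps)
    qed
    moreover have "norm ((1 / \<mu> + \<sigma>) *\<^sub>R (q g - q h)) \<le> norm ((1 / \<mu> + \<sigma>) *\<^sub>R (q g - q h) + \<sigma> *\<^sub>R ((P (x' g) - q g) - (P (x' h) - q h))) + norm (\<sigma> *\<^sub>R ((P (x' g) - q g) - (P (x' h) - q h)))"
      by (metis add_diff_cancel_right' norm_triangle_ineq4)
    ultimately have "(1 / \<mu> + \<sigma>) * norm (q g - q h) \<le> norm (P d) + \<sigma> * norm ((P (x' g) - q g) - (P (x' h) - q h))"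
      using \<mu> \<sigma> by simp
    also have "\<dots> \<le> norm d + \<sigma> * (2 * r)"
    proof (intro add_mono mult_left_mono \<sigma>)
      show "norm (P d) \<le> norm d" by (rule norm_perp_le[OF norm_f])
      show "norm (P (x' g) - q g - (P (x' h) - q h)) \<le> 2 * r"
        using norm_triangle_ineq4[of "P (x' g) - q g" "P (x' h) - q h"] near[OF RpA[OF gh(1)]] near[OF RpA[OF gh(2)]] by (simp add: Px')
    qed
    finally have "(1 / \<mu> + \<sigma>) * norm (q g - q h) \<le> norm d + 2 * r * \<sigma>" by (simp add: mult_ac)
    with d1 have "(1 / \<mu> + \<sigma>) * norm (q g - q h) \<le> 4 * r / \<mu> + 72 * real k * r * \<sigma> + 2 * r * \<sigma>"
      by linarith
    moreover have "(1 / \<mu> + \<sigma>) * (M * r) < (1 / \<mu> + \<sigma>) * norm (q g - q h)"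
      using far[OF gh] \<mu> \<sigma> by (intro mult_strict_left_mono) (auto intro: add_pos_nonneg)
    \<comment> \<open>Origin of 72 k + 6: it exceeds both the 4 needed for the two initial radii and
      the 72 k + 2 needed for the two opening speeds and the velocity errors.\<close>
    moreover have "4 * r / \<mu> + 72 * real k * r * \<sigma> + 2 * r * \<sigma> \<le> (1 / \<mu> + \<sigma>) * (M * r)"
    proof -
      have "4 * (r / \<mu>) \<le> M * (r / \<mu>)" using M78 r \<mu> by (intro mult_right_mono) auto
      moreover have "(72 * real k + 2) * (r * \<sigma>) \<le> M * (r * \<sigma>)" using r \<sigma> by (intro mult_right_mono) (auto simp: M_def)
      ultimately show ?thesis by (simp add: algebra_simps)
    qed
    ultimately show False by linarith
  qed
  define cl where "cl g = {e\<in>?A. rep e = g}" for g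
  \<comment> \<open>The invariant: each cone carries at time \<open>t\<close> exactly the flux and
    the multiplicity that its cluster had at time \<open>a\<close>.\<close>
  define Q where "Q t \<longleftrightarrow> (\<forall>g\<in>Rp. (\<Sum>e\<in>{e\<in>cross u E t. pos u e t \<in> K g t}. real (m e) *\<^sub>R dir e) = (\<Sum>e\<in>cl g. real (m e) *\<^sub>R dir e)
     \<and> (\<Sum>e\<in>{e\<in>cross u E t. pos u e t \<in> K g t}. m e) = (\<Sum>e\<in>cl g. m e))" for t
  have sum_cl: "(\<Sum>g\<in>Rp. \<Sum>e\<in>cl g. m e) = k"
  proof -
    have "(\<Sum>g\<in>Rp. \<Sum>e\<in>cl g. m e) = (\<Sum>e\<in>?A. m e)"
      unfolding cl_def using finR by (intro sum.group) (auto simp: Rp_def)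
    then show ?thesis using Na by (simp add: crossing_mult_def)
  qed
  have same: "norm (x' e - x' (rep e)) \<le> 6 * r" "norm (dir e - dir (rep e)) \<le> 6 * r" "pos u e a \<in> K (rep e) a" if e: "e \<in> ?A" for e
  proof -
    let ?g = "rep e"
    have g: "?g \<in> ?A" and qq: "norm (q e - q ?g) \<le> r" using rep_ex[OF e] by auto
    have eE: "e \<in> E" and gE: "?g \<in> E" using e g crossD by blast+
    have "(x' e - x' ?g) \<bullet> u = 0" using slope_pos[OF eE] slope_pos[OF gE] unfolding inner_commute[of _ u] by (simp add: x'_def inner_diff_right)
    then have "norm (x' e - x' ?g) \<le> 2 * norm (P (x' e - x' ?g))" by (rule norm_le_perp)
    also have "P (x' e - x' ?g) = (P (x' e) - q e) - (P (x' ?g) - q ?g) + (q e - q ?g)" by (simp add: perp_diff)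
    also have "norm \<dots> \<le> norm (P (x' e) - q e) + norm (P (x' ?g) - q ?g) + norm (q e - q ?g)"
      by (meson add_mono_thms_linordered_semiring(3) norm_triangle_ineq norm_triangle_ineq4 order_trans)
    also have "\<dots> \<le> r + r + r" using near[OF e] near[OF g] qq by (intro add_mono) (simp_all add: Px')
    finally show 1: "norm (x' e - x' ?g) \<le> 6 * r" by simp
    have "norm (dir e - dir ?g) \<le> norm (x' e - x' ?g)"
      unfolding x'_def using norm_dir slope_pos slope_le_1 eE gE by (intro norm_diff_le_slope_vector_diff) auto
    then show "norm (dir e - dir ?g) \<le> 6 * r" using 1 by simp
    have "(pos u e a - pos u ?g a) \<bullet> u = 0" using u_pos[OF eE] u_pos[OF gE] unfolding inner_commute[of _ u] by (simp add: inner_diff_right)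
    then have "norm (pos u e a - pos u ?g a) \<le> 2 * norm (P (pos u e a - pos u ?g a))" by (rule norm_le_perp)
    also have "P (pos u e a - pos u ?g a) = (1 / \<mu>) *\<^sub>R (q e - q ?g)"
      using \<mu> by (simp add: q_def perp_diff scaleR_diff_right)
    also have "2 * norm ((1 / \<mu>) *\<^sub>R (q e - q ?g)) \<le> 2 * r / \<mu>" using \<mu> qq by (simp add: divide_right_mono)
    finally show "pos u e a \<in> K ?g a" by (simp add: K_def)
  qed
  have Qa: "Q a"
  proof -
    have "{e\<in>?A. pos u e a \<in> K g a} = cl g" if g: "g \<in> Rp" for g
    proof -
      have "pos u e a \<in> K g a \<longleftrightarrow> rep e = g" if e: "e \<in> ?A" for e
        using same(3)[OF e] K_disj[OF _ g, of "rep e" a "pos u e a"] e by (auto simp: Rp_def)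
      then show ?thesis by (auto simp: cl_def)
    qed
    then show ?thesis by (simp add: Q_def)
  qed
  \<comment> \<open>The sum of \<open>m e\<close> times 1 - \<open>dir e \<bullet> dir g\<close> is
    a function of flux and multiplicity alone, so under the invariant it is still at most 18 k r^2.
    Any single term then gives directions within 6 k r of that of \<open>g\<close>, and velocities
    within 36 k r.\<close>
  have Q_slope: "norm (x' e - x' g) \<le> 36 * real k * r"
    if Q: "Q t" and t: "a \<le> t" "t \<le> b" and g: "g \<in> Rp" and e: "e \<in> cross u E t" "pos u e t \<in> K g t" for t g e
  proof -
    let ?S = "{e\<in>cross u E t. pos u e t \<in> K g t}"
    have gA: "g \<in> ?A" by (rule RpA[OF g])
    have gE: "g \<in> E" and eE: "e \<in> E" using gA e crossD by blast+
    have id: "1 - dir e \<bullet> dir g = (norm (dir e - dir g))\<^sup>2 / 2" if "e \<in> E" for e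
      using dir_inner_dir[OF that] dir_inner_dir[OF gE]
      by (simp add: power2_norm_eq_inner inner_diff_left inner_diff_right inner_commute)
    have ex: "(\<Sum>e\<in>S. real (m e) * (1 - dir e \<bullet> dir g)) = real (\<Sum>e\<in>S. m e) - (\<Sum>e\<in>S. real (m e) *\<^sub>R dir e) \<bullet> dir g" for S
      by (simp add: inner_sum_left right_diff_distrib sum_subtractf)
    have nn0: "0 \<le> 1 - dir e \<bullet> dir g" if "e \<in> E" for e unfolding id[OF that] by simp
    have nn: "0 \<le> real (m e) * (1 - dir e \<bullet> dir g)" if "e \<in> E" for e using nn0[OF that] by simp
    have "1 * (1 - dir e \<bullet> dir g) \<le> real (m e) * (1 - dir e \<bullet> dir g)"
      using mult_pos[OF eE] nn0[OF eE] by (intro mult_right_mono) auto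
    also have "\<dots> \<le> (\<Sum>e\<in>?S. real (m e) * (1 - dir e \<bullet> dir g))"
      using e nn crossD by (intro member_le_sum) auto
    also have "\<dots> = (\<Sum>e\<in>cl g. real (m e) * (1 - dir e \<bullet> dir g))"
      using Q g by (simp add: ex Q_def)
    also have "\<dots> \<le> (\<Sum>e\<in>cl g. real (m e) * (18 * r\<^sup>2))"
    proof (intro sum_mono mult_left_mono)
      fix e assume e: "e \<in> cl g"
      then have eA: "e \<in> ?A" and "rep e = g" by (auto simp: cl_def)
      then have "norm (dir e - dir g) \<le> 6 * r" using same(2)[OF eA] by simp
      then have "(norm (dir e - dir g))\<^sup>2 \<le> (6 * r)\<^sup>2" by (intro power_mono) auto
      then show "1 - dir e \<bullet> dir g \<le> 18 * r\<^sup>2" using id[OF crossD[OF eA]] by (simp add: power_mult_distrib)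
    qed simp
    also have "\<dots> = real (\<Sum>e\<in>cl g. m e) * (18 * r\<^sup>2)" by (simp add: sum_distrib_right)
    also have "\<dots> \<le> real k * (18 * r\<^sup>2)"
    proof (intro mult_right_mono)
      have "(\<Sum>e\<in>cl g. m e) \<le> (\<Sum>g\<in>Rp. \<Sum>e\<in>cl g. m e)" using g finR by (intro member_le_sum) auto
      then show "real (\<Sum>e\<in>cl g. m e) \<le> real k" unfolding sum_cl of_nat_le_iff .
    qed simp
    finally have "(norm (dir e - dir g))\<^sup>2 \<le> 36 * real k * r\<^sup>2" using id[OF eE] by simp
    also have "\<dots> \<le> 36 * (real k)\<^sup>2 * r\<^sup>2"
    proof -
      have "real k * 1 \<le> real k * real k" using kr by (intro mult_left_mono) auto
      then have "real k \<le> (real k)\<^sup>2" by (simp only: power2_eq_square mult_1_right)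
      then show ?thesis by (intro mult_right_mono mult_left_mono) auto
    qed
    also have "\<dots> = (6 * real k * r)\<^sup>2" by (simp add: power2_eq_square)
    finally have "norm (dir e - dir g) \<le> 6 * real k * r" by (rule power2_le_imp_le) (use r in simp)
    moreover have "norm (x' e - x' g) \<le> 6 * norm (dir e - dir g)"
      unfolding x'_def using norm_u norm_dir eE gE slope[OF e(1) t] slope[OF gA aa] by (intro slope_vector_diff) auto
    ultimately show ?thesis by simp
  qed
  have Q_stay: "pos u e \<tau> \<in> K g \<tau>"
    if Q: "Q t" and t: "a \<le> t" "t \<le> b" and g: "g \<in> Rp" and e: "e \<in> cross u E t" "pos u e t \<in> K g t" and \<tau>: "t \<le> \<tau>" for t g e \<tau>
  proof -
    have gE: "g \<in> E" and eE: "e \<in> E" using RpA[OF g] e crossD by blast+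
    have "pos u e \<tau> - pos u g \<tau> = (pos u e t - pos u g t) + (\<tau> - t) *\<^sub>R (x' e - x' g)"
      unfolding pos_lin[OF gE, of \<tau> t] pos_lin[OF eE, of \<tau> t] by (simp add: algebra_simps)
    also have "norm \<dots> \<le> norm (pos u e t - pos u g t) + (\<tau> - t) * norm (x' e - x' g)"
      using norm_triangle_ineq[of "pos u e t - pos u g t" "(\<tau> - t) *\<^sub>R (x' e - x' g)"] \<tau> by simp
    also have "\<dots> \<le> (2 * r / \<mu> + 36 * real k * r * (t - a)) + (\<tau> - t) * (36 * real k * r)"
      using e(2) Q_slope[OF Q t g e] \<tau> by (intro add_mono mult_left_mono) (auto simp: K_def)
    finally show ?thesis by (simp add: K_def algebra_simps)
  qed
  have K_sep: "{e\<in>cross u E t. pos u e t \<in> K g t} \<inter> {e\<in>cross u E t. pos u e t \<in> K h t} = {}"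
    if "g \<in> Rp" "h \<in> Rp" "g \<noteq> h" "a \<le> t" for g h t
    using K_disj[OF that] by blast
  \<comment> \<open>The disjoint cones already carry the whole multiplicity \<open>k\<close>, so no
    edge is left outside.\<close>
  have Q_cover: "\<exists>g\<in>Rp. pos u e t \<in> K g t" if Q: "Q t" and t: "a \<le> t" "t \<le> b" and e: "e \<in> cross u E t" for t e
  proof (rule ccontr)
    assume no: "\<not> ?thesis"
    let ?S = "\<lambda>g. {e\<in>cross u E t. pos u e t \<in> K g t}"
    have "k = (\<Sum>g\<in>Rp. \<Sum>e\<in>?S g. m e)" using Q sum_cl by (simp add: Q_def)
    also have "\<dots> = (\<Sum>e\<in>(\<Union>g\<in>Rp. ?S g). m e)"
      by (rule sum.UNION_disjoint[symmetric]) (use finR K_sep[OF _ _ _ t(1)] in simp_all)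
    also have "\<dots> \<le> (\<Sum>e\<in>cross u E t - {e}. m e)" using no by (intro sum_mono2) auto
    also have "\<dots> < m e + (\<Sum>e\<in>cross u E t - {e}. m e)" using mult_pos[OF crossD[OF e]] by simp
    also have "\<dots> = k" using mult[OF t] e by (simp add: crossing_mult_def sum.remove[symmetric])
    finally show False by simp
  qed
  define C where "C = (\<lambda>v. u \<bullet> v) ` (fst ` E \<union> snd ` E)"
  have finC: "finite C" using fin by (simp add: C_def)
  \<comment> \<open>Without vertices strictly between the two times edges run straight and stay in
    their cones. Only vertices at height \<tau> rearrange edges, and all edges at such a vertex
    share its position.\<close>
  have Q_step: "Q \<tau>" if Q: "Q t" and t: "a \<le> t" "t \<le> \<tau>" "\<tau> \<le> b" and crit: "\<And>c. c \<in> C \<Longrightarrow> \<not> (t < c \<and> c < \<tau>)" for t \<tau>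
  proof -
    have tb: "t \<le> b" and a\<tau>: "a \<le> \<tau>" using t by auto
    let ?S = "\<lambda>g. {e\<in>cross u E \<tau>. pos u e \<tau> \<in> K g \<tau>}"
    have flux_g: "(\<Sum>e\<in>?S g. real (m e) *\<^sub>R dir e) = (\<Sum>e\<in>cl g. real (m e) *\<^sub>R dir e)" if g: "g \<in> Rp" for g
    proof -
      \<comment> \<open>Membership is tested at the position extrapolated to \<tau>. So \<phi> does
        not vary along edges, and only the vertices at height \<tau> need to be balanced.\<close>
      define \<phi> where "\<phi> e s = (if pos u e \<tau> \<in> K g \<tau> then real (m e) *\<^sub>R dir e else 0)" for e and s :: real
      have "(\<Sum>e\<in>cross u E \<tau>. \<phi> e \<tau>) - (\<Sum>e\<in>cross u E t. \<phi> e t) = (\<Sum>e\<in>meeting u E t \<tau>. \<phi> e (min (u \<bullet> snd e) \<tau>) - \<phi> e (max (u \<bullet> fst e) t))"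
      proof (rule evolve)
        fix v assume v: "t < u \<bullet> v" "u \<bullet> v \<le> \<tau>"
        show "(\<Sum>e\<in>{e\<in>E. snd e = v}. \<phi> e (u \<bullet> v)) = (\<Sum>e\<in>{e\<in>E. fst e = v}. \<phi> e (u \<bullet> v))"
        proof (cases "u \<bullet> v = \<tau>")
          case True
          have s: "pos u e \<tau> = v" if "e \<in> E" "snd e = v" for e using that pos_snd[of e] True by simp
          have f: "pos u e \<tau> = v" if "e \<in> E" "fst e = v" for e using that pos_fst[of e] True by simp
          have 1: "(\<Sum>e\<in>{e\<in>E. snd e = v}. \<phi> e (u \<bullet> v)) = (\<Sum>e\<in>{e\<in>E. snd e = v}. if v \<in> K g \<tau> then real (m e) *\<^sub>R dir e else 0)"
            using s by (intro sum.cong refl) (simp add: \<phi>_def)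
          have 2: "(\<Sum>e\<in>{e\<in>E. fst e = v}. \<phi> e (u \<bullet> v)) = (\<Sum>e\<in>{e\<in>E. fst e = v}. if v \<in> K g \<tau> then real (m e) *\<^sub>R dir e else 0)"
            using f by (intro sum.cong refl) (simp add: \<phi>_def)
          show ?thesis unfolding 1 2 using balanced[of v] v t by (cases "v \<in> K g \<tau>") auto
        next
          case False
          then have "u \<bullet> v \<notin> C" using crit[of "u \<bullet> v"] v by auto
          then have "v \<notin> snd ` E" "v \<notin> fst ` E" unfolding C_def by blast+
          then have "{e\<in>E. snd e = v} = {}" "{e\<in>E. fst e = v} = {}" by blast+
          then show ?thesis by (simp only: sum.empty)
        qed
      qed (use t in simp)
      also have "\<dots> = 0" by (simp add: \<phi>_def)
      finally have "(\<Sum>e\<in>cross u E \<tau>. \<phi> e \<tau>) = (\<Sum>e\<in>cross u E t. \<phi> e t)" by simp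
      moreover have "(\<Sum>e\<in>cross u E \<tau>. \<phi> e \<tau>) = (\<Sum>e\<in>?S g. real (m e) *\<^sub>R dir e)"
        by (simp add: \<phi>_def sum.inter_filter)
      moreover have "(\<Sum>e\<in>cross u E t. \<phi> e t) = (\<Sum>e\<in>{e\<in>cross u E t. pos u e \<tau> \<in> K g \<tau>}. real (m e) *\<^sub>R dir e)"
        by (simp add: \<phi>_def sum.inter_filter)
      moreover have "{e\<in>cross u E t. pos u e \<tau> \<in> K g \<tau>} = {e\<in>cross u E t. pos u e t \<in> K g t}"
      proof -
        have "pos u e \<tau> \<in> K g \<tau> \<longleftrightarrow> pos u e t \<in> K g t" if e: "e \<in> cross u E t" for e
        proof
          assume 1: "pos u e \<tau> \<in> K g \<tau>"
          obtain h where h: "h \<in> Rp" "pos u e t \<in> K h t" using Q_cover[OF Q t(1) tb e] by blast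
          then have "pos u e \<tau> \<in> K h \<tau>" using Q_stay[OF Q t(1) tb h(1) e h(2) t(2)] by simp
          then have "h = g" using K_disj[OF h(1) g _ a\<tau>] 1 by blast
          then show "pos u e t \<in> K g t" using h by simp
        next
          assume "pos u e t \<in> K g t"
          then show "pos u e \<tau> \<in> K g \<tau>" using Q_stay[OF Q t(1) tb g e _ t(2)] by simp
        qed
        then show ?thesis by blast
      qed
      ultimately show ?thesis using Q g by (simp add: Q_def)
    qed
    \<comment> \<open>The flux in the cone is conserved and the cluster has defect below 1, so the
      multiplicity cannot drop. It cannot rise in any cone either, because the cones together hold
      at most \<open>k\<close>.\<close>
    have mult_ge: "(\<Sum>e\<in>cl g. m e) \<le> (\<Sum>e\<in>?S g. m e)" if g: "g \<in> Rp" for g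
    proof -
      have "(\<Sum>e\<in>cl g. real (m e) * (u \<bullet> dir e)) = u \<bullet> (\<Sum>e\<in>cl g. real (m e) *\<^sub>R dir e)" by (simp add: inner_sum_right)
      also have "\<dots> = (\<Sum>e\<in>?S g. real (m e) * (u \<bullet> dir e))" unfolding flux_g[OF g, symmetric] by (simp add: inner_sum_right)
      also have "\<dots> \<le> (\<Sum>e\<in>?S g. real (m e) * 1)" using slope_le_1 crossD by (intro sum_mono mult_left_mono) auto
      finally have 1: "(\<Sum>e\<in>cl g. real (m e) * (u \<bullet> dir e)) \<le> real (\<Sum>e\<in>?S g. m e)" by simp
      have "(\<Sum>e\<in>cl g. real (m e) * (1 - u \<bullet> dir e)) \<le> (\<Sum>e\<in>?A. real (m e) * (1 - u \<bullet> dir e))"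
        using slope_le_1 crossD by (intro sum_mono2) (auto simp: cl_def)
      also have "\<dots> < 1" using sum_rate_bound(2)[OF aa Na] dev512 by simp
      finally have "real (\<Sum>e\<in>cl g. m e) - (\<Sum>e\<in>cl g. real (m e) * (u \<bullet> dir e)) < 1"
        by (simp add: right_diff_distrib sum_subtractf)
      then show ?thesis using 1 by linarith
    qed
    have "(\<Sum>g\<in>Rp. \<Sum>e\<in>?S g. m e) = (\<Sum>e\<in>(\<Union>g\<in>Rp. ?S g). m e)"
      by (rule sum.UNION_disjoint[symmetric]) (use finR K_sep[OF _ _ _ a\<tau>] in simp_all)
    also have "\<dots> \<le> (\<Sum>e\<in>cross u E \<tau>. m e)" by (intro sum_mono2) auto
    also have "\<dots> = (\<Sum>g\<in>Rp. \<Sum>e\<in>cl g. m e)" using mult[OF a\<tau> t(3)] sum_cl by (simp add: crossing_mult_def)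
    finally have "(\<Sum>g\<in>Rp. \<Sum>e\<in>?S g. m e) = (\<Sum>g\<in>Rp. \<Sum>e\<in>cl g. m e)"
      using sum_mono[of Rp "\<lambda>g. \<Sum>e\<in>cl g. m e" "\<lambda>g. \<Sum>e\<in>?S g. m e"] mult_ge by simp
    then have "(\<Sum>e\<in>?S g. m e) = (\<Sum>e\<in>cl g. m e)" if "g \<in> Rp" for g
      using sum_mono_inv[of "\<lambda>g. \<Sum>e\<in>cl g. m e" Rp "\<lambda>g. \<Sum>e\<in>?S g. m e" g] mult_ge that finR by simp
    then show ?thesis using flux_g by (simp add: Q_def)
  qed
  \<comment> \<open>Induction on the number of vertex heights strictly between \<open>a\<close> and
    \<open>t\<close>, passing to the last of them.\<close>
  have Q_all: "Q t" if "a \<le> t" "t \<le> b" for t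
    using that
  proof (induction "card {c\<in>C. a < c \<and> c < t}" arbitrary: t rule: less_induct)
    case less
    show ?case
    proof (cases "{c\<in>C. a < c \<and> c < t} = {}")
      case True
      then show ?thesis using Q_step[OF Qa, of t] less.prems by auto
    next
      case False
      define c where "c = Max {c\<in>C. a < c \<and> c < t}"
      have c: "c \<in> {c\<in>C. a < c \<and> c < t}" unfolding c_def using False finC by (intro Max_in) auto
      have "{c'\<in>C. a < c' \<and> c' < c} \<subset> {c\<in>C. a < c \<and> c < t}" using c by auto
      then have "card {c'\<in>C. a < c' \<and> c' < c} < card {c\<in>C. a < c \<and> c < t}"
        using finC by (intro psubset_card_mono) auto
      then have "Q c" using less.hyps[of c] c less.prems by auto
      moreover have "\<not> (c < c' \<and> c' < t)" if "c' \<in> C" for c'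
        using that c Max_ge[of "{c\<in>C. a < c \<and> c < t}" c'] finC by (auto simp: c_def[symmetric])
      ultimately show ?thesis using Q_step[of c t] c less.prems by auto
    qed
  qed
  define g1 where "g1 = rep e1"
  define lo where "lo e = max (u \<bullet> fst e) a" for e :: "'a edge"
  let ?B = "meeting u E a b"
  have lo: "e \<in> cross u E (lo e)" "a \<le> lo e" "lo e \<le> b" if "e \<in> ?B" for e
    using that up[OF meetingD[OF that]] ab by (auto simp: lo_def meeting_def cross_def)
  \<comment> \<open>It suffices to test the position at the first time of an edge in [a, b], since
    edges never leave their cone.\<close>
  define E1 where "E1 = {e\<in>?B. pos u e (lo e) \<in> K g1 (lo e)}"
  define E2 where "E2 = ?B - E1"
  have g1: "g1 \<in> Rp" using two by (simp add: g1_def Rp_def)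
  have vert: "v \<in> K g (u \<bullet> v)"
    if e: "e \<in> ?B" and v: "a < u \<bullet> v" "u \<bullet> v \<le> b" "fst e = v \<or> snd e = v" and g: "g \<in> Rp" "pos u e (lo e) \<in> K g (lo e)" for e v g
  proof -
    have "lo e \<le> u \<bullet> v" "pos u e (u \<bullet> v) = v"
      using v up[OF meetingD[OF e]] pos_snd[OF meetingD[OF e]] by (auto simp: lo_def)
    then show ?thesis using Q_stay[OF Q_all[OF lo(2,3)[OF e]] lo(2,3)[OF e] g(1) lo(1)[OF e] g(2), of "u \<bullet> v"] by simp
  qed
  have "splits a b E1 E2"
    unfolding splits_def
  proof (intro conjI ballI allI impI)
    show "E1 \<union> E2 = ?B" "E1 \<inter> E2 = {}" by (auto simp: E1_def E2_def)
    fix e e' v assume ee: "e \<in> E1" "e' \<in> E2" and v: "a < u \<bullet> v \<and> u \<bullet> v \<le> b"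
    show "\<not> ((fst e = v \<or> snd e = v) \<and> (fst e' = v \<or> snd e' = v))"
    proof
      assume *: "(fst e = v \<or> snd e = v) \<and> (fst e' = v \<or> snd e' = v)"
      have 1: "v \<in> K g1 (u \<bullet> v)" using ee v * vert[of e v g1] g1 by (auto simp: E1_def)
      have e': "e' \<in> ?B" "pos u e' (lo e') \<notin> K g1 (lo e')" using ee by (auto simp: E1_def E2_def)
      obtain h where h: "h \<in> Rp" "pos u e' (lo e') \<in> K h (lo e')"
        using Q_cover[OF Q_all[OF lo(2,3)[OF e'(1)]] lo(2,3)[OF e'(1)] lo(1)[OF e'(1)]] by blast
      have "v \<in> K h (u \<bullet> v)" using e' v * vert[of e' v h] h by auto
      then show False using K_disj[OF h(1) g1, of "u \<bullet> v" v] 1 v e'(2) h(2) by auto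
    qed
  qed (use ab in auto)
  moreover have loA: "lo e = a" "e \<in> ?B" if "e \<in> ?A" for e using that ab by (auto simp: cross_def lo_def meeting_def)
  have "e1 \<in> E1" using same(3)[OF two(1)] loA[OF two(1)] by (simp add: E1_def g1_def)
  moreover have "e2 \<in> E2"
  proof -
    have "rep e2 \<noteq> g1"
    proof
      assume eq: "rep e2 = g1"
      have "norm (q e1 - q e2) \<le> r"
        using close_trans[OF two(1,2), of g1] rep_ex[OF two(1)] rep_ex[OF two(2)] eq
        by (auto simp: g1_def norm_minus_commute)
      moreover have "r < (72 * real k + 6) * r" using r by (simp add: algebra_simps add_pos_nonneg)
      ultimately show False using two(3) by linarith
    qed
    then have "pos u e2 a \<notin> K g1 a"
      using same(3)[OF two(2)] K_disj[OF _ g1, of "rep e2" a "pos u e2 a"] two(2) by (auto simp: Rp_def)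
    then show ?thesis using loA[OF two(2)] by (simp add: E1_def E2_def)
  qed
  ultimately have "splits a b E1 E2 \<and> e1 \<in> cross u E1 a \<and> e2 \<in> cross u E2 a"
    using two by (simp add: cross_def)
  then show ?thesis by blast
qed

end

section \<open>Counting singular vertices\<close>

text \<open>Clusters need gaps exceeding \<open>72 * k + 6\<close> times their diameter. At most \<open>k\<^sup>2\<close> distances occur, so
  by pigeonhole one of \<open>k\<^sup>2 + 1\<close> successive scales has such a gap.\<close>

definition scale_bound :: "nat \<Rightarrow> real" where
  "scale_bound k = (72 * real k + 6) ^ (k\<^sup>2 + 1)"

text \<open>The first factors are those demanded of a thin net. The squared scale bound keeps the
  deviation from radial motion below the finest of the scales among which a gap is sought.\<close>

definition flux_defect :: "nat \<Rightarrow> real" where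
  "flux_defect k = 1 / (512 * (real k)\<^sup>2 * (scale_bound k)\<^sup>2)"

lemma scale_bound_ge_1: "1 \<le> scale_bound k"
  unfolding scale_bound_def by (rule one_le_power) simp

lemma scale_bound_mono: "j \<le> k \<Longrightarrow> scale_bound j \<le> scale_bound k"
proof -
  assume "j \<le> k"
  then have "(72 * real j + 6) ^ (j\<^sup>2 + 1) \<le> (72 * real k + 6) ^ (j\<^sup>2 + 1)" by (intro power_mono) auto
  also have "\<dots> \<le> (72 * real k + 6) ^ (k\<^sup>2 + 1)" using \<open>j \<le> k\<close> by (intro power_increasing) (auto intro: power_mono)
  finally show ?thesis by (simp add: scale_bound_def)
qed

lemma flux_defect_pos: "1 \<le> k \<Longrightarrow> 0 < flux_defect k"
  using scale_bound_ge_1[of k] by (simp add: flux_defect_def)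

lemma flux_defect_antimono: "1 \<le> j \<Longrightarrow> j \<le> k \<Longrightarrow> flux_defect k \<le> flux_defect j"
proof -
  assume jk: "1 \<le> j" "j \<le> k"
  have "512 * (real j)\<^sup>2 * (scale_bound j)\<^sup>2 \<le> 512 * (real k)\<^sup>2 * (scale_bound k)\<^sup>2"
    using jk scale_bound_mono[OF jk(2)] scale_bound_ge_1[of j] by (intro mult_mono power_mono) auto
  then show ?thesis
    unfolding flux_defect_def using jk scale_bound_ge_1[of j] scale_bound_ge_1[of k]
    by (intro divide_left_mono mult_pos_pos) auto
qed

lemma flux_defect_le: "1 \<le> k \<Longrightarrow> flux_defect k \<le> 1 / (512 * (real k)\<^sup>2)"
proof -
  assume k: "1 \<le> k"
  have "512 * (real k)\<^sup>2 * 1 \<le> 512 * (real k)\<^sup>2 * (scale_bound k)\<^sup>2"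
    using scale_bound_ge_1[of k] by (intro mult_left_mono) (auto simp: one_le_power)
  then show ?thesis unfolding flux_defect_def using k scale_bound_ge_1[of k] by (intro divide_left_mono) auto
qed

lemma scale_gap:
  fixes d :: "'i \<Rightarrow> 'i \<Rightarrow> real"
  assumes "finite A" "card A \<le> k" "0 < d0" "1 < M"
  shows "\<exists>i\<in>{1..k\<^sup>2 + 1}. \<forall>x\<in>A. \<forall>y\<in>A. d x y \<le> d0 / M ^ i \<or> d0 / M ^ (i - 1) < d x y"
proof (rule ccontr)
  assume neg: "\<not> ?thesis"
  have "\<exists>p. p \<in> A \<times> A \<and> d0 / M ^ i < d (fst p) (snd p) \<and> d (fst p) (snd p) \<le> d0 / M ^ (i - 1)" if "i \<in> {1..k\<^sup>2 + 1}" for i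
  proof -
    from neg that obtain x y where "x \<in> A" "y \<in> A" "\<not> (d x y \<le> d0 / M ^ i \<or> d0 / M ^ (i - 1) < d x y)" by blast
    then show ?thesis by (intro exI[of _ "(x, y)"]) auto
  qed
  then obtain p where p: "\<And>i. i \<in> {1..k\<^sup>2 + 1} \<Longrightarrow> p i \<in> A \<times> A \<and> d0 / M ^ i < d (fst (p i)) (snd (p i)) \<and> d (fst (p i)) (snd (p i)) \<le> d0 / M ^ (i - 1)"
    by metis
  \<comment> \<open>A pair that spoils the scale i has its distance above d0 / M^i and at most d0 /
    M^(i - 1). These ranges are disjoint, so different scales are spoiled by different
    pairs.\<close>
  have less: "p i \<noteq> p j" if ij: "i \<in> {1..k\<^sup>2 + 1}" "j \<in> {1..k\<^sup>2 + 1}" "i < j" for i j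
  proof
    assume eq: "p i = p j"
    have "d0 / M ^ i < d (fst (p i)) (snd (p i))" using p[OF ij(1)] by simp
    also have "\<dots> \<le> d0 / M ^ (j - 1)" using p[OF ij(2)] eq by simp
    also have "\<dots> \<le> d0 / M ^ i" using ij assms by (intro divide_left_mono power_increasing) auto
    finally show False by simp
  qed
  have "inj_on p {1..k\<^sup>2 + 1}"
    using less by (intro inj_onI) (metis linorder_neqE_nat)
  then have "card {1..k\<^sup>2 + 1} \<le> card (A \<times> A)"
    by (rule card_inj_on_le) (use p assms in blast)+
  also have "\<dots> = card A * card A" by (simp add: card_cartesian_product)
  also have "\<dots> \<le> k\<^sup>2" using assms by (simp add: power2_eq_square mult_mono)
  finally show False by simp
qed

context thin_net begin

lemma card_cross_le: "a \<le> t \<Longrightarrow> t \<le> b \<Longrightarrow> card (cross u E t) \<le> k"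
proof -
  assume t: "a \<le> t" "t \<le> b"
  have "card (cross u E t) = (\<Sum>e\<in>cross u E t. 1)" by simp
  also have "\<dots> \<le> (\<Sum>e\<in>cross u E t. m e)" using mult_pos crossD by (intro sum_mono) auto
  finally show ?thesis using mult_const[OF t] by (simp add: crossing_mult_def)
qed

text \<open>After the expansion velocities agree with \<mu> times the positions up to the size r of
  the clusters, for whichever scale r the pigeonhole argument returns; the factor in
  \<open>q\<close> is calibrated to the smallest one. The far edges guarantee that there are at
  least two clusters, so the cones apply.\<close>

lemma radial_splits:
  assumes small: "real k - flux u E m a \<bullet> u \<le> flux_defect k"
    and xy: "a \<le> x" "x < y" "y \<le> b" and G: "0 \<le> G x" and en: "0 < en"
    and q: "J x \<le> 1 / (8 * real k * (scale_bound k)\<^sup>2) * (en * (y - x)\<^sup>2)"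
  shows "\<exists>E1 E2. splits y b E1 E2 \<and> cross u E1 y \<noteq> {} \<and> cross u E2 y \<noteq> {}"
proof -
  define W where "W = scale_bound k"
  have W: "1 \<le> W" by (simp add: W_def scale_bound_ge_1)
  have kr: "1 \<le> real k" using k1 by simp
  define B where "B = real k * W\<^sup>2"
  have B: "1 \<le> B" using kr W mult_mono[of 1 "real k" 1 "W\<^sup>2"] by (simp add: B_def one_le_power)
  have ay: "a \<le> y" "y \<le> b" using xy by auto
  interpret s: thin_net u E m y b k using thin_sub[of y b] ay by simp
  have fy: "flux u E m y = flux u E m a" by (rule flux_const[OF ay])
  have sf: "s.f = f" by (simp add: s.f_def f_def fy)
  define \<mu> where "\<mu> = G y / J y"
  have q1: "J x \<le> (1 / (8 * B)) * (en * (y - x)\<^sup>2)" using q by (simp add: B_def W_def mult.assoc)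
  note rad = radial[OF xy G en q1, folded \<mu>_def]
  have \<mu>: "0 < \<mu>" using rad(1,2) by (simp add: \<mu>_def)
  have dvnB: "dvn \<le> 1 / (512 * B)"
  proof -
    have "dvn \<le> 1 / (512 * (real k)\<^sup>2 * W\<^sup>2)" using small by (simp add: dvn_def flux_defect_def W_def)
    also have "\<dots> \<le> 1 / (512 * B)"
    proof (rule divide_left_mono)
      have "real k * (real k * W\<^sup>2) \<ge> 1 * (real k * W\<^sup>2)" using kr by (intro mult_right_mono) auto
      then show "512 * B \<le> 512 * (real k)\<^sup>2 * W\<^sup>2" by (simp add: B_def power2_eq_square mult.assoc)
    qed (use kr W B in auto)
    finally show ?thesis .
  qed
  define \<Lambda> where "\<Lambda> = en * (11 * dvn + 2 * (1 / (8 * B)))"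
  \<comment> \<open>\<Lambda> bounds the weighted sum of squared deviations, in which slopes are at
    least 1/2; hence the factor 2. Numerically 2 (11/512 + 1/4) < 1.\<close>
  have \<Lambda>: "2 * \<Lambda> \<le> en / B"
  proof -
    have "2 * (11 * dvn + 2 * (1 / (8 * B))) \<le> 2 * (11 * (1 / (512 * B)) + 2 * (1 / (8 * B)))"
      using dvnB by simp
    also have "\<dots> \<le> 1 / B" using B by (simp add: field_simps)
    finally have "en * (2 * (11 * dvn + 2 * (1 / (8 * B)))) \<le> en * (1 / B)" using en by (intro mult_left_mono) auto
    then show ?thesis by (simp add: \<Lambda>_def algebra_simps)
  qed
  have enJ: "en \<le> \<mu>\<^sup>2 * J y"
  proof -
    have "7 * dvn + 2 * (1 / (8 * B)) \<le> 7 * (1/512) + 2 * (1/8)"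
    proof -
      have "1 / (8 * B) \<le> 1/8" using B by (simp add: field_simps)
      then show ?thesis using dvn by linarith
    qed
    also have "\<dots> \<le> 1" by simp
    finally have "en * 1 \<le> en * (2 - 7 * dvn - 2 * (1 / (8 * B)))" using en by (intro mult_left_mono) auto
    then show ?thesis using rad(4) by simp
  qed
  define qv where "qv e = \<mu> *\<^sub>R P (pos u e y - ctr)" for e
  \<comment> \<open>The coarsest scale. Energy \<open>en\<close> on total multiplicity
    \<open>k\<close> makes the values \<open>qv\<close> of the two far edges differ by at least this
    much, so they lie in different clusters at every finer scale.\<close>
  define d0 where "d0 = sqrt (en / real k)"
  have d0: "0 < d0" using en kr by (simp add: d0_def)
  define M where "M = 72 * real k + 6"
  have M: "1 < M" by (simp add: M_def)
  let ?A = "cross u E y"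
  obtain i where i: "i \<in> {1..k\<^sup>2 + 1}" and gap: "\<And>e e'. e \<in> ?A \<Longrightarrow> e' \<in> ?A \<Longrightarrow> norm (qv e - qv e') \<le> d0 / M ^ i \<or> d0 / M ^ (i - 1) < norm (qv e - qv e')"
    using scale_gap[OF finite_cross card_cross_le[OF ay] d0 M, where d="\<lambda>e e'. norm (qv e - qv e')"] by blast
  define r where "r = d0 / M ^ i"
  have r: "0 < r" using d0 M by (simp add: r_def)
  have Mr: "M * r = d0 / M ^ (i - 1)"
  proof -
    have "M ^ i = M * M ^ (i - 1)" using i by (cases i) auto
    then show ?thesis using M by (simp add: r_def)
  qed
  have "M ^ i \<le> W" unfolding W_def scale_bound_def M_def[symmetric] using i M by (intro power_increasing) auto
  then have "d0 / W \<le> r" unfolding r_def using d0 M W by (intro divide_left_mono) auto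
  then have "(d0 / W)\<^sup>2 \<le> r\<^sup>2" using d0 W by (intro power_mono) auto
  then have r2: "en / B \<le> r\<^sup>2" using en kr by (simp add: d0_def B_def power_divide)
  have near: "norm ((1 / (u \<bullet> dir e)) *\<^sub>R P (dir e) - qv e) \<le> r" if e: "e \<in> ?A" for e
  proof -
    let ?n = "\<lambda>e. (norm ((1 / (u \<bullet> dir e)) *\<^sub>R P (dir e) - qv e))\<^sup>2"
    have c: "1/2 \<le> u \<bullet> dir e" using slope_ge[OF e ay] dvn by linarith
    have m1: "1 \<le> real (m e)" using mult_pos[OF crossD[OF e]] by simp
    have "1 * (1/2 * ?n e) \<le> real (m e) * ((u \<bullet> dir e) * ?n e)"
      using c m1 by (intro mult_mono) auto
    also have "\<dots> \<le> (\<Sum>e\<in>?A. real (m e) * ((u \<bullet> dir e) * ?n e))"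
      using e slope_pos crossD by (intro member_le_sum mult_nonneg_nonneg) (auto simp: less_imp_le)
    also have "\<dots> \<le> \<Lambda>" using rad(3) by (simp add: \<Lambda>_def qv_def)
    finally have "?n e \<le> r\<^sup>2" using \<Lambda> r2 by simp
    then show ?thesis by (rule power2_le_imp_le) (use r in simp)
  qed
  have two: "\<exists>e1 e2. e1 \<in> ?A \<and> e2 \<in> ?A \<and> M * r < norm (qv e1 - qv e2)"
  proof -
    define R where "R = sqrt (J y)"
    have R: "J y = R\<^sup>2" "0 < R" using rad(2) by (auto simp: R_def)
    obtain \<theta> e1 e2 where th: "norm \<theta> = 1" and e12: "e1 \<in> ?A" "e2 \<in> ?A"
      and v1: "R / sqrt (real k) \<le> \<theta> \<bullet> P (pos u e1 y - ctr)" and v2: "\<theta> \<bullet> P (pos u e2 y - ctr) \<le> 0"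
      using far_edges[OF ay R] by blast
    have "d0 \<le> \<mu> * (R / sqrt (real k))"
    proof -
      have "en / real k \<le> \<mu>\<^sup>2 * R\<^sup>2 / real k" using enJ R kr by (intro divide_right_mono) auto
      then have "d0 \<le> sqrt (\<mu>\<^sup>2 * R\<^sup>2 / real k)" unfolding d0_def by (rule real_sqrt_le_mono)
      then show ?thesis using \<mu> R by (simp add: real_sqrt_divide real_sqrt_mult)
    qed
    also have "\<dots> \<le> \<mu> * (\<theta> \<bullet> P (pos u e1 y - ctr) - \<theta> \<bullet> P (pos u e2 y - ctr))"
      using v1 v2 \<mu> by (intro mult_left_mono) auto
    also have "\<dots> = \<theta> \<bullet> (qv e1 - qv e2)" by (simp add: qv_def inner_diff_right right_diff_distrib)
    also have "\<dots> \<le> norm (qv e1 - qv e2)" using norm_cauchy_schwarz[of \<theta> "qv e1 - qv e2"] th by simp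
    finally have "d0 \<le> norm (qv e1 - qv e2)" .
    moreover have "r < d0"
    proof -
      have "M ^ 1 \<le> M ^ i" using i M by (intro power_increasing) auto
      then have "1 < M ^ i" using M by simp
      then show ?thesis using d0 by (simp add: r_def divide_less_eq)
    qed
    ultimately have "\<not> norm (qv e1 - qv e2) \<le> r" by linarith
    then have "M * r < norm (qv e1 - qv e2)" using gap[OF e12, folded r_def, folded Mr] by blast
    then show ?thesis using e12 by blast
  qed
  then obtain e1 e2 where e12: "e1 \<in> ?A" "e2 \<in> ?A" "M * r < norm (qv e1 - qv e2)" by blast
  have "\<exists>E1 E2. s.splits y b E1 E2 \<and> cross u E1 y \<noteq> {} \<and> cross u E2 y \<noteq> {}"
  proof (rule s.cones_split[where \<mu>=\<mu> and r=r and z=ctr and ?e1.0=e1 and ?e2.0=e2])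
    fix e assume "e \<in> ?A"
    then show "norm ((1 / (u \<bullet> dir e)) *\<^sub>R perp s.f (dir e) - \<mu> *\<^sub>R perp s.f (pos u e y - ctr)) \<le> r"
      using near[of e] by (simp only: sf qv_def)
  next
    fix e e' assume "e \<in> ?A" "e' \<in> ?A"
    then show "norm (\<mu> *\<^sub>R perp s.f (pos u e y - ctr) - \<mu> *\<^sub>R perp s.f (pos u e' y - ctr)) \<le> r \<or>
        (72 * real k + 6) * r < norm (\<mu> *\<^sub>R perp s.f (pos u e y - ctr) - \<mu> *\<^sub>R perp s.f (pos u e' y - ctr))"
      using gap[of e e', folded r_def, folded Mr] by (simp only: sf qv_def M_def)
  next
    show "(72 * real k + 6) * r < norm (\<mu> *\<^sub>R perp s.f (pos u e1 y - ctr) - \<mu> *\<^sub>R perp s.f (pos u e2 y - ctr))"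
      using e12(3) by (simp only: sf qv_def M_def)
  qed (use r \<mu> e12 in auto)
  then show ?thesis using ay by (auto simp: splits_def s.splits_def)
qed

end

section \<open>Vertex heights, constants of the recursion and time reversal\<close>

definition vertex_times :: "'a::euclidean_space \<Rightarrow> 'a edge set \<Rightarrow> real set" where
  "vertex_times u E = (\<lambda>v. u \<bullet> v) ` (fst ` E \<union> snd ` E)"

lemma vertex_timesI: "e \<in> E \<Longrightarrow> u \<bullet> fst e \<in> vertex_times u E" "e \<in> E \<Longrightarrow> u \<bullet> snd e \<in> vertex_times u E"
  by (auto simp: vertex_times_def)

lemma sing_vertices_times: "v \<in> sing_vertices u E x y \<Longrightarrow> u \<bullet> v \<in> vertex_times u E"
  by (auto simp: sing_vertices_def vertex_times_def)

lemma sing_vertices_empty: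
  assumes "\<And>t. t \<in> vertex_times u E \<Longrightarrow> \<not> (x < t \<and> t \<le> y)"
  shows "sing_vertices u E x y = {}"
proof -
  have "v \<notin> sing_vertices u E x y" for v
    using assms[of "u \<bullet> v"] sing_vertices_times[of v u E x y] unfolding sing_vertices_def by blast
  then show ?thesis by blast
qed

lemma sing_vertices_split: "x \<le> y \<Longrightarrow> y \<le> z \<Longrightarrow> sing_vertices u E x z = sing_vertices u E x y \<union> sing_vertices u E y z"
  by (auto simp: sing_vertices_def)

lemma perp_uminus: "perp (- f) = perp f"
  by (auto simp: perp_def fun_eq_iff)

text \<open>A step lasts sqrt (J a) / (32 k^2 sqrt en). With W the scale bound, 256 k^3 W steps take
  a time s with en s^2 \<ge> 64 k^2 W^2 J a, which is enough for the hypothesis of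
  \<open>radial_splits\<close>.\<close>

definition forward_steps :: "nat \<Rightarrow> nat" where
  "forward_steps k = nat \<lceil>256 * (real k)^3 * scale_bound k\<rceil>"

text \<open>The type argument fixes the ambient space, which the numbers \<open>k\<close> and
  \<open>C\<close> do not determine.\<close>

definition count_bound :: "'a::euclidean_space itself \<Rightarrow> nat \<Rightarrow> nat \<Rightarrow> bool" where
  "count_bound _ k C \<longleftrightarrow> (\<forall>j<k. \<forall>(u::'a) E m a b. thin_net u E m a b j \<and> real j - flux u E m a \<bullet> u \<le> flux_defect j \<longrightarrow>
     card (sing_vertices u E a b) \<le> C)"

lemma count_boundD:
  "count_bound TYPE('a::euclidean_space) k C \<Longrightarrow> j < k \<Longrightarrow> thin_net (u::'a) E m a b j \<Longrightarrow>
     real j - flux u E m a \<bullet> u \<le> flux_defect j \<Longrightarrow> card (sing_vertices u E a b) \<le> C"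
  unfolding count_bound_def by blast

context net begin

lemma sum_weight_pos:
  assumes "S \<noteq> {}" "S \<subseteq> E" "\<And>e. e \<in> E \<Longrightarrow> 0 < w e"
  shows "0 < (\<Sum>e\<in>S. w e :: 'b::ordered_comm_monoid_add)"
  by (rule sum_pos[OF finite_subset[OF assms(2) fin] assms(1)]) (use assms in blast)

lemma finite_vertex_times: "finite (vertex_times u E)"
  using fin by (simp add: vertex_times_def)

lemma isolated_time: "\<exists>d>0. \<forall>c\<in>vertex_times u E. c \<noteq> t \<longrightarrow> d \<le> \<bar>t - c\<bar>"
  using finite_set_avoid[OF finite_vertex_times, of t] by (simp add: dist_real_def)

lemma card_sing_split:
  "x \<le> y \<Longrightarrow> y \<le> z \<Longrightarrow> card (sing_vertices u E x z) \<le> card (sing_vertices u E x y) + card (sing_vertices u E y z)"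
  using sing_vertices_split[of x y z u E] card_Un_le[of "sing_vertices u E x y" "sing_vertices u E y z"] by simp

lemma dir_swap: "dir (prod.swap e) = - dir e"
  by (cases e) (simp add: dir_def sgn_minus[symmetric])

lemma swap_filter:
  "{d \<in> prod.swap ` E. snd d = v} = prod.swap ` {d\<in>E. fst d = v}"
  "{d \<in> prod.swap ` E. fst d = v} = prod.swap ` {d\<in>E. snd d = v}"
  by (auto simp: image_iff)

lemma sum_swap: "(\<Sum>e\<in>prod.swap ` S. g e) = (\<Sum>e\<in>S. g (prod.swap e))"
  by (simp add: sum.reindex)

text \<open>Time is reversed by negating \<open>u\<close> and swapping the ends of all edges. The
  half-open range of the balance is mirrored: the reversed net needs it at heights in [x, y), which
  explains the strict inequality \<open>a < x\<close>.\<close>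

lemma rev_net:
  assumes "a < x" "x \<le> y" "y \<le> b"
  shows "net (- u) (prod.swap ` E) (m \<circ> prod.swap) (- y) (- x)"
proof unfold_locales
  show "norm (- u) = 1" "finite (prod.swap ` E)" "- y \<le> - x" using norm_u fin assms by auto
  show "- u \<bullet> fst e < - u \<bullet> snd e" if "e \<in> prod.swap ` E" for e using that up by auto
  show "1 \<le> (m \<circ> prod.swap) e" if "e \<in> prod.swap ` E" for e using that mult_pos by auto
  show "e = e'" if ee: "e \<in> prod.swap ` E" "e' \<in> prod.swap ` E" "fst e = fst e'" "dir e = dir e'" for e e'
  proof -
    obtain d d' where d: "d \<in> E" "d' \<in> E" "e = prod.swap d" "e' = prod.swap d'" using ee by blast
    then have "d = d'" using emb_snd[of d d'] ee by (simp add: dir_swap)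
    then show ?thesis using d by simp
  qed
  show "e = e'" if ee: "e \<in> prod.swap ` E" "e' \<in> prod.swap ` E" "snd e = snd e'" "dir e = dir e'" for e e'
  proof -
    obtain d d' where d: "d \<in> E" "d' \<in> E" "e = prod.swap d" "e' = prod.swap d'" using ee by blast
    then have "d = d'" using emb_fst[of d d'] ee by (simp add: dir_swap)
    then show ?thesis using d by simp
  qed
  fix v assume v: "- y < - u \<bullet> v" "- u \<bullet> v \<le> - x"
  then have "(\<Sum>e\<in>{e\<in>E. snd e = v}. real (m e) *\<^sub>R dir e) = (\<Sum>e\<in>{e\<in>E. fst e = v}. real (m e) *\<^sub>R dir e)"
    using assms by (intro balanced) auto
  then show "(\<Sum>e\<in>{e \<in> prod.swap ` E. snd e = v}. real ((m \<circ> prod.swap) e) *\<^sub>R dir e) = (\<Sum>e\<in>{e \<in> prod.swap ` E. fst e = v}. real ((m \<circ> prod.swap) e) *\<^sub>R dir e)"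
    unfolding swap_filter sum_swap by (simp add: dir_swap sum_negf)
qed

text \<open>Reversal exchanges which end of an edge counts as crossing, so the slice has to avoid
  all vertices.\<close>

lemma rev_cross:
  assumes "t \<notin> vertex_times u E"
  shows "cross (- u) (prod.swap ` E) (- t) = prod.swap ` cross u E t"
proof -
  have *: "t \<noteq> u \<bullet> fst e" "t \<noteq> u \<bullet> snd e" if "e \<in> E" for e using vertex_timesI[OF that] assms by blast+
  have "cross (- u) (prod.swap ` E) (- t) = prod.swap ` {e\<in>E. u \<bullet> fst e < t \<and> t \<le> u \<bullet> snd e}"
    by (auto simp: cross_def image_iff)
  also have "{e\<in>E. u \<bullet> fst e < t \<and> t \<le> u \<bullet> snd e} = cross u E t"
    unfolding cross_def using * by (intro Collect_cong) (metis order_le_less)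
  finally show ?thesis .
qed

lemma rev_flux: "t \<notin> vertex_times u E \<Longrightarrow> flux (- u) (prod.swap ` E) (m \<circ> prod.swap) (- t) = - flux u E m t"
  by (simp add: flux_def rev_cross sum_swap dir_swap sum_negf)

lemma rev_mult: "t \<notin> vertex_times u E \<Longrightarrow> crossing_mult (- u) (prod.swap ` E) (m \<circ> prod.swap) (- t) = crossing_mult u E m t"
  by (simp add: crossing_mult_def rev_cross sum_swap)

lemma rev_pos:
  assumes "e \<in> E" shows "pos (- u) (prod.swap e) (- t) = pos u e t"
proof -
  have "pos (- u) (prod.swap e) (- t) = snd e + ((t - u \<bullet> snd e) / (u \<bullet> dir e)) *\<^sub>R dir e"
  proof -
    define c q where "c = u \<bullet> dir e" and "q = u \<bullet> snd e"
    have "((- t + q) / c) *\<^sub>R (- dir e) = (- ((- t + q) / c)) *\<^sub>R dir e" by simp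
    also have "- ((- t + q) / c) = (t - q) / c" by (simp add: minus_divide_left)
    finally show ?thesis by (simp add: pos_def dir_swap c_def q_def)
  qed
  also have "\<dots> = pos u e t"
    using pos_diff[OF assms, of t "u \<bullet> snd e"] pos_snd[OF assms] by (simp add: algebra_simps)
  finally show ?thesis .
qed

text \<open>Vertices at height \<open>y\<close> fall out of the mirrored half-open range and are
  therefore listed separately.\<close>

lemma rev_sing:
  "x \<notin> vertex_times u E \<Longrightarrow> sing_vertices u E x y \<subseteq> {v. u \<bullet> v = y} \<union> sing_vertices (- u) (prod.swap ` E) (- y) (- x)"
proof
  fix v assume v: "v \<in> sing_vertices u E x y"
  show "v \<in> {v. u \<bullet> v = y} \<union> sing_vertices (- u) (prod.swap ` E) (- y) (- x)"
  proof (cases "u \<bullet> v = y")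
    case False
    have 1: "- y < - u \<bullet> v" "- u \<bullet> v \<le> - x" using v False by (auto simp: sing_vertices_def)
    have 2: "\<exists>e\<in>prod.swap ` E. fst e = v \<or> snd e = v" using v by (auto simp: sing_vertices_def)
    have 3: "\<not> (\<exists>e e'. prod.swap ` {d\<in>E. fst d = v} = {e} \<and> prod.swap ` {d\<in>E. snd d = v} = {e'} \<and> dir e = dir e')"
    proof
      assume "\<exists>e e'. prod.swap ` {d\<in>E. fst d = v} = {e} \<and> prod.swap ` {d\<in>E. snd d = v} = {e'} \<and> dir e = dir e'"
      then obtain e e' where e: "prod.swap ` {d\<in>E. fst d = v} = {e}" "prod.swap ` {d\<in>E. snd d = v} = {e'}" "dir e = dir e'" by blast
      have "prod.swap ` prod.swap ` {d\<in>E. fst d = v} = {prod.swap e}" "prod.swap ` prod.swap ` {d\<in>E. snd d = v} = {prod.swap e'}"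
        unfolding e by auto
      then have "{d\<in>E. snd d = v} = {prod.swap e'}" "{d\<in>E. fst d = v} = {prod.swap e}"
        by (simp_all add: image_image)
      moreover have "dir (prod.swap e') = dir (prod.swap e)" using e by (simp add: dir_swap)
      ultimately show False using v unfolding sing_vertices_def by blast
    qed
    have "v \<in> sing_vertices (- u) (prod.swap ` E) (- y) (- x)"
      unfolding sing_vertices_def swap_filter using 1 2 3 by simp
    then show ?thesis by simp
  qed simp
qed

end

section \<open>Induction on the multiplicity\<close>

context thin_net begin

text \<open>The parts have smaller multiplicities and at most the defect of the whole. As
  \<open>flux_defect\<close> is antitone, this defect is admissible for them, and the induction
  hypothesis applies to both.\<close>

lemma split_count:
  assumes C: "count_bound TYPE('a) k C"
    and small: "real k - flux u E m a \<bullet> u \<le> flux_defect k"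
    and s: "splits x y E1 E2"
    and ne: "cross u E1 x \<noteq> {} \<or> cross u E1 y \<noteq> {}" "cross u E2 x \<noteq> {} \<or> cross u E2 y \<noteq> {}"
  shows "card (sing_vertices u E x y) \<le> 2 * C"
proof -
  have xy: "a \<le> x" "x \<le> y" "y \<le> b" using s by (auto simp: splits_def)
  have N: "crossing_mult u E m x = k" "crossing_mult u E m y = k" using mult_const xy by auto
  obtain k1 k2 where k: "thin_net u E1 m x y k1" "thin_net u E2 m x y k2" "k1 < k" "k2 < k"
    "real k1 - flux u E1 m x \<bullet> u \<le> real k - flux u E m a \<bullet> u"
    "real k2 - flux u E2 m x \<bullet> u \<le> real k - flux u E m a \<bullet> u"
    by (rule splits_thin[OF s N ne])
  have "flux_defect k \<le> flux_defect k1" "flux_defect k \<le> flux_defect k2"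
    using thin_net.k1[OF k(1)] thin_net.k1[OF k(2)] k by (auto intro: flux_defect_antimono)
  then have "card (sing_vertices u E1 x y) \<le> C" "card (sing_vertices u E2 x y) \<le> C"
    using count_boundD[OF C k(3,1)] count_boundD[OF C k(4,2)] k(5,6) small by linarith+
  then show ?thesis using splits_card_sing[OF s] by linarith
qed

lemma short_count:
  assumes C: "count_bound TYPE('a) k C"
    and small: "real k - flux u E m a \<bullet> u \<le> flux_defect k"
    and xy: "a \<le> x" "x \<le> y" "y \<le> b"
    and short: "0 < max (sqrt (J x)) (sqrt (J y))" "(y - x) * sqrt en \<le> max (sqrt (J x)) (sqrt (J y)) / (32 * (real k)\<^sup>2)"
  shows "card (sing_vertices u E x y) \<le> 2 * C"
proof -
  have N: "crossing_mult u E m x = k" "crossing_mult u E m y = k" using mult_const xy by auto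
  obtain E1 E2 where s: "splits x y E1 E2"
    and ne: "cross u E1 x \<noteq> {} \<or> cross u E1 y \<noteq> {}" "cross u E2 x \<noteq> {} \<or> cross u E2 y \<noteq> {}"
    using split_exists[OF xy N short(1) refl short(2)] by blast
  show ?thesis by (rule split_count[OF C small s ne])
qed

text \<open>While \<open>G\<close> is nonnegative the spread does not decrease, so one step length,
  computed from the initial spread, serves for all steps. After \<open>forward_steps\<close> of them
  the motion is radial enough for a splitting on the whole remaining interval.\<close>

lemma forward_count:
  assumes C: "count_bound TYPE('a) k C"
    and small: "real k - flux u E m a \<bullet> u \<le> flux_defect k"
    and G: "0 \<le> G a" and en: "0 < en"
  shows "card (sing_vertices u E a b) \<le> (forward_steps k + 1) * (2 * C)"
proof -
  define W where "W = scale_bound k"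
  have W: "1 \<le> W" by (simp add: W_def scale_bound_ge_1)
  have kr: "1 \<le> real k" using k1 by simp
  define n where "n = forward_steps k"
  have n: "256 * (real k)^3 * W \<le> real n" unfolding n_def forward_steps_def W_def by linarith
  have "\<exists>s>0. card (sing_vertices u E a (min b (a + s))) \<le> n * (2 * C) \<and> J a \<le> 1 / (8 * real k * W\<^sup>2) * (en * s\<^sup>2)"
  proof (cases "J a = 0")
    case True
    \<comment> \<open>If all edges start from one point, the motion is radial at once. The time s is
      then chosen only so small that no vertex has its height in (a, a + s].\<close>
    obtain d where d: "0 < d" "\<And>c. c \<in> vertex_times u E \<Longrightarrow> c \<noteq> a \<Longrightarrow> d \<le> \<bar>a - c\<bar>" using isolated_time[of a] by blast
    have "sing_vertices u E a (min b (a + d/2)) = {}"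
    proof (rule sing_vertices_empty)
      fix t assume "t \<in> vertex_times u E"
      then show "\<not> (a < t \<and> t \<le> min b (a + d / 2))" using d(2)[of t] d(1) by auto
    qed
    then show ?thesis using d True en by (intro exI[of _ "d/2"]) (auto intro!: mult_nonneg_nonneg)
  next
    case False
    then have Ja: "0 < J a" using J_nonneg[of a] by simp
    define st where "st = sqrt (J a) / (32 * (real k)\<^sup>2) / sqrt en"
    have st: "0 < st" using Ja en kr by (simp add: st_def)
    have steps: "card (sing_vertices u E a (min b (a + real j * st))) \<le> j * (2 * C)" for j
    proof (induction j)
      case 0
      have "sing_vertices u E a (min b (a + real 0 * st)) = {}" by (auto simp: sing_vertices_def)
      then show ?case by simp
    next
      case (Suc j)
      define x y where "x = min b (a + real j * st)" and "y = min b (a + real (Suc j) * st)"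
      have jst: "0 \<le> real j * st" using st by simp
      have xy: "a \<le> x" "x \<le> y" "y \<le> b" using st jst ab by (auto simp: x_def y_def algebra_simps)
      have "J a \<le> J x" using J_mono[of a x] xy G by simp
      then have R: "sqrt (J a) \<le> max (sqrt (J x)) (sqrt (J y))" by (simp add: le_max_iff_disj)
      have "y - x \<le> st" using st by (auto simp: x_def y_def min_def algebra_simps)
      then have "(y - x) * sqrt en \<le> st * sqrt en" using en by (intro mult_right_mono) auto
      also have "\<dots> = sqrt (J a) / (32 * (real k)\<^sup>2)" using en by (simp add: st_def)
      also have "\<dots> \<le> max (sqrt (J x)) (sqrt (J y)) / (32 * (real k)\<^sup>2)" using R by (intro divide_right_mono) auto
      finally have "card (sing_vertices u E x y) \<le> 2 * C"
        using R Ja by (intro short_count[OF C small xy]) (auto intro: less_le_trans[of 0 "sqrt (J a)"])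
      then show ?case using card_sing_split[OF xy(1,2)] Suc.IH by (simp add: x_def y_def)
    qed
    define s where "s = real n * st"
    have n0: "0 < real n"
    proof -
      have "0 < 256 * (real k)^3 * W" using kr W by simp
      then show ?thesis using n by linarith
    qed
    have "8 * real k * W \<le> real n / (32 * (real k)\<^sup>2)"
      using n kr by (simp add: field_simps power2_eq_square power3_eq_cube)
    then have "(8 * real k * W)\<^sup>2 \<le> (real n / (32 * (real k)\<^sup>2))\<^sup>2" using kr W by (intro power_mono) auto
    moreover have "8 * real k * W\<^sup>2 \<le> (8 * real k * W)\<^sup>2"
    proof -
      have "8 * real k * W\<^sup>2 * 1 \<le> 8 * real k * W\<^sup>2 * (8 * real k)" using kr W by (intro mult_left_mono) auto
      then show ?thesis by (simp add: power2_eq_square mult_ac)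
    qed
    ultimately have ge: "8 * real k * W\<^sup>2 \<le> (real n / (32 * (real k)\<^sup>2))\<^sup>2" by linarith
    have "en * s\<^sup>2 = (real n / (32 * (real k)\<^sup>2))\<^sup>2 * J a"
      using en Ja by (simp add: s_def st_def power_mult_distrib power_divide)
    then have "(8 * real k * W\<^sup>2) * J a \<le> en * s\<^sup>2" using ge Ja by (simp add: mult_right_mono)
    then have "J a \<le> 1 / (8 * real k * W\<^sup>2) * (en * s\<^sup>2)" using kr W by (simp add: pos_le_divide_eq mult.commute)
    then show ?thesis using steps[of n] n0 st by (intro exI[of _ s]) (auto simp: s_def)
  qed
  then obtain s where s: "0 < s" "card (sing_vertices u E a (min b (a + s))) \<le> n * (2 * C)"
    "J a \<le> 1 / (8 * real k * W\<^sup>2) * (en * s\<^sup>2)" by blast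
  show ?thesis
  proof (cases "a + s \<le> b")
    case True
    have q: "J a \<le> 1 / (8 * real k * (scale_bound k)\<^sup>2) * (en * ((a + s) - a)\<^sup>2)" using s(3) by (simp add: W_def)
    obtain E1 E2 where sp: "splits (a + s) b E1 E2" and ne: "cross u E1 (a + s) \<noteq> {}" "cross u E2 (a + s) \<noteq> {}"
      using radial_splits[OF small _ _ True G en q] s by auto
    have "card (sing_vertices u E (a + s) b) \<le> 2 * C"
      by (rule split_count[OF C small sp]) (use ne in auto)
    then show ?thesis using card_sing_split[of a "a + s" b] s True by (simp add: n_def)
  next
    case False
    then show ?thesis using s by (simp add: n_def)
  qed
qed

text \<open>Without energy all edges run in direction \<open>f\<close>, so the embedding conditions
  allow at most one edge on each side of a vertex, and the flux balance excludes an edge on one side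
  only.\<close>

lemma sing_empty_if_parallel:
  assumes "en = 0"
  shows "sing_vertices u E a b = {}"
proof (rule ccontr)
  assume "sing_vertices u E a b \<noteq> {}"
  then obtain v where v: "v \<in> sing_vertices u E a b" by blast
  then have vt: "a < u \<bullet> v" "u \<bullet> v \<le> b" by (auto simp: sing_vertices_def)
  have par: "dir e = f" if e: "e \<in> E" "fst e = v \<or> snd e = v" for e
  proof -
    have "e \<in> meeting u E a b" using e vt up[OF e(1)] by (auto simp: meeting_def)
    then have "1 \<le> dir e \<bullet> f" using dir_f_ge[of e "max (u \<bullet> fst e) a"] meeting_cross[of e a b] ab assms by auto
    then have "(norm (dir e - f))\<^sup>2 \<le> 0"
      using dir_inner_dir[OF e(1)] norm_f
      by (simp add: power2_norm_eq_inner inner_diff_left inner_diff_right inner_commute norm_eq_1)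
    then show ?thesis by simp
  qed
  let ?I = "{e\<in>E. snd e = v}" and ?O = "{e\<in>E. fst e = v}"
  have fl: "(\<Sum>e\<in>?I. real (m e) * (u \<bullet> dir e)) = (\<Sum>e\<in>?O. real (m e) * (u \<bullet> dir e))"
    using arg_cong[OF balanced[OF vt], of "\<lambda>z. u \<bullet> z"] by (simp add: inner_sum_right)
  have w: "0 < real (m e) * (u \<bullet> dir e)" if "e \<in> E" for e
    using mult_pos[OF that] slope_pos[OF that] by simp
  have pos: "0 < (\<Sum>e\<in>S. real (m e) * (u \<bullet> dir e))" if "S \<noteq> {}" "S \<subseteq> E" for S
    by (rule sum_weight_pos[OF that w])
  obtain e where "e \<in> E" "fst e = v \<or> snd e = v" using v by (auto simp: sing_vertices_def)
  then have "?I \<noteq> {} \<or> ?O \<noteq> {}" by blast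
  moreover have "?I = {} \<Longrightarrow> ?O = {}" using pos[of ?O] fl by (metis (no_types, lifting) less_irrefl mem_Collect_eq subsetI sum.empty)
  moreover have "?O = {} \<Longrightarrow> ?I = {}" using pos[of ?I] fl by (metis (no_types, lifting) less_irrefl mem_Collect_eq subsetI sum.empty)
  ultimately have ne: "?I \<noteq> {}" "?O \<noteq> {}" by blast+
  obtain e where eI: "e \<in> ?I" using ne(1) by (rule ex_in_conv[THEN iffD2, THEN exE])
  obtain e' where eO: "e' \<in> ?O" using ne(2) by (rule ex_in_conv[THEN iffD2, THEN exE])
  have e: "e \<in> E" "snd e = v" "e' \<in> E" "fst e' = v" using eI eO by auto
  have "d = e" if "d \<in> ?I" for d using emb_snd[of d e] par[of d] par[of e] that e by simp
  then have "?I = {e}" using eI by blast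
  moreover have "d = e'" if "d \<in> ?O" for d using emb_fst[of d e'] par[of d] par[of e'] that e by simp
  then have "?O = {e'}" using eO by blast
  moreover have "dir e = dir e'" using par e by simp
  ultimately show False using v unfolding sing_vertices_def by blast
qed

lemma rev_thin:
  assumes xy: "a < x" "x \<le> y" "y \<le> b" and gen: "x \<notin> vertex_times u E" "y \<notin> vertex_times u E"
  shows "thin_net (- u) (prod.swap ` E) (m \<circ> prod.swap) (- y) (- x) k"
proof -
  interpret r: net "- u" "prod.swap ` E" "m \<circ> prod.swap" "- y" "- x" by (rule rev_net[OF xy])
  show ?thesis
    using mult_const[of x] mult_const[of y] xy gen k1 dev flux_const[of y]
    by unfold_locales (auto simp: rev_mult rev_flux)
qed

text \<open>The growth bounds make \<open>G\<close> Lipschitz. If it changes sign it has a zero, the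
  time of smallest spread.\<close>

lemma G_continuous: "continuous_on {a..b} G"
proof -
  define Lc where "Lc = (2 + 4 * dvn) * en"
  have L: "0 \<le> Lc" using dvn en_nonneg by (simp add: Lc_def)
  have "dist (G x) (G y) \<le> Lc * dist x y" if "x \<in> {a..b}" "y \<in> {a..b}" for x y
  proof -
    have *: "\<bar>G y - G x\<bar> \<le> Lc * (y - x)" if "a \<le> x" "x \<le> y" "y \<le> b" for x y
      using G_growth(2)[OF that] G_mono[OF that] by (simp add: Lc_def algebra_simps)
    show ?thesis
    proof (cases "x \<le> y")
      case True then show ?thesis using *[of x y] that by (simp add: dist_real_def abs_minus_commute)
    next
      case False then show ?thesis using *[of y x] that by (simp add: dist_real_def)
    qed
  qed
  then have "Lc-lipschitz_on {a..b} G" using L by (intro lipschitz_onI) auto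
  then show ?thesis by (rule lipschitz_on_continuous_on)
qed

text \<open>Spread 0 puts all edges of the slice at one point, and by conservation of multiplicity
  every vertex at this height has an outgoing edge in the slice.\<close>

lemma instant_count:
  assumes t: "a < t" "t \<le> b" and J0: "J t = 0"
  shows "card {v \<in> sing_vertices u E a b. u \<bullet> v = t} \<le> 1"
proof -
  have tt: "a \<le> t" "t \<le> b" using t by auto
  have "v = w" if v: "v \<in> sing_vertices u E a b" "u \<bullet> v = t" and w: "w \<in> sing_vertices u E a b" "u \<bullet> w = t" for v w
  proof -
    have *: "P (v - ctr) = 0" if v: "v \<in> sing_vertices u E a b" "u \<bullet> v = t" for v
    proof -
      let ?I = "{e\<in>E. snd e = v}" and ?O = "{e\<in>E. fst e = v}"
      have vm: "(\<Sum>e\<in>?I. m e) = (\<Sum>e\<in>?O. m e)" using t v by (intro vertex_mult) auto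
      have w: "0 < m e" if "e \<in> E" for e using mult_pos[OF that] by simp
      have pos: "0 < (\<Sum>e\<in>S. m e)" if "S \<noteq> {}" "S \<subseteq> E" for S
        by (rule sum_weight_pos[OF that w])
      obtain e where "e \<in> E" "fst e = v \<or> snd e = v" using v by (auto simp: sing_vertices_def)
      then have "?I \<noteq> {} \<or> ?O \<noteq> {}" by blast
      moreover have "?O = {} \<Longrightarrow> ?I = {}" using pos[of ?I] vm by (metis (no_types, lifting) less_irrefl mem_Collect_eq subsetI sum.empty)
      ultimately have "?O \<noteq> {}" by blast
      then obtain e where e: "e \<in> E" "fst e = v" by blast
      then have ec: "e \<in> cross u E t" using up[OF e(1)] v by (auto simp: cross_def)
      have "0 \<le> real (m e') * ((u \<bullet> dir e') * (norm (P (pos u e' t - ctr)))\<^sup>2)" if "e' \<in> cross u E t" for e'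
        using slope_pos[OF crossD[OF that]] by simp
      then have "real (m e) * ((u \<bullet> dir e) * (norm (P (pos u e t - ctr)))\<^sup>2) = 0"
        using J0 ec unfolding J_def by (subst (asm) sum_nonneg_eq_0_iff) auto
      then have "P (pos u e t - ctr) = 0" using mult_pos[OF e(1)] slope_pos[OF e(1)] by simp
      moreover have "pos u e t = v" using pos_fst[of e] e v by simp
      ultimately show ?thesis by simp
    qed
    have "P (v - w) = 0" using *[OF v] *[OF w] perp_diff[of f "v - ctr" "w - ctr"] by simp
    moreover have "(v - w) \<bullet> u = 0" using v w unfolding inner_commute[of _ u] by (simp add: inner_diff_right)
    ultimately show "v = w" using norm_le_perp[of "v - w"] by simp
  qed
  then have "\<exists>w. {v \<in> sing_vertices u E a b. u \<bullet> v = t} \<subseteq> {w}" by blast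
  then show ?thesis by (metis card.empty card_insert_disjoint card_mono empty_iff finite.emptyI finite.insertI One_nat_def)
qed

text \<open>The time \<open>t0\<close> of smallest spread divides the interval: the forward estimate
  applies after it and, with time reversed, before it. A short piece just before \<open>t0\<close>
  is cut off so that the reversal can start at a time free of vertices.\<close>

lemma total_count:
  assumes C: "count_bound TYPE('a) k C"
    and small: "real k - flux u E m a \<bullet> u \<le> flux_defect k"
  shows "card (sing_vertices u E a b) \<le> 2 * ((forward_steps k + 1) * (2 * C)) + (2 * C + 1)"
proof -
  let ?F = "(forward_steps k + 1) * (2 * C)"
  have "en = 0 \<or> (0 < en \<and> (0 \<le> G a \<or> a = b)) \<or> (0 < en \<and> G a < 0 \<and> a < b)" using en_nonneg ab by linarith
  then consider "en = 0" | "a = b" | "0 < en" "0 \<le> G a" | "0 < en" "G a < 0" "a < b" by blast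
  then show ?thesis
  proof cases
    case 1
    then show ?thesis using sing_empty_if_parallel by simp
  next
    case 2
    then have "sing_vertices u E a b = {}" by (auto simp: sing_vertices_def)
    then show ?thesis by simp
  next
    case 3
    then show ?thesis using forward_count[OF C small] by simp
  next
    case 4
    have strict: "G x < G y" if "a \<le> x" "x < y" "y \<le> b" for x y
    proof -
      have "0 < (2 - dvn) * (en * (y - x))" using that 4 dvn by (intro mult_pos_pos) auto
      then show ?thesis using G_growth(1)[of x y] that by simp
    qed
    \<comment> \<open>If \<open>G\<close> stays negative, \<open>t0\<close> is the right end and the
      last piece is empty.\<close>
    obtain t0 where t0: "a < t0" "t0 \<le> b" "G t0 \<le> 0" "t0 = b \<or> G t0 = 0"
    proof (cases "G b < 0")
      case True
      then show ?thesis using that[of b] 4 by simp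
    next
      case False
      then obtain t where "a \<le> t" "t \<le> b" "G t = 0"
        using IVT'[of G a 0 b] 4 ab G_continuous by auto
      then show ?thesis using that[of t] 4 by (cases "t = a") auto
    qed
    obtain d1 where d1: "0 < d1" "\<And>c. c \<in> vertex_times u E \<Longrightarrow> c \<noteq> a \<Longrightarrow> d1 \<le> \<bar>a - c\<bar>"
      using isolated_time[of a] by blast
    obtain d0 where d0: "0 < d0" "\<And>c. c \<in> vertex_times u E \<Longrightarrow> c \<noteq> t0 \<Longrightarrow> d0 \<le> \<bar>t0 - c\<bar>"
      using isolated_time[of t0] by blast
    \<comment> \<open>So close to \<open>a\<close> that (a, x] contains no vertex height; reversal
      needs a start beyond \<open>a\<close> and away from vertices.\<close>
    define x where "x = a + min d1 (t0 - a) / 4"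
    have x: "a < x" "x < a + d1" "x < a + (t0 - a) / 2" using d1(1) t0(1) by (auto simp: x_def min_def field_simps)
    \<comment> \<open>The duration on which the network is separated because of its spread at
      \<open>t0\<close>. If the spread is 0 the value 1 is a dummy, and \<open>instant_count\<close>
      takes care of the piece.\<close>
    define sh where "sh = (if J t0 = 0 then 1 else sqrt (J t0) / (32 * (real k)\<^sup>2) / sqrt en)"
    have sh: "0 < sh" using J_nonneg[of t0] 4 k1 by (auto simp: sh_def)
    define \<delta> where "\<delta> = min sh (min d0 (t0 - a)) / 2"
    have \<delta>: "0 < \<delta>" "\<delta> \<le> sh" "\<delta> < d0" "\<delta> \<le> (t0 - a) / 2" using sh d0(1) t0(1) by (auto simp: \<delta>_def min_def)
    define t where "t = t0 - \<delta>"
    have t: "x < t" "t < t0" using x \<delta> by (auto simp: t_def field_simps)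
    have gx: "x \<notin> vertex_times u E" using d1(2)[of x] x by auto
    have gt: "t \<notin> vertex_times u E" using d0(2)[of t] \<delta> t by (auto simp: t_def)
    have "sing_vertices u E a x = {}"
    proof (rule sing_vertices_empty)
      fix c assume "c \<in> vertex_times u E"
      then show "\<not> (a < c \<and> c \<le> x)" using d1(2)[of c] x by auto
    qed
    then have S1: "card (sing_vertices u E a x) = 0" by simp
    have S2: "card (sing_vertices u E x t) \<le> ?F"
    proof -
      have xt: "x \<le> t" "t \<le> b" "a \<le> t" using x t t0 by auto
      let ?u = "- u" and ?E = "prod.swap ` E" and ?m = "m \<circ> prod.swap"
      interpret r: thin_net ?u ?E ?m "- t" "- x" k by (rule rev_thin[OF x(1) xt(1,2) gx gt])
      have fl: "flux ?u ?E ?m (- t) = - flux u E m a" using rev_flux[OF gt] flux_const[of t] xt by simp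
      have rf: "r.f = - f" by (simp add: r.f_def f_def fl sgn_minus)
      have ren: "r.en = en" by (simp add: r.en_def en_def fl)
      have "r.G (- t) = - G t"
        unfolding r.G_def G_def rev_cross[OF gt] sum_swap rf perp_uminus sum_negf[symmetric]
        by (intro sum.cong refl) (simp add: dir_swap rev_pos[OF crossD])
      then have rG: "0 \<le> r.G (- t)" using strict[of t t0] xt t t0 by simp
      have "card (sing_vertices ?u ?E (- t) (- x)) \<le> ?F"
        using small 4 by (intro r.forward_count[OF C] rG) (auto simp: fl ren)
      moreover have "sing_vertices u E x t \<subseteq> sing_vertices ?u ?E (- t) (- x)"
        using rev_sing[OF gx, of t] sing_vertices_times[of _ u E x t] gt by blast
      ultimately show ?thesis using card_mono[OF r.finite_sing] by (meson order_trans)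
    qed
    have S3: "card (sing_vertices u E t t0) \<le> 2 * C + 1"
    proof (cases "J t0 = 0")
      case True
      have "sing_vertices u E t t0 \<subseteq> {v \<in> sing_vertices u E a b. u \<bullet> v = t0}"
      proof
        fix v assume v: "v \<in> sing_vertices u E t t0"
        then have "u \<bullet> v = t0" using d0(2)[of "u \<bullet> v"] sing_vertices_times[OF v] \<delta> by (auto simp: sing_vertices_def t_def)
        then show "v \<in> {v \<in> sing_vertices u E a b. u \<bullet> v = t0}" using v x t t0 by (auto simp: sing_vertices_def)
      qed
      moreover have "finite {v \<in> sing_vertices u E a b. u \<bullet> v = t0}" using finite_sing by simp
      ultimately have "card (sing_vertices u E t t0) \<le> 1"
        using instant_count[OF t0(1,2) True] card_mono by (meson order_trans)
      then show ?thesis by simp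
    next
      case False
      then have Jt: "0 < J t0" using J_nonneg[of t0] by simp
      have "(t0 - t) * sqrt en \<le> sh * sqrt en" using \<delta> 4 by (intro mult_right_mono) (auto simp: t_def)
      also have "\<dots> = sqrt (J t0) / (32 * (real k)\<^sup>2)" using False 4 by (simp add: sh_def)
      also have "\<dots> \<le> max (sqrt (J t)) (sqrt (J t0)) / (32 * (real k)\<^sup>2)" by (intro divide_right_mono) auto
      finally have "card (sing_vertices u E t t0) \<le> 2 * C"
        using x t t0 Jt by (intro short_count[OF C small]) (auto simp: less_max_iff_disj)
      then show ?thesis by simp
    qed
    have S4: "card (sing_vertices u E t0 b) \<le> ?F"
    proof (cases "t0 = b")
      case True
      then have "sing_vertices u E t0 b = {}" by (auto simp: sing_vertices_def)
      then show ?thesis by simp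
    next
      case False
      have at: "a \<le> t0" using t0 by simp
      interpret s: thin_net u E m t0 b k using thin_sub[of t0 b] t0 at by simp
      have fl: "flux u E m t0 = flux u E m a" by (rule flux_const[OF at t0(2)])
      have "s.f = f" by (simp add: s.f_def f_def fl)
      then have "s.G t0 = G t0" by (simp add: s.G_def G_def)
      moreover have "s.en = en" by (simp add: s.en_def en_def fl)
      ultimately show ?thesis using small 4 False t0 by (intro s.forward_count[OF C]) (auto simp: fl)
    qed
    have "card (sing_vertices u E a b) \<le> card (sing_vertices u E a x) + card (sing_vertices u E x b)"
      using x t t0 by (intro card_sing_split) auto
    also have "card (sing_vertices u E x b) \<le> card (sing_vertices u E x t) + card (sing_vertices u E t b)"
      using x t t0 by (intro card_sing_split) auto
    also have "card (sing_vertices u E t b) \<le> card (sing_vertices u E t t0) + card (sing_vertices u E t0 b)"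
      using x t t0 by (intro card_sing_split) auto
    finally show ?thesis using S1 S2 S3 S4 by linarith
  qed
qed

end

theorem thin_net_count:
  "\<exists>C. \<forall>(u::'a::euclidean_space) E m a b. thin_net u E m a b k \<and> real k - flux u E m a \<bullet> u \<le> flux_defect k \<longrightarrow>
     card (sing_vertices u E a b) \<le> C"
proof -
  have "\<exists>C. count_bound TYPE('a) (Suc k) C"
  proof (induction k)
    case 0
    \<comment> \<open>Multiplicity 0 does not occur in a thin net, so the induction starts with
      nothing to count.\<close>
    have "\<not> thin_net u E m a b 0" for u :: 'a and E m a b using thin_net.k1[of u E m a b 0] by auto
    then have "count_bound TYPE('a) (Suc 0) 0" by (simp add: count_bound_def)
    then show ?case ..
  next
    case (Suc k)
    then obtain C where C: "count_bound TYPE('a) (Suc k) C" by blast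
    define D where "D = 2 * ((forward_steps (Suc k) + 1) * (2 * C)) + (2 * C + 1)"
    have main: "card (sing_vertices u E a b) \<le> D"
      if j: "j < Suc (Suc k)" and net: "thin_net u E m a b j" and small: "real j - flux u E m a \<bullet> u \<le> flux_defect j" for j and u :: 'a and E m a b
    proof (cases "j = Suc k")
      case True
      show ?thesis unfolding D_def using thin_net.total_count[OF net _ small, of C] C True by blast
    next
      case False
      then have "card (sing_vertices u E a b) \<le> C" using count_boundD[OF C _ net small] j by simp
      also have "C \<le> D" by (simp add: D_def)
      finally show ?thesis .
    qed
    have "count_bound TYPE('a) (Suc (Suc k)) D"
      unfolding count_bound_def by (intro allI impI, elim conjE) (rule main)
    then show ?case ..
  qed
  then obtain C where C: "count_bound TYPE('a) (Suc k) C" ..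
  show ?thesis by (intro exI[of _ C] allI impI, elim conjE) (rule count_boundD[OF C lessI])
qed

section \<open>Local structure of geodesic networks\<close>

text \<open>A cover of \<open>A\<close> is mapped to sets of real numbers of no larger diameter. The
  intervals between their infima and suprema cover [\<alpha>, \<beta>], and Lebesgue measure is
  subadditive.\<close>

lemma hausdorff1_outer_ge_lipschitz_image:
  fixes A :: "'a::metric_space set" and g :: "'a \<Rightarrow> real"
  assumes lip: "\<And>x y. x \<in> A \<Longrightarrow> y \<in> A \<Longrightarrow> \<bar>g x - g y\<bar> \<le> dist x y" and sub: "{\<alpha>..\<beta>} \<subseteq> g ` A"
  shows "ennreal (\<beta> - \<alpha>) \<le> hausdorff1_outer A"
proof -
  have "ennreal (\<beta> - \<alpha>) \<le> hausdorff1_pre 1 A"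
    unfolding hausdorff1_pre_def
  proof (rule INF_greatest, safe)
    fix C :: "nat \<Rightarrow> 'a set"
    assume cov: "A \<subseteq> (\<Union>i. C i)" and C: "\<forall>i. bounded (C i) \<and> diameter (C i) \<le> 1"
    define S where "S i = g ` (C i \<inter> A)" for i
    define I where "I i = (if S i = {} then {} else {Inf (S i)..Sup (S i)})" for i
    have dS: "s \<le> s' + diameter (C i)" if "s \<in> S i" "s' \<in> S i" for s s' i
    proof -
      obtain x y where xy: "x \<in> C i" "x \<in> A" "y \<in> C i" "y \<in> A" "s = g x" "s' = g y" using \<open>s \<in> S i\<close> \<open>s' \<in> S i\<close> by (auto simp: S_def)
      then have "\<bar>g x - g y\<bar> \<le> dist x y" by (intro lip)
      also have "\<dots> \<le> diameter (C i)" using C xy by (intro diameter_bounded_bound) auto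
      finally show ?thesis using xy by linarith
    qed
    have bdd: "bdd_above (S i)" "bdd_below (S i)" if "S i \<noteq> {}" for i
    proof -
      obtain s where s: "s \<in> S i" using \<open>S i \<noteq> {}\<close> by blast
      show "bdd_above (S i)" by (rule bdd_aboveI[of _ "s + diameter (C i)"]) (use dS s in blast)
      show "bdd_below (S i)" by (rule bdd_belowI[of _ "s - diameter (C i)"]) (use dS[OF s] in force)
    qed
    have em: "emeasure lborel (I i) \<le> ennreal (diameter (C i))" for i
    proof (cases "S i = {}")
      case False
      have "x - diameter (C i) \<le> Inf (S i)" if "x \<in> S i" for x
        using False dS[OF that] by (intro cInf_greatest) (auto simp: algebra_simps)
      then have "Sup (S i) \<le> Inf (S i) + diameter (C i)"
        using False by (intro cSup_least) (auto simp: algebra_simps)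
      moreover have "Inf (S i) \<le> Sup (S i)"
        using False bdd[OF False] by (meson cInf_le_cSup)
      ultimately show ?thesis using False by (simp add: I_def ennreal_leI)
    qed (simp add: I_def)
    have sub': "{\<alpha>..\<beta>} \<subseteq> (\<Union>i. I i)"
    proof
      fix t assume "t \<in> {\<alpha>..\<beta>}"
      then obtain x where x: "x \<in> A" "t = g x" using sub by blast
      then obtain i where "x \<in> C i" using cov by blast
      then have t: "t \<in> S i" using x by (auto simp: S_def)
      then have "S i \<noteq> {}" by blast
      then have "t \<in> I i" using t bdd[of i] by (auto simp: I_def intro: cInf_lower cSup_upper)
      then show "t \<in> (\<Union>i. I i)" by blast
    qed
    have "ennreal (\<beta> - \<alpha>) \<le> emeasure lborel {\<alpha>..\<beta>}"
      by (cases "\<alpha> \<le> \<beta>") (auto simp: ennreal_neg)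
    also have "\<dots> \<le> emeasure lborel (\<Union>i. I i)" by (rule emeasure_mono[OF sub']) (auto simp: I_def)
    also have "\<dots> \<le> (\<Sum>i. emeasure lborel (I i))" by (rule emeasure_subadditive_countably) (auto simp: I_def)
    also have "\<dots> \<le> (\<Sum>i. ennreal (diameter (C i)))" by (intro suminf_le em) auto
    finally show "ennreal (\<beta> - \<alpha>) \<le> (\<Sum>i. ennreal (diameter (C i)))" .
  qed
  also have "\<dots> \<le> hausdorff1_outer A" by (rule hausdorff1_pre_le_outer) simp
  finally show ?thesis .
qed

lemma hausdorff1_outer_segment_le:
  fixes p q :: "'a::euclidean_space"
  shows "hausdorff1_outer (closed_segment p q) \<le> ennreal (dist p q)"
  unfolding hausdorff1_outer_def
proof (rule SUP_least)
  fix \<delta> :: real assume "\<delta> \<in> {0<..}"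
  then have \<delta>: "0 < \<delta>" by simp
  obtain n :: nat where n: "dist p q / \<delta> < real n" using reals_Archimedean2 by blast
  have n0: "0 < n" using n \<delta> by (cases n) (auto simp: divide_less_0_iff dest: not_less_iff_gr_or_eq[THEN iffD1])
  define h where "h = dist p q / real n"
  have h: "0 \<le> h" "h \<le> \<delta>" using n n0 \<delta> by (auto simp: h_def field_simps)
  define \<gamma> where "\<gamma> s = (1 - s) *\<^sub>R p + s *\<^sub>R q" for s
  define C where "C i = (if i < n then \<gamma> ` {real i / real n..(real i + 1) / real n} else {})" for i
  have d\<gamma>: "dist (\<gamma> s) (\<gamma> t) = \<bar>s - t\<bar> * dist p q" for s t
  proof -
    have "\<gamma> s - \<gamma> t = (s - t) *\<^sub>R (q - p)" by (simp add: \<gamma>_def algebra_simps)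
    then show ?thesis by (simp add: dist_norm norm_minus_commute)
  qed
  have dC: "dist x y \<le> h" if xy: "x \<in> C i" "y \<in> C i" for x y i
  proof -
    obtain s t where st: "x = \<gamma> s" "y = \<gamma> t" "s \<in> {real i / real n..(real i + 1) / real n}" "t \<in> {real i / real n..(real i + 1) / real n}"
      using xy by (auto simp: C_def split: if_splits)
    have "\<bar>s - t\<bar> \<le> (real i + 1) / real n - real i / real n" using st by auto
    also have "\<dots> = 1 / real n" by (simp add: diff_divide_distrib[symmetric])
    finally show ?thesis unfolding st d\<gamma> h_def using mult_right_mono[of "\<bar>s - t\<bar>" "1 / real n" "dist p q"] by simp
  qed
  have diam: "diameter (C i) \<le> h" for i using dC h by (intro diameter_le) (auto simp: dist_norm)
  have bdd: "bounded (C i)" for i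
    using dC[of _ i] by (metis bounded_any_center bounded_empty equals0I)
  have cover: "closed_segment p q \<subseteq> (\<Union>i. C i)"
  proof
    fix x assume "x \<in> closed_segment p q"
    then obtain s where s: "0 \<le> s" "s \<le> 1" "x = \<gamma> s" by (auto simp: closed_segment_def \<gamma>_def)
    show "x \<in> (\<Union>i. C i)"
    proof (cases "s = 1")
      case True
      \<comment> \<open>For s = 1 the floor used in the other case would be n, whereas this point
        belongs to the last piece, number n - 1.\<close>
      then have "s \<in> {real (n - 1) / real n..(real (n - 1) + 1) / real n}" using n0 by (simp add: of_nat_diff field_simps)
      then have "x \<in> C (n - 1)" using s n0 by (simp add: C_def)
      then show ?thesis by blast
    next
      case False
      define i where "i = nat \<lfloor>s * real n\<rfloor>"
      have sn: "0 \<le> s * real n" "s * real n < real n" using s False n0 by auto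
      have i: "real i \<le> s * real n" "s * real n < real i + 1" using sn unfolding i_def by linarith+
      then have "i < n" using sn by linarith
      moreover have "s \<in> {real i / real n..(real i + 1) / real n}" using i n0 by (simp add: field_simps)
      ultimately have "x \<in> C i" using s by (simp add: C_def)
      then show ?thesis by blast
    qed
  qed
  have "hausdorff1_pre \<delta> (closed_segment p q) \<le> (\<Sum>i. ennreal (diameter (C i)))"
    using cover bdd diam h by (intro hausdorff1_pre_le) (auto intro: order_trans)
  also have "\<dots> = (\<Sum>i<n. ennreal (diameter (C i)))"
    by (intro suminf_finite) (auto simp: C_def)
  also have "\<dots> \<le> (\<Sum>i<n. ennreal h)" using diam by (intro sum_mono ennreal_leI)
  also have "\<dots> = ennreal (real n * h)" using h by (simp add: ennreal_mult' ennreal_of_nat_eq_real_of_nat)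
  also have "real n * h = dist p q" using n0 by (simp add: h_def)
  finally show "hausdorff1_pre \<delta> (closed_segment p q) \<le> ennreal (dist p q)" .
qed

text \<open>The lower bound comes from the distance to \<open>p\<close>, a 1-Lipschitz function
  which by connectedness takes all values up to the length of the segment.\<close>

lemma emeasure_hausdorff1_closed_segment:
  fixes p q :: "'a::euclidean_space"
  shows "emeasure hausdorff1 (closed_segment p q) = ennreal (dist p q)"
proof -
  have conn: "connected (dist p ` closed_segment p q)"
    by (intro connected_continuous_image continuous_intros) auto
  have "dist p p \<in> dist p ` closed_segment p q" "dist p q \<in> dist p ` closed_segment p q" by blast+
  then have "{0..dist p q} \<subseteq> dist p ` closed_segment p q"
    using connected_contains_Icc[OF conn, of 0 "dist p q"] by simp
  moreover have "\<bar>dist p x - dist p y\<bar> \<le> dist x y" for x y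
    using abs_dist_diff_le[of x p y] by (simp add: dist_commute)
  ultimately have "ennreal (dist p q - 0) \<le> hausdorff1_outer (closed_segment p q)"
    by (intro hausdorff1_outer_ge_lipschitz_image[where g="dist p"])
  then show ?thesis
    using hausdorff1_outer_segment_le[of p q] by (simp add: emeasure_hausdorff1 antisym)
qed

lemma hausdorff1_null_singleton [simp]: "{x::'a::euclidean_space} \<in> null_sets hausdorff1"
  using emeasure_hausdorff1_closed_segment[of x x] by (simp add: null_sets_def)

lemma hausdorff1_null_countable: "countable A \<Longrightarrow> (A::'a::euclidean_space set) \<in> null_sets hausdorff1"
  using null_sets_UN'[of A "\<lambda>x. {x}" hausdorff1] by simp

definition line_at :: "'a::euclidean_space set \<Rightarrow> 'a \<Rightarrow> 'a \<Rightarrow> real \<Rightarrow> bool" where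
  "line_at X x s r \<longleftrightarrow> norm s = 1 \<and> 0 < r \<and> X \<inter> ball x r = (\<lambda>t. x + t *\<^sub>R s) ` {-r<..<r}"

text \<open>The normal form of a network near a point: finitely many rays. In contrast to a graph it
  involves no choice of edges, and its set of directions is unique by
  \<open>cone_at_directions\<close>.\<close>

definition cone_at :: "'a::euclidean_space set \<Rightarrow> 'a \<Rightarrow> real \<Rightarrow> 'a set \<Rightarrow> bool" where
  "cone_at X x r D \<longleftrightarrow> 0 < r \<and> finite D \<and> D \<noteq> {} \<and> (\<forall>s\<in>D. norm s = 1) \<and>
     X \<inter> ball x r = {x + t *\<^sub>R s | s t. s \<in> D \<and> 0 \<le> t \<and> t < r}"

lemma ray_closed_segment:
  fixes x c :: "'a::euclidean_space"
  assumes "c \<noteq> x" "r \<le> dist x c"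
  shows "closed_segment x c \<inter> ball x r = {x + t *\<^sub>R sgn (c - x) | t. 0 \<le> t \<and> t < r}"
proof -
  define d where "d = dist x c"
  have d: "0 < d" using assms by (simp add: d_def)
  have sg: "sgn (c - x) = (1 / d) *\<^sub>R (c - x)" by (simp add: sgn_div_norm d_def dist_norm norm_minus_commute divide_inverse)
  have dist: "dist x (x + t *\<^sub>R sgn (c - x)) = t" if "0 \<le> t" for t
    using that assms by (simp add: dist_norm norm_sgn)
  show ?thesis
  proof (intro set_eqI iffI)
    fix y assume y: "y \<in> closed_segment x c \<inter> ball x r"
    then obtain w where w: "0 \<le> w" "w \<le> 1" "y = (1 - w) *\<^sub>R x + w *\<^sub>R c" by (auto simp: closed_segment_def)
    have y2: "y = x + (w * d) *\<^sub>R sgn (c - x)" using d by (simp add: w sg algebra_simps)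
    have "w * d < r" using y dist[of "w * d"] w d by (simp add: y2)
    then show "y \<in> {x + t *\<^sub>R sgn (c - x) | t. 0 \<le> t \<and> t < r}" using y2 w d by auto
  next
    fix y assume "y \<in> {x + t *\<^sub>R sgn (c - x) | t. 0 \<le> t \<and> t < r}"
    then obtain t where t: "0 \<le> t" "t < r" "y = x + t *\<^sub>R sgn (c - x)" by blast
    have "t / d \<le> 1" using t assms d by (simp add: d_def)
    moreover have "y = (1 - t / d) *\<^sub>R x + (t / d) *\<^sub>R c" by (simp add: t sg algebra_simps)
    ultimately show "y \<in> closed_segment x c \<inter> ball x r"
      using t d dist[of t] by (auto simp: closed_segment_def)
  qed
qed

text \<open>The radius stays below the distance to all edges that miss \<open>x\<close> and to all
  end points other than \<open>x\<close>. An edge with \<open>x\<close> in its interior contributes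
  two rays, one towards each end.\<close>

lemma geodesic_network_cone:
  fixes X :: "'a::euclidean_space set"
  assumes "geodesic_network X" "x \<in> X"
  obtains r D where "cone_at X x r D"
proof -
  obtain U E where U: "open U" "x \<in> U" and E: "straight_graph E" and XU: "X \<inter> U = (\<Union>(a, b)\<in>E. closed_segment a b) \<inter> U"
    using assms unfolding geodesic_network_def by blast
  have fin: "finite E" and nd: "\<And>a b. (a, b) \<in> E \<Longrightarrow> a \<noteq> b" using E by (auto simp: straight_graph_def)
  define S where "S = {c. \<exists>a b. (a, b) \<in> E \<and> x \<in> closed_segment a b \<and> (c = a \<or> c = b) \<and> c \<noteq> x}"
  define D where "D = (\<lambda>c. sgn (c - x)) ` S"
  have "S \<subseteq> fst ` E \<union> snd ` E" by (force simp: S_def)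
  then have finS: "finite S" using fin by (meson finite_UnI finite_imageI finite_subset)
  have "x \<in> (\<Union>(a, b)\<in>E. closed_segment a b)" using XU assms U by blast
  then obtain a b where ab: "(a, b) \<in> E" "x \<in> closed_segment a b" by blast
  have "a \<noteq> x \<Longrightarrow> a \<in> S" "b \<noteq> x \<Longrightarrow> b \<in> S" unfolding S_def using ab by blast+
  then have Sne: "S \<noteq> {}" using nd[OF ab(1)] by blast
  define F where "F = (\<Union>(a, b)\<in>{(a, b)\<in>E. x \<notin> closed_segment a b}. closed_segment a b)"
  have "finite {(a, b)\<in>E. x \<notin> closed_segment a b}" using fin by (rule rev_finite_subset) auto
  then have "closed F" unfolding F_def by (intro closed_UN) auto
  then have "open (U - F)" "x \<in> U - F" using U by (auto simp: F_def)
  then obtain r0 where r0: "0 < r0" "ball x r0 \<subseteq> U - F" using open_contains_ball by blast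
  obtain d where d: "0 < d" "\<And>c. c \<in> S \<Longrightarrow> c \<noteq> x \<Longrightarrow> d \<le> dist x c" using finite_set_avoid[OF finS, of x] by blast
  define r where "r = min r0 d"
  have r: "0 < r" "r \<le> r0" "r \<le> d" using r0 d by (auto simp: r_def)
  have sub: "ball x r \<subseteq> U - F" using r0(2) subset_ball[OF r(2), of x] by blast
  have Sx: "c \<noteq> x" "r \<le> dist x c" if "c \<in> S" for c
  proof -
    show c: "c \<noteq> x" using that by (auto simp: S_def)
    then show "r \<le> dist x c" using d(2)[OF that] r by simp
  qed
  have "X \<inter> ball x r = (\<Union>c\<in>S. closed_segment x c) \<inter> ball x r"
  proof (intro set_eqI iffI)
    fix y assume y: "y \<in> X \<inter> ball x r"
    then have "y \<in> U" "y \<notin> F" using sub by blast+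
    then obtain a b where ab: "(a, b) \<in> E" "y \<in> closed_segment a b" using XU y by blast
    then have xab: "x \<in> closed_segment a b" using \<open>y \<notin> F\<close> by (auto simp: F_def)
    then have "y \<in> closed_segment a x \<or> y \<in> closed_segment x b" using ab Un_closed_segment[OF xab] by blast
    then have "\<exists>c. (c = a \<or> c = b) \<and> y \<in> closed_segment x c" by (metis closed_segment_commute)
    then obtain c where c: "c = a \<or> c = b" "y \<in> closed_segment x c" by blast
    show "y \<in> (\<Union>c\<in>S. closed_segment x c) \<inter> ball x r"
    proof (cases "c = x")
      case True
      then have "y = x" using c by simp
      then show ?thesis using Sne r by auto
    next
      case False
      then have "c \<in> S" using ab xab c by (auto simp: S_def)
      then show ?thesis using c y by blast
    qed
  next
    fix y assume y: "y \<in> (\<Union>c\<in>S. closed_segment x c) \<inter> ball x r"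
    then obtain c a b where c: "y \<in> closed_segment x c" "(a, b) \<in> E" "x \<in> closed_segment a b" "c = a \<or> c = b"
      by (auto simp: S_def)
    have "closed_segment x c \<subseteq> closed_segment a b" using c by (intro closed_segment_subset) auto
    then have "y \<in> (\<Union>(a, b)\<in>E. closed_segment a b)" using c by blast
    moreover have "y \<in> U" using y sub by blast
    ultimately show "y \<in> X \<inter> ball x r" using XU y by blast
  qed
  also have "\<dots> = (\<Union>c\<in>S. closed_segment x c \<inter> ball x r)" by blast
  also have "\<dots> = (\<Union>c\<in>S. {x + t *\<^sub>R sgn (c - x) | t. 0 \<le> t \<and> t < r})"
    using ray_closed_segment Sx by (intro SUP_cong refl) blast
  also have "\<dots> = {x + t *\<^sub>R s | s t. s \<in> D \<and> 0 \<le> t \<and> t < r}" by (auto simp: D_def)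
  finally have "cone_at X x r D"
    unfolding cone_at_def using r finS Sne Sx by (auto simp: D_def norm_sgn)
  then show ?thesis by (rule that)
qed

lemma cone_at_ray: "cone_at X x r D \<Longrightarrow> s \<in> D \<Longrightarrow> 0 \<le> t \<Longrightarrow> t < r \<Longrightarrow> x + t *\<^sub>R s \<in> X"
proof -
  assume c: "cone_at X x r D" and s: "s \<in> D" "0 \<le> t" "t < r"
  then have "x + t *\<^sub>R s \<in> X \<inter> ball x r" unfolding cone_at_def by blast
  then show ?thesis by simp
qed

lemma cone_at_directions:
  assumes c: "cone_at X x r D" shows "directions X x = D"
proof (intro set_eqI iffI)
  fix s assume "s \<in> D"
  then show "s \<in> directions X x"
    using cone_at_ray[OF c, of s] c unfolding directions_def cone_at_def
    by (auto simp: eventually_at_right_field intro!: exI[of _ r])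
next
  fix s assume "s \<in> directions X x"
  then obtain b where n: "norm s = 1" and b: "0 < b" "\<And>t. 0 < t \<Longrightarrow> t < b \<Longrightarrow> x + t *\<^sub>R s \<in> X"
    by (auto simp: directions_def eventually_at_right_field)
  have r: "0 < r" using c by (simp add: cone_at_def)
  define t where "t = min b r / 2"
  have t: "0 < t" "t < b" "t < r" using b r by (auto simp: t_def)
  have "x + t *\<^sub>R s \<in> X \<inter> ball x r" using b(2) t n by (simp add: dist_norm)
  then obtain s' t' where s': "s' \<in> D" "0 \<le> t'" "x + t *\<^sub>R s = x + t' *\<^sub>R s'" using c unfolding cone_at_def by blast
  then have eq: "t *\<^sub>R s = t' *\<^sub>R s'" by simp
  have "norm s' = 1" using s' c by (simp add: cone_at_def)
  then have "t = t'" using arg_cong[OF eq, of norm] n t s' by simp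
  then have "s = s'" using eq t by simp
  then show "s \<in> D" using s' by simp
qed

lemma geodesic_network_finite_directions:
  assumes "geodesic_network X" "x \<in> X"
  shows "finite (directions X x)" "directions X x \<noteq> {}" "s \<in> directions X x \<Longrightarrow> norm s = 1"
    "\<exists>r. cone_at X x r (directions X x)"
proof -
  obtain r D where c: "cone_at X x r D" by (rule geodesic_network_cone[OF assms])
  have D: "directions X x = D" by (rule cone_at_directions[OF c])
  show "finite (directions X x)" "directions X x \<noteq> {}" "s \<in> directions X x \<Longrightarrow> norm s = 1"
    "\<exists>r. cone_at X x r (directions X x)" using c unfolding D by (auto simp: cone_at_def)
qed

lemma line_at_cone: "line_at X x s r \<longleftrightarrow> cone_at X x r {s, -s}"
proof -
  have "(\<lambda>t. x + t *\<^sub>R s) ` {-r<..<r} = {x + t *\<^sub>R s' | s' t. s' \<in> {s, -s} \<and> 0 \<le> t \<and> t < r}" if r: "0 < r"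
  proof (intro set_eqI iffI)
    fix y assume "y \<in> (\<lambda>t. x + t *\<^sub>R s) ` {-r<..<r}"
    then obtain t where t: "- r < t" "t < r" "y = x + t *\<^sub>R s" by auto
    then have "y = x + \<bar>t\<bar> *\<^sub>R (if 0 \<le> t then s else - s)" "\<bar>t\<bar> < r" by auto
    moreover have "(if 0 \<le> t then s else - s) \<in> {s, -s}" "0 \<le> \<bar>t\<bar>" by auto
    ultimately show "y \<in> {x + t *\<^sub>R s' | s' t. s' \<in> {s, -s} \<and> 0 \<le> t \<and> t < r}" by blast
  next
    fix y assume "y \<in> {x + t *\<^sub>R s' | s' t. s' \<in> {s, -s} \<and> 0 \<le> t \<and> t < r}"
    then obtain s' t where *: "s' \<in> {s, -s}" "0 \<le> t" "t < r" "y = x + t *\<^sub>R s'" by blast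
    then have "y = x + (if s' = s then t else - t) *\<^sub>R s" by auto
    moreover have "(if s' = s then t else - t) \<in> {-r<..<r}" using * by auto
    ultimately show "y \<in> (\<lambda>t. x + t *\<^sub>R s) ` {-r<..<r}" by blast
  qed
  note eq = this
  show ?thesis
  proof (cases "0 < r")
    case True
    define S where "S = {x + t *\<^sub>R s' | s' t. s' \<in> {s, -s} \<and> 0 \<le> t \<and> t < r}"
    show ?thesis unfolding line_at_def cone_at_def eq[OF True] S_def[symmetric] by auto
  qed (simp add: line_at_def cone_at_def)
qed

lemma line_at_directions: "line_at X x s r \<Longrightarrow> directions X x = {s, -s}"
  using cone_at_directions by (simp add: line_at_cone)

lemma line_at_shift:
  assumes l: "line_at X x s r" and t: "\<bar>t\<bar> < r"
  shows "line_at X (x + t *\<^sub>R s) s (r - \<bar>t\<bar>)"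
proof -
  have n: "norm s = 1" using l by (simp add: line_at_def)
  let ?y = "x + t *\<^sub>R s"
  have X: "X \<inter> ball x r = (\<lambda>t. x + t *\<^sub>R s) ` {-r<..<r}" using l by (simp add: line_at_def)
  have sub: "ball ?y (r - \<bar>t\<bar>) \<subseteq> ball x r"
  proof
    fix z assume "z \<in> ball ?y (r - \<bar>t\<bar>)"
    moreover have "dist x z \<le> dist x ?y + dist ?y z" by (rule dist_triangle)
    moreover have "dist x ?y = \<bar>t\<bar>" using n by (simp add: dist_norm)
    ultimately show "z \<in> ball x r" by simp
  qed
  have "X \<inter> ball ?y (r - \<bar>t\<bar>) = (\<lambda>\<tau>. ?y + \<tau> *\<^sub>R s) ` {-(r - \<bar>t\<bar>)<..<r - \<bar>t\<bar>}"
  proof (intro set_eqI iffI)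
    fix z assume z: "z \<in> X \<inter> ball ?y (r - \<bar>t\<bar>)"
    then have "z \<in> X \<inter> ball x r" using sub by blast
    then obtain t' where "z = x + t' *\<^sub>R s" using X by blast
    then have zz: "z = ?y + (t' - t) *\<^sub>R s" by (simp add: algebra_simps)
    then have "\<bar>t' - t\<bar> < r - \<bar>t\<bar>" using z n by (simp add: dist_norm)
    then have "t' - t \<in> {-(r - \<bar>t\<bar>)<..<r - \<bar>t\<bar>}" by auto
    then show "z \<in> (\<lambda>\<tau>. ?y + \<tau> *\<^sub>R s) ` {-(r - \<bar>t\<bar>)<..<r - \<bar>t\<bar>}" using zz by blast
  next
    fix z assume "z \<in> (\<lambda>\<tau>. ?y + \<tau> *\<^sub>R s) ` {-(r - \<bar>t\<bar>)<..<r - \<bar>t\<bar>}"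
    then obtain \<tau> where \<tau>0: "\<tau> \<in> {-(r - \<bar>t\<bar>)<..<r - \<bar>t\<bar>}" "z = ?y + \<tau> *\<^sub>R s" by blast
    then have \<tau>: "\<bar>\<tau>\<bar> < r - \<bar>t\<bar>" "z = ?y + \<tau> *\<^sub>R s" by auto
    have zb: "z \<in> ball ?y (r - \<bar>t\<bar>)" using \<tau> n by (simp add: dist_norm)
    have "z = x + (t + \<tau>) *\<^sub>R s" "t + \<tau> \<in> {-r<..<r}" using \<tau> by (auto simp: algebra_simps)
    then have "z \<in> X \<inter> ball x r" unfolding X by blast
    then show "z \<in> X \<inter> ball ?y (r - \<bar>t\<bar>)" using zb by blast
  qed
  then show ?thesis using n t by (simp add: line_at_def)
qed

text \<open>Within a radius below the distances to both ends an open segment is a pair of opposite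
  rays, that is, a cone over \<open>s\<close> and \<open>- s\<close>.\<close>

lemma reg_iff_line_at: "x \<in> reg_points X \<longleftrightarrow> (\<exists>s r. line_at X x s r)"
proof
  assume "x \<in> reg_points X"
  then have "x \<in> X \<and> (\<exists>U a b. open U \<and> x \<in> U \<and> x \<in> open_segment a b \<and> X \<inter> U = open_segment a b \<inter> U)"
    unfolding reg_points_def by (rule CollectD)
  then obtain U a b where U: "x \<in> X" "open U" "x \<in> U" "x \<in> open_segment a b" "X \<inter> U = open_segment a b \<inter> U"
    by (elim conjE exE) (rule that)
  have nab: "a \<noteq> b" "x \<noteq> a" "x \<noteq> b" using U(4) by (auto simp: open_segment_def)
  obtain w where w: "0 < w" "w < 1" "x = (1 - w) *\<^sub>R a + w *\<^sub>R b" using U(4) by (auto simp: in_segment)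
  obtain r0 where r0: "0 < r0" "ball x r0 \<subseteq> U" using U(2,3) open_contains_ball by blast
  define r where "r = min r0 (min (dist x a) (dist x b))"
  have r: "0 < r" "r \<le> r0" "r \<le> dist x a" "r \<le> dist x b" using r0 nab by (auto simp: r_def)
  define s where "s = sgn (b - x)"
  have bx: "b - x = (1 - w) *\<^sub>R (b - a)" and ax: "a - x = (- w) *\<^sub>R (b - a)" by (simp_all add: w algebra_simps)
  have "s = sgn (b - a)" unfolding s_def bx sgn_scaleR using w by simp
  moreover have "sgn (a - x) = - sgn (b - a)" unfolding ax sgn_scaleR using w by simp
  ultimately have sa: "sgn (a - x) = - s" by simp
  have xab: "x \<in> closed_segment a b" using U(4) by (simp add: open_segment_def)
  have "X \<inter> ball x r = (X \<inter> U) \<inter> ball x r" using r0 r by auto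
  also have "\<dots> = open_segment a b \<inter> ball x r" using U(5) r0 r by auto
  also have "\<dots> = closed_segment a b \<inter> ball x r" using r by (auto simp: open_segment_def)
  also have "\<dots> = (closed_segment x a \<inter> ball x r) \<union> (closed_segment x b \<inter> ball x r)"
    using Un_closed_segment[OF xab] by (auto simp: closed_segment_commute)
  also have "\<dots> = {x + t *\<^sub>R s' | s' t. s' \<in> {s, -s} \<and> 0 \<le> t \<and> t < r}"
    unfolding ray_closed_segment[OF nab(2)[symmetric] r(3)] ray_closed_segment[OF nab(3)[symmetric] r(4)] sa s_def[symmetric] by blast
  finally have "cone_at X x r {s, -s}" using r nab by (auto simp: cone_at_def s_def norm_sgn)
  then show "\<exists>s r. line_at X x s r" by (auto simp: line_at_cone)
next
  assume "\<exists>s r. line_at X x s r"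
  then obtain s r where l: "line_at X x s r" by blast
  then have n: "norm s = 1" and r: "0 < r" and X: "X \<inter> ball x r = (\<lambda>t. x + t *\<^sub>R s) ` {-r<..<r}" by (auto simp: line_at_def)
  have ne: "x - r *\<^sub>R s \<noteq> x + r *\<^sub>R s"
  proof
    assume "x - r *\<^sub>R s = x + r *\<^sub>R s"
    then have "(2 * r) *\<^sub>R s = 0" by (simp add: algebra_simps scaleR_2[symmetric])
    then show False using n r by auto
  qed
  have param: "(1 - w) *\<^sub>R (x - r *\<^sub>R s) + w *\<^sub>R (x + r *\<^sub>R s) = x + (w * (2 * r) - r) *\<^sub>R s" for w
  proof -
    have "w * (2 * r) = w * r + w * r" by simp
    then have "(w * (2 * r) - r) *\<^sub>R s = (w * r) *\<^sub>R s + (w * r) *\<^sub>R s - r *\<^sub>R s"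
      by (simp only: scaleR_left_diff_distrib scaleR_left_distrib)
    then show ?thesis by (simp add: algebra_simps)
  qed
  have "(\<lambda>t. x + t *\<^sub>R s) ` {-r<..<r} = open_segment (x - r *\<^sub>R s) (x + r *\<^sub>R s)"
  proof (intro set_eqI iffI)
    fix y assume "y \<in> (\<lambda>t. x + t *\<^sub>R s) ` {-r<..<r}"
    then obtain t where t: "- r < t" "t < r" "y = x + t *\<^sub>R s" by auto
    define w where "w = (t + r) / (2 * r)"
    have w: "0 < w" "w < 1" "w * (2 * r) = t + r" using t r by (auto simp: w_def field_simps)
    have "y = (1 - w) *\<^sub>R (x - r *\<^sub>R s) + w *\<^sub>R (x + r *\<^sub>R s)" using w t by (simp only: param) simp
    then show "y \<in> open_segment (x - r *\<^sub>R s) (x + r *\<^sub>R s)" using w ne by (auto simp: in_segment)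
  next
    fix y assume "y \<in> open_segment (x - r *\<^sub>R s) (x + r *\<^sub>R s)"
    then obtain w where w: "0 < w" "w < 1" "y = (1 - w) *\<^sub>R (x - r *\<^sub>R s) + w *\<^sub>R (x + r *\<^sub>R s)" by (auto simp: in_segment)
    have "y = x + (w * (2 * r) - r) *\<^sub>R s" unfolding w by (rule param)
    moreover have "w * (2 * r) - r \<in> {-r<..<r}" using w r by auto
    ultimately show "y \<in> (\<lambda>t. x + t *\<^sub>R s) ` {-r<..<r}" by blast
  qed
  moreover have "open_segment (x - r *\<^sub>R s) (x + r *\<^sub>R s) \<subseteq> ball x r" using X calculation by blast
  moreover have "x \<in> (\<lambda>t. x + t *\<^sub>R s) ` {-r<..<r}" using r by (auto intro!: image_eqI[of _ _ 0])
  ultimately show "x \<in> reg_points X"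
    unfolding reg_points_def using X r by (intro CollectI conjI exI[of _ "ball x r"] exI[of _ "x - r *\<^sub>R s"] exI[of _ "x + r *\<^sub>R s"]) auto
qed

text \<open>The apex and the other rays form a closed set that misses the point, so a small ball
  around it sees a single ray.\<close>

lemma cone_at_ray_line:
  assumes c: "cone_at X x r D" and s: "s \<in> D" and t: "0 < t" "t < r"
  shows "\<exists>r'. line_at X (x + t *\<^sub>R s) s r'"
proof -
  define F where "F = insert x (\<Union>s'\<in>D - {s}. closed_segment x (x + r *\<^sub>R s'))"
  have D: "finite D" "\<And>s. s \<in> D \<Longrightarrow> norm s = 1" and X: "X \<inter> ball x r = {x + t *\<^sub>R s | s t. s \<in> D \<and> 0 \<le> t \<and> t < r}"
    using c by (auto simp: cone_at_def)
  let ?y = "x + t *\<^sub>R s"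
  have n: "norm s = 1" by (rule D(2)[OF s])
  have "closed F" unfolding F_def using D by (intro closed_insert closed_UN) auto
  moreover have "?y \<notin> F"
  proof
    assume "?y \<in> F"
    moreover have "?y \<noteq> x" using t n by auto
    ultimately obtain s' where s': "s' \<in> D" "s' \<noteq> s" "?y \<in> closed_segment x (x + r *\<^sub>R s')" by (auto simp: F_def)
    then obtain w where w: "0 \<le> w" "w \<le> 1" "?y = (1 - w) *\<^sub>R x + w *\<^sub>R (x + r *\<^sub>R s')" by (auto simp: in_segment)
    then have eq: "t *\<^sub>R s = (w * r) *\<^sub>R s'" by (simp add: algebra_simps)
    have "t = norm (t *\<^sub>R s)" using n t by simp
    also have "\<dots> = norm ((w * r) *\<^sub>R s')" by (simp only: eq)
    also have "\<dots> = w * r" using D(2)[OF s'(1)] t w by simp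
    finally have "t = w * r" .
    then show False using eq t s' by simp
  qed
  moreover have "?y \<in> ball x r" using t n by (simp add: dist_norm)
  ultimately have "open (ball x r - F)" "?y \<in> ball x r - F" by auto
  then obtain r' where r': "0 < r'" "ball ?y r' \<subseteq> ball x r - F" using open_contains_ball by blast
  have r't: "r' \<le> t"
  proof (rule ccontr)
    assume "\<not> r' \<le> t"
    then have "x \<in> ball ?y r'" using n t by (simp add: dist_norm)
    then show False using r' by (auto simp: F_def)
  qed
  have "X \<inter> ball ?y r' = (\<lambda>\<tau>. ?y + \<tau> *\<^sub>R s) ` {-r'<..<r'}"
  proof (intro set_eqI iffI)
    fix z assume z: "z \<in> X \<inter> ball ?y r'"
    then have "z \<in> X \<inter> ball x r" "z \<notin> F" using r' by auto
    then obtain s' t' where s': "s' \<in> D" "0 \<le> t'" "t' < r" "z = x + t' *\<^sub>R s'" using X by blast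
    have "s' = s"
    proof (rule ccontr)
      assume "s' \<noteq> s"
      moreover have "z = (1 - t' / r) *\<^sub>R x + (t' / r) *\<^sub>R (x + r *\<^sub>R s')" using s' by (simp add: algebra_simps)
      then have "z \<in> closed_segment x (x + r *\<^sub>R s')" using s' by (auto simp: in_segment intro!: exI[of _ "t' / r"])
      ultimately show False using s' \<open>z \<notin> F\<close> by (auto simp: F_def)
    qed
    then have zz: "z = ?y + (t' - t) *\<^sub>R s" using s' by (simp add: algebra_simps)
    then have "\<bar>t' - t\<bar> < r'" using z n by (simp add: dist_norm)
    then have "t' - t \<in> {-r'<..<r'}" by auto
    then show "z \<in> (\<lambda>\<tau>. ?y + \<tau> *\<^sub>R s) ` {-r'<..<r'}" using zz by blast
  next
    fix z assume "z \<in> (\<lambda>\<tau>. ?y + \<tau> *\<^sub>R s) ` {-r'<..<r'}"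
    then obtain \<tau> where \<tau>: "- r' < \<tau>" "\<tau> < r'" "z = ?y + \<tau> *\<^sub>R s" by auto
    have zz: "z = x + (t + \<tau>) *\<^sub>R s" using \<tau> by (simp add: algebra_simps)
    have zb: "z \<in> ball ?y r'" using \<tau> n by (simp add: dist_norm)
    then have "z \<in> ball x r" using r' by blast
    then have "\<bar>t + \<tau>\<bar> < r" using n by (simp add: zz dist_norm)
    moreover have "0 \<le> t + \<tau>" using \<tau> r't by simp
    ultimately have "z \<in> X \<inter> ball x r" unfolding X using zz s by auto
    then show "z \<in> X \<inter> ball ?y r'" using zb by blast
  qed
  then show ?thesis using n r' by (auto simp: line_at_def)
qed

lemma mult_constant_on_connected:
  assumes "network_with_mult X \<Theta>" "connected S" "S \<subseteq> reg_points X" "x \<in> S" "y \<in> S"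
  shows "\<Theta> x = \<Theta> y"
proof (rule connected_local_const[OF assms(2,4,5)], intro ballI)
  fix a assume a: "a \<in> S"
  then obtain U where U: "open U" "a \<in> U" "\<Theta> constant_on (U \<inter> reg_points X)"
    using assms unfolding network_with_mult_def by blast
  have "\<Theta> a = \<Theta> b" if "b \<in> U" "b \<in> S" for b
    using U a that assms(3) unfolding constant_on_def by (metis IntI subsetD)
  then show "\<forall>\<^sub>F b in at a within S. \<Theta> a = \<Theta> b"
    unfolding eventually_at_topological using U by blast
qed

text \<open>The open segment is connected and regular, so \<Theta> is constant along it. As the
  filter at 0 from the right is not trivial, the definite description in \<open>edge_mult\<close>
  can only denote this constant.\<close>

lemma edge_mult_eq:
  assumes N: "network_with_mult X \<Theta>" and reg: "\<And>t. 0 < t \<Longrightarrow> t < l \<Longrightarrow> x + t *\<^sub>R s \<in> reg_points X" and t: "0 < t" "t < l"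
  shows "edge_mult \<Theta> x s = \<Theta> (x + t *\<^sub>R s)"
proof -
  have "connected ((\<lambda>t. x + t *\<^sub>R s) ` {0<..<l})"
    by (intro connected_continuous_image continuous_intros) auto
  then have c: "\<Theta> (x + t' *\<^sub>R s) = \<Theta> (x + t *\<^sub>R s)" if "0 < t'" "t' < l" for t'
    using reg that t by (intro mult_constant_on_connected[OF N]) auto
  show ?thesis
    unfolding edge_mult_def
  proof (rule the_equality)
    show ev: "\<forall>\<^sub>F t' in at_right 0. \<Theta> (x + t' *\<^sub>R s) = \<Theta> (x + t *\<^sub>R s)"
      unfolding eventually_at_right_field
      by (rule exI[of _ l], intro conjI allI impI c) (use t in simp)
    fix m assume "\<forall>\<^sub>F t in at_right 0. \<Theta> (x + t *\<^sub>R s) = m"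
    with ev have "\<forall>\<^sub>F t' in at_right (0::real). m = \<Theta> (x + t *\<^sub>R s)" by eventually_elim simp
    then show "m = \<Theta> (x + t *\<^sub>R s)" by (simp add: eventually_const_iff)
  qed
qed

lemma reg_points_subset: "reg_points X \<subseteq> X"
  by (auto simp: reg_points_def)

lemma cone_at_edge_mult:
  assumes N: "network_with_mult X \<Theta>" and c: "cone_at X x r D" "s \<in> D" "0 < t" "t < r"
  shows "edge_mult \<Theta> x s = \<Theta> (x + t *\<^sub>R s)" "x + t *\<^sub>R s \<in> reg_points X"
proof -
  have reg: "x + t *\<^sub>R s \<in> reg_points X" if "0 < t" "t < r" for t
    using cone_at_ray_line[OF c(1,2) that] by (auto simp: reg_iff_line_at)
  show "edge_mult \<Theta> x s = \<Theta> (x + t *\<^sub>R s)" by (rule edge_mult_eq[OF N reg c(3,4)])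
  show "x + t *\<^sub>R s \<in> reg_points X" by (rule reg[OF c(3,4)])
qed

lemma edge_mult_pos:
  assumes N: "network_with_mult X \<Theta>" and x: "x \<in> X" and s: "s \<in> directions X x"
  shows "0 < edge_mult \<Theta> x s"
proof -
  obtain r where c: "cone_at X x r (directions X x)"
    using geodesic_network_finite_directions(4)[of X x] N x by (auto simp: network_with_mult_def)
  then have r: "0 < r" by (simp add: cone_at_def)
  show ?thesis using cone_at_edge_mult[OF N c s, of "r/2"] r N by (auto simp: network_with_mult_def)
qed

lemma line_at_mult:
  assumes N: "network_with_mult X \<Theta>" and l: "line_at X x s r"
  shows "edge_mult \<Theta> x s = \<Theta> x" "edge_mult \<Theta> x (- s) = \<Theta> x"
proof -
  have r: "0 < r" using l by (simp add: line_at_def)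
  have reg: "x + t *\<^sub>R s \<in> reg_points X" if "\<bar>t\<bar> < r" for t
    using line_at_shift[OF l that] by (auto simp: reg_iff_line_at)
  have "connected ((\<lambda>t. x + t *\<^sub>R s) ` {-r<..<r})"
    by (intro connected_continuous_image continuous_intros) auto
  note conn = this
  have mem: "x + t *\<^sub>R s \<in> (\<lambda>t. x + t *\<^sub>R s) ` {-r<..<r}" if "\<bar>t\<bar> < r" for t
    using that by (intro image_eqI[of _ _ t]) auto
  have c: "\<Theta> (x + t *\<^sub>R s) = \<Theta> (x + 0 *\<^sub>R s)" if "\<bar>t\<bar> < r" for t
    by (rule mult_constant_on_connected[OF N conn _ mem[OF that] mem]) (use reg r in auto)
  have cone: "cone_at X x r {s, -s}" using l by (simp add: line_at_cone)
  show "edge_mult \<Theta> x s = \<Theta> x"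
    using cone_at_edge_mult(1)[OF N cone, of s "r/2"] c[of "r/2"] r by simp
  show "edge_mult \<Theta> x (- s) = \<Theta> x"
    using cone_at_edge_mult(1)[OF N cone, of "- s" "r/2"] c[of "-(r/2)"] r by simp
qed

text \<open>At a regular point the two opposite directions carry the same multiplicity and cancel,
  so the balance holds at regular and singular points alike.\<close>

lemma stationary_balance:
  assumes "stationary_network X \<Theta>" "x \<in> X"
  shows "(\<Sum>s\<in>directions X x. edge_mult \<Theta> x s *\<^sub>R s) = 0"
proof (cases "x \<in> reg_points X")
  case True
  have N: "network_with_mult X \<Theta>" using assms by (simp add: stationary_network_def)
  obtain s r where l: "line_at X x s r" using True reg_iff_line_at by blast
  have "norm s = 1" using l by (simp add: line_at_def)
  have "s \<noteq> - s"
  proof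
    assume "s = - s"
    then have "s + s = 0" by (metis add.right_inverse)
    then have "(2::real) *\<^sub>R s = 0" by (simp only: scaleR_2)
    then show False using \<open>norm s = 1\<close> by simp
  qed
  then show ?thesis unfolding line_at_directions[OF l] using line_at_mult[OF N l] by simp
next
  case False
  then show ?thesis using assms by (auto simp: stationary_network_def sing_points_def)
qed

text \<open>A maximum of the strictly convex distance function would violate the balance of directions.\<close>

lemma stationary_network_reaches_sphere:
  fixes X :: "'a::euclidean_space set"
  assumes st: "stationary_network X \<Theta>" and x: "x \<in> X" and \<rho>: "0 \<le> \<rho>"
  shows "\<exists>y\<in>X. dist x y = \<rho>"
proof (rule ccontr)
  assume no: "\<not> ?thesis"
  have N: "network_with_mult X \<Theta>" and gn: "geodesic_network X"
    using st by (auto simp: stationary_network_def network_with_mult_def)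
  have "compact (X \<inter> cball x \<rho>)" using gn by (auto simp: geodesic_network_def closed_Int_compact)
  moreover have "X \<inter> cball x \<rho> \<noteq> {}" using x \<rho> by auto
  moreover have "continuous_on (X \<inter> cball x \<rho>) (dist x)" by (intro continuous_intros)
  ultimately obtain y where y: "y \<in> X \<inter> cball x \<rho>" and max: "\<And>z. z \<in> X \<inter> cball x \<rho> \<Longrightarrow> dist x z \<le> dist x y"
    using continuous_attains_sup[of "X \<inter> cball x \<rho>" "dist x"] by blast
  have yX: "y \<in> X" using y by simp
  have lt: "dist x y < \<rho>" using y no by (auto simp: less_le)
  obtain r where c: "cone_at X y r (directions X y)" using geodesic_network_finite_directions(4)[OF gn yX] by blast
  \<comment> \<open>A step t along \<open>s\<close> changes the squared distance by
    \<open>2 * t * (s \<bullet> (y - x))\<close> plus t^2. At a maximum this is not positive, so the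
    inner product is strictly negative.\<close>
  have neg: "s \<bullet> (y - x) < 0" if s: "s \<in> directions X y" for s
  proof -
    have n: "norm s = 1" by (rule geodesic_network_finite_directions(3)[OF gn yX s])
    define t where "t = min r (\<rho> - dist x y) / 2"
    have t: "0 < t" "t < r" "dist x y + t < \<rho>" using c lt by (auto simp: t_def cone_at_def min_def field_simps)
    have "y + t *\<^sub>R s \<in> X" using cone_at_ray[OF c s] t by simp
    moreover have "dist x (y + t *\<^sub>R s) \<le> \<rho>"
      using dist_triangle[of x "y + t *\<^sub>R s" y] t n by (simp add: dist_norm)
    ultimately have "dist x (y + t *\<^sub>R s) \<le> dist x y" by (intro max) auto
    then have "(norm (y + t *\<^sub>R s - x))\<^sup>2 \<le> (norm (y - x))\<^sup>2" by (simp add: dist_norm norm_minus_commute power_mono)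
    moreover have "(norm (y + t *\<^sub>R s - x))\<^sup>2 = (norm (y - x))\<^sup>2 + 2 * t * (s \<bullet> (y - x)) + t * t"
    proof -
      define q where "q = y - x"
      have "y + t *\<^sub>R s - x = q + t *\<^sub>R s" by (simp add: q_def)
      moreover have "s \<bullet> s = 1" using n by (simp add: norm_eq_1)
      ultimately show ?thesis unfolding power2_norm_eq_inner q_def[symmetric]
        by (simp add: inner_add_left inner_add_right inner_commute[of q s] algebra_simps)
    qed
    ultimately have "t * (2 * (s \<bullet> (y - x)) + t) \<le> 0" by (simp add: algebra_simps)
    then have "2 * (s \<bullet> (y - x)) + t \<le> 0" using t by (simp add: mult_le_0_iff)
    then show ?thesis using t by linarith
  qed
  have "0 = (\<Sum>s\<in>directions X y. edge_mult \<Theta> y s *\<^sub>R s) \<bullet> (y - x)" by (simp add: stationary_balance[OF st yX])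
  also have "\<dots> = (\<Sum>s\<in>directions X y. edge_mult \<Theta> y s * (s \<bullet> (y - x)))" by (simp add: inner_sum_left)
  also have "\<dots> < (\<Sum>s\<in>directions X y. 0)"
    using geodesic_network_finite_directions(1,2)[OF gn yX] edge_mult_pos[OF N yX] neg
    by (intro sum_strict_mono) (auto intro: mult_pos_neg)
  finally show False by simp
qed

section \<open>Network measures and weak convergence\<close>

lemma finite_Int_compact_local:
  fixes W :: "'a::topological_space set"
  assumes "compact W" and loc: "\<And>x. x \<in> W \<Longrightarrow> \<exists>U. open U \<and> x \<in> U \<and> finite (S \<inter> U)"
  shows "finite (S \<inter> W)"
proof -
  obtain U where U: "\<And>x. x \<in> W \<Longrightarrow> open (U x) \<and> x \<in> U x \<and> finite (S \<inter> U x)" using loc by metis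
  obtain C where C: "C \<subseteq> W" "finite C" "W \<subseteq> (\<Union>x\<in>C. U x)"
    using compactE_image[OF assms(1), of W U] U by blast
  have "S \<inter> W \<subseteq> (\<Union>x\<in>C. S \<inter> U x)" using C by blast
  moreover have "finite (\<Union>x\<in>C. S \<inter> U x)" using C U by blast
  ultimately show ?thesis by (rule finite_subset)
qed

lemma cone_at_sing:
  assumes "cone_at X x r D" "y \<in> sing_points X" "y \<in> ball x r" shows "y = x"
proof (rule ccontr)
  assume "y \<noteq> x"
  have "y \<in> X \<inter> ball x r" using assms by (auto simp: sing_points_def)
  then obtain s t where st: "s \<in> D" "0 \<le> t" "t < r" "y = x + t *\<^sub>R s" using assms(1) unfolding cone_at_def by blast
  then have "0 < t" using \<open>y \<noteq> x\<close> by (cases "t = 0") auto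
  then have "y \<in> reg_points X" using cone_at_ray_line[OF assms(1) st(1) _ st(3)] st(4) reg_iff_line_at by blast
  then show False using assms by (simp add: sing_points_def)
qed

lemma finite_sing_points:
  fixes X :: "'a::euclidean_space set"
  assumes gn: "geodesic_network X" and "compact W"
  shows "finite (sing_points X \<inter> W)"
proof (rule finite_Int_compact_local[OF assms(2)])
  fix x assume "x \<in> W"
  show "\<exists>U. open U \<and> x \<in> U \<and> finite (sing_points X \<inter> U)"
  proof (cases "x \<in> X")
    case True
    obtain r D where c: "cone_at X x r D" by (rule geodesic_network_cone[OF gn True])
    then have "sing_points X \<inter> ball x r \<subseteq> {x}" using cone_at_sing[OF c] by blast
    then have "finite (sing_points X \<inter> ball x r)" by (rule finite_subset) simp
    then show ?thesis using c by (intro exI[of _ "ball x r"]) (auto simp: cone_at_def)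
  next
    case False
    have "sing_points X \<inter> (- X) = {}" by (auto simp: sing_points_def)
    then show ?thesis using False gn by (intro exI[of _ "- X"]) (auto simp: geodesic_network_def)
  qed
qed

lemma countable_sing_points:
  fixes X :: "'a::euclidean_space set"
  assumes "geodesic_network X" shows "countable (sing_points X)"
proof -
  have "sing_points X = (\<Union>n::nat. sing_points X \<inter> cball 0 (real n))"
    using real_arch_simple by (auto simp: dist_norm)
  moreover have "countable (\<Union>n::nat. sing_points X \<inter> cball 0 (real n))"
    using finite_sing_points[OF assms] by (intro countable_UN) (auto intro: countable_finite)
  ultimately show ?thesis by simp
qed

lemma borel_countable: "countable A \<Longrightarrow> (A :: 'a::t1_space set) \<in> sets borel"
  by (rule sets.countable[rotated]) auto

text \<open>On the regular points \<Theta> is locally constant, so preimages are relatively open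
  there. The singular points are countable, hence harmless whatever values they carry.\<close>

lemma extended_mult_measurable:
  fixes X :: "'a::euclidean_space set"
  assumes N: "network_with_mult X \<Theta>"
  shows "extended_mult X \<Theta> \<in> borel_measurable borel"
proof (rule borel_measurableI)
  fix S :: "real set" assume "open S"
  have gn: "geodesic_network X" using N by (simp add: network_with_mult_def)
  have bX: "X \<in> sets borel" using gn by (simp add: geodesic_network_def borel_closed)
  have sub: "sing_points X \<inter> A \<in> sets borel" for A
    by (rule borel_countable) (use countable_subset[OF _ countable_sing_points[OF gn]] in blast)
  have reg: "reg_points X = X - sing_points X" using reg_points_subset[of X] by (auto simp: sing_points_def)
  have breg: "reg_points X \<in> sets borel" unfolding reg using bX sub[of UNIV] by simp
  have "\<forall>x\<in>reg_points X. \<exists>U. open U \<and> x \<in> U \<and> (\<forall>y\<in>U \<inter> reg_points X. \<Theta> y = \<Theta> x)"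
    using N unfolding network_with_mult_def constant_on_def by (metis IntI)
  then obtain U where U: "\<And>x. x \<in> reg_points X \<Longrightarrow> open (U x) \<and> x \<in> U x \<and> (\<forall>y\<in>U x \<inter> reg_points X. \<Theta> y = \<Theta> x)"
    by metis
  define G where "G = (\<Union>x\<in>{x\<in>reg_points X. \<Theta> x \<in> S}. U x)"
  have "open G" using U by (auto simp: G_def)
  have "{x\<in>reg_points X. \<Theta> x \<in> S} = reg_points X \<inter> G"
  proof (intro set_eqI iffI)
    fix x assume x: "x \<in> {x\<in>reg_points X. \<Theta> x \<in> S}"
    then have "x \<in> U x" using U by blast
    then show "x \<in> reg_points X \<inter> G" using x unfolding G_def by blast
  next
    fix x assume x: "x \<in> reg_points X \<inter> G"
    then obtain z where z: "z \<in> reg_points X" "\<Theta> z \<in> S" "x \<in> U z" unfolding G_def by blast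
    then have "\<Theta> x = \<Theta> z" using U[OF z(1)] x by blast
    then show "x \<in> {x\<in>reg_points X. \<Theta> x \<in> S}" using x z by simp
  qed
  then have b1: "{x\<in>reg_points X. \<Theta> x \<in> S} \<in> sets borel" using breg \<open>open G\<close> by simp
  have eq: "extended_mult X \<Theta> -` S = {x\<in>reg_points X. \<Theta> x \<in> S} \<union> (sing_points X \<inter> extended_mult X \<Theta> -` S) \<union> (if 0 \<in> S then - X else {})"
  proof (intro set_eqI)
    fix x
    consider "x \<in> reg_points X" "x \<in> X" "x \<notin> sing_points X" | "x \<notin> reg_points X" "x \<in> sing_points X" "x \<in> X"
      | "x \<notin> reg_points X" "x \<notin> sing_points X" "x \<notin> X"
      using reg_points_subset[of X] unfolding sing_points_def by blast
    then show "x \<in> extended_mult X \<Theta> -` S \<longleftrightarrow> x \<in> {x\<in>reg_points X. \<Theta> x \<in> S} \<union> (sing_points X \<inter> extended_mult X \<Theta> -` S) \<union> (if 0 \<in> S then - X else {})"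
      by cases (simp_all add: extended_mult_def)
  qed
  have "(if 0 \<in> S then - X else {}) \<in> sets borel" using bX by (simp add: borel_comp)
  then have "extended_mult X \<Theta> -` S \<in> sets borel"
    by (intro subst[OF eq[symmetric], where P="\<lambda>A. A \<in> sets borel"] sets.Un b1 sub)
  then show "extended_mult X \<Theta> -` S \<inter> space borel \<in> sets borel" by simp
qed

lemma sets_network_measure [simp]: "sets (network_measure X \<Theta>) = sets borel"
  for X :: "'a::euclidean_space set"
  by (simp add: network_measure_def)

lemma emeasure_network_measure:
  fixes X :: "'a::euclidean_space set"
  assumes "network_with_mult X \<Theta>" "A \<in> sets borel"
  shows "emeasure (network_measure X \<Theta>) A = (\<integral>\<^sup>+x. ennreal (extended_mult X \<Theta> x) * indicator A x \<partial>hausdorff1)"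
  unfolding network_measure_def
proof (rule emeasure_density)
  have "extended_mult X \<Theta> \<in> borel_measurable hausdorff1"
    using extended_mult_measurable[OF assms(1)] by (simp cong: measurable_cong_sets)
  then show "(\<lambda>x. ennreal (extended_mult X \<Theta> x)) \<in> borel_measurable hausdorff1" by simp
qed (use assms in simp)

text \<open>Plays the role of the monotonicity formula. The network reaches every sphere around
  \<open>x\<close>, so the distance from \<open>x\<close> maps its part in the ball onto
  [0, \<rho>]; by integrality the density is at least 1 off the countable singular set.\<close>

lemma network_mass_lower:
  fixes X :: "'a::euclidean_space set"
  assumes st: "stationary_network X \<Theta>" and int: "integral_network X \<Theta>" and x: "x \<in> X" and \<rho>: "0 \<le> \<rho>"
  shows "ennreal \<rho> \<le> emeasure (network_measure X \<Theta>) (cball x \<rho>)"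
proof -
  have N: "network_with_mult X \<Theta>" using st by (simp add: stationary_network_def)
  have gn: "geodesic_network X" using N by (simp add: network_with_mult_def)
  have clX: "closed X" using gn by (simp add: geodesic_network_def)
  have "{0..\<rho>} \<subseteq> dist x ` (X \<inter> cball x \<rho>)"
  proof
    fix t assume t: "t \<in> {0..\<rho>}"
    then obtain y where "y \<in> X" "dist x y = t" using stationary_network_reaches_sphere[OF st x, of t] by auto
    then show "t \<in> dist x ` (X \<inter> cball x \<rho>)" using t by (intro image_eqI[of _ _ y]) auto
  qed
  moreover have "\<bar>dist x y - dist x z\<bar> \<le> dist y z" for y z
    using abs_dist_diff_le[of y x z] by (simp add: dist_commute)
  ultimately have "ennreal (\<rho> - 0) \<le> hausdorff1_outer (X \<inter> cball x \<rho>)"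
    by (intro hausdorff1_outer_ge_lipschitz_image[where g="dist x"])
  also have "\<dots> = emeasure hausdorff1 (X \<inter> cball x \<rho>)"
    using clX by (intro emeasure_hausdorff1[symmetric]) (simp add: borel_closed)
  also have "\<dots> = (\<integral>\<^sup>+y. indicator (X \<inter> cball x \<rho>) y \<partial>hausdorff1)"
    using clX by (simp add: borel_closed)
  also have "\<dots> \<le> (\<integral>\<^sup>+y. ennreal (extended_mult X \<Theta> y) * indicator (cball x \<rho>) y \<partial>hausdorff1)"
  proof (rule nn_integral_mono_AE, rule AE_I'[OF hausdorff1_null_countable[OF countable_sing_points[OF gn]]], rule subsetI)
    fix y assume "y \<in> {y \<in> space hausdorff1. \<not> indicator (X \<inter> cball x \<rho>) y \<le> ennreal (extended_mult X \<Theta> y) * indicator (cball x \<rho>) y}"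
    then have no: "\<not> indicator (X \<inter> cball x \<rho>) y \<le> ennreal (extended_mult X \<Theta> y) * indicator (cball x \<rho>) y" by simp
    have y: "y \<in> X \<inter> cball x \<rho>" by (rule ccontr) (use no in simp)
    show "y \<in> sing_points X"
    proof (rule ccontr)
      assume "y \<notin> sing_points X"
      then have reg: "y \<in> reg_points X" using y unfolding sing_points_def by blast
      then obtain j :: nat where "0 < j" "\<Theta> y = real j" using int unfolding integral_network_def by blast
      then have "1 \<le> extended_mult X \<Theta> y" using reg by (simp add: extended_mult_def)
      then show False using no y by simp
    qed
  qed
  also have "\<dots> = emeasure (network_measure X \<Theta>) (cball x \<rho>)"
    by (rule emeasure_network_measure[symmetric, OF N]) simp
  finally show ?thesis by simp
qed

definition finite_on_compacts :: "'a::euclidean_space measure \<Rightarrow> bool" where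
  "finite_on_compacts M \<longleftrightarrow> sets M = sets borel \<and> (\<forall>C. compact C \<longrightarrow> emeasure M C < \<infinity>)"

text \<open>Near a point of the network the measure is dominated by finitely many segments of finite
  length with constant multiplicities; finitely many such neighbourhoods cover a compact
  set.\<close>

lemma network_measure_finite_on_compacts:
  fixes X :: "'a::euclidean_space set"
  assumes N: "network_with_mult X \<Theta>"
  shows "finite_on_compacts (network_measure X \<Theta>)"
  unfolding finite_on_compacts_def
proof (intro conjI allI impI)
  let ?M = "network_measure X \<Theta>"
  show sM: "sets ?M = sets borel" by simp
  fix C :: "'a set" assume C: "compact C"
  have gn: "geodesic_network X" using N by (simp add: network_with_mult_def)
  have "\<exists>U. open U \<and> x \<in> U \<and> emeasure ?M U < \<infinity>" for x
  proof (cases "x \<in> X")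
    case False
    have "emeasure ?M (- X) = (\<integral>\<^sup>+x. ennreal (extended_mult X \<Theta> x) * indicator (- X) x \<partial>hausdorff1)"
      using gn by (intro emeasure_network_measure[OF N]) (auto simp: geodesic_network_def borel_closed)
    also have "\<dots> = (\<integral>\<^sup>+(x::'a). 0 \<partial>hausdorff1)"
      using reg_points_subset[of X] by (intro nn_integral_cong) (auto simp: extended_mult_def sing_points_def indicator_def)
    finally show ?thesis using False gn by (intro exI[of _ "- X"]) (auto simp: geodesic_network_def)
  next
    case True
    obtain r D where c: "cone_at X x r D" by (rule geodesic_network_cone[OF gn True])
    have D: "finite D" "\<And>s. s \<in> D \<Longrightarrow> norm s = 1" "0 < r" and X: "X \<inter> ball x r = {x + t *\<^sub>R s | s t. s \<in> D \<and> 0 \<le> t \<and> t < r}"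
      using c by (auto simp: cone_at_def)
    let ?h = "\<lambda>y. \<Sum>s\<in>D. ennreal (edge_mult \<Theta> x s) * indicator (closed_segment x (x + r *\<^sub>R s)) y"
    have "emeasure ?M (ball x r) = (\<integral>\<^sup>+y. ennreal (extended_mult X \<Theta> y) * indicator (ball x r) y \<partial>hausdorff1)"
      by (intro emeasure_network_measure[OF N]) simp
    also have "\<dots> \<le> (\<integral>\<^sup>+y. ?h y \<partial>hausdorff1)"
    proof (rule nn_integral_mono_AE, rule AE_I'[OF hausdorff1_null_singleton[of x]], safe)
      fix y assume no: "\<not> ennreal (extended_mult X \<Theta> y) * indicator (ball x r) y \<le> ?h y"
      show "y = x"
      proof (rule ccontr)
        assume "y \<noteq> x"
        have "y \<in> X \<inter> ball x r"
        proof (rule ccontr)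
          assume "y \<notin> X \<inter> ball x r"
          then have "ennreal (extended_mult X \<Theta> y) * indicator (ball x r) y = 0"
            using reg_points_subset[of X] by (auto simp: extended_mult_def sing_points_def indicator_def)
          then show False using no by (metis zero_le)
        qed
        then obtain s t where st: "s \<in> D" "0 \<le> t" "t < r" "y = x + t *\<^sub>R s" using X by blast
        then have t: "0 < t" using \<open>y \<noteq> x\<close> by (cases "t = 0") auto
        note em = cone_at_edge_mult[OF N c st(1) t st(3), folded st(4)]
        have "y = (1 - t / r) *\<^sub>R x + (t / r) *\<^sub>R (x + r *\<^sub>R s)" using st t by (simp add: algebra_simps)
        then have seg: "y \<in> closed_segment x (x + r *\<^sub>R s)" using st t by (auto simp: in_segment intro!: exI[of _ "t / r"])
        have "ennreal (extended_mult X \<Theta> y) * indicator (ball x r) y \<le> ennreal (edge_mult \<Theta> x s) * indicator (closed_segment x (x + r *\<^sub>R s)) y"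
          using em seg by (simp add: extended_mult_def indicator_def)
        also have "\<dots> \<le> ?h y" using D st by (intro member_le_sum) auto
        finally show False using no by simp
      qed
    qed
    also have "\<dots> = (\<Sum>s\<in>D. ennreal (edge_mult \<Theta> x s) * emeasure hausdorff1 (closed_segment x (x + r *\<^sub>R s)))"
    proof -
      have seg: "closed_segment p q \<in> sets hausdorff1" for p q :: 'a by (simp add: borel_closed)
      have "(\<integral>\<^sup>+y. ?h y \<partial>hausdorff1) = (\<Sum>s\<in>D. \<integral>\<^sup>+y. ennreal (edge_mult \<Theta> x s) * indicator (closed_segment x (x + r *\<^sub>R s)) y \<partial>hausdorff1)"
        by (rule nn_integral_sum) (intro borel_measurable_times_ennreal borel_measurable_const borel_measurable_indicator seg)
      also have "\<dots> = (\<Sum>s\<in>D. ennreal (edge_mult \<Theta> x s) * emeasure hausdorff1 (closed_segment x (x + r *\<^sub>R s)))"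
        by (intro sum.cong refl nn_integral_cmult_indicator seg)
      finally show ?thesis .
    qed
    also have "\<dots> < \<infinity>"
      using D by (simp add: emeasure_hausdorff1_closed_segment ennreal_mult_less_top)
    finally show ?thesis using D by (intro exI[of _ "ball x r"]) auto
  qed
  then obtain U where U: "\<And>x. open (U x) \<and> x \<in> U x \<and> emeasure ?M (U x) < \<infinity>" by metis
  obtain F where F: "F \<subseteq> C" "finite F" "C \<subseteq> (\<Union>x\<in>F. U x)"
    using compactE_image[OF C, of C U] U by blast
  have "emeasure ?M C \<le> emeasure ?M (\<Union>x\<in>F. U x)"
    using U F by (intro emeasure_mono) auto
  also have "\<dots> \<le> (\<Sum>x\<in>F. emeasure ?M (U x))"
    using U F by (intro emeasure_subadditive_finite) auto
  also have "\<dots> < \<infinity>" using U F(2) by simp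
  finally show "emeasure ?M C < \<infinity>" .
qed

lemma emeasure_multiplicity_line_measure:
  fixes L :: "'a::euclidean_space set"
  assumes "L \<in> sets borel" "A \<in> sets borel"
  shows "emeasure (multiplicity_line_measure k L) A = of_nat k * emeasure hausdorff1 (L \<inter> A)"
proof -
  have "emeasure (multiplicity_line_measure k L) A = (\<integral>\<^sup>+x. (of_nat k * indicator L x) * indicator A x \<partial>hausdorff1)"
    unfolding multiplicity_line_measure_def using assms by (intro emeasure_density) auto
  also have "\<dots> = (\<integral>\<^sup>+x. of_nat k * indicator (L \<inter> A) x \<partial>hausdorff1)"
    by (intro nn_integral_cong) (auto simp: indicator_def)
  also have "\<dots> = of_nat k * emeasure hausdorff1 (L \<inter> A)"
    using assms by (intro nn_integral_cmult_indicator) auto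
  finally show ?thesis .
qed

lemma bump_function:
  fixes K V :: "'a::euclidean_space set"
  assumes "compact K" "open V" "K \<subseteq> V" "bounded V"
  obtains f :: "'a \<Rightarrow> real" where "continuous_on UNIV f" "compact (closure {x. f x \<noteq> 0})"
    "\<And>x. 0 \<le> f x \<and> f x \<le> 1" "\<And>x. x \<in> K \<Longrightarrow> f x = 1" "\<And>x. x \<notin> V \<Longrightarrow> f x = 0"
proof -
  obtain f :: "'a \<Rightarrow> real" where f: "continuous_on UNIV f" "\<And>x. f x \<in> closed_segment 1 0" "\<And>x. x \<in> K \<Longrightarrow> f x = 1" "\<And>x. x \<in> - V \<Longrightarrow> f x = 0"
  proof (rule Urysohn[of K "- V" "1::real" 0])
    show "closed K" "closed (- V)" "K \<inter> - V = {}" using assms by (auto simp: compact_imp_closed)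
  qed (rule that)
  have "{x. f x \<noteq> 0} \<subseteq> V" using f(4) by auto
  then have "bounded {x. f x \<noteq> 0}" using assms(4) bounded_subset by blast
  then have "compact (closure {x. f x \<noteq> 0})" by (simp add: compact_closure)
  moreover have "0 \<le> f x \<and> f x \<le> 1" for x using f(2)[of x] by (simp add: closed_segment_eq_real_ivl)
  ultimately show ?thesis using f by (intro that[of f]) simp_all
qed

lemma nn_integral_bump:
  fixes f :: "'a::euclidean_space \<Rightarrow> real"
  assumes M: "finite_on_compacts M" and f: "continuous_on UNIV f" "compact (closure {x. f x \<noteq> 0})" "\<And>x. 0 \<le> f x \<and> f x \<le> 1"
  shows "(\<integral>\<^sup>+x. ennreal (f x) \<partial>M) = ennreal (\<integral>x. f x \<partial>M)"
proof (rule nn_integral_eq_integral)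
  have sM: "sets M = sets borel" using M by (simp add: finite_on_compacts_def)
  have meas: "f \<in> borel_measurable M"
    using borel_measurable_continuous_onI[OF f(1)] by (simp add: measurable_cong_sets[OF sM refl])
  let ?C = "closure {x. f x \<noteq> 0}"
  have "(\<integral>\<^sup>+x. ennreal (norm (f x)) \<partial>M) \<le> (\<integral>\<^sup>+x. indicator ?C x \<partial>M)"
  proof (rule nn_integral_mono)
    fix x
    show "ennreal (norm (f x)) \<le> indicator ?C x"
    proof (cases "f x = 0")
      case False
      then have "x \<in> ?C" using closure_subset[of "{x. f x \<noteq> 0}"] by blast
      then show ?thesis using f(3)[of x] by (simp add: ennreal_le_1)
    qed simp
  qed
  also have "\<dots> = emeasure M ?C" using sM by (simp add: borel_closed)
  also have "\<dots> < \<infinity>" using M f(2) by (simp add: finite_on_compacts_def)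
  finally show "integrable M f" using meas by (intro integrableI_bounded) auto
qed (use f in auto)

lemma bump_bounds:
  fixes f :: "'a::euclidean_space \<Rightarrow> real"
  assumes M: "finite_on_compacts M" and f: "continuous_on UNIV f" "compact (closure {x. f x \<noteq> 0})" "\<And>x. 0 \<le> f x \<and> f x \<le> 1"
    and K: "compact K" "\<And>x. x \<in> K \<Longrightarrow> f x = 1" and V: "open V" "\<And>x. x \<notin> V \<Longrightarrow> f x = 0"
  shows "emeasure M K \<le> ennreal (\<integral>x. f x \<partial>M)" "ennreal (\<integral>x. f x \<partial>M) \<le> emeasure M V"
proof -
  have sM: "sets M = sets borel" using M by (simp add: finite_on_compacts_def)
  note eq = nn_integral_bump[OF M f]
  have "emeasure M K = (\<integral>\<^sup>+x. indicator K x \<partial>M)" using sM K by (simp add: borel_compact)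
  also have "\<dots> \<le> (\<integral>\<^sup>+x. ennreal (f x) \<partial>M)" using K by (intro nn_integral_mono) (auto simp: indicator_def)
  finally show "emeasure M K \<le> ennreal (\<integral>x. f x \<partial>M)" using eq by simp
  have "(\<integral>\<^sup>+x. ennreal (f x) \<partial>M) \<le> (\<integral>\<^sup>+x. indicator V x \<partial>M)"
    using V f(3) by (intro nn_integral_mono) (auto simp: indicator_def ennreal_le_1)
  also have "\<dots> = emeasure M V" using sM V by simp
  finally show "ennreal (\<integral>x. f x \<partial>M) \<le> emeasure M V" using eq by simp
qed

text \<open>A continuous function that is 1 on \<open>K\<close> and vanishes off \<open>V\<close>
  lies between the two indicators, so its converging integrals compare the measures of
  \<open>K\<close> and \<open>V\<close>.\<close>

lemma weak_conv_bounds: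
  fixes K V :: "'a::euclidean_space set"
  assumes conv: "radon_weak_conv M N" and M: "\<And>i. finite_on_compacts (M i)" and N: "finite_on_compacts N"
    and KV: "compact K" "open V" "K \<subseteq> V" "bounded V" and \<epsilon>: "0 < \<epsilon>"
  shows "\<forall>\<^sub>F i in sequentially. emeasure (M i) K \<le> emeasure N V + ennreal \<epsilon>"
    "\<forall>\<^sub>F i in sequentially. emeasure N K \<le> emeasure (M i) V + ennreal \<epsilon>"
proof -
  obtain f :: "'a \<Rightarrow> real" where f: "continuous_on UNIV f" "compact (closure {x. f x \<noteq> 0})"
    "\<And>x. 0 \<le> f x \<and> f x \<le> 1" "\<And>x. x \<in> K \<Longrightarrow> f x = 1" "\<And>x. x \<notin> V \<Longrightarrow> f x = 0"
    by (rule bump_function[OF KV], rule that)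
  have "(\<lambda>i. \<integral>x. f x \<partial>M i) \<longlonglongrightarrow> (\<integral>x. f x \<partial>N)" using conv f(1,2) unfolding radon_weak_conv_def by blast
  then have ev: "\<forall>\<^sub>F i in sequentially. dist (\<integral>x. f x \<partial>M i) (\<integral>x. f x \<partial>N) < \<epsilon>" using \<epsilon> by (rule tendstoD)
  note bM = bump_bounds[OF M f(1-3) KV(1) f(4) KV(2) f(5)]
  note bN = bump_bounds[OF N f(1-3) KV(1) f(4) KV(2) f(5)]
  have nn: "0 \<le> (\<integral>x. f x \<partial>N)" "0 \<le> (\<integral>x. f x \<partial>M i)" for i using f(3) by (auto intro!: integral_nonneg_AE)
  show "\<forall>\<^sub>F i in sequentially. emeasure (M i) K \<le> emeasure N V + ennreal \<epsilon>"
    using ev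
  proof eventually_elim
    case (elim i)
    have "emeasure (M i) K \<le> ennreal (\<integral>x. f x \<partial>M i)" by (rule bM(1))
    also have "\<dots> \<le> ennreal ((\<integral>x. f x \<partial>N) + \<epsilon>)" using elim by (intro ennreal_leI) (auto simp: dist_real_def)
    also have "\<dots> = ennreal (\<integral>x. f x \<partial>N) + ennreal \<epsilon>" using nn \<epsilon> by (intro ennreal_plus) auto
    also have "\<dots> \<le> emeasure N V + ennreal \<epsilon>" by (intro add_right_mono bN(2))
    finally show ?case .
  qed
  show "\<forall>\<^sub>F i in sequentially. emeasure N K \<le> emeasure (M i) V + ennreal \<epsilon>"
    using ev
  proof eventually_elim
    case (elim i)
    have "emeasure N K \<le> ennreal (\<integral>x. f x \<partial>N)" by (rule bN(1))
    also have "\<dots> \<le> ennreal ((\<integral>x. f x \<partial>M i) + \<epsilon>)" using elim by (intro ennreal_leI) (auto simp: dist_real_def)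
    also have "\<dots> = ennreal (\<integral>x. f x \<partial>M i) + ennreal \<epsilon>" using nn \<epsilon> by (intro ennreal_plus) auto
    also have "\<dots> \<le> emeasure (M i) V + ennreal \<epsilon>" by (intro add_right_mono bM(2))
    finally show ?case .
  qed
qed

lemma affine_line:
  fixes L :: "'a::euclidean_space set"
  assumes "affine L" "aff_dim L = 1"
  obtains p w where "norm w = 1" "L = range (\<lambda>t. p + t *\<^sub>R w)"
proof -
  have "L \<noteq> {}" using assms(2) by auto
  then obtain p where p: "p \<in> L" by blast
  define S where "S = (\<lambda>x. - p + x) ` L"
  have "subspace S" unfolding S_def using affine_diffs_subspace[OF assms(1) p] by simp
  have "aff_dim L = int (dim S)" unfolding S_def using aff_dim_eq_dim[of p L] p by (simp add: hull_inc)
  then have "dim S = 1" using assms(2) by simp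
  then obtain B where B: "B \<subseteq> S" "independent B" "S \<subseteq> span B" "card B = 1" using basis_exists[of S] by metis
  then obtain b where b: "B = {b}" by (metis card_1_singletonE)
  have "b \<noteq> 0" using B b by (metis dependent_zero singletonI)
  have "span B \<subseteq> S" using B(1) \<open>subspace S\<close> by (rule span_minimal)
  then have S: "S = range (\<lambda>k. k *\<^sub>R b)" using B(3) b by (auto simp: span_singleton)
  have "L = (\<lambda>x. p + x) ` S" by (simp add: S_def image_image)
  also have "\<dots> = range (\<lambda>t. p + t *\<^sub>R sgn b)"
  proof (intro set_eqI iffI)
    fix x assume "x \<in> (\<lambda>x. p + x) ` S"
    then obtain k where "x = p + k *\<^sub>R b" by (auto simp: S)
    then have "x = p + (k * norm b) *\<^sub>R sgn b" using \<open>b \<noteq> 0\<close> by (simp add: sgn_div_norm)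
    then show "x \<in> range (\<lambda>t. p + t *\<^sub>R sgn b)" by blast
  next
    fix x assume "x \<in> range (\<lambda>t. p + t *\<^sub>R sgn b)"
    then obtain t where "x = p + (t / norm b) *\<^sub>R b" by (auto simp: sgn_div_norm divide_inverse)
    then show "x \<in> (\<lambda>x. p + x) ` S" by (auto simp: S)
  qed
  finally show ?thesis using that[of "sgn b" p] \<open>b \<noteq> 0\<close> by (simp add: norm_sgn)
qed

section \<open>The net of a network in a slab\<close>

lemma pos_image_segment:
  fixes u :: "'a::euclidean_space"
  assumes up: "u \<bullet> fst e < u \<bullet> snd e" and st: "s \<le> t"
  shows "closed_segment (pos u e s) (pos u e t) = pos u e ` {s..t}"
proof -
  have lin: "(1 - w) *\<^sub>R pos u e s + w *\<^sub>R pos u e t = pos u e (s + w * (t - s))" for w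
  proof -
    define c where "c = u \<bullet> dir e"
    have "(s + w * (t - s) - u \<bullet> fst e) / c = (1 - w) * ((s - u \<bullet> fst e) / c) + w * ((t - u \<bullet> fst e) / c)"
      by (simp add: add_divide_distrib diff_divide_distrib algebra_simps)
    then show ?thesis unfolding pos_def c_def[symmetric] by (simp add: scaleR_left_distrib algebra_simps)
  qed
  show ?thesis
  proof (intro set_eqI iffI)
    fix z assume "z \<in> closed_segment (pos u e s) (pos u e t)"
    then obtain w where w: "0 \<le> w" "w \<le> 1" "z = pos u e (s + w * (t - s))" unfolding in_segment lin by blast
    have "0 \<le> w * (t - s)" using w st by simp
    moreover have "w * (t - s) \<le> 1 * (t - s)" using w st by (intro mult_right_mono) auto
    ultimately show "z \<in> pos u e ` {s..t}" unfolding w(3) by (intro imageI) auto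
  next
    fix z assume "z \<in> pos u e ` {s..t}"
    then obtain r where r: "s \<le> r" "r \<le> t" "z = pos u e r" by auto
    show "z \<in> closed_segment (pos u e s) (pos u e t)"
    proof (cases "s = t")
      case True then show ?thesis using r by auto
    next
      case False
      define w where "w = (r - s) / (t - s)"
      have "0 \<le> w" "w \<le> 1" "s + w * (t - s) = r" using r st False by (auto simp: w_def field_simps)
      then show ?thesis unfolding in_segment lin using r by (intro exI[of _ w]) simp
    qed
  qed
qed

lemma segment_direction:
  fixes X :: "'a::euclidean_space set"
  assumes "closed_segment p q \<subseteq> X" "p \<noteq> q" "z \<in> closed_segment p q" "z \<noteq> q"
  shows "sgn (q - p) \<in> directions X z"
proof -
  obtain w where w: "0 \<le> w" "w \<le> 1" "z = (1 - w) *\<^sub>R p + w *\<^sub>R q" using assms(3) by (auto simp: in_segment)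
  have w1: "w < 1" using w assms(4) by (cases "w = 1") auto
  define d where "d = norm (q - p)"
  have d: "0 < d" using assms(2) by (simp add: d_def)
  have "z + t *\<^sub>R sgn (q - p) \<in> X" if t: "0 < t" "t < (1 - w) * d" for t
  proof -
    have s: "sgn (q - p) = (1 / d) *\<^sub>R (q - p)" by (simp add: sgn_div_norm d_def divide_inverse)
    have "z + t *\<^sub>R sgn (q - p) = (1 - (w + t / d)) *\<^sub>R p + (w + t / d) *\<^sub>R q"
      unfolding s w(3) by (simp add: algebra_simps)
    moreover have "0 \<le> w + t / d" "w + t / d \<le> 1" using t w d by (auto simp: field_simps)
    ultimately have "z + t *\<^sub>R sgn (q - p) \<in> closed_segment p q" unfolding in_segment by blast
    then show ?thesis using assms(1) by blast
  qed
  moreover have "0 < (1 - w) * d" using w1 d by simp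
  ultimately have "\<forall>\<^sub>F t in at_right 0. z + t *\<^sub>R sgn (q - p) \<in> X"
    unfolding eventually_at_right_field by blast
  then show ?thesis using assms(2) by (simp add: directions_def norm_sgn)
qed

text \<open>\<open>R\<close> is an open window around the line. Compactness of the part of the
  network in the window and the closed slab means that it can leave only through the bottom and the
  top; \<open>trans\<close> is transversality to the slices.\<close>

locale slab_network =
  fixes X :: "'a::euclidean_space set" and \<Theta> :: "'a \<Rightarrow> real" and u :: 'a and \<alpha> \<beta> :: real and R :: "'a set"
  assumes st: "stationary_network X \<Theta>" and int: "integral_network X \<Theta>" and norm_u: "norm u = 1" and \<alpha>\<beta>: "\<alpha> < \<beta>"
    and open_R: "open R" and compact_W: "compact (X \<inter> R \<inter> {x. \<alpha> \<le> u \<bullet> x \<and> u \<bullet> x \<le> \<beta>})"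
    and trans: "\<And>x s. x \<in> X \<inter> R \<Longrightarrow> s \<in> directions X x \<Longrightarrow> u \<bullet> s \<noteq> 0"
begin

definition W where "W = X \<inter> R \<inter> {x. \<alpha> \<le> u \<bullet> x \<and> u \<bullet> x \<le> \<beta>}"
text \<open>The heights at which the network is cut: both faces and all heights of singular points.
  Cutting everything at all these heights makes edges span consecutive heights. The additional
  vertices are regular points, which \<open>sing_vertices\<close> does not count.\<close>

definition T where "T = insert \<alpha> (insert \<beta> ((\<lambda>x. u \<bullet> x) ` (sing_points X \<inter> W)))"
definition V where "V = {x \<in> W. u \<bullet> x \<in> T}"
definition E where "E = {(p, q). p \<in> V \<and> q \<in> V \<and> u \<bullet> p < u \<bullet> q \<and> (\<forall>t\<in>T. \<not> (u \<bullet> p < t \<and> t < u \<bullet> q)) \<and> closed_segment p q \<subseteq> W}"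
text \<open>The midpoint stands for any interior point of the edge, and the floor turns the integral
  real value into a natural number.\<close>

definition m where "m e = nat \<lfloor>\<Theta> (midpoint (fst e) (snd e))\<rfloor>"

lemma N: "network_with_mult X \<Theta>" and gn: "geodesic_network X"
  using st by (auto simp: stationary_network_def network_with_mult_def)

lemma WI: "x \<in> X \<Longrightarrow> x \<in> R \<Longrightarrow> \<alpha> \<le> u \<bullet> x \<Longrightarrow> u \<bullet> x \<le> \<beta> \<Longrightarrow> x \<in> W"
  by (simp add: W_def)

lemma WD: "x \<in> W \<Longrightarrow> x \<in> X" "x \<in> W \<Longrightarrow> x \<in> R" "x \<in> W \<Longrightarrow> \<alpha> \<le> u \<bullet> x" "x \<in> W \<Longrightarrow> u \<bullet> x \<le> \<beta>"
  by (simp_all add: W_def)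

lemma cW: "compact W" using compact_W by (simp add: W_def)

lemma transW: "x \<in> W \<Longrightarrow> s \<in> directions X x \<Longrightarrow> u \<bullet> s \<noteq> 0"
  using trans WD by blast

lemma finite_T: "finite T"
  unfolding T_def using finite_sing_points[OF gn cW] by simp

lemma T_mem: "\<alpha> \<in> T" "\<beta> \<in> T" by (simp_all add: T_def)

lemma reg_if: "x \<in> W \<Longrightarrow> u \<bullet> x \<notin> T \<Longrightarrow> x \<in> reg_points X"
  unfolding T_def sing_points_def W_def by blast

text \<open>By transversality the rays of the cone at a point leave the slice through this point, so
  slices of the compact set \<open>W\<close> are discrete.\<close>

lemma finite_V: "finite V"
proof -
  have "finite ({x. u \<bullet> x = \<tau>} \<inter> W)" for \<tau>
  proof -
    have "finite ((W \<inter> {x. u \<bullet> x = \<tau>}) \<inter> W)"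
    proof (rule finite_Int_compact_local[OF cW])
      fix x assume x: "x \<in> W"
      show "\<exists>U. open U \<and> x \<in> U \<and> finite ((W \<inter> {x. u \<bullet> x = \<tau>}) \<inter> U)"
      proof (cases "u \<bullet> x = \<tau>")
        case False
        have "open {y. u \<bullet> y \<noteq> \<tau>}" by (intro open_Collect_neq continuous_intros)
        moreover have "(W \<inter> {x. u \<bullet> x = \<tau>}) \<inter> {y. u \<bullet> y \<noteq> \<tau>} = {}" by blast
        ultimately show ?thesis using False by (intro exI[of _ "{y. u \<bullet> y \<noteq> \<tau>}"]) (simp only: finite.emptyI, simp)
      next
        case True
        obtain r where c: "cone_at X x r (directions X x)"
          using geodesic_network_finite_directions(4)[OF gn WD(1)[OF x]] by blast
        have "(W \<inter> {x. u \<bullet> x = \<tau>}) \<inter> ball x r \<subseteq> {x}"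
        proof
          fix y assume y: "y \<in> (W \<inter> {x. u \<bullet> x = \<tau>}) \<inter> ball x r"
          then have "y \<in> X \<inter> ball x r" using WD(1) by blast
          then obtain s t where s: "s \<in> directions X x" "y = x + t *\<^sub>R s" using c unfolding cone_at_def by blast
          have "u \<bullet> y = \<tau>" using y by simp
          then have "t * (u \<bullet> s) = 0" using s True by (simp add: inner_add_right)
          then have "t = 0" using transW[OF x s(1)] by simp
          then show "y \<in> {x}" using s by simp
        qed
        then have "finite ((W \<inter> {x. u \<bullet> x = \<tau>}) \<inter> ball x r)" by (rule finite_subset) simp
        then show ?thesis using c by (intro exI[of _ "ball x r"]) (simp add: cone_at_def)
      qed
    qed
    then show ?thesis by (simp add: Int_commute Int_left_absorb)
  qed
  then have "finite (\<Union>\<tau>\<in>T. {x. u \<bullet> x = \<tau>} \<inter> W)" by (intro finite_UN_I finite_T)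
  moreover have "V = (\<Union>\<tau>\<in>T. {x. u \<bullet> x = \<tau>} \<inter> W)" unfolding V_def by blast
  ultimately show ?thesis by simp
qed

lemma finite_E: "finite E"
proof -
  have "E \<subseteq> V \<times> V" by (auto simp: E_def)
  then show ?thesis using finite_V by (meson finite_SigmaI finite_subset)
qed

lemma reg_directions:
  assumes "z \<in> W" "u \<bullet> z \<notin> T"
  obtains s where "directions X z = {s, - s}" "0 < u \<bullet> s" "norm s = 1"
proof -
  obtain s r where l: "line_at X z s r" using reg_if[OF assms] reg_iff_line_at by blast
  have D: "directions X z = {s, - s}" by (rule line_at_directions[OF l])
  have n: "norm s = 1" using l by (simp add: line_at_def)
  have "u \<bullet> s \<noteq> 0" using transW[OF assms(1)] D by simp
  then consider "0 < u \<bullet> s" | "0 < u \<bullet> (- s)" by force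
  then show ?thesis
  proof cases
    case 1 then show ?thesis using that[of s] D n by simp
  next
    case 2 then show ?thesis using that[of "- s"] D n by (simp add: insert_commute)
  qed
qed

text \<open>Continuation of a segment until the next critical time.\<close>

lemma follow:
  assumes x: "x \<in> W" and s: "s \<in> directions X x" and l: "0 \<le> l"
    and slab: "\<And>t. 0 \<le> t \<Longrightarrow> t \<le> l \<Longrightarrow> \<alpha> \<le> u \<bullet> (x + t *\<^sub>R s) \<and> u \<bullet> (x + t *\<^sub>R s) \<le> \<beta>"
    and crit: "\<And>t. 0 < t \<Longrightarrow> t < l \<Longrightarrow> u \<bullet> (x + t *\<^sub>R s) \<notin> T"
  shows "\<And>t. 0 \<le> t \<Longrightarrow> t \<le> l \<Longrightarrow> x + t *\<^sub>R s \<in> W"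
proof -
  have n: "norm s = 1" by (rule geodesic_network_finite_directions(3)[OF gn WD(1)[OF x] s])
  \<comment> \<open>Continuation up to the supremum: closedness of \<open>W\<close> reaches it, and
    beyond it the direction persists, while openness of \<open>R\<close> and the assumption on the
    slab keep the points in \<open>W\<close>.\<close>
  define A where "A = {t. 0 \<le> t \<and> t \<le> l \<and> (\<forall>t'. 0 \<le> t' \<and> t' \<le> t \<longrightarrow> x + t' *\<^sub>R s \<in> W)}"
  have "x + t *\<^sub>R s \<in> W" if "0 \<le> t" "t \<le> 0" for t
  proof -
    have "t = 0" using that by simp
    then show ?thesis using x by simp
  qed
  then have A0: "0 \<in> A" unfolding A_def using l by blast
  have bdd: "bdd_above A" unfolding A_def by (rule bdd_aboveI[of _ l]) simp
  define t0 where "t0 = Sup A"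
  have t0: "0 \<le> t0" "t0 \<le> l"
  proof -
    show "0 \<le> t0" unfolding t0_def by (rule cSup_upper[OF A0 bdd])
    show "t0 \<le> l" unfolding t0_def by (rule cSup_least) (use A0 in \<open>blast, simp add: A_def\<close>)
  qed
  have before: "x + t *\<^sub>R s \<in> W" if "0 \<le> t" "t < t0" for t
  proof -
    have "A \<noteq> {}" "t < Sup A" using A0 that by (auto simp: t0_def)
    then obtain t' where "t' \<in> A" "t < t'" using less_cSupD[of A t] by blast
    then show ?thesis using that by (simp add: A_def)
  qed
  have at: "x + t0 *\<^sub>R s \<in> W"
  proof (cases "t0 = 0")
    case True then show ?thesis using x by simp
  next
    case False
    have "closed ((\<lambda>t. x + t *\<^sub>R s) -` W)"
      by (intro closed_vimage compact_imp_closed cW continuous_intros)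
    then have "closure {0..<t0} \<subseteq> (\<lambda>t. x + t *\<^sub>R s) -` W"
      using before by (intro closure_minimal) auto
    then show ?thesis using False t0 by (auto simp: closure_atLeastLessThan)
  qed
  have t0A: "t0 \<in> A"
  proof -
    have "x + t *\<^sub>R s \<in> W" if "0 \<le> t" "t \<le> t0" for t
      using before[of t] at that by (cases "t = t0") auto
    then show ?thesis using t0 by (simp add: A_def)
  qed
  have "t0 = l"
  proof (rule ccontr)
    assume "t0 \<noteq> l"
    then have lt: "t0 < l" using t0 by simp
    define y where "y = x + t0 *\<^sub>R s"
    have yW: "y \<in> W" using at by (simp add: y_def)
    \<comment> \<open>The point is regular and the direction back towards \<open>x\<close> is
      present, hence so is its opposite.\<close>
    have sy: "s \<in> directions X y"
    proof (cases "t0 = 0")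
      case True then show ?thesis using s by (simp add: y_def)
    next
      case False
      then have t0p: "0 < t0" using t0 by simp
      have "u \<bullet> y \<notin> T" using crit[OF t0p lt] by (simp add: y_def)
      then obtain s0 where D: "directions X y = {s0, - s0}" using reg_directions[OF yW] by blast
      have "- s \<in> directions X y"
      proof -
        have "y + t *\<^sub>R (- s) \<in> X" if "0 < t" "t < t0" for t
        proof -
          have "y + t *\<^sub>R (- s) = x + (t0 - t) *\<^sub>R s" by (simp add: y_def algebra_simps)
          then show ?thesis using before[of "t0 - t"] that WD(1) by simp
        qed
        then have "\<forall>\<^sub>F t in at_right 0. y + t *\<^sub>R (- s) \<in> X"
          unfolding eventually_at_right_field using t0p by blast
        then show ?thesis using n by (simp add: directions_def)
      qed
      then have "- s = s0 \<or> - s = - s0" unfolding D by blast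
      then have "s = - s0 \<or> s = s0" by force
      then show ?thesis unfolding D by blast
    qed
    obtain r where c: "cone_at X y r (directions X y)"
      using geodesic_network_finite_directions(4)[OF gn WD(1)[OF yW]] by blast
    obtain r1 where r1: "0 < r1" "ball y r1 \<subseteq> R" using open_R WD(2)[OF yW] open_contains_ball by blast
    define h where "h = min (min r r1) (l - t0) / 2"
    have h: "0 < h" "h < r" "h < r1" "t0 + h \<le> l"
      using c r1 lt by (auto simp: h_def cone_at_def min_def field_simps)
    have "x + t *\<^sub>R s \<in> W" if t: "0 \<le> t" "t \<le> t0 + h" for t
    proof (cases "t \<le> t0")
      case True then show ?thesis using t0A t by (simp add: A_def)
    next
      case False
      define w where "w = t - t0"
      have w: "0 \<le> w" "w < r" "w < r1" using False t h by (auto simp: w_def)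
      have eq: "x + t *\<^sub>R s = y + w *\<^sub>R s" by (simp add: y_def w_def algebra_simps)
      have "y + w *\<^sub>R s \<in> X" by (rule cone_at_ray[OF c sy w(1,2)])
      moreover have "y + w *\<^sub>R s \<in> ball y r1" using w n by (simp add: dist_norm)
      ultimately show ?thesis using r1(2) slab[of t] t h eq by (intro WI) auto
    qed
    then have "t0 + h \<in> A" using t0 h by (simp add: A_def)
    then have "t0 + h \<le> t0" unfolding t0_def using bdd by (rule cSup_upper)
    then show False using h by simp
  qed
  then show "\<And>t. 0 \<le> t \<Longrightarrow> t \<le> l \<Longrightarrow> x + t *\<^sub>R s \<in> W" using t0A by (simp add: A_def)
qed

text \<open>Only the sign of the quotient is prescribed, so \<tau> may lie above or below the height
  of \<open>x\<close>. Thus the same lemma yields outgoing and incoming edges.\<close>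

lemma follow_segment:
  assumes x: "x \<in> W" and s: "s \<in> directions X x" and \<tau>: "\<tau> \<in> T" "\<alpha> \<le> \<tau>" "\<tau> \<le> \<beta>" "0 < (\<tau> - u \<bullet> x) / (u \<bullet> s)"
    and crit: "\<And>t. t \<in> T \<Longrightarrow> \<not> (min \<tau> (u \<bullet> x) < t \<and> t < max \<tau> (u \<bullet> x))"
  defines "q \<equiv> x + ((\<tau> - u \<bullet> x) / (u \<bullet> s)) *\<^sub>R s"
  shows "q \<in> V" "u \<bullet> q = \<tau>" "closed_segment x q \<subseteq> W"
proof -
  define c where "c = u \<bullet> s"
  have c: "c \<noteq> 0" using transW[OF x s] by (simp add: c_def)
  define l where "l = (\<tau> - u \<bullet> x) / c"
  have l: "0 < l" using \<tau> by (simp add: l_def c_def)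
  have ux: "u \<bullet> (x + t *\<^sub>R s) = u \<bullet> x + t * c" for t by (simp add: c_def inner_add_right)
  have lc: "l * c = \<tau> - u \<bullet> x" using c by (simp add: l_def)
  have between: "min \<tau> (u \<bullet> x) \<le> u \<bullet> x + t * c \<and> u \<bullet> x + t * c \<le> max \<tau> (u \<bullet> x)" if "0 \<le> t" "t \<le> l" for t
  proof (cases "0 < c")
    case True
    then have "0 \<le> t * c" "t * c \<le> l * c" using that by auto
    then show ?thesis using lc by auto
  next
    case False
    then have "t * c \<le> 0" "l * c \<le> t * c" using that c by (auto simp: mult_le_0_iff mult_right_mono_neg)
    then show ?thesis using lc by auto
  qed
  have strict: "min \<tau> (u \<bullet> x) < u \<bullet> x + t * c \<and> u \<bullet> x + t * c < max \<tau> (u \<bullet> x)" if "0 < t" "t < l" for t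
  proof (cases "0 < c")
    case True
    then have "0 < t * c" "t * c < l * c" using that by auto
    then show ?thesis using lc by auto
  next
    case False
    then have "t * c < 0" "l * c < t * c" using that c by (auto simp: mult_less_0_iff mult_strict_right_mono_neg)
    then show ?thesis using lc by auto
  qed
  have mem: "x + t *\<^sub>R s \<in> W" if "0 \<le> t" "t \<le> l" for t
  proof (rule follow[OF x s, of l])
    show "0 \<le> l" using l by simp
    show "\<alpha> \<le> u \<bullet> (x + t *\<^sub>R s) \<and> u \<bullet> (x + t *\<^sub>R s) \<le> \<beta>" if "0 \<le> t" "t \<le> l" for t
      using between[OF that] \<tau> WD(3,4)[OF x] unfolding ux by linarith
    show "u \<bullet> (x + t *\<^sub>R s) \<notin> T" if "0 < t" "t < l" for t
      using strict[OF that] crit unfolding ux by blast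
  qed fact+
  have q: "q = x + l *\<^sub>R s" by (simp add: q_def l_def c_def)
  show uq: "u \<bullet> q = \<tau>" unfolding q ux using lc by simp
  show "q \<in> V" unfolding V_def using mem[of l] l uq \<tau>(1) by (simp add: q)
  show "closed_segment x q \<subseteq> W"
  proof
    fix z assume "z \<in> closed_segment x q"
    then obtain w where w: "0 \<le> w" "w \<le> 1" "z = (1 - w) *\<^sub>R x + w *\<^sub>R q" by (auto simp: in_segment)
    have "z = x + (w * l) *\<^sub>R s" unfolding w(3) q by (simp add: algebra_simps)
    moreover have "w * l \<le> 1 * l" using w l by (intro mult_right_mono) auto
    ultimately show "z \<in> W" using mem[of "w * l"] w l by simp
  qed
qed

lemma next_time:
  assumes "\<alpha> \<le> \<sigma>" "\<sigma> < \<beta>"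
  obtains \<tau> where "\<tau> \<in> T" "\<sigma> < \<tau>" "\<tau> \<le> \<beta>" "\<And>t. t \<in> T \<Longrightarrow> \<not> (\<sigma> < t \<and> t < \<tau>)"
proof -
  define S where "S = {t\<in>T. \<sigma> < t}"
  have S: "finite S" "\<beta> \<in> S" using finite_T T_mem assms by (auto simp: S_def)
  have min: "Min S \<in> S" using S Min_in[of S] by blast
  show ?thesis
    using that[of "Min S"] min Min_le[OF S(1)] S unfolding S_def by (metis (mono_tags, lifting) linorder_not_le mem_Collect_eq)
qed

lemma prev_time:
  assumes "\<alpha> < \<sigma>" "\<sigma> \<le> \<beta>"
  obtains \<tau> where "\<tau> \<in> T" "\<tau> < \<sigma>" "\<alpha> \<le> \<tau>" "\<And>t. t \<in> T \<Longrightarrow> \<not> (\<tau> < t \<and> t < \<sigma>)"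
proof -
  define S where "S = {t\<in>T. t < \<sigma>}"
  have S: "finite S" "\<alpha> \<in> S" using finite_T T_mem assms by (auto simp: S_def)
  have max: "Max S \<in> S" using S Max_in[of S] by blast
  show ?thesis
    using that[of "Max S"] max Max_ge[OF S(1)] S unfolding S_def by (metis (mono_tags, lifting) linorder_not_le mem_Collect_eq)
qed

lemma sgn_shift: "norm s = 1 \<Longrightarrow> 0 < l \<Longrightarrow> sgn (x + l *\<^sub>R s - x) = (s::'a)"
  by (simp add: sgn_scaleR) (simp add: sgn_div_norm)

lemma out_edge:
  assumes v: "v \<in> V" "u \<bullet> v < \<beta>" and s: "s \<in> directions X v" "0 < u \<bullet> s"
  shows "\<exists>e\<in>E. fst e = v \<and> dir e = s"
proof -
  have vW: "v \<in> W" using v by (simp add: V_def)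
  have n: "norm s = 1" by (rule geodesic_network_finite_directions(3)[OF gn WD(1)[OF vW] s(1)])
  obtain \<tau> where \<tau>: "\<tau> \<in> T" "u \<bullet> v < \<tau>" "\<tau> \<le> \<beta>" "\<And>t. t \<in> T \<Longrightarrow> \<not> (u \<bullet> v < t \<and> t < \<tau>)"
    using next_time[of "u \<bullet> v"] WD(3)[OF vW] v(2) by blast
  define l where "l = (\<tau> - u \<bullet> v) / (u \<bullet> s)"
  have l: "0 < l" using \<tau> s by (simp add: l_def)
  define q where "q = v + l *\<^sub>R s"
  have q: "q \<in> V" "u \<bullet> q = \<tau>" "closed_segment v q \<subseteq> W"
    using follow_segment[OF vW s(1) \<tau>(1) _ \<tau>(3)] \<tau> l WD(3)[OF vW] unfolding q_def l_def by auto
  have "(v, q) \<in> E" unfolding E_def using v q \<tau> by simp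
  moreover have "dir (v, q) = s" using sgn_shift[OF n l, of v] by (simp add: dir_def q_def)
  ultimately show ?thesis by (intro bexI[of _ "(v, q)"]) auto
qed

lemma in_edge:
  assumes v: "v \<in> V" "\<alpha> < u \<bullet> v" and s: "s \<in> directions X v" "u \<bullet> s < 0"
  shows "\<exists>e\<in>E. snd e = v \<and> dir e = - s"
proof -
  have vW: "v \<in> W" using v by (simp add: V_def)
  have n: "norm s = 1" by (rule geodesic_network_finite_directions(3)[OF gn WD(1)[OF vW] s(1)])
  obtain \<tau> where \<tau>: "\<tau> \<in> T" "\<tau> < u \<bullet> v" "\<alpha> \<le> \<tau>" "\<And>t. t \<in> T \<Longrightarrow> \<not> (\<tau> < t \<and> t < u \<bullet> v)"
    using prev_time[of "u \<bullet> v"] WD(4)[OF vW] v(2) by blast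
  define l where "l = (\<tau> - u \<bullet> v) / (u \<bullet> s)"
  have l: "0 < l" using \<tau> s by (simp add: l_def divide_neg_neg)
  define p where "p = v + l *\<^sub>R s"
  have p: "p \<in> V" "u \<bullet> p = \<tau>" "closed_segment v p \<subseteq> W"
    using follow_segment[OF vW s(1) \<tau>(1,3)] \<tau> l WD(4)[OF vW] unfolding p_def l_def by auto
  have "(p, v) \<in> E" unfolding E_def using v p \<tau> by (simp add: closed_segment_commute)
  moreover have "dir (p, v) = - s"
  proof -
    have "dir (p, v) = - sgn (p - v)" by (simp add: dir_def sgn_minus[symmetric])
    then show ?thesis using sgn_shift[OF n l, of v] by (simp add: p_def)
  qed
  ultimately show ?thesis by (intro bexI[of _ "(p, v)"]) auto
qed

lemma E_D:
  assumes "e \<in> E"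
  shows "fst e \<in> V" "snd e \<in> V" "u \<bullet> fst e < u \<bullet> snd e" "t \<in> T \<Longrightarrow> \<not> (u \<bullet> fst e < t \<and> t < u \<bullet> snd e)"
    "closed_segment (fst e) (snd e) \<subseteq> W"
  using assms by (auto simp: E_def)

lemma E_T: "e \<in> E \<Longrightarrow> u \<bullet> fst e \<in> T" "e \<in> E \<Longrightarrow> u \<bullet> snd e \<in> T"
  using E_D(1,2)[of e] by (auto simp: V_def)

lemma E_segment:
  assumes "e \<in> E" shows "closed_segment (fst e) (snd e) = pos u e ` {u \<bullet> fst e..u \<bullet> snd e}"
proof -
  have "pos u e (u \<bullet> snd e) = snd e"
  proof -
    \<comment> \<open>A net consisting of one edge, with the empty range (0, 0] for the balance,
      gives access to \<open>pos_snd\<close>.\<close>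
    interpret n: net u "{e}" "\<lambda>_. 1" 0 0
      by unfold_locales (use norm_u E_D(3)[OF assms] in auto)
    show ?thesis by (rule n.pos_snd) simp
  qed
  moreover have "pos u e (u \<bullet> fst e) = fst e" by (simp add: pos_def)
  ultimately show ?thesis using pos_image_segment[of u e "u \<bullet> fst e" "u \<bullet> snd e"] E_D(3)[OF assms] by simp
qed

lemma E_mult:
  assumes e: "e \<in> E" and z: "z \<in> open_segment (fst e) (snd e)"
  shows "z \<in> reg_points X" "\<Theta> z = real (m e)" "1 \<le> m e" "u \<bullet> z \<notin> T" "z \<in> W"
proof -
  have reg: "z \<in> reg_points X \<and> u \<bullet> z \<notin> T \<and> z \<in> W" if z: "z \<in> open_segment (fst e) (snd e)" for z
  proof -
    obtain w where w: "0 < w" "w < 1" "z = (1 - w) *\<^sub>R fst e + w *\<^sub>R snd e" using z by (auto simp: in_segment)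
    have uz: "u \<bullet> z = u \<bullet> fst e + w * (u \<bullet> snd e - u \<bullet> fst e)" unfolding w by (simp add: inner_add_right algebra_simps)
    define d where "d = u \<bullet> snd e - u \<bullet> fst e"
    have d: "0 < d" using E_D(3)[OF e] by (simp add: d_def)
    have "0 < w * d" using w d by simp
    moreover have "w * d < 1 * d" using w d by (intro mult_strict_right_mono)
    moreover have "u \<bullet> snd e = u \<bullet> fst e + d" by (simp add: d_def)
    ultimately have "u \<bullet> fst e < u \<bullet> z" "u \<bullet> z < u \<bullet> snd e" unfolding uz d_def[symmetric] by linarith+
    then have "u \<bullet> z \<notin> T" using E_D(4)[OF e] by blast
    moreover have "z \<in> W" using E_D(5)[OF e] z by (auto simp: open_segment_def)
    ultimately show ?thesis using reg_if by blast
  qed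
  show "z \<in> reg_points X" "u \<bullet> z \<notin> T" "z \<in> W" using reg[OF z] by auto
  have ne: "fst e \<noteq> snd e" using E_D(3)[OF e] by auto
  then have mid: "midpoint (fst e) (snd e) \<in> open_segment (fst e) (snd e)" by simp
  have eq: "\<Theta> z = \<Theta> (midpoint (fst e) (snd e))"
    by (rule mult_constant_on_connected[OF N _ _ z mid]) (use reg in \<open>auto simp: convex_connected\<close>)
  obtain j :: nat where "0 < j" "\<Theta> (midpoint (fst e) (snd e)) = real j" using int reg[OF mid] unfolding integral_network_def by blast
  then show "\<Theta> z = real (m e)" "1 \<le> m e" unfolding eq m_def by auto
qed

lemma E_dir_norm: "e \<in> E \<Longrightarrow> norm (dir e) = 1"
  using E_D(3)[of e] by (auto simp: dir_def norm_sgn)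

lemma E_dir_pos: "e \<in> E \<Longrightarrow> 0 < u \<bullet> dir e"
  using E_D(3)[of e] by (auto simp: dir_def sgn_div_norm inner_diff_right intro!: mult_pos_pos)

lemma E_snd: "e \<in> E \<Longrightarrow> snd e = fst e + ((u \<bullet> snd e - u \<bullet> fst e) / (u \<bullet> dir e)) *\<^sub>R dir e"
  using E_segment[of e] net.pos_snd[of u "{e}" "\<lambda>_. 1" 0 0 e] E_D(3)[of e] norm_u
  by (simp add: net_def pos_def)

lemma E_out_dir:
  assumes e: "e \<in> E" shows "dir e \<in> directions X (fst e)" "edge_mult \<Theta> (fst e) (dir e) = real (m e)"
proof -
  have ne: "fst e \<noteq> snd e" using E_D(3)[OF e] by auto
  have sub: "closed_segment (fst e) (snd e) \<subseteq> X" using E_D(5)[OF e] WD(1) by blast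
  show "dir e \<in> directions X (fst e)" unfolding dir_def using ne by (intro segment_direction[OF sub]) auto
  define d where "d = norm (snd e - fst e)"
  have d: "0 < d" using ne by (simp add: d_def)
  have op: "fst e + t *\<^sub>R dir e \<in> open_segment (fst e) (snd e)" if "0 < t" "t < d" for t
  proof -
    have "fst e + t *\<^sub>R dir e = (1 - t / d) *\<^sub>R fst e + (t / d) *\<^sub>R snd e"
      by (simp add: dir_def sgn_div_norm d_def[symmetric] divide_inverse algebra_simps)
    then show ?thesis unfolding in_segment using that d ne by (intro conjI exI[of _ "t / d"]) auto
  qed
  have "edge_mult \<Theta> (fst e) (dir e) = \<Theta> (fst e + (d / 2) *\<^sub>R dir e)"
    by (rule edge_mult_eq[OF N, of d]) (use E_mult(1)[OF e op] d in auto)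
  also have "\<dots> = real (m e)" using d by (intro E_mult(2)[OF e] op) auto
  finally show "edge_mult \<Theta> (fst e) (dir e) = real (m e)" .
qed

lemma E_in_dir:
  assumes e: "e \<in> E" shows "- dir e \<in> directions X (snd e)" "edge_mult \<Theta> (snd e) (- dir e) = real (m e)"
proof -
  have ne: "snd e \<noteq> fst e" using E_D(3)[OF e] by auto
  have sub: "closed_segment (snd e) (fst e) \<subseteq> X" using E_D(5)[OF e] WD(1) by (metis closed_segment_commute subset_iff)
  have md: "- dir e = sgn (fst e - snd e)" by (simp add: dir_def sgn_minus[symmetric])
  show "- dir e \<in> directions X (snd e)" unfolding md using ne by (intro segment_direction[OF sub]) auto
  define d where "d = norm (snd e - fst e)"
  have d: "0 < d" using ne by (simp add: d_def)
  have op: "snd e + t *\<^sub>R (- dir e) \<in> open_segment (fst e) (snd e)" if "0 < t" "t < d" for t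
  proof -
    have "snd e + t *\<^sub>R (- dir e) = (1 - (1 - t / d)) *\<^sub>R fst e + (1 - t / d) *\<^sub>R snd e"
      by (simp add: dir_def sgn_div_norm d_def[symmetric] divide_inverse algebra_simps)
    then show ?thesis unfolding in_segment using that d ne by (intro conjI exI[of _ "1 - t / d"]) auto
  qed
  have "edge_mult \<Theta> (snd e) (- dir e) = \<Theta> (snd e + (d / 2) *\<^sub>R (- dir e))"
    by (rule edge_mult_eq[OF N, of d]) (use E_mult(1)[OF e op] d in auto)
  also have "\<dots> = real (m e)" using d by (intro E_mult(2)[OF e] op) auto
  finally show "edge_mult \<Theta> (snd e) (- dir e) = real (m e)" .
qed

text \<open>Edges span consecutive heights of \<open>T\<close>, so overlapping edges span the same
  heights; a common direction and a common point of their lines then force equal ends.\<close>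

lemma E_eq:
  assumes e: "e \<in> E" "e' \<in> E" and d: "dir e = dir e'" and z: "z = fst e + t *\<^sub>R dir e" "z = fst e' + t' *\<^sub>R dir e'"
    and over: "u \<bullet> fst e < u \<bullet> snd e'" "u \<bullet> fst e' < u \<bullet> snd e"
  shows "e = e'"
proof -
  have f: "u \<bullet> fst e = u \<bullet> fst e'"
    using E_D(4)[OF e(1) E_T(1)[OF e(2)]] E_D(4)[OF e(2) E_T(1)[OF e(1)]] over by linarith
  have s: "u \<bullet> snd e = u \<bullet> snd e'"
    using E_D(4)[OF e(1) E_T(2)[OF e(2)]] E_D(4)[OF e(2) E_T(2)[OF e(1)]] over by linarith
  have "u \<bullet> z = u \<bullet> fst e + t * (u \<bullet> dir e)" by (subst z(1)) (simp add: inner_add_right)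
  moreover have "u \<bullet> z = u \<bullet> fst e + t' * (u \<bullet> dir e)" by (subst z(2)) (simp add: inner_add_right f d)
  ultimately have "t * (u \<bullet> dir e) = t' * (u \<bullet> dir e)" by linarith
  then have "t = t'" using E_dir_pos[OF e(1)] by (simp only: mult_cancel_right) auto
  then have ff: "fst e = fst e'" using z d by simp
  then have "snd e = snd e'" using E_snd[OF e(1)] E_snd[OF e(2)] s d by simp
  then show ?thesis using ff by (simp add: prod_eq_iff)
qed

lemma E_emb_fst: "e \<in> E \<Longrightarrow> e' \<in> E \<Longrightarrow> fst e = fst e' \<Longrightarrow> dir e = dir e' \<Longrightarrow> e = e'"
  using E_eq[of e e' "fst e" 0 0] E_D(3)[of e] E_D(3)[of e'] by simp

lemma E_emb_snd:
  assumes "e \<in> E" "e' \<in> E" "snd e = snd e'" "dir e = dir e'" shows "e = e'"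
  using E_eq[OF assms(1,2,4) E_snd[OF assms(1)], folded assms(3)] E_snd[OF assms(2)] E_D(3)[OF assms(1)] E_D(3)[OF assms(2)] assms(3) by simp

lemma out_bij: "v \<in> V \<Longrightarrow> u \<bullet> v < \<beta> \<Longrightarrow> bij_betw dir {e\<in>E. fst e = v} {s\<in>directions X v. 0 < u \<bullet> s}"
proof (rule bij_betw_imageI)
  show "inj_on dir {e\<in>E. fst e = v}" using E_emb_fst by (intro inj_onI) simp
  assume v: "v \<in> V" "u \<bullet> v < \<beta>"
  show "dir ` {e\<in>E. fst e = v} = {s\<in>directions X v. 0 < u \<bullet> s}"
  proof (intro set_eqI iffI)
    fix s assume "s \<in> dir ` {e\<in>E. fst e = v}"
    then obtain e where "e \<in> E" "fst e = v" "s = dir e" by blast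
    then show "s \<in> {s\<in>directions X v. 0 < u \<bullet> s}" using E_out_dir(1)[of e] E_dir_pos[of e] by simp
  next
    fix s assume "s \<in> {s\<in>directions X v. 0 < u \<bullet> s}"
    then obtain e where "e \<in> E" "fst e = v" "dir e = s" using out_edge[OF v, of s] by blast
    then show "s \<in> dir ` {e\<in>E. fst e = v}" by blast
  qed
qed

lemma in_bij: "v \<in> V \<Longrightarrow> \<alpha> < u \<bullet> v \<Longrightarrow> bij_betw (\<lambda>e. - dir e) {e\<in>E. snd e = v} {s\<in>directions X v. u \<bullet> s < 0}"
proof (rule bij_betw_imageI)
  show "inj_on (\<lambda>e. - dir e) {e\<in>E. snd e = v}" using E_emb_snd by (intro inj_onI) simp
  assume v: "v \<in> V" "\<alpha> < u \<bullet> v"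
  show "(\<lambda>e. - dir e) ` {e\<in>E. snd e = v} = {s\<in>directions X v. u \<bullet> s < 0}"
  proof (intro set_eqI iffI)
    fix s assume "s \<in> (\<lambda>e. - dir e) ` {e\<in>E. snd e = v}"
    then obtain e where "e \<in> E" "snd e = v" "s = - dir e" by blast
    then show "s \<in> {s\<in>directions X v. u \<bullet> s < 0}" using E_in_dir(1)[of e] E_dir_pos[of e] by simp
  next
    fix s assume "s \<in> {s\<in>directions X v. u \<bullet> s < 0}"
    then obtain e where "e \<in> E" "snd e = v" "dir e = - s" using in_edge[OF v, of s] by blast
    then have "e \<in> {e\<in>E. snd e = v}" "s = - dir e" by auto
    then show "s \<in> (\<lambda>e. - dir e) ` {e\<in>E. snd e = v}" by blast
  qed
qed

text \<open>Upward directions at \<open>v\<close> correspond to outgoing edges, and the negatives of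
  downward ones to incoming edges. Transversality excludes other directions, so stationarity becomes
  the balance.\<close>

lemma E_balanced:
  assumes v: "\<alpha> < u \<bullet> v" "u \<bullet> v < \<beta>"
  shows "(\<Sum>e\<in>{e\<in>E. snd e = v}. real (m e) *\<^sub>R dir e) = (\<Sum>e\<in>{e\<in>E. fst e = v}. real (m e) *\<^sub>R dir e)"
proof (cases "v \<in> V")
  case False
  then have "{e\<in>E. snd e = v} = {}" "{e\<in>E. fst e = v} = {}" using E_D(1,2) by blast+
  then show ?thesis by (simp only: sum.empty)
next
  case True
  then have vW: "v \<in> W" by (simp add: V_def)
  let ?D = "directions X v" and ?g = "\<lambda>s. edge_mult \<Theta> v s *\<^sub>R s"
  have finD: "finite ?D" by (rule geodesic_network_finite_directions(1)[OF gn WD(1)[OF vW]])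
  have "?D = {s\<in>?D. 0 < u \<bullet> s} \<union> {s\<in>?D. u \<bullet> s < 0}" using transW[OF vW] by (auto simp: neq_iff)
  then have "(\<Sum>s\<in>?D. ?g s) = (\<Sum>s\<in>{s\<in>?D. 0 < u \<bullet> s} \<union> {s\<in>?D. u \<bullet> s < 0}. ?g s)" by (rule arg_cong)
  also have "\<dots> = (\<Sum>s\<in>{s\<in>?D. 0 < u \<bullet> s}. ?g s) + (\<Sum>s\<in>{s\<in>?D. u \<bullet> s < 0}. ?g s)"
    using finD by (intro sum.union_disjoint) auto
  also have "(\<Sum>s\<in>{s\<in>?D. 0 < u \<bullet> s}. ?g s) = (\<Sum>e\<in>{e\<in>E. fst e = v}. ?g (dir e))"
    by (rule sum.reindex_bij_betw[OF out_bij[OF True v(2)], symmetric])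
  also have "\<dots> = (\<Sum>e\<in>{e\<in>E. fst e = v}. real (m e) *\<^sub>R dir e)"
  proof (rule sum.cong[OF refl])
    fix e assume "e \<in> {e\<in>E. fst e = v}"
    then show "?g (dir e) = real (m e) *\<^sub>R dir e" using E_out_dir(2)[of e] by simp
  qed
  also have "(\<Sum>s\<in>{s\<in>?D. u \<bullet> s < 0}. ?g s) = (\<Sum>e\<in>{e\<in>E. snd e = v}. ?g (- dir e))"
    by (rule sum.reindex_bij_betw[OF in_bij[OF True v(1)], symmetric])
  also have "\<dots> = (\<Sum>e\<in>{e\<in>E. snd e = v}. - (real (m e) *\<^sub>R dir e))"
  proof (rule sum.cong[OF refl])
    fix e assume "e \<in> {e\<in>E. snd e = v}"
    then show "?g (- dir e) = - (real (m e) *\<^sub>R dir e)" using E_in_dir(2)[of e] by simp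
  qed
  finally show ?thesis
    using stationary_balance[OF st WD(1)[OF vW]] by (simp add: sum_negf)
qed

lemma slab_net: "\<alpha> \<le> a \<Longrightarrow> a \<le> b \<Longrightarrow> b < \<beta> \<Longrightarrow> net u E m a b"
proof unfold_locales
  assume ab: "\<alpha> \<le> a" "a \<le> b" "b < \<beta>"
  show "norm u = 1" "finite E" "a \<le> b" using norm_u finite_E ab by auto
  show "u \<bullet> fst e < u \<bullet> snd e" if "e \<in> E" for e by (rule E_D(3)[OF that])
  show "1 \<le> m e" if e: "e \<in> E" for e
  proof -
    have "fst e \<noteq> snd e" using E_D(3)[OF e] by auto
    then have "midpoint (fst e) (snd e) \<in> open_segment (fst e) (snd e)" by simp
    then show ?thesis by (rule E_mult(3)[OF e])
  qed
  show "e = e'" if "e \<in> E" "e' \<in> E" "fst e = fst e'" "dir e = dir e'" for e e' by (rule E_emb_fst[OF that])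
  show "e = e'" if "e \<in> E" "e' \<in> E" "snd e = snd e'" "dir e = dir e'" for e e' by (rule E_emb_snd[OF that])
  fix v assume "a < u \<bullet> v" "u \<bullet> v \<le> b"
  then show "(\<Sum>e\<in>{e\<in>E. snd e = v}. real (m e) *\<^sub>R dir e) = (\<Sum>e\<in>{e\<in>E. fst e = v}. real (m e) *\<^sub>R dir e)"
    using ab by (intro E_balanced) auto
qed

text \<open>Were a singular point a mere subdivision vertex, it would have exactly two opposite
  directions and the network would be a line near it.\<close>

lemma sing_subset:
  assumes ab: "\<alpha> \<le> a" "b < \<beta>"
  shows "{x \<in> sing_points X \<inter> R. a < u \<bullet> x \<and> u \<bullet> x \<le> b} \<subseteq> sing_vertices u E a b"
proof
  fix v assume "v \<in> {x \<in> sing_points X \<inter> R. a < u \<bullet> x \<and> u \<bullet> x \<le> b}"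
  then have v: "v \<in> sing_points X" "v \<in> R" "a < u \<bullet> v" "u \<bullet> v \<le> b" by auto
  have vX: "v \<in> X" using v(1) by (simp add: sing_points_def)
  have vW: "v \<in> W" using v ab vX by (intro WI) auto
  then have vV: "v \<in> V" using v(1) by (auto simp: V_def T_def)
  have t: "\<alpha> < u \<bullet> v" "u \<bullet> v < \<beta>" using v ab by auto
  let ?D = "directions X v"
  note D = geodesic_network_finite_directions[OF gn vX]
  obtain s where s: "s \<in> ?D" using D(2) by blast
  have ex: "\<exists>e\<in>E. fst e = v \<or> snd e = v"
  proof (cases "0 < u \<bullet> s")
    case True then show ?thesis using out_edge[OF vV t(2) s] by blast
  next
    case False
    then have "u \<bullet> s < 0" using transW[OF vW s] by simp
    then show ?thesis using in_edge[OF vV t(1) s] by blast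
  qed
  have "\<not> (\<exists>e e'. {d\<in>E. snd d = v} = {e} \<and> {d\<in>E. fst d = v} = {e'} \<and> dir e = dir e')"
  proof
    assume "\<exists>e e'. {d\<in>E. snd d = v} = {e} \<and> {d\<in>E. fst d = v} = {e'} \<and> dir e = dir e'"
    then obtain e e' where e: "{d\<in>E. snd d = v} = {e}" "{d\<in>E. fst d = v} = {e'}" "dir e = dir e'" by blast
    have "dir ` {d\<in>E. fst d = v} = {s\<in>?D. 0 < u \<bullet> s}" using out_bij[OF vV t(2)] by (rule bij_betw_imp_surj_on)
    then have o: "{s\<in>?D. 0 < u \<bullet> s} = {dir e'}" unfolding e by simp
    have "(\<lambda>e. - dir e) ` {d\<in>E. snd d = v} = {s\<in>?D. u \<bullet> s < 0}" using in_bij[OF vV t(1)] by (rule bij_betw_imp_surj_on)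
    then have i: "{s\<in>?D. u \<bullet> s < 0} = {- dir e'}" unfolding e using e(3) by simp
    have "?D = {s\<in>?D. 0 < u \<bullet> s} \<union> {s\<in>?D. u \<bullet> s < 0}" using transW[OF vW] by (auto simp: neq_iff)
    then have "?D = {dir e', - dir e'}" unfolding o i by blast
    then obtain r where "cone_at X v r {dir e', - dir e'}" using D(4) by metis
    then have "v \<in> reg_points X" unfolding reg_iff_line_at line_at_cone by blast
    then show False using v(1) by (simp add: sing_points_def)
  qed
  then show "v \<in> sing_vertices u E a b" unfolding sing_vertices_def using v ex by blast
qed

text \<open>The regular point is continued up and down to the neighbouring heights of
  \<open>T\<close>; the two collinear pieces make up one edge.\<close>

lemma interior_edge:
  assumes z: "z \<in> W" "z \<notin> V"
  shows "\<exists>e\<in>E. z \<in> open_segment (fst e) (snd e)"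
proof -
  have uT: "u \<bullet> z \<notin> T" using z by (simp add: V_def)
  then have ne: "u \<bullet> z \<noteq> \<alpha>" "u \<bullet> z \<noteq> \<beta>" using T_mem by auto
  then have t: "\<alpha> < u \<bullet> z" "u \<bullet> z < \<beta>" using WD(3,4)[OF z(1)] by auto
  obtain s where D: "directions X z = {s, - s}" and s: "0 < u \<bullet> s" "norm s = 1" by (rule reg_directions[OF z(1) uT])
  obtain \<tau> where \<tau>: "\<tau> \<in> T" "u \<bullet> z < \<tau>" "\<tau> \<le> \<beta>" "\<And>t. t \<in> T \<Longrightarrow> \<not> (u \<bullet> z < t \<and> t < \<tau>)"
    using next_time[of "u \<bullet> z"] t by (metis less_imp_le)
  obtain \<rho> where \<rho>: "\<rho> \<in> T" "\<rho> < u \<bullet> z" "\<alpha> \<le> \<rho>" "\<And>t. t \<in> T \<Longrightarrow> \<not> (\<rho> < t \<and> t < u \<bullet> z)"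
    using prev_time[of "u \<bullet> z"] t by (metis less_imp_le)
  define l where "l = (\<tau> - u \<bullet> z) / (u \<bullet> s)"
  define k where "k = (\<rho> - u \<bullet> z) / (u \<bullet> (- s))"
  have l: "0 < l" using \<tau> s by (simp add: l_def)
  have k: "0 < k" using \<rho> s unfolding k_def by (intro divide_neg_neg) auto
  define q p where "q = z + l *\<^sub>R s" and "p = z + k *\<^sub>R (- s)"
  have q: "q \<in> V" "u \<bullet> q = \<tau>" "closed_segment z q \<subseteq> W"
    using follow_segment[OF z(1) _ \<tau>(1) _ \<tau>(3), of s] D \<tau> l t unfolding q_def l_def by auto
  have p: "p \<in> V" "u \<bullet> p = \<rho>" "closed_segment z p \<subseteq> W"
    using follow_segment[OF z(1) _ \<rho>(1,3), of "- s"] D \<rho> k t unfolding p_def k_def by auto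
  define w where "w = k / (k + l)"
  have w: "0 < w" "w < 1" using k l by (auto simp: w_def)
  have wkl: "w * l = (1 - w) * k" using k l by (simp add: w_def field_simps)
  have "(1 - w) *\<^sub>R p + w *\<^sub>R q = z + (w * l - (1 - w) * k) *\<^sub>R s" unfolding p_def q_def by (simp add: algebra_simps)
  then have zw: "z = (1 - w) *\<^sub>R p + w *\<^sub>R q" using wkl by simp
  have upq: "u \<bullet> p < u \<bullet> q" using p q \<rho> \<tau> by simp
  then have pq: "p \<noteq> q" by auto
  then have zo: "z \<in> open_segment p q" unfolding in_segment using w zw by blast
  then have "closed_segment p q = closed_segment p z \<union> closed_segment z q"
    by (intro Un_closed_segment[symmetric]) (auto simp: open_segment_def)
  then have sub: "closed_segment p q \<subseteq> W" using p(3) q(3) closed_segment_commute[of p z] by simp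
  have "\<not> (u \<bullet> p < t \<and> t < u \<bullet> q)" if "t \<in> T" for t
    using \<tau>(4)[OF that] \<rho>(4)[OF that] p(2) q(2) that uT by (metis linorder_neqE_linordered_idom)
  then have "(p, q) \<in> E" unfolding E_def using p q upq sub by simp
  then show ?thesis using zo by (intro bexI[of _ "(p, q)"]) auto
qed

text \<open>A common interior point is regular and has a single upward direction, which is therefore
  the direction of both edges.\<close>

lemma open_segments_disjoint:
  assumes e: "e \<in> E" "e' \<in> E" and z: "z \<in> open_segment (fst e) (snd e)" "z \<in> open_segment (fst e') (snd e')"
  shows "e = e'"
proof -
  have zW: "z \<in> W" "u \<bullet> z \<notin> T" using E_mult(4,5)[OF e(1) z(1)] by auto
  obtain s where D: "directions X z = {s, - s}" and s: "0 < u \<bullet> s" by (rule reg_directions[OF zW])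
  have *: "dir e = s \<and> (\<exists>t. z = fst e + t *\<^sub>R dir e) \<and> u \<bullet> fst e < u \<bullet> z \<and> u \<bullet> z < u \<bullet> snd e"
    if e: "e \<in> E" and z: "z \<in> open_segment (fst e) (snd e)" for e
  proof -
    have ne: "fst e \<noteq> snd e" using E_D(3)[OF e] by auto
    have sub: "closed_segment (fst e) (snd e) \<subseteq> X" using E_D(5)[OF e] WD(1) by blast
    have "dir e \<in> directions X z" unfolding dir_def using z ne by (intro segment_direction[OF sub]) (auto simp: open_segment_def)
    then have d: "dir e = s" using D E_dir_pos[OF e] s by auto
    obtain w where w: "0 < w" "w < 1" "z = (1 - w) *\<^sub>R fst e + w *\<^sub>R snd e" using z by (auto simp: in_segment)
    define l where "l = (u \<bullet> snd e - u \<bullet> fst e) / (u \<bullet> dir e)"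
    have l: "0 < l" "l * (u \<bullet> dir e) = u \<bullet> snd e - u \<bullet> fst e" using E_D(3)[OF e] E_dir_pos[OF e] by (auto simp: l_def)
    have se: "snd e = fst e + l *\<^sub>R dir e" using E_snd[OF e] by (simp add: l_def)
    have zz: "z = fst e + (w * l) *\<^sub>R dir e" unfolding w(3) by (subst se) (simp add: algebra_simps)
    have uz: "u \<bullet> z = u \<bullet> fst e + w * (u \<bullet> snd e - u \<bullet> fst e)" unfolding zz using l by (simp add: inner_add_right mult.assoc)
    define h where "h = u \<bullet> snd e - u \<bullet> fst e"
    have h: "0 < h" using E_D(3)[OF e] by (simp add: h_def)
    have "0 < w * h" using w h by simp
    moreover have "w * h < 1 * h" using w h by (intro mult_strict_right_mono)
    moreover have "u \<bullet> snd e = u \<bullet> fst e + h" by (simp add: h_def)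
    moreover have "u \<bullet> z = u \<bullet> fst e + w * h" using uz by (simp only: h_def)
    ultimately have "u \<bullet> fst e < u \<bullet> z" "u \<bullet> z < u \<bullet> snd e" by linarith+
    then show ?thesis using d zz by blast
  qed
  obtain t t' where "z = fst e + t *\<^sub>R dir e" "z = fst e' + t' *\<^sub>R dir e'" using * e z by blast
  then show ?thesis using *[OF e(1) z(1)] *[OF e(2) z(2)] by (intro E_eq[OF e]) auto
qed

text \<open>Off the finite vertex set each point of the network in the slab lies on exactly one
  edge, so the density is a finite sum of indicators of clipped edges. The length of a clipped edge
  is its time span divided by its slope.\<close>

lemma slab_mass:
  assumes xy: "\<alpha> \<le> x" "x \<le> y" "y \<le> \<beta>"
  shows "emeasure (network_measure X \<Theta>) (R \<inter> {z. x \<le> u \<bullet> z \<and> u \<bullet> z \<le> y}) =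
     ennreal (\<Sum>e\<in>meeting u E x y. real (m e) * (span_time u x y e / (u \<bullet> dir e)))"
proof -
  interpret n: net u E m \<alpha> \<alpha> by (rule slab_net) (use \<alpha>\<beta> in auto)
  let ?A = "R \<inter> {z. x \<le> u \<bullet> z \<and> u \<bullet> z \<le> y}"
  let ?B = "meeting u E x y"
  define lo hi where "lo e = max (u \<bullet> fst e) x" and "hi e = min (u \<bullet> snd e) y" for e :: "'a edge"
  define c where "c e = closed_segment (pos u e (lo e)) (pos u e (hi e))" for e
  have lohi: "lo e \<le> hi e" if "e \<in> ?B" for e
    using that xy n.up[OF n.meetingD[OF that]] by (auto simp: lo_def hi_def meeting_def)
  have c_im: "c e = pos u e ` {lo e..hi e}" if "e \<in> ?B" for e
    unfolding c_def by (rule pos_image_segment[OF n.up[OF n.meetingD[OF that]] lohi[OF that]])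
  have seg: "closed_segment p q \<in> sets hausdorff1" for p q :: 'a by (simp add: borel_closed)
  have bA: "?A \<in> sets borel"
  proof -
    have "{z. x \<le> u \<bullet> z \<and> u \<bullet> z \<le> y} = {z. x \<le> u \<bullet> z} \<inter> {z. u \<bullet> z \<le> y}" by blast
    moreover have "closed {z. x \<le> u \<bullet> z}" "closed {z. u \<bullet> z \<le> y}" by (intro closed_Collect_le continuous_intros)+
    ultimately show ?thesis using open_R by (simp add: borel_closed closed_Int)
  qed
  have nullV: "V \<in> null_sets hausdorff1" using finite_V by (intro hausdorff1_null_countable countable_finite)
  have ptw: "ennreal (extended_mult X \<Theta> z) * indicator ?A z = (\<Sum>e\<in>?B. ennreal (real (m e)) * indicator (c e) z)"
    if zV: "z \<notin> V" for z
  proof (cases "z \<in> X \<inter> ?A")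
    case True
    then have zW: "z \<in> W" using xy by (intro WI) auto
    obtain e where e: "e \<in> E" "z \<in> open_segment (fst e) (snd e)" using interior_edge[OF zW zV] by blast
    have "z \<in> pos u e ` {u \<bullet> fst e..u \<bullet> snd e}" using e E_segment[OF e(1)] by (auto simp: open_segment_def)
    then obtain \<tau> where \<tau>: "u \<bullet> fst e \<le> \<tau>" "\<tau> \<le> u \<bullet> snd e" "z = pos u e \<tau>" by auto
    have uz: "u \<bullet> z = \<tau>" using n.u_pos[OF e(1)] \<tau> by simp
    have "\<tau> \<noteq> u \<bullet> snd e" using E_T(2)[OF e(1)] E_mult(4)[OF e] uz by auto
    then have eB: "e \<in> ?B" using e(1) \<tau> True uz by (auto simp: meeting_def)
    have "\<tau> \<in> {lo e..hi e}" using \<tau> True uz by (auto simp: lo_def hi_def)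
    then have zc: "z \<in> c e" unfolding c_im[OF eB] \<tau>(3) by (rule imageI)
    have other: "z \<notin> c e'" if e': "e' \<in> ?B" "e' \<noteq> e" for e'
    proof
      assume "z \<in> c e'"
      then have "z \<in> pos u e' ` {u \<bullet> fst e'..u \<bullet> snd e'}" unfolding c_im[OF e'(1)] lo_def hi_def by auto
      then have "z \<in> closed_segment (fst e') (snd e')" using E_segment[OF n.meetingD[OF e'(1)]] by simp
      moreover have "z \<noteq> fst e'" "z \<noteq> snd e'" using zV E_D(1,2)[OF n.meetingD[OF e'(1)]] by auto
      ultimately have "z \<in> open_segment (fst e') (snd e')" by (simp add: open_segment_def)
      then show False using open_segments_disjoint[OF n.meetingD[OF e'(1)] e(1) _ e(2)] e'(2) by blast
    qed
    have "(\<Sum>e\<in>?B. ennreal (real (m e)) * indicator (c e) z) = (\<Sum>e'\<in>?B. if e' = e then ennreal (real (m e)) else 0)"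
      using other zc by (intro sum.cong refl) auto
    also have "\<dots> = ennreal (real (m e))" using eB by (simp add: sum.delta)
    finally show ?thesis using True E_mult(1,2)[OF e] by (simp add: extended_mult_def)
  next
    case False
    have l: "ennreal (extended_mult X \<Theta> z) * indicator ?A z = 0"
    proof (cases "z \<in> ?A")
      case True
      then have "z \<notin> X" using False by blast
      then have "z \<notin> reg_points X" "z \<notin> sing_points X" using reg_points_subset[of X] by (auto simp: sing_points_def)
      then show ?thesis by (simp add: extended_mult_def)
    qed simp
    have "z \<notin> c e" if e: "e \<in> ?B" for e
    proof
      assume "z \<in> c e"
      then obtain \<tau> where \<tau>: "lo e \<le> \<tau>" "\<tau> \<le> hi e" "z = pos u e \<tau>" unfolding c_im[OF e] by auto
      then have "z \<in> pos u e ` {u \<bullet> fst e..u \<bullet> snd e}" unfolding lo_def hi_def by auto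
      then have "z \<in> W" using E_segment[OF n.meetingD[OF e]] E_D(5)[OF n.meetingD[OF e]] by blast
      moreover have "u \<bullet> z = \<tau>" using n.u_pos[OF n.meetingD[OF e]] \<tau> by simp
      ultimately have "z \<in> X \<inter> ?A" using \<tau> WD(1,2) unfolding lo_def hi_def by auto
      then show False using False by blast
    qed
    then have "(\<Sum>e\<in>?B. ennreal (real (m e)) * indicator (c e) z) = 0" by (intro sum.neutral) simp
    then show ?thesis using l by simp
  qed
  have "emeasure (network_measure X \<Theta>) ?A = (\<integral>\<^sup>+z. ennreal (extended_mult X \<Theta> z) * indicator ?A z \<partial>hausdorff1)"
    by (rule emeasure_network_measure[OF N bA])
  also have "\<dots> = (\<integral>\<^sup>+z. (\<Sum>e\<in>?B. ennreal (real (m e)) * indicator (c e) z) \<partial>hausdorff1)"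
    by (rule nn_integral_cong_AE, rule AE_I'[OF nullV]) (use ptw in blast)
  also have "\<dots> = (\<Sum>e\<in>?B. \<integral>\<^sup>+z. ennreal (real (m e)) * indicator (c e) z \<partial>hausdorff1)"
    unfolding c_def by (rule nn_integral_sum) (intro borel_measurable_times_ennreal borel_measurable_const borel_measurable_indicator seg)
  also have "\<dots> = (\<Sum>e\<in>?B. ennreal (real (m e)) * emeasure hausdorff1 (c e))"
    unfolding c_def by (intro sum.cong refl nn_integral_cmult_indicator seg)
  also have "\<dots> = (\<Sum>e\<in>?B. ennreal (real (m e) * (span_time u x y e / (u \<bullet> dir e))))"
  proof (rule sum.cong[OF refl])
    fix e assume e: "e \<in> ?B"
    have eE: "e \<in> E" by (rule n.meetingD[OF e])
    have "dist (pos u e (lo e)) (pos u e (hi e)) = norm (pos u e (hi e) - pos u e (lo e))" by (simp add: dist_norm norm_minus_commute)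
    also have "\<dots> = (hi e - lo e) / (u \<bullet> dir e)"
      unfolding n.pos_diff[OF eE] using lohi[OF e] E_dir_pos[OF eE] E_dir_norm[OF eE] by simp
    also have "hi e - lo e = span_time u x y e" by (simp add: hi_def lo_def span_time_def)
    finally have "emeasure hausdorff1 (c e) = ennreal (span_time u x y e / (u \<bullet> dir e))"
      by (simp add: c_def emeasure_hausdorff1_closed_segment)
    then show "ennreal (real (m e)) * emeasure hausdorff1 (c e) = ennreal (real (m e) * (span_time u x y e / (u \<bullet> dir e)))"
      using n.span_nonneg[OF e xy(2)] E_dir_pos[OF eE] by (simp only:) (intro ennreal_mult[symmetric], auto)
  qed
  also have "\<dots> = ennreal (\<Sum>e\<in>?B. real (m e) * (span_time u x y e / (u \<bullet> dir e)))"
  proof (rule sum_ennreal)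
    fix e assume e: "e \<in> ?B"
    show "0 \<le> real (m e) * (span_time u x y e / (u \<bullet> dir e))"
      using n.span_nonneg[OF e xy(2)] E_dir_pos[OF n.meetingD[OF e]] by simp
  qed
  finally show ?thesis .
qed

end

section \<open>Networks close to a line\<close>

context net begin

text \<open>The boundary term in the first variation of length along the vector field
  \<open>perp u (z - p)\<close>. It is the analogue of \<open>G\<close> with \<open>u\<close> in
  place of \<open>f\<close>, available before the direction of the flux is controlled.\<close>

definition lateral where "lateral p t = (\<Sum>e\<in>cross u E t. real (m e) * (dir e \<bullet> perp u (pos u e t - p)))"

text \<open>Per unit of time an edge of slope c contributes 1 / c - c: its length minus its
  component of the flux. So small lateral distances force the flux to be almost as large as the mass
  per unit of time.\<close>

lemma lateral_diff:
  assumes xy: "a \<le> x" "x \<le> y" "y \<le> b"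
  shows "lateral p y - lateral p x = (\<Sum>e\<in>meeting u E x y. real (m e) * (span_time u x y e / (u \<bullet> dir e))) - (y - x) * (flux u E m a \<bullet> u)"
proof -
  have "lateral p y - lateral p x = (\<Sum>e\<in>meeting u E x y. real (m e) * (dir e \<bullet> perp u (pos u e (min (u \<bullet> snd e) y) - p) - dir e \<bullet> perp u (pos u e (max (u \<bullet> fst e) x) - p)))"
    unfolding lateral_def using xy by (intro evolve_inner[where W="\<lambda>v s. s \<bullet> perp u (v - p)"]) (auto simp: linear_iff inner_add_left)
  also have "\<dots> = (\<Sum>e\<in>meeting u E x y. real (m e) * (span_time u x y e / (u \<bullet> dir e)) - ((real (m e) * span_time u x y e) *\<^sub>R dir e) \<bullet> u)"
  proof (rule sum.cong[OF refl])
    fix e assume "e \<in> meeting u E x y"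
    then have e: "e \<in> E" by (rule meetingD)
    define c where "c = u \<bullet> dir e"
    have c: "0 < c" using slope_pos[OF e] by (simp add: c_def)
    have P: "dir e \<bullet> perp u (dir e) = 1 - c * c"
      using dir_inner_dir[OF e] by (simp add: perp_def inner_diff_right c_def inner_commute)
    have "dir e \<bullet> perp u (pos u e (min (u \<bullet> snd e) y) - p) - dir e \<bullet> perp u (pos u e (max (u \<bullet> fst e) x) - p)
       = dir e \<bullet> perp u ((span_time u x y e / c) *\<^sub>R dir e)"
      by (simp add: inner_diff_right[symmetric] perp_diff[symmetric] pos_diff[OF e] span_time_def c_def)
    also have "\<dots> = span_time u x y e / c * (1 - c * c)" by (simp add: perp_scale P)
    also have "\<dots> = span_time u x y e / c - span_time u x y e * c" using c by (simp add: field_simps)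
    finally show "real (m e) * (dir e \<bullet> perp u (pos u e (min (u \<bullet> snd e) y) - p) - dir e \<bullet> perp u (pos u e (max (u \<bullet> fst e) x) - p)) =
       real (m e) * (span_time u x y e / (u \<bullet> dir e)) - ((real (m e) * span_time u x y e) *\<^sub>R dir e) \<bullet> u"
      by (simp add: c_def inner_commute[of "dir e" u] right_diff_distrib)
  qed
  also have "\<dots> = (\<Sum>e\<in>meeting u E x y. real (m e) * (span_time u x y e / (u \<bullet> dir e))) - ((y - x) *\<^sub>R flux u E m a) \<bullet> u"
    unfolding sum_subtractf inner_sum_left[symmetric] flux_time_integral[OF xy] ..
  finally show ?thesis by simp
qed

lemma span_le_length: "x \<le> y \<Longrightarrow> (\<Sum>e\<in>meeting u E x y. real (m e) * span_time u x y e) \<le> (\<Sum>e\<in>meeting u E x y. real (m e) * (span_time u x y e / (u \<bullet> dir e)))"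
proof (intro sum_mono mult_left_mono)
  fix e assume xy: "x \<le> y" and e: "e \<in> meeting u E x y"
  have c: "0 < u \<bullet> dir e" "u \<bullet> dir e \<le> 1" using slope_pos slope_le_1 meetingD[OF e] by auto
  then show "span_time u x y e \<le> span_time u x y e / (u \<bullet> dir e)"
    using span_nonneg[OF e xy] by (simp add: pos_le_divide_eq mult_left_le)
qed simp

lemma lateral_mono:
  assumes xy: "a \<le> x" "x \<le> y" "y \<le> b"
  shows "lateral p x \<le> lateral p y"
proof -
  have "(y - x) * (flux u E m a \<bullet> u) = (\<Sum>e\<in>meeting u E x y. (real (m e) * span_time u x y e) *\<^sub>R dir e) \<bullet> u"
    unfolding flux_time_integral[OF xy] by simp
  also have "\<dots> = (\<Sum>e\<in>meeting u E x y. real (m e) * span_time u x y e * (u \<bullet> dir e))"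
    unfolding inner_commute[of _ u] by (simp add: inner_sum_right)
  also have "\<dots> \<le> (\<Sum>e\<in>meeting u E x y. real (m e) * span_time u x y e * 1)"
    using slope_le_1 meetingD span_nonneg xy by (intro sum_mono mult_left_mono mult_nonneg_nonneg) auto
  also have "\<dots> \<le> (\<Sum>e\<in>meeting u E x y. real (m e) * (span_time u x y e / (u \<bullet> dir e)))"
    using span_le_length[OF xy(2)] by simp
  finally show ?thesis using lateral_diff[OF xy, of p] by linarith
qed

lemma lateral_bound:
  assumes "\<And>e. e \<in> cross u E t \<Longrightarrow> norm (perp u (pos u e t - p)) \<le> h"
  shows "\<bar>lateral p t\<bar> \<le> real (crossing_mult u E m t) * h"
proof -
  have "\<bar>lateral p t\<bar> \<le> (\<Sum>e\<in>cross u E t. \<bar>real (m e) * (dir e \<bullet> perp u (pos u e t - p))\<bar>)"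
    unfolding lateral_def by (rule sum_abs)
  also have "\<dots> \<le> (\<Sum>e\<in>cross u E t. real (m e) * h)"
  proof (rule sum_mono)
    fix e assume e: "e \<in> cross u E t"
    have "\<bar>dir e \<bullet> perp u (pos u e t - p)\<bar> \<le> norm (dir e) * norm (perp u (pos u e t - p))" by (rule Cauchy_Schwarz_ineq2)
    also have "\<dots> \<le> h" using norm_dir[OF crossD[OF e]] assms[OF e] by simp
    finally show "\<bar>real (m e) * (dir e \<bullet> perp u (pos u e t - p))\<bar> \<le> real (m e) * h" by (simp add: abs_mult mult_left_mono)
  qed
  finally show ?thesis by (simp add: real_crossing_mult sum_distrib_right)
qed

text \<open>Otherwise the time integral of the multiplicity, which is at most the mass in the slab,
  would be at least k + 1.\<close>

lemma low_crossing_exists: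
  assumes "x + 1 = y" and M: "(\<Sum>e\<in>meeting u E x y. real (m e) * (span_time u x y e / (u \<bullet> dir e))) < real k + 1"
  shows "\<exists>t. x \<le> t \<and> t \<le> y \<and> crossing_mult u E m t \<le> k"
proof (rule ccontr)
  assume no: "\<not> ?thesis"
  have xy: "x \<le> y" using assms by simp
  have ge: "real (k + 1) \<le> real (crossing_mult u E m t)" if "t \<in> {x..y}" for t
  proof -
    have "\<not> crossing_mult u E m t \<le> k" using no that by auto
    then have "k + 1 \<le> crossing_mult u E m t" by simp
    then show ?thesis by (simp only: of_nat_le_iff)
  qed
  have "((\<lambda>t. real (k + 1)) has_integral real (k + 1) * (y - x)) {x..y}"
    using has_integral_const_real[of "real (k + 1)" x y] xy by (simp add: mult.commute)
  then have "real (k + 1) * (y - x) \<le> (\<Sum>e\<in>meeting u E x y. real (m e) * span_time u x y e)"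
    using mult_time_integral[OF xy] ge by (rule has_integral_le)
  then have "real k + 1 \<le> (\<Sum>e\<in>meeting u E x y. real (m e) * span_time u x y e)"
    using assms(1) by (simp add: \<open>x + 1 = y\<close>[symmetric] add.commute)
  then show False using span_le_length[OF xy] M by linarith
qed

end

text \<open>Finitely many hyperplanes form a null set and cannot fill a ball around
  \<open>w\<close>; normalising at most doubles the distance to \<open>w\<close>.\<close>

lemma generic_direction:
  fixes w :: "'a::euclidean_space"
  assumes "finite D" "0 \<notin> D" "norm w = 1" "0 < \<delta>"
  shows "\<exists>u. norm u = 1 \<and> norm (u - w) < \<delta> \<and> (\<forall>s\<in>D. u \<bullet> s \<noteq> 0)"
proof -
  define d where "d = min \<delta> 1 / 2"
  have d: "0 < d" "d \<le> \<delta> / 2" "d \<le> 1/2" using assms by (auto simp: d_def)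
  have "negligible (\<Union>s\<in>D. {x. s \<bullet> x = 0})"
    using assms by (intro negligible_Union) (auto intro: negligible_hyperplane)
  moreover have "\<not> negligible (ball w d)" using d by (intro open_not_negligible) auto
  ultimately obtain v where v: "v \<in> ball w d" "v \<notin> (\<Union>s\<in>D. {x. s \<bullet> x = 0})"
    using negligible_subset by blast
  have vw: "norm (v - w) < d" using v by (simp add: dist_norm norm_minus_commute)
  have nv: "\<bar>norm v - 1\<bar> < d" using norm_triangle_ineq3[of v w] vw assms(3) by linarith
  then have "v \<noteq> 0" using d by auto
  have "sgn v - v = (1 - norm v) *\<^sub>R sgn v" using \<open>v \<noteq> 0\<close> by (simp add: sgn_div_norm algebra_simps)
  then have "norm (sgn v - v) = \<bar>1 - norm v\<bar>" using \<open>v \<noteq> 0\<close> by (simp add: norm_sgn)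
  then have "norm (sgn v - w) < 2 * d" using norm_triangle_ineq[of "sgn v - v" "v - w"] vw nv by simp
  moreover have "sgn v \<bullet> s \<noteq> 0" if "s \<in> D" for s
    using v(2) that \<open>v \<noteq> 0\<close> by (auto simp: sgn_div_norm inner_commute)
  ultimately show ?thesis using \<open>v \<noteq> 0\<close> d by (intro exI[of _ "sgn v"]) (auto simp: norm_sgn)
qed

text \<open>Near a point all directions are those of its cone or their opposites; a finite cover
  finishes the proof.\<close>

lemma finite_directions_compact:
  fixes X :: "'a::euclidean_space set"
  assumes gn: "geodesic_network X" and "compact C"
  shows "finite (\<Union>x\<in>X \<inter> C. directions X x)"
proof -
  have "\<exists>U. open U \<and> x \<in> U \<and> finite (\<Union>y\<in>X \<inter> U. directions X y)" for x
  proof (cases "x \<in> X")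
    case False
    have "X \<inter> - X = {}" by blast
    then show ?thesis using False gn by (intro exI[of _ "- X"]) (auto simp: geodesic_network_def)
  next
    case True
    obtain r D where c: "cone_at X x r D" by (rule geodesic_network_cone[OF gn True])
    have "directions X y \<subseteq> D \<union> uminus ` D" if y: "y \<in> X \<inter> ball x r" for y
    proof -
      obtain s t where s: "s \<in> D" "0 \<le> t" "t < r" "y = x + t *\<^sub>R s" using c y unfolding cone_at_def by blast
      show ?thesis
      proof (cases "t = 0")
        case True then show ?thesis using s cone_at_directions[OF c] by simp
      next
        case False
        then obtain r' where "line_at X y s r'" using cone_at_ray_line[OF c s(1) _ s(3)] s(2,4) by auto
        then show ?thesis using line_at_directions[of X y s r'] s(1) by auto
      qed
    qed
    then have "(\<Union>y\<in>X \<inter> ball x r. directions X y) \<subseteq> D \<union> uminus ` D" by blast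
    moreover have "finite (D \<union> uminus ` D)" using c by (simp add: cone_at_def)
    ultimately have "finite (\<Union>y\<in>X \<inter> ball x r. directions X y)" by (rule finite_subset)
    then show ?thesis using c by (intro exI[of _ "ball x r"]) (simp add: cone_at_def)
  qed
  then obtain U where U: "\<And>x. open (U x) \<and> x \<in> U x \<and> finite (\<Union>y\<in>X \<inter> U x. directions X y)" by metis
  obtain F where F: "F \<subseteq> C" "finite F" "C \<subseteq> (\<Union>x\<in>F. U x)"
    using compactE_image[OF assms(2), of C U] U by blast
  have "(\<Union>x\<in>X \<inter> C. directions X x) \<subseteq> (\<Union>z\<in>F. \<Union>y\<in>X \<inter> U z. directions X y)" using F(3) by blast
  moreover have "finite (\<Union>z\<in>F. \<Union>y\<in>X \<inter> U z. directions X y)" by (rule finite_UN_I[OF F(2)]) (use U in blast)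
  ultimately show ?thesis by (rule finite_subset)
qed

lemma norm_perp_tilt:
  fixes u w z :: "'a::euclidean_space"
  assumes "norm u = 1" "norm w = 1" "norm z \<le> \<rho>" "norm (u - w) * \<rho> \<le> \<sigma>"
  shows "\<bar>z \<bullet> u - z \<bullet> w\<bar> \<le> \<sigma>" "norm (perp u z) \<le> norm (perp w z) + 2 * \<sigma>"
proof -
  have "\<bar>z \<bullet> (u - w)\<bar> \<le> norm z * norm (u - w)" by (rule Cauchy_Schwarz_ineq2)
  also have "\<dots> \<le> \<rho> * norm (u - w)" using assms by (intro mult_right_mono) auto
  also have "\<dots> \<le> \<sigma>" using assms(4) by (simp add: mult.commute)
  finally show 1: "\<bar>z \<bullet> u - z \<bullet> w\<bar> \<le> \<sigma>" by (simp add: inner_diff_right)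
  have "\<bar>z \<bullet> u\<bar> \<le> \<rho>" using Cauchy_Schwarz_ineq2[of z u] assms by simp
  then have "\<bar>z \<bullet> u\<bar> * norm (u - w) \<le> \<rho> * norm (u - w)" by (intro mult_right_mono) auto
  then have 2: "\<bar>z \<bullet> u\<bar> * norm (u - w) \<le> \<sigma>" using assms(4) by (simp add: mult.commute)
  have "perp u z = perp w z - ((z \<bullet> u - z \<bullet> w) *\<^sub>R w + (z \<bullet> u) *\<^sub>R (u - w))"
    by (simp add: perp_def algebra_simps)
  then have "norm (perp u z) \<le> norm (perp w z) + norm ((z \<bullet> u - z \<bullet> w) *\<^sub>R w + (z \<bullet> u) *\<^sub>R (u - w))"
    using norm_triangle_ineq4 by metis
  also have "norm ((z \<bullet> u - z \<bullet> w) *\<^sub>R w + (z \<bullet> u) *\<^sub>R (u - w)) \<le> \<bar>z \<bullet> u - z \<bullet> w\<bar> + \<bar>z \<bullet> u\<bar> * norm (u - w)"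
    using norm_triangle_ineq[of "(z \<bullet> u - z \<bullet> w) *\<^sub>R w" "(z \<bullet> u) *\<^sub>R (u - w)"] assms(2) by simp
  finally show "norm (perp u z) \<le> norm (perp w z) + 2 * \<sigma>" using 1 2 by simp
qed

lemma norm_le_perp_inner:
  assumes "norm (w::'a::euclidean_space) = 1" shows "norm z \<le> \<bar>z \<bullet> w\<bar> + norm (perp w z)"
proof -
  have "z = (z \<bullet> w) *\<^sub>R w + perp w z" by (simp add: perp_def)
  then have "norm z \<le> norm ((z \<bullet> w) *\<^sub>R w) + norm (perp w z)" by (metis norm_triangle_ineq)
  then show ?thesis using assms by simp
qed

text \<open>A generic \<open>u\<close> near \<open>w\<close> serves as time. On either side beyond
  \<open>K\<close> there is a slice of multiplicity at most \<open>k\<close>, since the mass of a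
  unit slab is below k + 1. Between these slices \<open>lateral\<close> hardly changes, so the mass
  near \<open>p\<close> forces the flux component to be almost \<open>k\<close>; hence both
  multiplicities equal \<open>k\<close> and the net between them is thin.\<close>

lemma network_near_line_count:
  fixes X :: "'a::euclidean_space set" and k :: nat
  assumes C: "\<And>(u::'a) E m a b. thin_net u E m a b k \<Longrightarrow> real k - flux u E m a \<bullet> u \<le> flux_defect k \<Longrightarrow> card (sing_vertices u E a b) \<le> C"
    and k: "1 \<le> k" and w: "norm w = 1" and r: "0 \<le> r" and \<sigma>: "0 < \<sigma>" "\<sigma> \<le> 1" and T: "T = r + 1"
    and st: "stationary_network X \<Theta>" and int: "integral_network X \<Theta>"
    and near: "\<And>x. x \<in> X \<Longrightarrow> norm (x - p) \<le> T + 10 \<Longrightarrow> norm (perp w (x - p)) < \<sigma>"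
    and up1: "emeasure (network_measure X \<Theta>) {x. norm (x - p) \<le> T + 10 \<and> - T - 2 - \<sigma> \<le> (x - p) \<bullet> w \<and> (x - p) \<bullet> w \<le> - T - 1 + \<sigma>} \<le> ennreal (real k + 3/4)"
    and up2: "emeasure (network_measure X \<Theta>) {x. norm (x - p) \<le> T + 10 \<and> T + 1 - \<sigma> \<le> (x - p) \<bullet> w \<and> (x - p) \<bullet> w \<le> T + 2 + \<sigma>} \<le> ennreal (real k + 3/4)"
    and low: "ennreal (2 * real k - \<kappa>) \<le> emeasure (network_measure X \<Theta>) {x. norm (x - p) < T + 9 \<and> - 1 + \<sigma> < (x - p) \<bullet> w \<and> (x - p) \<bullet> w < 1 - \<sigma>}"
    and small: "\<kappa> / 2 + 3 * real k * \<sigma> \<le> flux_defect k"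
    and K: "K \<subseteq> cball p r"
  shows "finite (sing_points X \<inter> K) \<and> card (sing_points X \<inter> K) \<le> C"
proof -
  let ?\<mu> = "network_measure X \<Theta>"
  have N: "network_with_mult X \<Theta>" and gn: "geodesic_network X"
    using st by (auto simp: stationary_network_def network_with_mult_def)
  have clX: "closed X" using gn by (simp add: geodesic_network_def)
  have T0: "1 \<le> T" using r T by simp
  define D where "D = (\<Union>x\<in>X \<inter> cball p (T + 10). directions X x)"
  have "finite D" unfolding D_def by (rule finite_directions_compact[OF gn]) simp
  moreover have "0 \<notin> D"
  proof
    assume "0 \<in> D"
    then obtain x where "x \<in> X" "0 \<in> directions X x" unfolding D_def by blast
    then have "norm (0::'a) = 1" by (rule geodesic_network_finite_directions(3)[OF gn])
    then show False by simp
  qed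
  moreover have "0 < \<sigma> / (T + 10)" using \<sigma> T0 by simp
  ultimately obtain u where u: "norm u = 1" "norm (u - w) < \<sigma> / (T + 10)" "\<And>s. s \<in> D \<Longrightarrow> u \<bullet> s \<noteq> 0"
    using generic_direction[of D w "\<sigma> / (T + 10)"] w by blast
  have tilt: "norm (u - w) * (T + 10) \<le> \<sigma>" using u(2) T0 by (simp add: less_divide_eq)
  define a0 where "a0 = u \<bullet> p"
  have time: "\<bar>(u \<bullet> x - a0) - (x - p) \<bullet> w\<bar> \<le> \<sigma>" if "norm (x - p) \<le> T + 10" for x
    using norm_perp_tilt(1)[OF u(1) w that tilt] by (simp add: a0_def inner_diff_right inner_commute[of "x - p" u])
  have lat: "norm (perp u (x - p)) \<le> 3 * \<sigma>" if "x \<in> X" "norm (x - p) \<le> T + 10" for x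
    using norm_perp_tilt(2)[OF u(1) w that(2) tilt] near[OF that] by simp
  define \<alpha> \<beta> where "\<alpha> = a0 - T - 3" and "\<beta> = a0 + T + 3"
  let ?R = "ball p (T + 9)"
  \<comment> \<open>Within the slab the network is at distance less than T + 5 from
    \<open>p\<close>. It stays off the boundary of the window, so the open and the closed ball cut
    out the same, compact, set.\<close>
  have inner: "norm (x - p) < T + 9" if x: "x \<in> X" "norm (x - p) \<le> T + 9" "\<alpha> \<le> u \<bullet> x" "u \<bullet> x \<le> \<beta>" for x
  proof -
    have "\<bar>(x - p) \<bullet> w\<bar> \<le> T + 4" using time[of x] x \<sigma> by (auto simp: \<alpha>_def \<beta>_def)
    moreover have "norm (perp w (x - p)) < 1" using near[OF x(1)] x(2) \<sigma> by simp
    ultimately show ?thesis using norm_le_perp_inner[OF w, of "x - p"] by linarith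
  qed
  have "X \<inter> ?R \<inter> {x. \<alpha> \<le> u \<bullet> x \<and> u \<bullet> x \<le> \<beta>} = X \<inter> cball p (T + 9) \<inter> ({x. \<alpha> \<le> u \<bullet> x} \<inter> {x. u \<bullet> x \<le> \<beta>})"
    using inner by (auto simp: dist_norm norm_minus_commute less_imp_le)
  moreover have "compact (X \<inter> cball p (T + 9) \<inter> ({x. \<alpha> \<le> u \<bullet> x} \<inter> {x. u \<bullet> x \<le> \<beta>}))"
    using clX by (intro compact_Int_closed closed_Int closed_Int_compact closed_Collect_le continuous_intros) auto
  ultimately have cW: "compact (X \<inter> ?R \<inter> {x. \<alpha> \<le> u \<bullet> x \<and> u \<bullet> x \<le> \<beta>})" by simp
  interpret sn: slab_network X \<Theta> u \<alpha> \<beta> ?R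
  proof unfold_locales
    show "\<alpha> < \<beta>" using T0 by (simp add: \<alpha>_def \<beta>_def)
    show "open ?R" by simp
    fix x s assume "x \<in> X \<inter> ?R" "s \<in> directions X x"
    then have "s \<in> D" unfolding D_def by (auto simp: less_imp_le)
    then show "u \<bullet> s \<noteq> 0" by (rule u(3))
  qed (use st int u(1) cW in auto)
  \<comment> \<open>Strictly below \<beta>, as \<open>slab_net\<close> requires, and above every
    candidate for the upper slice.\<close>
  define b' where "b' = a0 + T + 5/2"
  interpret n: net u sn.E sn.m \<alpha> b' by (rule sn.slab_net) (use T0 in \<open>auto simp: \<alpha>_def \<beta>_def b'_def\<close>)
  let ?N = "crossing_mult u sn.E sn.m"
  let ?F = "flux u sn.E sn.m \<alpha>"
  let ?M = "\<lambda>x y. \<Sum>e\<in>meeting u sn.E x y. real (sn.m e) * (span_time u x y e / (u \<bullet> dir e))"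
  have M0: "0 \<le> ?M x y" if "x \<le> y" for x y
    using n.span_nonneg[OF _ that] n.slope_pos n.meetingD by (intro sum_nonneg mult_nonneg_nonneg divide_nonneg_pos) auto
  have posW: "pos u e t \<in> X \<and> norm (pos u e t - p) \<le> T + 10" if e: "e \<in> cross u sn.E t" for e t
  proof -
    have eE: "e \<in> sn.E" by (rule n.crossD[OF e])
    have "pos u e t \<in> pos u e ` {u \<bullet> fst e..u \<bullet> snd e}" using e by (intro imageI) (auto simp: cross_def)
    then have "pos u e t \<in> sn.W" using sn.E_segment[OF eE] sn.E_D(5)[OF eE] by blast
    then have "pos u e t \<in> X" "pos u e t \<in> ?R" using sn.WD(1,2) by blast+
    then show ?thesis by (auto simp: dist_norm norm_minus_commute)
  qed
  have latb: "\<bar>n.lateral p t\<bar> \<le> real (?N t) * (3 * \<sigma>)" for t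
    by (rule n.lateral_bound) (use lat posW in blast)
  have bset: "{x. norm (x - p) \<le> T + 10 \<and> c \<le> (x - p) \<bullet> w \<and> (x - p) \<bullet> w \<le> d} \<in> sets borel" for c d
    by (intro borel_closed closed_Collect_conj closed_Collect_le continuous_intros)
  have find: "\<exists>t. x \<le> t \<and> t \<le> y \<and> ?N t \<le> k"
    if xy: "x + 1 = y" "\<alpha> \<le> x" "y \<le> \<beta>" and mass: "emeasure ?\<mu> {z. norm (z - p) \<le> T + 10 \<and> x - a0 - \<sigma> \<le> (z - p) \<bullet> w \<and> (z - p) \<bullet> w \<le> y - a0 + \<sigma>} \<le> ennreal (real k + 3/4)" for x y
  proof -
    have xy': "x \<le> y" using xy by simp
    have "ennreal (?M x y) = emeasure ?\<mu> (?R \<inter> {z. x \<le> u \<bullet> z \<and> u \<bullet> z \<le> y})"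
      by (rule sn.slab_mass[symmetric, OF xy(2) xy' xy(3)])
    also have "\<dots> \<le> emeasure ?\<mu> {z. norm (z - p) \<le> T + 10 \<and> x - a0 - \<sigma> \<le> (z - p) \<bullet> w \<and> (z - p) \<bullet> w \<le> y - a0 + \<sigma>}"
    proof (rule emeasure_mono)
      show "?R \<inter> {z. x \<le> u \<bullet> z \<and> u \<bullet> z \<le> y} \<subseteq> {z. norm (z - p) \<le> T + 10 \<and> x - a0 - \<sigma> \<le> (z - p) \<bullet> w \<and> (z - p) \<bullet> w \<le> y - a0 + \<sigma>}"
      proof
        fix z assume z: "z \<in> ?R \<inter> {z. x \<le> u \<bullet> z \<and> u \<bullet> z \<le> y}"
        then have "norm (z - p) \<le> T + 10" by (auto simp: dist_norm norm_minus_commute)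
        then show "z \<in> {z. norm (z - p) \<le> T + 10 \<and> x - a0 - \<sigma> \<le> (z - p) \<bullet> w \<and> (z - p) \<bullet> w \<le> y - a0 + \<sigma>}"
          using time[of z] z by auto
      qed
      show "{z. norm (z - p) \<le> T + 10 \<and> x - a0 - \<sigma> \<le> (z - p) \<bullet> w \<and> (z - p) \<bullet> w \<le> y - a0 + \<sigma>} \<in> sets ?\<mu>"
        using bset by simp
    qed
    also note mass
    finally have "ennreal (?M x y) \<le> ennreal (real k + 3/4)" .
    then have "?M x y \<le> real k + 3/4" by (rule ennreal_le_iff[THEN iffD1, rotated]) simp
    then show ?thesis by (intro n.low_crossing_exists[OF xy(1)]) simp
  qed
  obtain a1 where a1: "a0 - T - 2 \<le> a1" "a1 \<le> a0 - T - 1" "?N a1 \<le> k"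
    using find[of "a0 - T - 2" "a0 - T - 1"] up1 T0 by (auto simp: \<alpha>_def \<beta>_def)
  obtain b1 where b1: "a0 + T + 1 \<le> b1" "b1 \<le> a0 + T + 2" "?N b1 \<le> k"
    using find[of "a0 + T + 1" "a0 + T + 2"] up2 T0 by (auto simp: \<alpha>_def \<beta>_def)
  have order: "\<alpha> \<le> a1" "a1 \<le> a0 - 1" "a0 + 1 \<le> b1" "b1 \<le> b'" "a1 \<le> b1" using a1 b1 T0 by (auto simp: \<alpha>_def b'_def)
  \<comment> \<open>Both slices have multiplicity at most \<open>k\<close>, and all their points
    have lateral distance at most 3 \<sigma>, tilt included.\<close>
  have lat1: "n.lateral p b1 - n.lateral p a1 \<le> 6 * real k * \<sigma>"
  proof -
    have "real (?N t) * (3 * \<sigma>) \<le> real k * (3 * \<sigma>)" if "?N t \<le> k" for t using that \<sigma> by (intro mult_right_mono) auto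
    then have "\<bar>n.lateral p b1\<bar> \<le> real k * (3 * \<sigma>)" "\<bar>n.lateral p a1\<bar> \<le> real k * (3 * \<sigma>)" using latb a1 b1 by (meson order_trans)+
    then show ?thesis by (simp add: abs_le_iff)
  qed
  have "2 * real k - \<kappa> \<le> ?M (a0 - 1) (a0 + 1)"
  proof -
    have "ennreal (2 * real k - \<kappa>) \<le> emeasure ?\<mu> (?R \<inter> {z. a0 - 1 \<le> u \<bullet> z \<and> u \<bullet> z \<le> a0 + 1})"
    proof (rule order_trans[OF low], rule emeasure_mono)
      show "{x. norm (x - p) < T + 9 \<and> - 1 + \<sigma> < (x - p) \<bullet> w \<and> (x - p) \<bullet> w < 1 - \<sigma>} \<subseteq> ?R \<inter> {z. a0 - 1 \<le> u \<bullet> z \<and> u \<bullet> z \<le> a0 + 1}"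
      proof
        fix z assume z: "z \<in> {x. norm (x - p) < T + 9 \<and> - 1 + \<sigma> < (x - p) \<bullet> w \<and> (x - p) \<bullet> w < 1 - \<sigma>}"
        then show "z \<in> ?R \<inter> {z. a0 - 1 \<le> u \<bullet> z \<and> u \<bullet> z \<le> a0 + 1}"
          using time[of z] by (auto simp: dist_norm norm_minus_commute)
      qed
      have "{z. a0 - 1 \<le> u \<bullet> z \<and> u \<bullet> z \<le> a0 + 1} \<in> sets borel"
        by (intro borel_closed closed_Collect_conj closed_Collect_le continuous_intros)
      then show "?R \<inter> {z. a0 - 1 \<le> u \<bullet> z \<and> u \<bullet> z \<le> a0 + 1} \<in> sets ?\<mu>" by (simp add: sets.Int)
    qed
    also have "\<dots> = ennreal (?M (a0 - 1) (a0 + 1))" using T0 by (intro sn.slab_mass) (auto simp: \<alpha>_def \<beta>_def)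
    finally have "ennreal (2 * real k - \<kappa>) \<le> ennreal (?M (a0 - 1) (a0 + 1))" .
    then show ?thesis by (rule ennreal_le_iff[THEN iffD1, rotated]) (rule M0, simp)
  qed
  moreover have "n.lateral p (a0 + 1) - n.lateral p (a0 - 1) = ?M (a0 - 1) (a0 + 1) - 2 * (?F \<bullet> u)"
    using n.lateral_diff[of "a0 - 1" "a0 + 1" p] order by simp
  \<comment> \<open>Monotonicity transfers the bound from the distant slices to the central slab of
    width 2, where a lower bound for the mass is available.\<close>
  moreover have "n.lateral p (a0 + 1) \<le> n.lateral p b1" "n.lateral p a1 \<le> n.lateral p (a0 - 1)"
    using order by (auto intro!: n.lateral_mono)
  ultimately have Fu: "real k - ?F \<bullet> u \<le> \<kappa> / 2 + 3 * real k * \<sigma>" using lat1 by (simp add: field_simps)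
  then have Fd: "real k - ?F \<bullet> u \<le> flux_defect k" using small by simp
  have Fd': "real k - ?F \<bullet> u \<le> 1 / (512 * (real k)\<^sup>2)" using Fd flux_defect_le[OF k] by simp
  also have "\<dots> \<le> 1/2"
  proof -
    have "1 \<le> (real k)\<^sup>2" using k by (simp add: one_le_power)
    then have "2 \<le> 512 * (real k)\<^sup>2" by linarith
    then show ?thesis by (intro frac_le) auto
  qed
  finally have Fk: "real k - ?F \<bullet> u \<le> 1/2" .
  have Neq: "?N t = k" if "?N t \<le> k" "\<alpha> \<le> t" "t \<le> b'" for t
  proof -
    have "?F \<bullet> u \<le> real (?N t)" using n.flux_inner_le[of t] n.flux_const[OF that(2,3)] by simp
    then have "real k < real (?N t) + 1" using Fk by linarith
    then show ?thesis using that by linarith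
  qed
  interpret s: net u sn.E sn.m a1 b1 by (rule n.net_sub) (use order in auto)
  have fl: "flux u sn.E sn.m a1 = ?F" by (rule n.flux_const) (use order in auto)
  have "thin_net u sn.E sn.m a1 b1 k"
    by unfold_locales (use Neq[OF a1(3)] Neq[OF b1(3)] order k fl Fd' in auto)
  then have card: "card (sing_vertices u sn.E a1 b1) \<le> C" by (rule C) (simp add: fl Fd)
  have "sing_points X \<inter> K \<subseteq> {x \<in> sing_points X \<inter> ?R. a1 < u \<bullet> x \<and> u \<bullet> x \<le> b1}"
  proof
    fix x assume x: "x \<in> sing_points X \<inter> K"
    then have xr: "norm (x - p) \<le> r" using K by (auto simp: dist_norm norm_minus_commute)
    have "\<bar>u \<bullet> (x - p)\<bar> \<le> r" using Cauchy_Schwarz_ineq2[of u "x - p"] u(1) xr by simp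
    then have "\<bar>u \<bullet> x - a0\<bar> \<le> r" by (simp add: a0_def inner_diff_right)
    moreover have "x \<in> ?R" using xr T by (simp add: dist_norm norm_minus_commute)
    ultimately show "x \<in> {x \<in> sing_points X \<inter> ?R. a1 < u \<bullet> x \<and> u \<bullet> x \<le> b1}" using x a1 b1 T by auto
  qed
  also have "\<dots> \<subseteq> sing_vertices u sn.E a1 b1" by (rule sn.sing_subset) (use order in \<open>auto simp: b'_def \<beta>_def\<close>)
  finally have sub: "sing_points X \<inter> K \<subseteq> sing_vertices u sn.E a1 b1" .
  then show ?thesis using s.finite_sing card card_mono[OF s.finite_sing sub] finite_subset by (meson order_trans)
qed

lemma closed_segment_line:
  fixes w :: "'a::real_normed_vector"
  assumes "c \<le> d"
  shows "closed_segment (p + c *\<^sub>R w) (p + d *\<^sub>R w) = (\<lambda>t. p + t *\<^sub>R w) ` {c..d}"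
proof -
  have "linear (\<lambda>t::real. t *\<^sub>R w)" by (simp add: linear_iff scaleR_left_distrib)
  then show ?thesis
    unfolding closed_segment_translation closed_segment_linear_image[OF \<open>linear _\<close>] closed_segment_eq_real_ivl
    using assms by (simp add: image_image)
qed

lemma closed_line:
  fixes w :: "'a::euclidean_space"
  shows "closed (range (\<lambda>t. p + t *\<^sub>R w))"
proof -
  have "range (\<lambda>t. p + t *\<^sub>R w) = (\<lambda>x. p + x) ` span {w}" by (simp add: span_singleton image_image)
  then show ?thesis by (simp add: closed_translation)
qed

lemma line_measure_bounds:
  fixes w :: "'a::euclidean_space"
  assumes w: "norm w = 1" and cd: "c \<le> d" and A: "A \<in> sets borel"
  shows "(\<And>t. p + t *\<^sub>R w \<in> A \<Longrightarrow> c \<le> t \<and> t \<le> d) \<Longrightarrow> emeasure (multiplicity_line_measure k (range (\<lambda>t. p + t *\<^sub>R w))) A \<le> ennreal (real k * (d - c))"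
    "(\<And>t. c \<le> t \<Longrightarrow> t \<le> d \<Longrightarrow> p + t *\<^sub>R w \<in> A) \<Longrightarrow> ennreal (real k * (d - c)) \<le> emeasure (multiplicity_line_measure k (range (\<lambda>t. p + t *\<^sub>R w))) A"
proof -
  let ?L = "range (\<lambda>t. p + t *\<^sub>R w)"
  have bL: "?L \<in> sets borel" by (rule borel_closed[OF closed_line])
  have "dist (p + c *\<^sub>R w) (p + d *\<^sub>R w) = norm ((c - d) *\<^sub>R w)"
    unfolding dist_norm by (rule arg_cong[where f=norm]) (simp add: scaleR_left_diff_distrib)
  then have "emeasure hausdorff1 (closed_segment (p + c *\<^sub>R w) (p + d *\<^sub>R w)) = ennreal (d - c)"
    using w cd by (simp add: emeasure_hausdorff1_closed_segment)
  then have len: "of_nat k * emeasure hausdorff1 ((\<lambda>t. p + t *\<^sub>R w) ` {c..d}) = ennreal (real k * (d - c))"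
    using cd unfolding closed_segment_line[OF cd] by (simp add: ennreal_mult ennreal_of_nat_eq_real_of_nat)
  have bS: "(\<lambda>t. p + t *\<^sub>R w) ` {c..d} \<in> sets borel"
    unfolding closed_segment_line[OF cd, symmetric] by (simp add: borel_closed)
  note eq = emeasure_multiplicity_line_measure[OF bL A]
  show "emeasure (multiplicity_line_measure k ?L) A \<le> ennreal (real k * (d - c))"
    if "\<And>t. p + t *\<^sub>R w \<in> A \<Longrightarrow> c \<le> t \<and> t \<le> d"
  proof -
    have "?L \<inter> A \<subseteq> (\<lambda>t. p + t *\<^sub>R w) ` {c..d}" using that by auto
    then show ?thesis unfolding eq len[symmetric] using bS by (intro mult_left_mono emeasure_mono) auto
  qed
  show "ennreal (real k * (d - c)) \<le> emeasure (multiplicity_line_measure k ?L) A"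
    if "\<And>t. c \<le> t \<Longrightarrow> t \<le> d \<Longrightarrow> p + t *\<^sub>R w \<in> A"
  proof -
    have "(\<lambda>t. p + t *\<^sub>R w) ` {c..d} \<subseteq> ?L \<inter> A" using that by auto
    then show ?thesis unfolding eq len[symmetric] using bL A by (intro mult_left_mono emeasure_mono) auto
  qed
qed

lemma line_param:
  fixes w :: "'a::euclidean_space"
  assumes "norm w = 1"
  shows "norm (p + t *\<^sub>R w - p) = \<bar>t\<bar>" "(p + t *\<^sub>R w - p) \<bullet> w = t" "perp w (p + t *\<^sub>R w - p) = 0"
  using assms by (simp_all add: perp_def norm_eq_1)

lemma line_measure_finite_on_compacts:
  fixes w :: "'a::euclidean_space"
  assumes w: "norm w = 1"
  shows "finite_on_compacts (multiplicity_line_measure k (range (\<lambda>t. p + t *\<^sub>R w)))"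
  unfolding finite_on_compacts_def
proof (intro conjI allI impI)
  show "sets (multiplicity_line_measure k (range (\<lambda>t. p + t *\<^sub>R w))) = sets borel"
    by (simp add: multiplicity_line_measure_def)
  fix C :: "'a set" assume C: "compact C"
  obtain r where r: "0 < r" "\<And>x. x \<in> C \<Longrightarrow> norm (x - p) \<le> r"
  proof -
    have "bounded ((\<lambda>x. x - p) ` C)" using C by (simp add: bounded_translation_minus compact_imp_bounded)
    then show ?thesis using that unfolding bounded_pos by auto
  qed
  have "emeasure (multiplicity_line_measure k (range (\<lambda>t. p + t *\<^sub>R w))) C \<le> ennreal (real k * (r - (- r)))"
  proof (rule line_measure_bounds(1)[OF w])
    fix t assume "p + t *\<^sub>R w \<in> C"
    then show "- r \<le> t \<and> t \<le> r" using r(2) line_param(1)[OF w, of p t] by fastforce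
  qed (use r C in \<open>auto simp: borel_compact\<close>)
  then show "emeasure (multiplicity_line_measure k (range (\<lambda>t. p + t *\<^sub>R w))) C < \<infinity>"
    by (rule le_less_trans) simp
qed

text \<open>A point of the network away from the line would carry mass \<sigma>/3 in a ball
  contained in a fixed compact set off the line, where weak convergence eventually leaves at most
  \<sigma>/6.\<close>

lemma eventually_near_line:
  fixes X :: "nat \<Rightarrow> 'a::euclidean_space set"
  assumes w: "norm w = 1" and \<sigma>: "0 < \<sigma>"
    and nets: "\<And>i. integral_network (X i) (\<Theta> i)" "\<And>i. stationary_network (X i) (\<Theta> i)"
    and conv: "radon_weak_conv (\<lambda>i. network_measure (X i) (\<Theta> i)) (multiplicity_line_measure k (range (\<lambda>t. p + t *\<^sub>R w)))"
  shows "\<forall>\<^sub>F i in sequentially. \<forall>x\<in>X i. norm (x - p) \<le> R \<longrightarrow> norm (perp w (x - p)) < \<sigma>"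
proof -
  let ?L = "range (\<lambda>t. p + t *\<^sub>R w)"
  define Z where "Z = {x. norm (x - p) \<le> R \<and> \<sigma> \<le> norm (perp w (x - p))}"
  show ?thesis
  proof (cases "Z = {}")
    case True
    then have "norm (x - p) \<le> R \<longrightarrow> norm (perp w (x - p)) < \<sigma>" for x unfolding Z_def by force
    then show ?thesis by simp
  next
    case False
    have clZ: "closed Z" unfolding Z_def perp_def
      by (intro closed_Collect_conj closed_Collect_le continuous_intros)
    have "Z \<subseteq> cball p R" by (auto simp: Z_def dist_norm norm_minus_commute)
    then have cZ: "compact Z" using clZ bounded_subset[OF bounded_cball] by (auto simp: compact_eq_bounded_closed)
    let ?K = "{x. infdist x Z \<le> \<sigma> / 3}" and ?V = "{x. infdist x Z < \<sigma> / 2}"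
    have cK: "compact ?K" by (rule compact_infdist_le[OF False cZ]) (use \<sigma> in simp)
    have oV: "open ?V" by (intro open_Collect_less continuous_intros)
    have "compact {x. infdist x Z \<le> \<sigma> / 2}" by (rule compact_infdist_le[OF False cZ]) (use \<sigma> in simp)
    then have bV: "bounded ?V" by (rule bounded_subset[OF compact_imp_bounded]) auto
    have dis: "x \<notin> ?V" if x: "x \<in> ?L" for x
    proof
      assume "x \<in> ?V"
      then have "infdist x Z < \<sigma> / 2" by simp
      moreover obtain z where "z \<in> Z" "infdist x Z = dist x z" by (rule infdist_attains_inf[OF clZ False])
      ultimately have z: "z \<in> Z" "dist x z < \<sigma> / 2" by simp_all
      obtain t where "x = p + t *\<^sub>R w" using x by blast
      then have "perp w (x - p) = 0" using line_param(3)[OF w, of p t] by blast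
      then have "perp w (z - p) = perp w (z - x)" using perp_diff[of w "z - p" "x - p"] by simp
      then have "norm (perp w (z - p)) \<le> norm (z - x)" using norm_perp_le[OF w, of "z - x"] by simp
      then show False using z \<sigma> by (auto simp: Z_def dist_norm norm_minus_commute)
    qed
    have "?L \<in> sets borel" by (rule borel_closed[OF closed_line])
    moreover have "?V \<in> sets borel" using oV by simp
    moreover have "?L \<inter> ?V = {}" using dis by blast
    ultimately have zero: "emeasure (multiplicity_line_measure k ?L) ?V = 0"
      by (simp add: emeasure_multiplicity_line_measure)
    have fin: "finite_on_compacts (network_measure (X i) (\<Theta> i))" for i
      by (rule network_measure_finite_on_compacts) (use nets in \<open>simp add: stationary_network_def\<close>)
    have "?K \<subseteq> ?V" using \<sigma> by auto
    then have "\<forall>\<^sub>F i in sequentially. emeasure (network_measure (X i) (\<Theta> i)) ?K \<le> 0 + ennreal (\<sigma> / 6)"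
      using weak_conv_bounds(1)[OF conv fin line_measure_finite_on_compacts[OF w] cK oV _ bV, of "\<sigma> / 6"] \<sigma>
      unfolding zero by simp
    then show ?thesis
    proof eventually_elim
      case (elim i)
      show ?case
      proof (intro ballI impI, rule ccontr)
        fix x assume x: "x \<in> X i" "norm (x - p) \<le> R" "\<not> norm (perp w (x - p)) < \<sigma>"
        then have "x \<in> Z" by (simp add: Z_def)
        have "infdist y Z \<le> \<sigma> / 3" if "y \<in> cball x (\<sigma> / 3)" for y
          using infdist_le[OF \<open>x \<in> Z\<close>, of y] that unfolding mem_cball dist_commute[of x y] by linarith
        then have "cball x (\<sigma> / 3) \<subseteq> ?K" by blast
        then have "emeasure (network_measure (X i) (\<Theta> i)) (cball x (\<sigma> / 3)) \<le> emeasure (network_measure (X i) (\<Theta> i)) ?K"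
          using cK by (intro emeasure_mono) (auto simp: borel_compact)
        moreover have "ennreal (\<sigma> / 3) \<le> emeasure (network_measure (X i) (\<Theta> i)) (cball x (\<sigma> / 3))"
          by (rule network_mass_lower[OF nets(2) nets(1) x(1)]) (use \<sigma> in simp)
        ultimately have "ennreal (\<sigma> / 3) \<le> ennreal (\<sigma> / 6)" using elim by simp
        then show False using \<sigma> by (simp add: ennreal_le_iff)
      qed
    qed
  qed
qed

text \<open>Compact and open slabs whose faces are shifted by \<sigma> and 2 \<sigma> are nested as
  weak convergence needs, and the larger shift on both sides changes the length on the line by 4
  \<sigma>.\<close>

lemma eventually_slab_mass:
  fixes X :: "nat \<Rightarrow> 'a::euclidean_space set"
  assumes w: "norm w = 1" and \<sigma>: "0 < \<sigma>"
    and nets: "\<And>i. stationary_network (X i) (\<Theta> i)"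
    and conv: "radon_weak_conv (\<lambda>i. network_measure (X i) (\<Theta> i)) (multiplicity_line_measure k (range (\<lambda>t. p + t *\<^sub>R w)))"
    and cd: "c \<le> d" and \<epsilon>: "0 < \<epsilon>"
  shows "\<forall>\<^sub>F i in sequentially. emeasure (network_measure (X i) (\<Theta> i)) {x. norm (x - p) \<le> R \<and> c - \<sigma> \<le> (x - p) \<bullet> w \<and> (x - p) \<bullet> w \<le> d + \<sigma>}
      \<le> ennreal (real k * (d - c + 4 * \<sigma>) + \<epsilon>)"
    and "2 * \<sigma> \<le> d - c \<Longrightarrow> \<bar>c\<bar> < R \<Longrightarrow> \<bar>d\<bar> < R \<Longrightarrow> \<epsilon> \<le> real k * (d - c - 4 * \<sigma>) \<Longrightarrow> 4 * \<sigma> \<le> d - c \<Longrightarrow>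
     \<forall>\<^sub>F i in sequentially. ennreal (real k * (d - c - 4 * \<sigma>) - \<epsilon>) \<le>
      emeasure (network_measure (X i) (\<Theta> i)) {x. norm (x - p) < R + 1 \<and> c + \<sigma> < (x - p) \<bullet> w \<and> (x - p) \<bullet> w < d - \<sigma>}"
proof -
  let ?L = "range (\<lambda>t. p + t *\<^sub>R w)"
  have fin: "finite_on_compacts (network_measure (X i) (\<Theta> i))" for i
    by (rule network_measure_finite_on_compacts) (use nets in \<open>simp add: stationary_network_def\<close>)
  have comp: "compact {x. norm (x - p) \<le> R \<and> c \<le> (x - p) \<bullet> w \<and> (x - p) \<bullet> w \<le> d}" for R c d
  proof -
    have "{x. norm (x - p) \<le> R \<and> c \<le> (x - p) \<bullet> w \<and> (x - p) \<bullet> w \<le> d} \<subseteq> cball p R"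
      by (auto simp: dist_norm norm_minus_commute)
    then have "bounded {x. norm (x - p) \<le> R \<and> c \<le> (x - p) \<bullet> w \<and> (x - p) \<bullet> w \<le> d}"
      by (rule bounded_subset[OF bounded_cball])
    moreover have "closed {x. norm (x - p) \<le> R \<and> c \<le> (x - p) \<bullet> w \<and> (x - p) \<bullet> w \<le> d}"
      by (intro closed_Collect_conj closed_Collect_le continuous_intros)
    ultimately show ?thesis by (simp add: compact_eq_bounded_closed)
  qed
  have op: "open {x. norm (x - p) < R \<and> c < (x - p) \<bullet> w \<and> (x - p) \<bullet> w < d}" for R c d
    by (intro open_Collect_conj open_Collect_less continuous_intros)
  have bd: "bounded {x. norm (x - p) < R \<and> c < (x - p) \<bullet> w \<and> (x - p) \<bullet> w < d}" for R c d
    by (rule bounded_subset[OF bounded_ball[of p R]]) (auto simp: dist_norm norm_minus_commute)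
  note wcb = weak_conv_bounds[OF conv fin line_measure_finite_on_compacts[OF w] comp op _ bd \<epsilon>]
  let ?V = "{x. norm (x - p) < R + 1 \<and> c - 2 * \<sigma> < (x - p) \<bullet> w \<and> (x - p) \<bullet> w < d + 2 * \<sigma>}"
  have "emeasure (multiplicity_line_measure k ?L) ?V \<le> ennreal (real k * ((d + 2 * \<sigma>) - (c - 2 * \<sigma>)))"
  proof (rule line_measure_bounds(1)[OF w])
    fix t assume "p + t *\<^sub>R w \<in> ?V"
    then show "c - 2 * \<sigma> \<le> t \<and> t \<le> d + 2 * \<sigma>" unfolding mem_Collect_eq line_param(1,2)[OF w] by linarith
  next
    show "?V \<in> sets borel" using op by (rule borel_open)
  qed (use cd \<sigma> in simp)
  also have "(d + 2 * \<sigma>) - (c - 2 * \<sigma>) = d - c + 4 * \<sigma>" by simp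
  finally have V: "emeasure (multiplicity_line_measure k ?L) ?V \<le> ennreal (real k * (d - c + 4 * \<sigma>))" .
  have "\<forall>\<^sub>F i in sequentially. emeasure (network_measure (X i) (\<Theta> i)) {x. norm (x - p) \<le> R \<and> c - \<sigma> \<le> (x - p) \<bullet> w \<and> (x - p) \<bullet> w \<le> d + \<sigma>}
      \<le> emeasure (multiplicity_line_measure k ?L) ?V + ennreal \<epsilon>"
    by (rule wcb(1)) (use \<sigma> in auto)
  then show "\<forall>\<^sub>F i in sequentially. emeasure (network_measure (X i) (\<Theta> i)) {x. norm (x - p) \<le> R \<and> c - \<sigma> \<le> (x - p) \<bullet> w \<and> (x - p) \<bullet> w \<le> d + \<sigma>}
      \<le> ennreal (real k * (d - c + 4 * \<sigma>) + \<epsilon>)"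
  proof eventually_elim
    case (elim i)
    also have "emeasure (multiplicity_line_measure k ?L) ?V + ennreal \<epsilon> \<le> ennreal (real k * (d - c + 4 * \<sigma>)) + ennreal \<epsilon>"
      by (rule add_right_mono[OF V])
    also have "\<dots> = ennreal (real k * (d - c + 4 * \<sigma>) + \<epsilon>)" using \<epsilon> \<sigma> cd by (intro ennreal_plus[symmetric]) auto
    finally show ?case .
  qed
  assume R: "\<bar>c\<bar> < R" "\<bar>d\<bar> < R" and \<epsilon>k: "\<epsilon> \<le> real k * (d - c - 4 * \<sigma>)" and \<sigma>4: "4 * \<sigma> \<le> d - c"
  let ?C = "{x. norm (x - p) \<le> R \<and> c + 2 * \<sigma> \<le> (x - p) \<bullet> w \<and> (x - p) \<bullet> w \<le> d - 2 * \<sigma>}"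
  let ?W = "\<lambda>i. emeasure (network_measure (X i) (\<Theta> i)) {x. norm (x - p) < R + 1 \<and> c + \<sigma> < (x - p) \<bullet> w \<and> (x - p) \<bullet> w < d - \<sigma>}"
  have "ennreal (real k * ((d - 2 * \<sigma>) - (c + 2 * \<sigma>))) \<le> emeasure (multiplicity_line_measure k ?L) ?C"
  proof (rule line_measure_bounds(2)[OF w])
    fix t assume "c + 2 * \<sigma> \<le> t" "t \<le> d - 2 * \<sigma>"
    then show "p + t *\<^sub>R w \<in> ?C" unfolding mem_Collect_eq line_param(1,2)[OF w] using R \<sigma> by linarith
  next
    show "?C \<in> sets borel" using comp by (rule borel_compact)
  qed (use \<sigma>4 in simp)
  also have "(d - 2 * \<sigma>) - (c + 2 * \<sigma>) = d - c - 4 * \<sigma>" by simp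
  finally have C: "ennreal (real k * (d - c - 4 * \<sigma>)) \<le> emeasure (multiplicity_line_measure k ?L) ?C" .
  have "\<forall>\<^sub>F i in sequentially. emeasure (multiplicity_line_measure k ?L) ?C \<le> ?W i + ennreal \<epsilon>"
    by (rule wcb(2)) (use \<sigma> in auto)
  then show "\<forall>\<^sub>F i in sequentially. ennreal (real k * (d - c - 4 * \<sigma>) - \<epsilon>) \<le> ?W i"
  proof eventually_elim
    case (elim i)
    have "ennreal (real k * (d - c - 4 * \<sigma>)) \<le> ?W i + ennreal \<epsilon>" using C elim by (rule order_trans)
    then have "ennreal (real k * (d - c - 4 * \<sigma>)) - ennreal \<epsilon> \<le> ?W i" by (simp add: ennreal_minus_le_iff add.commute)
    then show ?case using \<epsilon> by (simp add: ennreal_minus)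
  qed
qed

theorem eventually_bounded_singularities:
  fixes X :: "nat \<Rightarrow> 'a::euclidean_space set"
  assumes C: "\<And>(u::'a) E m a b. thin_net u E m a b k \<Longrightarrow> real k - flux u E m a \<bullet> u \<le> flux_defect k \<Longrightarrow> card (sing_vertices u E a b) \<le> C"
    and k: "1 \<le> k" and nets: "\<And>i. integral_network (X i) (\<Theta> i)" "\<And>i. stationary_network (X i) (\<Theta> i)"
    and L: "affine L" "aff_dim L = 1"
    and conv: "radon_weak_conv (\<lambda>i. network_measure (X i) (\<Theta> i)) (multiplicity_line_measure k L)"
    and K: "compact K"
  shows "\<forall>\<^sub>F i in sequentially. finite (sing_points (X i) \<inter> K) \<and> card (sing_points (X i) \<inter> K) \<le> C"
proof -
  obtain p w where w: "norm w = 1" and Lw: "L = range (\<lambda>t. p + t *\<^sub>R w)" by (rule affine_line[OF L])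
  note conv = conv[unfolded Lw]
  obtain r where r: "0 \<le> r" "K \<subseteq> cball p r"
  proof -
    obtain e where "\<forall>y\<in>K. dist p y \<le> e" using compact_imp_bounded[OF K] bounded_any_center by metis
    then have "K \<subseteq> cball p (max e 0)" by (auto simp: le_max_iff_disj)
    then show ?thesis using that[of "max e 0"] by simp
  qed
  define T where "T = r + 1"
  define fd where "fd = flux_defect k"
  have fd: "0 < fd" using flux_defect_pos[OF k] by (simp add: fd_def)
  \<comment> \<open>With k \<sigma> = min 1 fd / 16 and \<epsilon> = min 1 fd / 4, the eventual
    bound 5 k \<sigma> + \<epsilon> / 2 for the defect is 7/16 of min 1 fd, and the excess 4 k
    \<sigma> + \<epsilon> of the mass of a unit slab over \<open>k\<close> is at most 1/2.\<close>
  define \<sigma> where "\<sigma> = min 1 fd / (16 * real k)"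
  have k1: "1 \<le> real k" using k by simp
  have k\<sigma>: "real k * \<sigma> = min 1 fd / 16" using k1 by (simp add: \<sigma>_def)
  have \<sigma>: "0 < \<sigma>" using fd k1 by (simp add: \<sigma>_def)
  have "1 * \<sigma> \<le> real k * \<sigma>" using k1 \<sigma> by (intro mult_right_mono) auto
  then have \<sigma>1: "\<sigma> \<le> 1/16" using k\<sigma> by (auto simp: min_def split: if_splits)
  have T0: "1 \<le> T" using r by (simp add: T_def)
  define \<epsilon> where "\<epsilon> = min 1 fd / 4"
  have \<epsilon>: "0 < \<epsilon>" "\<epsilon> \<le> 1/4" "\<epsilon> \<le> fd / 4" using fd by (auto simp: \<epsilon>_def)
  note mass = eventually_slab_mass[OF w \<sigma> nets(2) conv _ \<epsilon>(1)]
  have slack: "real k * (d - c + 4 * \<sigma>) + \<epsilon> \<le> real k + 3/4" if "d - c = 1" for c d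
  proof -
    have "real k * (d - c + 4 * \<sigma>) = real k + 4 * (real k * \<sigma>)" unfolding that by (simp add: algebra_simps)
    then show ?thesis using k\<sigma> \<epsilon> by (auto simp: min_def split: if_splits)
  qed
  have up: "\<forall>\<^sub>F i in sequentially. emeasure (network_measure (X i) (\<Theta> i)) {x. norm (x - p) \<le> T + 10 \<and> c - \<sigma> \<le> (x - p) \<bullet> w \<and> (x - p) \<bullet> w \<le> d + \<sigma>} \<le> ennreal (real k + 3/4)"
    if "d - c = 1" for c d
  proof -
    have "\<forall>\<^sub>F i in sequentially. emeasure (network_measure (X i) (\<Theta> i)) {x. norm (x - p) \<le> T + 10 \<and> c - \<sigma> \<le> (x - p) \<bullet> w \<and> (x - p) \<bullet> w \<le> d + \<sigma>} \<le> ennreal (real k * (d - c + 4 * \<sigma>) + \<epsilon>)"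
      by (rule mass(1)) (use that in simp)
    then show ?thesis by eventually_elim (erule order_trans, rule ennreal_leI[OF slack[OF that]])
  qed
  have up1: "\<forall>\<^sub>F i in sequentially. emeasure (network_measure (X i) (\<Theta> i)) {x. norm (x - p) \<le> T + 10 \<and> - T - 2 - \<sigma> \<le> (x - p) \<bullet> w \<and> (x - p) \<bullet> w \<le> - T - 1 + \<sigma>} \<le> ennreal (real k + 3/4)"
    by (rule up) simp
  have up2: "\<forall>\<^sub>F i in sequentially. emeasure (network_measure (X i) (\<Theta> i)) {x. norm (x - p) \<le> T + 10 \<and> T + 1 - \<sigma> \<le> (x - p) \<bullet> w \<and> (x - p) \<bullet> w \<le> T + 2 + \<sigma>} \<le> ennreal (real k + 3/4)"
    by (rule up) simp
  \<comment> \<open>The possible loss of mass in the central slab of width 2.\<close>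
  define \<kappa> where "\<kappa> = 4 * (real k * \<sigma>) + \<epsilon>"
  have \<kappa>: "real k * (1 - (- 1) - 4 * \<sigma>) - \<epsilon> = 2 * real k - \<kappa>" by (simp add: \<kappa>_def algebra_simps)
  have "\<epsilon> \<le> real k * (1 - (- 1) - 4 * \<sigma>)"
  proof -
    have "1 * 1 \<le> real k * (1 - (- 1) - 4 * \<sigma>)" using k1 \<sigma>1 by (intro mult_mono) auto
    then show ?thesis using \<epsilon> by simp
  qed
  then have low: "\<forall>\<^sub>F i in sequentially. ennreal (2 * real k - \<kappa>) \<le>
      emeasure (network_measure (X i) (\<Theta> i)) {x. norm (x - p) < T + 9 \<and> - 1 + \<sigma> < (x - p) \<bullet> w \<and> (x - p) \<bullet> w < 1 - \<sigma>}"
    using mass(2)[of "-1" 1 "T + 8", unfolded \<kappa>] \<sigma>1 T0 by (simp add: add.commute[of T])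
  have near: "\<forall>\<^sub>F i in sequentially. \<forall>x\<in>X i. norm (x - p) \<le> T + 10 \<longrightarrow> norm (perp w (x - p)) < \<sigma>"
    by (rule eventually_near_line[OF w \<sigma> nets conv])
  have small: "\<kappa> / 2 + 3 * real k * \<sigma> \<le> flux_defect k"
  proof -
    have "\<kappa> / 2 + 3 * real k * \<sigma> = 5 * (min 1 fd / 16) + \<epsilon> / 2" unfolding \<kappa>_def k\<sigma>[symmetric] by (simp add: algebra_simps)
    also have "\<dots> \<le> fd" unfolding \<epsilon>_def using fd by (auto simp: min_def)
    finally show ?thesis by (simp add: fd_def)
  qed
  show ?thesis
    using up1 up2 low near
  proof eventually_elim
    case (elim i)
    show ?case
      by (rule network_near_line_count[OF C k w r(1) \<sigma> _ T_def nets(2) nets(1) _ elim(1) elim(2) elim(3) small r(2)])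
        (use \<sigma>1 elim(4) in auto)
  qed
qed

theorem theorem1:
  fixes k :: nat
  assumes "CARD('n::finite) \<ge> 2" and "k \<ge> 1"
  shows "\<exists>C::nat. \<forall>(X :: nat \<Rightarrow> (real ^ 'n) set) (\<Theta> :: nat \<Rightarrow> real ^ 'n \<Rightarrow> real) L K.
           (\<forall>i. integral_network (X i) (\<Theta> i) \<and> stationary_network (X i) (\<Theta> i)) \<and>
           affine L \<and> aff_dim L = 1 \<and>
           radon_weak_conv (\<lambda>i. network_measure (X i) (\<Theta> i)) (multiplicity_line_measure k L) \<and>
           compact K \<longrightarrow>
           (\<forall>\<^sub>F i in sequentially.
              finite (sing_points (X i) \<inter> K) \<and> card (sing_points (X i) \<inter> K) \<le> C)"
proof -
  \<comment> \<open>The constant is fixed by the type of the space and by \<open>k\<close>, before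
    any sequence, line or compact set is considered.\<close>
  obtain C where C: "\<And>(u::real ^ 'n) E m a b. thin_net u E m a b k \<Longrightarrow> real k - flux u E m a \<bullet> u \<le> flux_defect k
      \<Longrightarrow> card (sing_vertices u E a b) \<le> C"
    using thin_net_count[where ?'a = "real ^ 'n", of k] by blast
  show ?thesis
  proof (intro exI[of _ C] allI impI, elim conjE)
    fix X :: "nat \<Rightarrow> (real ^ 'n) set" and \<Theta> and L K :: "(real ^ 'n) set"
    assume "\<forall>i. integral_network (X i) (\<Theta> i) \<and> stationary_network (X i) (\<Theta> i)" "affine L" "aff_dim L = 1"
      "radon_weak_conv (\<lambda>i. network_measure (X i) (\<Theta> i)) (multiplicity_line_measure k L)" "compact K"
    then show "\<forall>\<^sub>F i in sequentially. finite (sing_points (X i) \<inter> K) \<and> card (sing_points (X i) \<inter> K) \<le> C"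
      by (intro eventually_bounded_singularities[OF _ assms(2), where L = L] C) auto
  qed
qed

end
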